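(* Let $r_1,r_2,r_3$ be pairwise distinct complex numbers, and let $\mathbb{C}[E_{r_1,r_2,r_3}]$ be the coordinate ring of the curve $E_{r_1,r_2,r_3}$. The Lie subalgebra of $\mathfrak{sl}(2,\mathbb{C})\otimes_{\mathbb{C}}\mathbb{C}[E_{r_1,r_2,r_3}]$ generated by $$v_1\otimes\lambda_1,\quad v_2\otimes\lambda_2,\quad v_3\otimes\lambda_3$$ is isomorphic to the complex Lie algebra generated by $p_1,p_2,p_3$ with relations $$[p_i,[p_j,p_k]]=0,\qquad [p_i,[p_i,p_k]]-[p_j,[p_j,p_k]]=(r_j-r_i)p_k,$$ where $(i,j,k)$ is a cyclic permutation of $(1,2,3)$. In particular, denoting the latter algebra by $\mathbb{C}\langle p_1,p_2,p_3\rangle$, $$\mathbb{C}\langle p_1,p_2,p_3\rangle\cong(\mathfrak{sl}(2,\mathbb{C})\otimes_{\mathbb{C}}\mathcal{O}_{T\setminus D_2\cdot\{0\}})^{D_2}\cong\mathfrak{sl}(2,\mathbb{C})\otimes_{\mathbb{C}}\mathbb{C}[\wp_\Lambda,\wp_\Lambda'].$$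
   Context: $E_{r_1,r_2,r_3}\subset\mathbb{C}^3$ is the affine curve $\lambda_i^2-\lambda_j^2=r_j-r_i$ ($i,j=1,2,3$), and $\mathbb{C}[E_{r_1,r_2,r_3}]=\mathbb{C}[\lambda_1,\lambda_2,\lambda_3]/(\lambda_i^2-\lambda_j^2-r_j+r_i)$. The bracket is $[A\otimes f,B\otimes g]=[A,B]\otimes fg$. Also $$v_1=\tfrac12\begin{pmatrix}\mathrm i&0\\0&-\mathrm i\end{pmatrix},\quad v_2=\tfrac12\begin{pmatrix}0&1\\-1&0\end{pmatrix},\quad v_3=\tfrac12\begin{pmatrix}0&\mathrm i\\\mathrm i&0\end{pmatrix}.$$ $T=\mathbb{C}/\Lambda$ with $\Lambda=\mathbb{Z}+\mathbb{Z}\tau$, where $\tau$ in the upper half plane satisfies $\lambda(\tau)=\frac{r_3-r_2}{r_3-r_1}$, with $\lambda(\tau)=\theta_2^4(0|\tau)/\theta_3^4(0|\tau)$ the modular lambda function ($\theta_2(0|\tau)=\sum_{k\in\mathbb Z}e^{\pi \mathrm i\tau(k+1/2)^2}$, $\theta_3(0|\tau)=\sum_{k\in\mathbb Z}e^{\pi \mathrm i\tau k^2}$). $\wp_\Lambda$ is the Weierstrass function of $\Lambda$. $D_2=\langle t_1,t_2\rangle\cong C_2\times C_2$ acts on $T$ via $\sigma(t_1)z=z+\frac12$, $\sigma(t_2)z=z+\frac\tau2$ and on $\mathfrak{sl}(2,\mathbb{C})$ via $\rho(t_1)X=T_1XT_1^{-1}$, $\rho(t_2)X=T_2XT_2^{-1}$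 with $T_1=\begin{pmatrix}1&0\\0&-1\end{pmatrix}$, $T_2=\begin{pmatrix}0&1\\1&0\end{pmatrix}$. $\mathcal{O}_{T\setminus D_2\cdot\{0\}}$ is the ring of meromorphic functions on $T$ holomorphic outside $D_2\cdot\{0\}=\{0,\frac12,\frac\tau2,\frac{1+\tau}2\}$; $\gamma\in D_2$ acts on it by $f\mapsto f\circ\sigma(\gamma^{-1})$, and the superscript $D_2$ denotes fixed points for the diagonal action on the tensor product. *)

theory Defs
  imports
    "HOL-Library.Poly_Mapping"
    "HOL-Library.Numeral_Type"
    "HOL-Algebra.QuotRing"
    "HOL-Algebra.Elementary_Groups"
    "HOL-Algebra.Algebraic_Closure_Type"
    "HOL-Complex_Analysis.Complex_Analysis"
begin

unbundle no fps_syntax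

abbreviation complex_field :: "complex ring" where
  "complex_field \<equiv> ring_of_type_algebra"

text \<open>
  As for modules in HOL-Algebra, the inherited multiplicative fields \<open>mult\<close> and \<open>one\<close> of a
  Lie algebra play no role.
\<close>

record ('a, 'b) lie_alg = "('a, 'b) module" +
  lie_bracket :: "'b \<Rightarrow> 'b \<Rightarrow> 'b"

locale complex_lie_algebra = module complex_field L
  for L :: "(complex, 'b, 'm) lie_alg_scheme" (structure) +
  assumes bracket_closed:
      "\<lbrakk>x \<in> carrier L; y \<in> carrier L\<rbrakk> \<Longrightarrow> lie_bracket L x y \<in> carrier L"
    and bracket_add_left:
      "\<lbrakk>x \<in> carrier L; y \<in> carrier L; z \<in> carrier L\<rbrakk> \<Longrightarrow>
        lie_bracket L (x \<oplus> y) z = lie_bracket L x z \<oplus> lie_bracket L y z"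
    and bracket_add_right:
      "\<lbrakk>x \<in> carrier L; y \<in> carrier L; z \<in> carrier L\<rbrakk> \<Longrightarrow>
        lie_bracket L x (y \<oplus> z) = lie_bracket L x y \<oplus> lie_bracket L x z"
    and bracket_smult_left:
      "\<lbrakk>x \<in> carrier L; y \<in> carrier L\<rbrakk> \<Longrightarrow>
        lie_bracket L (c \<odot> x) y = c \<odot> lie_bracket L x y"
    and bracket_smult_right:
      "\<lbrakk>x \<in> carrier L; y \<in> carrier L\<rbrakk> \<Longrightarrow>
        lie_bracket L x (c \<odot> y) = c \<odot> lie_bracket L x y"
    and bracket_self: "x \<in> carrier L \<Longrightarrow> lie_bracket L x x = \<zero>"
    and jacobi:
      "\<lbrakk>x \<in> carrier L; y \<in> carrier L; z \<in> carrier L\<rbrakk> \<Longrightarrow>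
        lie_bracket L x (lie_bracket L y z) \<oplus> lie_bracket L y (lie_bracket L z x)
          \<oplus> lie_bracket L z (lie_bracket L x y) = \<zero>"

definition lie_iso ::
  "(complex, 'b, 'm) lie_alg_scheme \<Rightarrow> (complex, 'c, 'n) lie_alg_scheme \<Rightarrow> ('b \<Rightarrow> 'c) set" where
  "lie_iso L M = {h. bij_betw h (carrier L) (carrier M) \<and>
     (\<forall>x\<in>carrier L. \<forall>y\<in>carrier L. h (x \<oplus>\<^bsub>L\<^esub> y) = h x \<oplus>\<^bsub>M\<^esub> h y) \<and>
     (\<forall>c. \<forall>x\<in>carrier L. h (c \<odot>\<^bsub>L\<^esub> x) = c \<odot>\<^bsub>M\<^esub> h x) \<and>
     (\<forall>x\<in>carrier L. \<forall>y\<in>carrier L. h (lie_bracket L x y) = lie_bracket M (h x) (h y))}"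

definition lie_isomorphic ::
  "(complex, 'b, 'm) lie_alg_scheme \<Rightarrow> (complex, 'c, 'n) lie_alg_scheme \<Rightarrow> bool"
  (infixr \<open>\<cong>\<^sub>L\<close> 60) where
  "L \<cong>\<^sub>L M \<longleftrightarrow> complex_lie_algebra L \<and> complex_lie_algebra M \<and> lie_iso L M \<noteq> {}"

inductive_set lie_span :: "(complex, 'b, 'm) lie_alg_scheme \<Rightarrow> 'b set \<Rightarrow> 'b set"
  for L :: "(complex, 'b, 'm) lie_alg_scheme" and S :: "'b set" where
  zero: "\<zero>\<^bsub>L\<^esub> \<in> lie_span L S"
| incl: "x \<in> S \<Longrightarrow> x \<in> lie_span L S"
| add: "\<lbrakk>x \<in> lie_span L S; y \<in> lie_span L S\<rbrakk> \<Longrightarrow> x \<oplus>\<^bsub>L\<^esub> y \<in> lie_span L S"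
| smult: "x \<in> lie_span L S \<Longrightarrow> c \<odot>\<^bsub>L\<^esub> x \<in> lie_span L S"
| bracket: "\<lbrakk>x \<in> lie_span L S; y \<in> lie_span L S\<rbrakk> \<Longrightarrow> lie_bracket L x y \<in> lie_span L S"

definition lie_subalgebra_generated ::
  "(complex, 'b, 'm) lie_alg_scheme \<Rightarrow> 'b set \<Rightarrow> (complex, 'b, 'm) lie_alg_scheme" where
  "lie_subalgebra_generated L S = L\<lparr>carrier := lie_span L S\<rparr>"

datatype 'x lie_term =
    LGen 'x
  | LZero
  | LAdd "'x lie_term" "'x lie_term"
  | LScale complex "'x lie_term"
  | LBracket "'x lie_term" "'x lie_term"

abbreviation LDiff :: "'x lie_term \<Rightarrow> 'x lie_term \<Rightarrow> 'x lie_term" where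
  "LDiff s t \<equiv> LAdd s (LScale (-1) t)"

text \<open>
  The least congruence on Lie terms that contains the relations \<open>R\<close> and all instances of the
  axioms of a complex Lie algebra.
\<close>

inductive lie_cong :: "('x lie_term \<times> 'x lie_term) set \<Rightarrow> 'x lie_term \<Rightarrow> 'x lie_term \<Rightarrow> bool"
  for R :: "('x lie_term \<times> 'x lie_term) set" where
  relation: "(s, t) \<in> R \<Longrightarrow> lie_cong R s t"
| refl: "lie_cong R s s"
| sym: "lie_cong R s t \<Longrightarrow> lie_cong R t s"
| trans: "\<lbrakk>lie_cong R s t; lie_cong R t u\<rbrakk> \<Longrightarrow> lie_cong R s u"
| cong_add: "\<lbrakk>lie_cong R s s'; lie_cong R t t'\<rbrakk> \<Longrightarrow> lie_cong R (LAdd s t) (LAdd s' t')"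
| cong_scale: "lie_cong R s s' \<Longrightarrow> lie_cong R (LScale c s) (LScale c s')"
| cong_bracket:
    "\<lbrakk>lie_cong R s s'; lie_cong R t t'\<rbrakk> \<Longrightarrow> lie_cong R (LBracket s t) (LBracket s' t')"
| add_assoc: "lie_cong R (LAdd (LAdd s t) u) (LAdd s (LAdd t u))"
| add_comm: "lie_cong R (LAdd s t) (LAdd t s)"
| add_zero: "lie_cong R (LAdd LZero s) s"
| add_inverse: "lie_cong R (LDiff s s) LZero"
| scale_add_right: "lie_cong R (LScale c (LAdd s t)) (LAdd (LScale c s) (LScale c t))"
| scale_add_left: "lie_cong R (LScale (c + d) s) (LAdd (LScale c s) (LScale d s))"
| scale_scale: "lie_cong R (LScale c (LScale d s)) (LScale (c * d) s)"
| scale_one: "lie_cong R (LScale 1 s) s"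
| bracket_add_left:
    "lie_cong R (LBracket (LAdd s t) u) (LAdd (LBracket s u) (LBracket t u))"
| bracket_add_right:
    "lie_cong R (LBracket s (LAdd t u)) (LAdd (LBracket s t) (LBracket s u))"
| bracket_scale_left: "lie_cong R (LBracket (LScale c s) t) (LScale c (LBracket s t))"
| bracket_scale_right: "lie_cong R (LBracket s (LScale c t)) (LScale c (LBracket s t))"
| bracket_self: "lie_cong R (LBracket s s) LZero"
| jacobi: "lie_cong R
    (LAdd (LAdd (LBracket s (LBracket t u)) (LBracket t (LBracket u s))) (LBracket u (LBracket s t)))
    LZero"

definition lie_class ::
  "('x lie_term \<times> 'x lie_term) set \<Rightarrow> 'x lie_term \<Rightarrow> 'x lie_term set" where
  "lie_class R s = {t. lie_cong R s t}"

definition presented_lie_algebra ::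
  "('x lie_term \<times> 'x lie_term) set \<Rightarrow> (complex, 'x lie_term set) lie_alg" where
  "presented_lie_algebra R =
    \<lparr>carrier = range (lie_class R), monoid.mult = undefined, one = undefined,
     zero = lie_class R LZero,
     add = (\<lambda>U V. \<Union>s\<in>U. \<Union>t\<in>V. lie_class R (LAdd s t)),
     module.smult = (\<lambda>c U. \<Union>s\<in>U. lie_class R (LScale c s)),
     lie_bracket = (\<lambda>U V. \<Union>s\<in>U. \<Union>t\<in>V. lie_class R (LBracket s t))\<rparr>"

text \<open>The index type \<open>3\<close> has the elements \<open>1\<close>, \<open>2\<close> and \<open>3\<close> (with \<open>3 = 0\<close>).\<close>

definition cyclic_triples :: "(3 \<times> 3 \<times> 3) set" where
  "cyclic_triples = {(1, 2, 3), (2, 3, 1), (3, 1, 2)}"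

definition p_relations :: "(3 \<Rightarrow> complex) \<Rightarrow> (3 lie_term \<times> 3 lie_term) set" where
  "p_relations r =
    {(LBracket (LGen i) (LBracket (LGen j) (LGen k)), LZero) | i j k. (i, j, k) \<in> cyclic_triples}
    \<union> {(LDiff (LBracket (LGen i) (LBracket (LGen i) (LGen k)))
              (LBracket (LGen j) (LBracket (LGen j) (LGen k))),
        LScale (r j - r i) (LGen k)) | i j k. (i, j, k) \<in> cyclic_triples}"

definition p_algebra :: "(3 \<Rightarrow> complex) \<Rightarrow> (complex, 3 lie_term set) lie_alg" where
  "p_algebra r = presented_lie_algebra (p_relations r)"

text \<open>
  The tensor product of \<open>V\<close> and \<open>W\<close> is the quotient of the free vector space on
  \<open>carrier V \<times> carrier W\<close> (finitely supported functions) by the span of the bilinearity relations;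
  its elements are cosets.
\<close>

type_synonym ('v, 'w) tensor = "('v \<times> 'w \<Rightarrow>\<^sub>0 complex) set"

definition fscale :: "complex \<Rightarrow> ('k \<Rightarrow>\<^sub>0 complex) \<Rightarrow> 'k \<Rightarrow>\<^sub>0 complex" where
  "fscale c = Poly_Mapping.map ((*) c)"

definition pure :: "'v \<Rightarrow> 'w \<Rightarrow> ('v \<times> 'w) \<Rightarrow>\<^sub>0 complex" where
  "pure v w = Poly_Mapping.single (v, w) 1"

definition tensor_relators ::
  "(complex, 'v, 'm) module_scheme \<Rightarrow> (complex, 'w, 'n) module_scheme \<Rightarrow>
    ('v \<times> 'w \<Rightarrow>\<^sub>0 complex) set" where
  "tensor_relators V W =
     {pure (v \<oplus>\<^bsub>V\<^esub> v') w - pure v w - pure v' w | v v' w.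
        v \<in> carrier V \<and> v' \<in> carrier V \<and> w \<in> carrier W}
   \<union> {pure v (w \<oplus>\<^bsub>W\<^esub> w') - pure v w - pure v w' | v w w'.
        v \<in> carrier V \<and> w \<in> carrier W \<and> w' \<in> carrier W}
   \<union> {pure (c \<odot>\<^bsub>V\<^esub> v) w - fscale c (pure v w) | c v w. v \<in> carrier V \<and> w \<in> carrier W}
   \<union> {pure v (c \<odot>\<^bsub>W\<^esub> w) - fscale c (pure v w) | c v w. v \<in> carrier V \<and> w \<in> carrier W}"

definition tensor_null ::
  "(complex, 'v, 'm) module_scheme \<Rightarrow> (complex, 'w, 'n) module_scheme \<Rightarrow>
    ('v \<times> 'w \<Rightarrow>\<^sub>0 complex) set" where
  "tensor_null V W = Modules.module.span fscale (tensor_relators V W)"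

definition tensor_class ::
  "(complex, 'v, 'm) module_scheme \<Rightarrow> (complex, 'w, 'n) module_scheme \<Rightarrow>
    (('v \<times> 'w) \<Rightarrow>\<^sub>0 complex) \<Rightarrow> ('v, 'w) tensor" where
  "tensor_class V W x = (\<lambda>n. x + n) ` tensor_null V W"

definition tensor_carrier ::
  "(complex, 'v, 'm) module_scheme \<Rightarrow> (complex, 'w, 'n) module_scheme \<Rightarrow>
    ('v, 'w) tensor set" where
  "tensor_carrier V W =
     tensor_class V W ` {x. Poly_Mapping.keys x \<subseteq> carrier V \<times> carrier W}"

text \<open>\<open>formal_bracket\<close> is the bilinear extension of \<open>[a \<otimes> f, b \<otimes> g] = [a, b] \<otimes> fg\<close>.\<close>

definition formal_bracket ::
  "(complex, 'v, 'm) lie_alg_scheme \<Rightarrow> (complex, 'w, 'n) module_scheme \<Rightarrow>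
    (('v \<times> 'w) \<Rightarrow>\<^sub>0 complex) \<Rightarrow> (('v \<times> 'w) \<Rightarrow>\<^sub>0 complex) \<Rightarrow> (('v \<times> 'w) \<Rightarrow>\<^sub>0 complex)" where
  "formal_bracket L A x y =
     (\<Sum>(a, f)\<in>Poly_Mapping.keys x. \<Sum>(b, g)\<in>Poly_Mapping.keys y.
        fscale (Poly_Mapping.lookup x (a, f) * Poly_Mapping.lookup y (b, g))
          (pure (lie_bracket L a b) (f \<otimes>\<^bsub>A\<^esub> g)))"

definition tensor_lie ::
  "(complex, 'v, 'm) lie_alg_scheme \<Rightarrow> (complex, 'w, 'n) module_scheme \<Rightarrow>
    (complex, ('v, 'w) tensor) lie_alg" where
  "tensor_lie L A =
    \<lparr>carrier = tensor_carrier L A, monoid.mult = undefined, one = undefined,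
     zero = tensor_class L A 0,
     add = (\<lambda>U V. \<Union>x\<in>U. \<Union>y\<in>V. tensor_class L A (x + y)),
     module.smult = (\<lambda>c U. \<Union>x\<in>U. tensor_class L A (fscale c x)),
     lie_bracket = (\<lambda>U V. \<Union>x\<in>U. \<Union>y\<in>V. tensor_class L A (formal_bracket L A x y))\<rparr>"

definition pure_tensor ::
  "(complex, 'v, 'm) module_scheme \<Rightarrow> (complex, 'w, 'n) module_scheme \<Rightarrow> 'v \<Rightarrow> 'w \<Rightarrow>
    ('v, 'w) tensor" where
  "pure_tensor V W v w = tensor_class V W (pure v w)"

text \<open>The endomorphism \<open>\<phi> \<otimes> \<psi>\<close> of \<open>V \<otimes> W\<close>, for linear \<open>\<phi>\<close> and \<open>\<psi>\<close>.\<close>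

definition tensor_map ::
  "(complex, 'v, 'm) module_scheme \<Rightarrow> (complex, 'w, 'n) module_scheme \<Rightarrow> ('v \<Rightarrow> 'v) \<Rightarrow> ('w \<Rightarrow> 'w) \<Rightarrow>
    ('v, 'w) tensor \<Rightarrow> ('v, 'w) tensor" where
  "tensor_map V W \<phi> \<psi> U = (\<Union>x\<in>U. tensor_class V W
     (\<Sum>(v, w)\<in>Poly_Mapping.keys x. fscale (Poly_Mapping.lookup x (v, w)) (pure (\<phi> v) (\<psi> w))))"

definition mat2 :: "complex \<Rightarrow> complex \<Rightarrow> complex \<Rightarrow> complex \<Rightarrow> complex^2^2" where
  "mat2 a b c d = vector [vector [a, b], vector [c, d]]"

definition sl2 :: "(complex, complex^2^2) lie_alg" where
  "sl2 = \<lparr>carrier = {A. trace A = 0}, monoid.mult = undefined, one = undefined,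
     zero = 0, add = (+), module.smult = (\<lambda>c A. \<chi> i j. c * A $ i $ j),
     lie_bracket = (\<lambda>A B. A ** B - B ** A)\<rparr>"

definition v\<^sub>1 :: "complex^2^2" where "v\<^sub>1 = mat2 (\<i> / 2) 0 0 (- \<i> / 2)"
definition v\<^sub>2 :: "complex^2^2" where "v\<^sub>2 = mat2 0 (1 / 2) (- 1 / 2) 0"
definition v\<^sub>3 :: "complex^2^2" where "v\<^sub>3 = mat2 0 (\<i> / 2) (\<i> / 2) 0"

type_synonym poly3 = "(3 \<Rightarrow>\<^sub>0 nat) \<Rightarrow>\<^sub>0 complex"

definition poly3_ring :: "poly3 ring" where
  "poly3_ring = ring_of_type_algebra"

definition const3 :: "complex \<Rightarrow> poly3" where
  "const3 c = Poly_Mapping.single 0 c"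

definition var3 :: "3 \<Rightarrow> poly3" where
  "var3 i = Poly_Mapping.single (Poly_Mapping.single i 1) 1"

definition curve_ideal :: "(3 \<Rightarrow> complex) \<Rightarrow> poly3 set" where
  "curve_ideal r = genideal poly3_ring
     {(var3 i)\<^sup>2 - (var3 j)\<^sup>2 - const3 (r j) + const3 (r i) | i j. True}"

definition curve_class :: "(3 \<Rightarrow> complex) \<Rightarrow> poly3 \<Rightarrow> poly3 set" where
  "curve_class r f = curve_ideal r +>\<^bsub>poly3_ring\<^esub> f"

definition coordinate_ring :: "(3 \<Rightarrow> complex) \<Rightarrow> (complex, poly3 set) module" where
  "coordinate_ring r = (let Q = poly3_ring Quot curve_ideal r in
    \<lparr>carrier = carrier Q, monoid.mult = monoid.mult Q, one = one Q, zero = zero Q, add = add Q,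
     module.smult = (\<lambda>c U. curve_class r (const3 c) \<otimes>\<^bsub>Q\<^esub> U)\<rparr>)"

definition sl2_curve ::
  "(3 \<Rightarrow> complex) \<Rightarrow> (complex, (complex^2^2, poly3 set) tensor) lie_alg" where
  "sl2_curve r = tensor_lie sl2 (coordinate_ring r)"

definition curve_generator ::
  "(3 \<Rightarrow> complex) \<Rightarrow> complex^2^2 \<Rightarrow> 3 \<Rightarrow> (complex^2^2, poly3 set) tensor" where
  "curve_generator r v i = pure_tensor sl2 (coordinate_ring r) v (curve_class r (var3 i))"

definition lattice :: "complex \<Rightarrow> complex set" where
  "lattice \<tau> = {of_int m + of_int n * \<tau> | m n. True}"

text \<open>The points of \<open>\<complex> / \<Lambda>\<close> are the cosets of \<open>\<Lambda>\<close>; \<open>torus_proj\<close> is the quotient map.\<close>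

definition torus_proj :: "complex \<Rightarrow> complex \<Rightarrow> complex set" where
  "torus_proj \<tau> z = (\<lambda>w. z + w) ` lattice \<tau>"

definition torus :: "complex \<Rightarrow> complex set set" where
  "torus \<tau> = range (torus_proj \<tau>)"

text \<open>
  The algebra of meromorphic functions on the torus that are holomorphic outside a finite set \<open>P\<close>
  of points. Such a function is determined by its values outside \<open>P\<close>, and it is represented by
  its restriction to the complement of \<open>P\<close>, so that the operations are pointwise. The values that
  the pull-back to the plane takes over \<open>P\<close> are irrelevant for \<open>meromorphic_on\<close>.
\<close>

definition torus_functions :: "complex \<Rightarrow> complex set set \<Rightarrow> (complex, complex set \<Rightarrow> complex) module" where
  "torus_functions \<tau> P =
    \<lparr>carrier = {f \<in> extensional (torus \<tau> - P).
       (\<lambda>z. f (torus_proj \<tau> z)) holomorphic_on {z. torus_proj \<tau> z \<notin> P} \<and>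
       (\<lambda>z. f (torus_proj \<tau> z)) meromorphic_on UNIV},
     monoid.mult = (\<lambda>f g. \<lambda>p\<in>torus \<tau> - P. f p * g p),
     one = (\<lambda>p\<in>torus \<tau> - P. 1),
     zero = (\<lambda>p\<in>torus \<tau> - P. 0),
     add = (\<lambda>f g. \<lambda>p\<in>torus \<tau> - P. f p + g p),
     module.smult = (\<lambda>c f. \<lambda>p\<in>torus \<tau> - P. c * f p)\<rparr>"

text \<open>The function on \<open>torus \<tau> - P\<close> induced by a \<open>\<Lambda>\<close>-periodic function on the plane.\<close>

definition torus_descend ::
  "complex \<Rightarrow> complex set set \<Rightarrow> (complex \<Rightarrow> complex) \<Rightarrow> complex set \<Rightarrow> complex" where
  "torus_descend \<tau> P f = (\<lambda>p\<in>torus \<tau> - P. f (SOME z. torus_proj \<tau> z = p))"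

definition weierstrass_p :: "complex \<Rightarrow> complex \<Rightarrow> complex" where
  "weierstrass_p \<tau> z = 1 / z\<^sup>2 + (\<Sum>\<^sub>\<infinity>\<omega>\<in>lattice \<tau> - {0}. 1 / (z - \<omega>)\<^sup>2 - 1 / \<omega>\<^sup>2)"

inductive_set algebra_span :: "(complex, 'b, 'm) module_scheme \<Rightarrow> 'b set \<Rightarrow> 'b set"
  for A :: "(complex, 'b, 'm) module_scheme" and S :: "'b set" where
  zero: "\<zero>\<^bsub>A\<^esub> \<in> algebra_span A S"
| one: "\<one>\<^bsub>A\<^esub> \<in> algebra_span A S"
| incl: "x \<in> S \<Longrightarrow> x \<in> algebra_span A S"
| add: "\<lbrakk>x \<in> algebra_span A S; y \<in> algebra_span A S\<rbrakk> \<Longrightarrow> x \<oplus>\<^bsub>A\<^esub> y \<in> algebra_span A S"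
| smult: "x \<in> algebra_span A S \<Longrightarrow> c \<odot>\<^bsub>A\<^esub> x \<in> algebra_span A S"
| mult: "\<lbrakk>x \<in> algebra_span A S; y \<in> algebra_span A S\<rbrakk> \<Longrightarrow> x \<otimes>\<^bsub>A\<^esub> y \<in> algebra_span A S"

text \<open>\<open>\<complex>[\<wp>, \<wp>']\<close>, as an algebra of functions on the torus with poles only at \<open>0\<close>.\<close>

definition weierstrass_algebra :: "complex \<Rightarrow> (complex, complex set \<Rightarrow> complex) module" where
  "weierstrass_algebra \<tau> =
    (let P = {torus_proj \<tau> 0}; A = torus_functions \<tau> P in
      A\<lparr>carrier := algebra_span A
        {torus_descend \<tau> P (weierstrass_p \<tau>), torus_descend \<tau> P (deriv (weierstrass_p \<tau>))}\<rparr>)"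

text \<open>\<open>D\<^sub>2 = C\<^sub>2 \<times> C\<^sub>2\<close> with \<open>t\<^sub>1 = (1, 0)\<close> and \<open>t\<^sub>2 = (0, 1)\<close>.\<close>

definition D2 :: "(int \<times> int) monoid" where
  "D2 = integer_mod_group 2 \<times>\<times> integer_mod_group 2"

text \<open>The action in which \<open>t\<^sub>1\<close> and \<open>t\<^sub>2\<close> act by the commuting involutions \<open>a\<close> and \<open>b\<close>.\<close>

definition D2_action :: "('s \<Rightarrow> 's) \<Rightarrow> ('s \<Rightarrow> 's) \<Rightarrow> int \<times> int \<Rightarrow> 's \<Rightarrow> 's" where
  "D2_action a b \<gamma> = (a ^^ nat (fst \<gamma>)) \<circ> (b ^^ nat (snd \<gamma>))"

definition T\<^sub>1 :: "complex^2^2" where "T\<^sub>1 = mat2 1 0 0 (- 1)"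
definition T\<^sub>2 :: "complex^2^2" where "T\<^sub>2 = mat2 0 1 1 0"

definition D2_rho :: "int \<times> int \<Rightarrow> complex^2^2 \<Rightarrow> complex^2^2" where
  "D2_rho = D2_action (\<lambda>A. T\<^sub>1 ** A ** matrix_inv T\<^sub>1) (\<lambda>A. T\<^sub>2 ** A ** matrix_inv T\<^sub>2)"

text \<open>Translating a coset elementwise by \<open>a\<close> is addition of the point \<open>a + \<Lambda>\<close> in the torus.\<close>

definition D2_sigma :: "complex \<Rightarrow> int \<times> int \<Rightarrow> complex set \<Rightarrow> complex set" where
  "D2_sigma \<tau> = D2_action (\<lambda>p. (\<lambda>z. z + 1 / 2) ` p) (\<lambda>p. (\<lambda>z. z + \<tau> / 2) ` p)"

definition D2_orbit_zero :: "complex \<Rightarrow> complex set set" where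
  "D2_orbit_zero \<tau> = (\<lambda>\<gamma>. D2_sigma \<tau> \<gamma> (torus_proj \<tau> 0)) ` carrier D2"

definition D2_on_functions ::
  "complex \<Rightarrow> int \<times> int \<Rightarrow> (complex set \<Rightarrow> complex) \<Rightarrow> complex set \<Rightarrow> complex" where
  "D2_on_functions \<tau> \<gamma> f = (\<lambda>p\<in>torus \<tau> - D2_orbit_zero \<tau>. f (D2_sigma \<tau> (inv\<^bsub>D2\<^esub> \<gamma>) p))"

definition sl2_D2_invariants ::
  "complex \<Rightarrow> (complex, (complex^2^2, complex set \<Rightarrow> complex) tensor) lie_alg" where
  "sl2_D2_invariants \<tau> =
    (let A = torus_functions \<tau> (D2_orbit_zero \<tau>) in
      (tensor_lie sl2 A)\<lparr>carrier := {U \<in> carrier (tensor_lie sl2 A).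
        \<forall>\<gamma>\<in>carrier D2. tensor_map sl2 A (D2_rho \<gamma>) (D2_on_functions \<tau> \<gamma>) U = U}\<rparr>)"

definition theta2_null :: "complex \<Rightarrow> complex" where
  "theta2_null \<tau> = (\<Sum>\<^sub>\<infinity>k\<in>(UNIV :: int set). exp (of_real pi * \<i> * \<tau> * (of_int k + 1 / 2)\<^sup>2))"

definition theta3_null :: "complex \<Rightarrow> complex" where
  "theta3_null \<tau> = (\<Sum>\<^sub>\<infinity>k\<in>(UNIV :: int set). exp (of_real pi * \<i> * \<tau> * (of_int k)\<^sup>2))"

definition modular_lambda :: "complex \<Rightarrow> complex" where
  "modular_lambda \<tau> = theta2_null \<tau> ^ 4 / theta3_null \<tau> ^ 4"

end

theory Submission
  imports Defs
begin

text \<open>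
  All four Lie algebras are identified with one polynomial model: triples of pairs \<open>(a\<^sub>k, b\<^sub>k)\<close> of
  polynomials, standing for \<open>\<Sum>\<^sub>k v\<^sub>k \<otimes> (\<lambda>\<^sub>k a\<^sub>k(x) + \<lambda>\<^sub>i\<lambda>\<^sub>j b\<^sub>k(x))\<close> with \<open>x = \<lambda>\<^sub>k\<^sup>2 + r\<^sub>k\<close>.
  These elements form the subalgebra generated by the \<open>v\<^sub>k \<otimes> \<lambda>\<^sub>k\<close>, and the relations bound
  each graded piece of the presented algebra by the corresponding piece of the model.
  On the torus, \<open>\<lambda>\<^sub>k(z) = \<kappa> (\<wp>(2z) - e\<^sub>k)\<^sup>1\<^sup>/\<^sup>2\<close> is single-valued and half periods act on it by signs;
  the cross ratio of the \<open>e\<^sub>k\<close>, expressed by theta constants, matches the moduli. Removing poles at 0 with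
  elements of the model leaves, by Liouville's theorem, nothing: so the model is the algebra of invariants.
  Since \<open>\<complex>[x, \<lambda>\<^sub>1\<lambda>\<^sub>2\<lambda>\<^sub>3] \<cong> \<complex>[\<wp>, \<wp>']\<close>, an explicit orthonormal frame of the model over this
  ring gives the last isomorphism.
\<close>


subsection \<open>Lattices and the Weierstrass function\<close>

text \<open>The relations are inhomogeneous, and the bound on the presented algebra uses their
  leading terms: modulo lower order the generators behave like \<open>v_k \<otimes> t\<close>, and
  from degree four on the Jacobi identity alone determines all brackets, since antisymmetry forces
  \<open>(N + 1) f = 0\<close> for a possible deviation \<open>f\<close>. Independence is then
  tested on leading coefficients in the model. Identities in the model are checked at points of the
  curve, where the bracket is the cross product on \<open>\<complex>^3\<close>; changing the sign of
  one \<open>\<lambda>_k\<close> keeps a point on the curve, and this makes the points separate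
  elements. On the analytic side, doubling identifies the quotient of the torus by its points of
  order two with the torus itself: the invariants live over \<open>\<wp>(2z)\<close>, the last
  algebra is written with \<open>\<wp>(z)\<close>. The half periods are treated symmetrically
  through pairs of independent points of order two, and the basic elliptic identities come from
  products and quotients without poles. The cross ratio results from a linear dependence among three
  theta functions of order two, whose space has dimension at most two.\<close>

lemma lattice_0: "0 \<in> lattice \<tau>"
  unfolding lattice_def by (auto intro!: exI[of _ 0])

lemma lattice_1: "1 \<in> lattice \<tau>"
  unfolding lattice_def by (rule CollectI, rule exI[of _ 1], rule exI[of _ 0]) simp

lemma lattice_tau: "\<tau> \<in> lattice \<tau>"
  unfolding lattice_def by (rule CollectI, rule exI[of _ 0], rule exI[of _ 1]) simp

lemma lattice_add: "x \<in> lattice \<tau> \<Longrightarrow> y \<in> lattice \<tau> \<Longrightarrow> x + y \<in> lattice \<tau>"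
  unfolding lattice_def
proof clarify
  fix m n m' n' :: int
  show "\<exists>a b. of_int m + of_int n * \<tau> + (of_int m' + of_int n' * \<tau>) = of_int a + of_int b * \<tau> \<and> True"
    by (rule exI[of _ "m + m'"], rule exI[of _ "n + n'"]) (simp add: algebra_simps)
qed

lemma lattice_uminus: "x \<in> lattice \<tau> \<Longrightarrow> - x \<in> lattice \<tau>"
  unfolding lattice_def
proof clarify
  fix m n :: int
  show "\<exists>a b. - (of_int m + of_int n * \<tau>) = of_int a + of_int b * \<tau> \<and> True"
    by (rule exI[of _ "- m"], rule exI[of _ "- n"]) (simp add: algebra_simps)
qed

lemma lattice_diff: "x \<in> lattice \<tau> \<Longrightarrow> y \<in> lattice \<tau> \<Longrightarrow> x - y \<in> lattice \<tau>"
  using lattice_add[OF _ lattice_uminus] by fastforce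

lemma lattice_uminus_iff: "- x \<in> lattice \<tau> \<longleftrightarrow> x \<in> lattice \<tau>"
  using lattice_uminus by force

lemma lattice_add_iff: "w \<in> lattice \<tau> \<Longrightarrow> z + w \<in> lattice \<tau> \<longleftrightarrow> z \<in> lattice \<tau>"
  using lattice_add lattice_diff by (metis add_diff_cancel_right')

lemma countable_lattice: "countable (lattice \<tau>)"
proof -
  have "lattice \<tau> = (\<lambda>(m, n). of_int m + of_int n * \<tau>) ` (UNIV :: (int \<times> int) set)"
    unfolding lattice_def by auto
  then show ?thesis by (metis countableI_type countable_image)
qed

section \<open>Convergence of sums over the integers and over a lattice\<close>

lemma summable_on_int_abs:
  fixes f :: "nat \<Rightarrow> real"
  assumes "summable f" "\<And>n. f n \<ge> 0"
  shows "(\<lambda>k::int. f (nat \<bar>k\<bar>)) summable_on UNIV"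
proof -
  have "f summable_on UNIV"
    using assms by (subst summable_on_UNIV_nonneg_real_iff) auto
  then have nat: "(\<lambda>k. f (nat \<bar>k\<bar>)) summable_on range int"
    by (subst summable_on_reindex) (auto simp: o_def inj_on_def)
  then have "(\<lambda>k. f (nat \<bar>k\<bar>)) summable_on uminus ` range int"
    by (subst summable_on_reindex) (auto simp: o_def inj_on_def)
  then have "(\<lambda>k. f (nat \<bar>k\<bar>)) summable_on range int \<union> uminus ` range int"
    using nat by (subst summable_on_union) auto
  moreover have "range int \<union> uminus ` range int = UNIV"
  proof -
    have "k \<in> range int \<union> uminus ` range int" for k :: int
      by (cases k rule: int_cases2) auto
    then show ?thesis by blast
  qed
  ultimately show ?thesis by simp
qed

text \<open>The exponent is half of three: two such factors, one for each coordinate, will dominate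
  the inverse cube of the norm of a lattice point, and each sum converges because 3/2 > 1.\<close>

lemma summable_inverse_powr_int: "(\<lambda>n::int. (\<bar>real_of_int n\<bar> + 1) powr (-3/2)) summable_on UNIV"
proof -
  have "summable (\<lambda>n. real n powr (-3/2))"
    by (subst summable_real_powr_iff) auto
  then have "summable (\<lambda>n. real (Suc n) powr (-3/2))"
    by (subst summable_Suc_iff)
  then have "summable (\<lambda>n. (real n + 1) powr (-3/2))" by (simp add: add_ac)
  then have "(\<lambda>k::int. (real (nat \<bar>k\<bar>) + 1) powr (-3/2)) summable_on UNIV"
    by (rule summable_on_int_abs) simp
  then show ?thesis by simp
qed

locale upper_half_plane =
  fixes \<tau> :: complex
  assumes Im_pos: "Im \<tau> > 0"
begin

abbreviation "\<Lambda> \<equiv> lattice \<tau>"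

lemma lattice_point_inj:
  "of_int m + of_int n * \<tau> = of_int m' + of_int n' * \<tau> \<longleftrightarrow> m = m' \<and> n = n'"
proof
  assume eq: "of_int m + of_int n * \<tau> = of_int m' + of_int n' * \<tau>"
  then have "Im (of_int m + of_int n * \<tau>) = Im (of_int m' + of_int n' * \<tau>)" by simp
  then have "n = n'" using Im_pos by simp
  with eq show "m = m' \<and> n = n'" by simp
qed simp

text \<open>For \<open>w = m + n\<tau>\<close> the constant comes from
  \<open>|n| Im \<tau> = |Im w| \<le> |w|\<close> and then
  \<open>|m| \<le> |w| + |n| |\<tau>|\<close>; it is large enough for both coordinates.\<close>

definition lattice_bound :: real where
  "lattice_bound = 1 + (1 + norm \<tau>) / Im \<tau>"

lemma lattice_bound_pos: "lattice_bound > 0"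
  unfolding lattice_bound_def using Im_pos by (intro add_pos_nonneg) auto

lemma lattice_coeff_bound:
  "\<bar>real_of_int m\<bar> \<le> lattice_bound * norm (of_int m + of_int n * \<tau>)"
  "\<bar>real_of_int n\<bar> \<le> lattice_bound * norm (of_int m + of_int n * \<tau>)"
proof -
  define w where "w = of_int m + of_int n * \<tau>"
  have "\<bar>Im w\<bar> \<le> norm w" by (rule abs_Im_le_cmod)
  have bound: "lattice_bound * norm w = norm w + norm w / Im \<tau> + norm w / Im \<tau> * norm \<tau>"
    by (simp add: lattice_bound_def distrib_right add_divide_distrib)
  have nonneg: "0 \<le> norm w / Im \<tau>" using Im_pos by simp
  with \<open>\<bar>Im w\<bar> \<le> norm w\<close> have n: "\<bar>real_of_int n\<bar> \<le> norm w / Im \<tau>"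
    using Im_pos by (simp add: w_def abs_mult pos_le_divide_eq)
  have "of_int m = w - of_int n * \<tau>" by (simp add: w_def)
  then have "norm (of_int m :: complex) \<le> norm w + norm (of_int n * \<tau>)"
    by (metis norm_triangle_ineq4)
  then have "\<bar>real_of_int m\<bar> \<le> norm w + \<bar>real_of_int n\<bar> * norm \<tau>"
    by (simp add: norm_mult)
  also have "\<dots> \<le> norm w + norm w / Im \<tau> * norm \<tau>"
    using n by (intro add_left_mono mult_right_mono) auto
  also have "\<dots> \<le> lattice_bound * norm w"
    using nonneg by (simp add: bound)
  finally show "\<bar>real_of_int m\<bar> \<le> lattice_bound * norm (of_int m + of_int n * \<tau>)"
    by (simp add: w_def)
  have "norm w / Im \<tau> \<le> lattice_bound * norm w"
    using mult_nonneg_nonneg[OF nonneg norm_ge_zero[of \<tau>]] by (simp add: bound)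
  with n show "\<bar>real_of_int n\<bar> \<le> lattice_bound * norm (of_int m + of_int n * \<tau>)"
    by (simp add: w_def)
qed

lemma finite_lattice_cball: "finite (\<Lambda> \<inter> cball 0 R)"
proof (rule finite_subset)
  define B where "B = \<lceil>lattice_bound * R\<rceil>"
  show "finite ((\<lambda>(m, n). of_int m + of_int n * \<tau>) ` ({-B..B} \<times> {-B..B}))" by auto
  show "\<Lambda> \<inter> cball 0 R \<subseteq> (\<lambda>(m, n). of_int m + of_int n * \<tau>) ` ({-B..B} \<times> {-B..B})"
  proof
    fix w assume w: "w \<in> \<Lambda> \<inter> cball 0 R"
    then obtain m n :: int where mn: "w = of_int m + of_int n * \<tau>" by (auto simp: lattice_def)
    have "lattice_bound * norm w \<le> lattice_bound * R"
      using w lattice_bound_pos by auto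
    with lattice_coeff_bound[where m = m and n = n]
    have "\<bar>real_of_int m\<bar> \<le> lattice_bound * R" "\<bar>real_of_int n\<bar> \<le> lattice_bound * R" by (auto simp: mn)
    then have "\<bar>m\<bar> \<le> B" "\<bar>n\<bar> \<le> B" unfolding B_def by linarith+
    then have "(m, n) \<in> {-B..B} \<times> {-B..B}" by auto
    then show "w \<in> (\<lambda>(m, n). of_int m + of_int n * \<tau>) ` ({-B..B} \<times> {-B..B})"
      unfolding mn by (rule rev_image_eqI) simp
  qed
qed

text \<open>The two coordinates are decoupled. For \<open>M = max |m| |n| \<ge> 1\<close> both
  \<open>|m| + 1\<close> and \<open>|n| + 1\<close> are at most \<open>2M\<close>, so the product of
  their powers with exponent 3/2 is at most \<open>(2M)^3 \<le> (K |w|)^3\<close>. The sum over the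
  lattice is thus dominated by a product of two sums over the integers.\<close>

lemma lattice_inverse_cubes_summable: "(\<lambda>w. 1 / norm w ^ 3) summable_on (\<Lambda> - {0})"
proof -
  let ?g = "\<lambda>(m::int, n::int). (\<bar>real_of_int m\<bar> + 1) powr (-3/2) * (\<bar>real_of_int n\<bar> + 1) powr (-3/2)"
  let ?h = "\<lambda>(m::int, n::int). of_int m + of_int n * \<tau>"
  define K where "K = 2 * lattice_bound"
  have K: "K > 0" using lattice_bound_pos by (simp add: K_def)
  have "?g summable_on (UNIV \<times> UNIV)"
  proof (rule summable_on_SigmaI)
    fix m :: int
    show "((\<lambda>n. ?g (m, n)) has_sum (\<bar>real_of_int m\<bar> + 1) powr (-3/2) *
        (\<Sum>\<^sub>\<infinity>n. (\<bar>real_of_int n\<bar> + 1) powr (-3/2))) UNIV"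
      unfolding prod.case
      by (rule has_sum_cmult_right[OF has_sum_infsum[OF summable_inverse_powr_int]])
    show "(\<lambda>m. (\<bar>real_of_int m\<bar> + 1) powr (-3/2) *
        (\<Sum>\<^sub>\<infinity>n. (\<bar>real_of_int n\<bar> + 1) powr (-3/2))) summable_on UNIV"
      using summable_inverse_powr_int by (rule summable_on_cmult_left)
  qed auto
  then have "?g summable_on (UNIV - {(0,0)})"
    by (rule summable_on_subset_banach) auto
  then have g: "(\<lambda>p. K ^ 3 * ?g p) summable_on (UNIV - {(0,0)})"
    by (rule summable_on_cmult_right)
  have le: "norm (1 / norm (?h p) ^ 3) \<le> K ^ 3 * ?g p" if "p \<in> UNIV - {(0,0)}" for p
  proof -
    obtain m n where p: "p = (m, n)" by force
    define a b where "a = \<bar>real_of_int m\<bar> + 1" and "b = \<bar>real_of_int n\<bar> + 1"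
    have ab: "a \<ge> 1" "b \<ge> 1" by (auto simp: a_def b_def)
    define M where "M = max \<bar>real_of_int m\<bar> \<bar>real_of_int n\<bar>"
    have "m \<noteq> 0 \<or> n \<noteq> 0" using that p by auto
    then have "\<bar>m\<bar> \<ge> 1 \<or> \<bar>n\<bar> \<ge> 1" by linarith
    then have "M \<ge> 1" unfolding M_def by linarith
    then have aM: "a \<le> 2 * M" "b \<le> 2 * M" by (auto simp: a_def b_def M_def)
    define w where "w = norm (?h p)"
    have hM: "M \<le> lattice_bound * w"
      using lattice_coeff_bound[where m = m and n = n] by (auto simp: M_def p w_def)
    have wpos: "w > 0"
    proof (rule ccontr)
      assume "\<not> w > 0"
      then have "w = 0" by (simp add: w_def)
      with hM \<open>M \<ge> 1\<close> show False by simp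
    qed
    have "a powr (3/2) * b powr (3/2) \<le> (2*M) powr (3/2) * (2*M) powr (3/2)"
      using ab aM by (intro mult_mono powr_mono2) auto
    also have "\<dots> = (2*M) powr 3" by (simp flip: powr_add)
    also have "\<dots> = (2*M) ^ 3" using \<open>M \<ge> 1\<close> powr_realpow[of "2*M" 3] by simp
    also have "\<dots> \<le> (K * w) ^ 3"
      using hM \<open>M \<ge> 1\<close> by (intro power_mono) (auto simp: K_def)
    finally have le: "a powr (3/2) * b powr (3/2) \<le> K ^ 3 * w ^ 3"
      by (simp only: power_mult_distrib)
    have pos: "a powr (3/2) * b powr (3/2) > 0" using ab by auto
    have "1 / w ^ 3 = K ^ 3 / (K ^ 3 * w ^ 3)" using K wpos by simp
    also have "\<dots> \<le> K ^ 3 / (a powr (3/2) * b powr (3/2))"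
      using le pos K by (intro divide_left_mono) auto
    also have "\<dots> = K ^ 3 * ?g p"
      unfolding p a_def b_def prod.case by (simp add: powr_minus_divide)
    finally show ?thesis using wpos unfolding w_def[symmetric] by simp
  qed
  have "(\<lambda>p. 1 / norm (?h p) ^ 3) summable_on (UNIV - {(0,0)})"
    by (rule summable_on_comparison_test[OF g]) (use le in auto)
  moreover have "bij_betw ?h (UNIV - {(0,0)}) (\<Lambda> - {0})"
    unfolding bij_betw_def
  proof
    show "inj_on ?h (UNIV - {(0, 0)})"
      by (rule inj_onI) (auto simp: lattice_point_inj split: prod.splits)
    have "?h ` UNIV = \<Lambda>" by (auto simp: lattice_def)
    moreover have "inj ?h" by (rule injI) (auto simp: lattice_point_inj split: prod.splits)
    ultimately have "?h ` (UNIV - {(0, 0)}) = \<Lambda> - ?h ` {(0, 0)}"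
      by (simp only: image_set_diff)
    then show "?h ` (UNIV - {(0, 0)}) = \<Lambda> - {0}" by simp
  qed
  ultimately show ?thesis
    using summable_on_reindex_bij_betw[of ?h _ _ "\<lambda>w. 1 / norm w ^ 3"] by simp
qed

end

section \<open>Holomorphy, periods and pole of the Weierstrass function\<close>

context upper_half_plane
begin

abbreviation "wp \<equiv> weierstrass_p \<tau>"

text \<open>The difference equals \<open>z (2w - z) / ((z - w)^2 w^2)\<close>. For
  \<open>|z| \<le> R < |w| / 2\<close> the numerator is at most \<open>5/2 R |w|\<close> and the
  denominator at least \<open>|w|^4 / 4\<close>, whence the factor 10.\<close>

lemma wp_term_bound:
  fixes w z :: complex
  assumes "norm w > 2 * R" "norm z \<le> R"
  shows "norm (1 / (z - w)\<^sup>2 - 1 / w\<^sup>2) \<le> 10 * R * (1 / norm w ^ 3)"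
proof -
  have R: "R \<ge> 0" using assms(2) norm_ge_zero order_trans by blast
  have w: "norm w > 0" using assms R by linarith
  then have w0: "w \<noteq> 0" by auto
  have "norm w \<le> norm z + norm (z - w)"
    using norm_triangle_ineq4[of z "z - w"] by simp
  then have zw: "norm (z - w) \<ge> norm w / 2" using assms by simp
  then have zw0: "z - w \<noteq> 0" using w by auto
  have p: "(z - w)\<^sup>2 \<noteq> 0" and q: "w\<^sup>2 \<noteq> 0" using w0 zw0 by auto
  have "1 / (z - w)\<^sup>2 - 1 / w\<^sup>2 = (w\<^sup>2 - (z - w)\<^sup>2) / ((z - w)\<^sup>2 * w\<^sup>2)"
    using diff_frac_eq[OF p q, of 1 1] by (simp only: mult_1_left)
  also have "w\<^sup>2 - (z - w)\<^sup>2 = z * (2 * w - z)" by (simp add: power2_eq_square algebra_simps)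
  finally have eq: "norm (1 / (z - w)\<^sup>2 - 1 / w\<^sup>2) = norm z * norm (2 * w - z) / (norm (z - w) ^ 2 * norm w ^ 2)"
    by (simp add: norm_mult norm_divide norm_power)
  have "norm (2 * w - z) \<le> norm (2 * w) + norm z" by (rule norm_triangle_ineq4)
  then have "norm (2 * w - z) \<le> 5 / 2 * norm w" using assms by (simp add: norm_mult)
  then have num: "norm z * norm (2 * w - z) \<le> R * (5 / 2 * norm w)"
    using assms R by (intro mult_mono) auto
  have "(norm w / 2) ^ 2 \<le> norm (z - w) ^ 2" using zw by (intro power_mono) auto
  then have "(norm w / 2) ^ 2 * norm w ^ 2 \<le> norm (z - w) ^ 2 * norm w ^ 2"
    by (rule mult_right_mono) simp
  with num have "norm z * norm (2 * w - z) / (norm (z - w) ^ 2 * norm w ^ 2)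
      \<le> R * (5 / 2 * norm w) / ((norm w / 2) ^ 2 * norm w ^ 2)"
    using w R zw0 by (intro frac_le) auto
  also have "\<dots> = 10 * R * (1 / norm w ^ 3)"
    using w by (simp add: power2_eq_square power3_eq_cube)
  finally show ?thesis using eq by simp
qed

text \<open>Cutting at \<open>2R\<close> separates the finitely many summands that may have poles in
  the disc of radius \<open>R\<close> from a tail that converges uniformly on it.\<close>

definition far :: "real \<Rightarrow> complex set" where "far R = {w \<in> \<Lambda>. norm w > 2 * R}"
definition near :: "real \<Rightarrow> complex set" where "near R = {w \<in> \<Lambda> - {0}. norm w \<le> 2 * R}"
definition wp_tail :: "real \<Rightarrow> complex \<Rightarrow> complex" where
  "wp_tail R z = (\<Sum>\<^sub>\<infinity>w\<in>far R. 1 / (z - w)\<^sup>2 - 1 / w\<^sup>2)"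

lemma finite_near: "finite (near R)"
  by (rule finite_subset[OF _ finite_lattice_cball[of "2 * R"]]) (auto simp: near_def)

lemma lattice_split: "R \<ge> 0 \<Longrightarrow> \<Lambda> - {0} = near R \<union> far R" "near R \<inter> far R = {}"
  by (auto simp: near_def far_def)

lemma far_summable: "R \<ge> 0 \<Longrightarrow> (\<lambda>w. C * (1 / norm w ^ 3)) summable_on far R"
  by (intro summable_on_cmult_right summable_on_subset_banach[OF lattice_inverse_cubes_summable])
     (auto simp: far_def)

lemma wp_tail_summable:
  assumes "norm z \<le> R" "R \<ge> 0"
  shows "(\<lambda>w. 1 / (z - w)\<^sup>2 - 1 / w\<^sup>2) summable_on far R"
  by (rule abs_summable_summable, rule Infinite_Sum.abs_summable_on_comparison_test'[OF far_summable[of R "10 * R"]])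
     (use assms in \<open>auto simp: far_def intro!: order_trans[OF wp_term_bound]\<close>)

lemma wp_split:
  assumes "norm z \<le> R" "R \<ge> 0"
  shows "wp z = 1 / z\<^sup>2 + (\<Sum>w\<in>near R. 1 / (z - w)\<^sup>2 - 1 / w\<^sup>2) + wp_tail R z"
proof -
  have "(\<Sum>\<^sub>\<infinity>w\<in>\<Lambda> - {0}. 1 / (z - w)\<^sup>2 - 1 / w\<^sup>2) =
      (\<Sum>\<^sub>\<infinity>w\<in>near R. 1 / (z - w)\<^sup>2 - 1 / w\<^sup>2) + wp_tail R z"
    unfolding wp_tail_def lattice_split(1)[OF assms(2)]
    by (rule infsum_Un_disjoint[OF summable_on_finite[OF finite_near] wp_tail_summable[OF assms] lattice_split(2)])
  then show ?thesis by (simp add: weierstrass_p_def finite_near)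
qed

lemma wp_term_deriv:
  "((\<lambda>z. 1 / (z - w)\<^sup>2 - c) has_field_derivative - 2 / (z - w) ^ 3) (at z)"
  if "z - w \<noteq> 0" for z w c :: complex
proof -
  have "((\<lambda>z. 1 / (z - w)\<^sup>2 - c) has_field_derivative
      (0 * (z - w)\<^sup>2 - 1 * (2 * (z - w))) / ((z - w)\<^sup>2 * (z - w)\<^sup>2) - 0) (at z)"
    using that by (auto intro!: derivative_eq_intros)
  also have "(0 * (z - w)\<^sup>2 - 1 * (2 * (z - w))) / ((z - w)\<^sup>2 * (z - w)\<^sup>2) - 0 = - 2 / (z - w) ^ 3"
  proof -
    define d where "d = z - w"
    have "d \<noteq> 0" using that by (simp add: d_def)
    then show ?thesis unfolding d_def[symmetric]
      by (simp add: power2_eq_square power3_eq_cube)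
  qed
  finally show ?thesis .
qed

text \<open>The finite partial sums converge uniformly on the closed disc, so their derivatives
  converge inside; a limit along finite subsets is by definition an unordered sum.\<close>

lemma wp_tail_deriv:
  assumes "norm z < R"
  shows "\<exists>D. (wp_tail R has_field_derivative D) (at z) \<and> ((\<lambda>w. - 2 / (z - w) ^ 3) has_sum D) (far R)"
proof -
  have R: "R > 0" using assms norm_ge_zero le_less_trans by blast
  let ?f = "\<lambda>Y z. (\<Sum>w\<in>Y. 1 / (z - w)\<^sup>2 - 1 / w\<^sup>2)"
  let ?f' = "\<lambda>Y z. (\<Sum>w\<in>Y. - 2 / (z - w) ^ 3)"
  have ne: "z - w \<noteq> 0" if "z \<in> cball 0 R" "w \<in> far R" for z w
    using that R by (auto simp: far_def)
  have ulim: "uniform_limit (cball 0 R) ?f (wp_tail R) (finite_subsets_at_top (far R))"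
    unfolding wp_tail_def
    by (rule Weierstrass_m_test_general[OF _ far_summable[of R "10 * R"]])
       (use R in \<open>auto simp: far_def intro!: order_trans[OF wp_term_bound]\<close>)
  have cont: "\<forall>\<^sub>F Y in finite_subsets_at_top (far R). continuous_on (cball 0 R) (?f Y) \<and>
      (\<forall>z\<in>ball 0 R. (?f Y has_field_derivative ?f' Y z) (at z))"
  proof (rule eventually_finite_subsets_at_top_weakI)
    fix Y assume Y: "finite Y" "Y \<subseteq> far R"
    have d: "(?f Y has_field_derivative ?f' Y z) (at z)" if "z \<in> cball 0 R" for z
      using Y that ne by (intro DERIV_sum wp_term_deriv) blast
    then have "continuous_on (cball 0 R) (?f Y)"
      by (intro DERIV_continuous_on[of _ _ "?f' Y"]) (blast intro: has_field_derivative_at_within)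
    with d show "continuous_on (cball 0 R) (?f Y) \<and>
      (\<forall>z\<in>ball 0 R. (?f Y has_field_derivative ?f' Y z) (at z))" by auto
  qed
  obtain g' where g': "\<And>w. w \<in> ball 0 R \<Longrightarrow> (wp_tail R has_field_derivative (g' w)) (at w) \<and>
      ((\<lambda>Y. ?f' Y w) \<longlongrightarrow> g' w) (finite_subsets_at_top (far R))"
    using has_complex_derivative_uniform_limit[OF cont ulim finite_subsets_at_top_neq_bot R] by metis
  from g'[of z] show ?thesis using assms unfolding has_sum_def by auto
qed

text \<open>Differentiation removes the constants \<open>1 / w^2\<close>, so the three pieces
  recombine into one sum over the whole lattice. In this form translation by a lattice point merely
  permutes the terms, which gives the periods of the derivative at once.\<close>

lemma wp_has_deriv:
  assumes "z \<notin> \<Lambda>"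
  shows "(wp has_field_derivative deriv wp z) (at z)"
    and "((\<lambda>w. - 2 / (z - w) ^ 3) has_sum deriv wp z) \<Lambda>"
proof -
  define R where "R = norm z + 1"
  have R: "R > 0" "norm z < R" unfolding R_def by (auto intro: add_nonneg_pos)
  obtain D where D: "(wp_tail R has_field_derivative D) (at z)"
      "((\<lambda>w. - 2 / (z - w) ^ 3) has_sum D) (far R)"
    using wp_tail_deriv[OF R(2)] by blast
  have ne: "z - w \<noteq> 0" if "w \<in> \<Lambda>" for w using that assms by auto
  have z0: "z \<noteq> 0" using assms lattice_0 by auto
  have "((\<lambda>z. 1 / z\<^sup>2 + (\<Sum>w\<in>near R. 1 / (z - w)\<^sup>2 - 1 / w\<^sup>2) + wp_tail R z) has_field_derivative
      - 2 / z ^ 3 + (\<Sum>w\<in>near R. - 2 / (z - w) ^ 3) + D) (at z)"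
  proof (intro DERIV_add DERIV_sum D(1))
    show "((\<lambda>z. 1 / z\<^sup>2) has_field_derivative - 2 / z ^ 3) (at z)"
      using wp_term_deriv[of z 0 0] z0 by simp
    show "((\<lambda>z. 1 / (z - w)\<^sup>2 - 1 / w\<^sup>2) has_field_derivative - 2 / (z - w) ^ 3) (at z)"
      if "w \<in> near R" for w using that ne by (intro wp_term_deriv) (auto simp: near_def)
  qed
  then have wd: "(wp has_field_derivative - 2 / z ^ 3 + (\<Sum>w\<in>near R. - 2 / (z - w) ^ 3) + D) (at z)"
    by (rule has_field_derivative_transform_within_open[where S = "ball 0 R"])
       (use R wp_split[of _ R] in auto)
  then have eq: "deriv wp z = - 2 / z ^ 3 + (\<Sum>w\<in>near R. - 2 / (z - w) ^ 3) + D"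
    by (rule DERIV_imp_deriv)
  with wd show "(wp has_field_derivative deriv wp z) (at z)" by simp
  have "((\<lambda>w. - 2 / (z - w) ^ 3) has_sum (\<Sum>w\<in>near R. - 2 / (z - w) ^ 3) + D) (near R \<union> far R)"
    by (intro has_sum_Un_disjoint has_sum_finite finite_near D(2) lattice_split(2))
  then have "((\<lambda>w. - 2 / (z - w) ^ 3) has_sum - 2 / z ^ 3 + ((\<Sum>w\<in>near R. - 2 / (z - w) ^ 3) + D))
      ({0} \<union> (near R \<union> far R))"
    by (rule has_sum_Un_disjoint[rotated]) (use R in \<open>auto simp: near_def far_def intro!: has_sum_finiteI\<close>)
  moreover have "{0} \<union> (near R \<union> far R) = \<Lambda>"
    using lattice_split(1)[OF less_imp_le[OF R(1)]] lattice_0[of \<tau>] by blast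
  ultimately show "((\<lambda>w. - 2 / (z - w) ^ 3) has_sum deriv wp z) \<Lambda>"
    unfolding eq by (simp only: add.assoc)
qed

lemma closed_lattice: "closed \<Lambda>"
proof -
  have "open (- \<Lambda>)"
  proof (rule openI)
    fix z assume z: "z \<in> - \<Lambda>"
    define F where "F = \<Lambda> \<inter> cball 0 (norm z + 1)"
    have "open (- F \<inter> ball z 1)"
      by (intro open_Int open_Compl finite_imp_closed) (auto simp: F_def finite_lattice_cball)
    moreover have "z \<in> - F \<inter> ball z 1" using z by (auto simp: F_def)
    ultimately obtain e where e: "e > 0" "ball z e \<subseteq> - F \<inter> ball z 1"
      using openE by blast
    have "ball z e \<subseteq> - \<Lambda>"
    proof
      fix w assume "w \<in> ball z e"
      then have "w \<notin> F" "dist z w < 1" using e by auto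
      moreover have "norm w \<le> norm z + norm (w - z)"
        using norm_triangle_ineq[of z "w - z"] by simp
      ultimately show "w \<in> - \<Lambda>" by (auto simp: F_def dist_norm norm_minus_commute)
    qed
    with e(1) show "\<exists>e>0. ball z e \<subseteq> - \<Lambda>" by blast
  qed
  then show ?thesis by (simp add: closed_def)
qed

lemma connected_Compl_lattice: "connected (- \<Lambda>)"
  unfolding Compl_eq_Diff_UNIV
  by (rule connected_open_diff_countable) (auto simp: countable_lattice)

lemma wp_holomorphic: "wp holomorphic_on - \<Lambda>"
  using wp_has_deriv(1) closed_lattice
  by (subst holomorphic_on_open) (auto simp: open_Compl)

lemma wp_uminus: "wp (- z) = wp z"
proof -
  have "(\<Sum>\<^sub>\<infinity>w\<in>\<Lambda> - {0}. 1 / (- z - w)\<^sup>2 - 1 / w\<^sup>2) = (\<Sum>\<^sub>\<infinity>w\<in>\<Lambda> - {0}. 1 / (z - w)\<^sup>2 - 1 / w\<^sup>2)"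
  proof (rule infsum_reindex_bij_witness[where i = uminus and j = uminus])
    fix w
    have "(z - - w)\<^sup>2 = (- z - w)\<^sup>2" by (simp add: power2_eq_square algebra_simps)
    then show "1 / (z - - w)\<^sup>2 - 1 / (- w)\<^sup>2 = 1 / (- z - w)\<^sup>2 - 1 / w\<^sup>2" by simp
  qed (auto simp: lattice_uminus_iff)
  then show ?thesis by (simp add: weierstrass_p_def)
qed

lemma deriv_wp_periodic:
  assumes "z \<notin> \<Lambda>" "u \<in> \<Lambda>"
  shows "deriv wp (z + u) = deriv wp z"
proof -
  have "z + u \<notin> \<Lambda>" using assms lattice_add_iff by blast
  then have "((\<lambda>w. - 2 / (z + u - w) ^ 3) has_sum deriv wp (z + u)) \<Lambda>"
    by (rule wp_has_deriv(2))
  also have "?this \<longleftrightarrow> ((\<lambda>w. - 2 / (z - w) ^ 3) has_sum deriv wp (z + u)) \<Lambda>"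
    by (rule has_sum_reindex_bij_witness[where i = "\<lambda>w. w + u" and j = "\<lambda>w. w - u"])
       (use assms lattice_add lattice_diff in \<open>auto simp: algebra_simps\<close>)
  finally show ?thesis
    using wp_has_deriv(2)[OF assms(1)] has_sum_unique by blast
qed

text \<open>The difference \<open>\<wp>(z + u) - \<wp>(z)\<close> has derivative zero on the
  connected complement of the lattice. Its constant value is read off at \<open>z = - u / 2\<close>,
  where it vanishes because \<open>\<wp>\<close> is even; hence the condition
  \<open>u / 2 \<notin> \<Lambda>\<close>.\<close>

lemma wp_periodic_half:
  assumes u: "u \<in> \<Lambda>" "u / 2 \<notin> \<Lambda>" and z: "z \<notin> \<Lambda>"
  shows "wp (z + u) = wp z"
proof -
  have ev: "((\<lambda>z. wp (z + u) - wp z) has_field_derivative 0) (at z)" if "z \<in> - \<Lambda>" for z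
  proof -
    have "z + u \<notin> \<Lambda>" "z \<notin> \<Lambda>" using that u lattice_add_iff by auto
    from DERIV_shift[THEN iffD1, OF wp_has_deriv(1)[OF this(1)]] wp_has_deriv(1)[OF this(2)]
    have "((\<lambda>z. wp (z + u) - wp z) has_field_derivative deriv wp (z + u) - deriv wp z) (at z)"
      by (intro DERIV_diff)
    then show ?thesis using deriv_wp_periodic[OF \<open>z \<notin> \<Lambda>\<close> u(1)] by simp
  qed
  obtain c where c: "\<And>z. z \<in> - \<Lambda> \<Longrightarrow> wp (z + u) - wp z = c"
  proof (rule DERIV_zero_connected_constant[OF connected_Compl_lattice _ finite.emptyI])
    show "open (- \<Lambda>)" using closed_lattice by (rule open_Compl)
    show "continuous_on (- \<Lambda>) (\<lambda>z. wp (z + u) - wp z)"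
      using ev by (intro continuous_at_imp_continuous_on ballI DERIV_isCont) blast
  qed (use ev in auto)
  have "- (u / 2) \<in> - \<Lambda>" using u(2) lattice_uminus_iff by auto
  from c[OF this] wp_uminus[of "u / 2"] have "c = 0" by simp
  with c[of z] z show ?thesis by simp
qed

lemma half_notin: "1 / 2 \<notin> \<Lambda>" "\<tau> / 2 \<notin> \<Lambda>" "(1 + \<tau>) / 2 \<notin> \<Lambda>"
proof -
  have Im: "Im (of_int m + of_int n * \<tau>) = of_int n * Im \<tau>"
    and Re: "Re (of_int m + of_int n * \<tau>) = of_int m + of_int n * Re \<tau>" for m n
    by auto
  have half: "of_int n \<noteq> (1 / 2 :: real)" for n
  proof
    assume "of_int n = (1 / 2 :: real)"
    then have "2 * n = 1" by linarith
    then show False by presburger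
  qed
  show "1 / 2 \<notin> \<Lambda>"
  proof
    assume "1 / 2 \<in> \<Lambda>"
    then obtain m n :: int where mn: "1 / 2 = of_int m + of_int n * \<tau>" by (auto simp: lattice_def)
    have "n = 0" using arg_cong[OF mn, of Im] Im_pos by (simp only: Im) auto
    then show False using arg_cong[OF mn, of Re] half[of m] by (simp only: Re) auto
  qed
  show "\<tau> / 2 \<notin> \<Lambda>"
  proof
    assume "\<tau> / 2 \<in> \<Lambda>"
    then obtain m n :: int where mn: "\<tau> / 2 = of_int m + of_int n * \<tau>" by (auto simp: lattice_def)
    have "of_int n = (1 / 2 :: real)" using arg_cong[OF mn, of Im] Im_pos by (simp only: Im) auto
    then show False using half by auto
  qed
  show "(1 + \<tau>) / 2 \<notin> \<Lambda>"
  proof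
    assume "(1 + \<tau>) / 2 \<in> \<Lambda>"
    then obtain m n :: int where mn: "(1 + \<tau>) / 2 = of_int m + of_int n * \<tau>" by (auto simp: lattice_def)
    have "of_int n = (1 / 2 :: real)" using arg_cong[OF mn, of Im] Im_pos by (simp only: Im) auto
    then show False using half by auto
  qed
qed

text \<open>Evaluation at \<open>- u / 2\<close> is impossible for \<open>u\<close> in
  \<open>2\<Lambda>\<close>, so it is applied to the generators 1 and \<open>\<tau>\<close>, and
  general periods are reached by iteration.\<close>

lemma wp_periodic:
  assumes "u \<in> \<Lambda>" "z \<notin> \<Lambda>"
  shows "wp (z + u) = wp z"
proof -
  have one: "wp (z + 1) = wp z" if "z \<notin> \<Lambda>" for z
    using wp_periodic_half[OF lattice_1 half_notin(1) that] .
  have tau: "wp (z + \<tau>) = wp z" if "z \<notin> \<Lambda>" for z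
    using wp_periodic_half[OF lattice_tau half_notin(2) that] .
  have nat: "wp (z + of_nat n) = wp z \<and> wp (z + of_nat n * \<tau>) = wp z" if "z \<notin> \<Lambda>" for n z
  proof (induction n)
    case (Suc n)
    have "of_int (int n) + of_int 0 * \<tau> \<in> \<Lambda>" "of_int 0 + of_int (int n) * \<tau> \<in> \<Lambda>"
      unfolding lattice_def by blast+
    then have "z + of_nat n \<notin> \<Lambda>" "z + of_nat n * \<tau> \<notin> \<Lambda>"
      using that lattice_add_iff by auto
    from one[OF this(1)] tau[OF this(2)] Suc show ?case by (simp add: algebra_simps)
  qed simp
  have neg: "wp (z - of_nat n) = wp z \<and> wp (z - of_nat n * \<tau>) = wp z" if z: "z \<notin> \<Lambda>" for n z
  proof -
    have "of_int (int n) + of_int 0 * \<tau> \<in> \<Lambda>" "of_int 0 + of_int (int n) * \<tau> \<in> \<Lambda>"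
      unfolding lattice_def by blast+
    then have "z - of_nat n \<notin> \<Lambda>" "z - of_nat n * \<tau> \<notin> \<Lambda>"
      using that lattice_add by force+
    then show ?thesis using nat[of "z - of_nat n" n] nat[of "z - of_nat n * \<tau>" n] by simp
  qed
  obtain m n :: int where u: "u = of_int m + of_int n * \<tau>" using assms(1) by (auto simp: lattice_def)
  have mL: "z + of_int m \<notin> \<Lambda>"
  proof -
    have "of_int m + of_int 0 * \<tau> \<in> \<Lambda>" unfolding lattice_def by blast
    then show ?thesis using assms(2) lattice_add_iff by auto
  qed
  have "wp (z + of_int m) = wp z"
    using nat[OF assms(2), of "nat m"] neg[OF assms(2), of "nat (- m)"] by (cases "m \<ge> 0") auto
  moreover have "wp (z + of_int m + of_int n * \<tau>) = wp (z + of_int m)"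
    using nat[OF mL, of "nat n"] neg[OF mL, of "nat (- n)"] by (cases "n \<ge> 0") auto
  ultimately show ?thesis by (simp add: u add.assoc)
qed

lemma deriv_wp_uminus:
  assumes "z \<notin> \<Lambda>"
  shows "deriv wp (- z) = - deriv wp z"
proof -
  have "((\<lambda>z. wp (- z)) has_field_derivative deriv wp (- z) * (- 1)) (at z)"
    using assms by (intro DERIV_chain2[of wp] wp_has_deriv(1)) (auto intro!: derivative_eq_intros simp: lattice_uminus_iff)
  then have "(wp has_field_derivative - deriv wp (- z)) (at z)" by (simp add: wp_uminus)
  then show ?thesis using wp_has_deriv(1)[OF assms] DERIV_unique by fastforce
qed

lemma wp_near_0:
  obtains R G where "R > 0" "G holomorphic_on ball 0 R" "\<Lambda> \<inter> ball 0 R = {0}"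
    "\<And>z. z \<in> ball 0 R \<Longrightarrow> wp z = 1 / z\<^sup>2 + G z"
proof -
  define F where "F = (\<Lambda> \<inter> cball 0 1) - {0}"
  have "finite F" unfolding F_def using finite_lattice_cball by auto
  then obtain d where d: "d > 0" "\<And>x. x \<in> F \<Longrightarrow> x \<noteq> 0 \<Longrightarrow> d \<le> dist 0 x"
    using finite_set_avoid[of F 0] by blast
  \<comment> \<open>With \<open>2R < min d 1\<close> no nonzero lattice point has norm at most
    \<open>2R\<close>. Hence \<open>near R\<close> is empty and \<open>wp_tail R\<close> is the
    entire regular part.\<close>
  define R where "R = min d 1 / 3"
  have R: "R > 0" "2 * R < d" "2 * R < 1" using d(1) by (auto simp: R_def)
  have near: "near R = {}"
  proof (rule ccontr)
    assume "near R \<noteq> {}"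
    then obtain w where w: "w \<in> \<Lambda>" "w \<noteq> 0" "norm w \<le> 2 * R" by (auto simp: near_def)
    then have "w \<in> F" using R by (auto simp: F_def)
    with d(2)[OF this] w R show False by simp
  qed
  have "wp_tail R holomorphic_on ball 0 R"
    using wp_tail_deriv by (subst holomorphic_on_open) fastforce+
  moreover have "\<Lambda> \<inter> ball 0 R = {0}"
  proof (intro equalityI subsetI)
    fix w assume w: "w \<in> \<Lambda> \<inter> ball 0 R"
    have "w \<notin> near R" by (simp add: near)
    with w R(1) show "w \<in> {0}" by (auto simp: near_def)
  qed (use R lattice_0 in auto)
  moreover have "wp z = 1 / z\<^sup>2 + wp_tail R z" if "z \<in> ball 0 R" for z
    using wp_split[of z R] that near R by simp
  ultimately show ?thesis using that R(1) by blast
qed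

text \<open>These two leading terms are all that the later arguments use of the Laurent expansion at
  0.\<close>

lemma tendsto_wp_0: "((\<lambda>z. z\<^sup>2 * wp z) \<longlongrightarrow> 1) (at 0)"
  and tendsto_deriv_wp_0: "((\<lambda>z. z ^ 3 * deriv wp z) \<longlongrightarrow> - 2) (at 0)"
proof -
  obtain R G where R: "R > 0" and G: "G holomorphic_on ball 0 R"
    and L: "\<Lambda> \<inter> ball 0 R = {0}" and eq: "\<And>z. z \<in> ball 0 R \<Longrightarrow> wp z = 1 / z\<^sup>2 + G z"
    using wp_near_0 by metis
  have ev: "\<forall>\<^sub>F z in at 0. z \<in> ball 0 R - {0}"
    using R eventually_at_in_open[of "ball 0 R" 0] by simp
  have "isCont G 0"
    using holomorphic_on_imp_continuous_on[OF G] R by (simp add: continuous_on_eq_continuous_at)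
  then have "((\<lambda>z. 1 + z\<^sup>2 * G z) \<longlongrightarrow> 1 + 0\<^sup>2 * G 0) (at 0)"
    by (intro tendsto_intros) (simp add: isCont_def)
  then have lim: "((\<lambda>z. 1 + z\<^sup>2 * G z) \<longlongrightarrow> 1) (at 0)" by simp
  have "\<forall>\<^sub>F z in at 0. 1 + z\<^sup>2 * G z = z\<^sup>2 * wp z"
    using ev by (rule eventually_mono) (auto simp: eq algebra_simps)
  from Lim_transform_eventually[OF lim this] show "((\<lambda>z. z\<^sup>2 * wp z) \<longlongrightarrow> 1) (at 0)" .
  have dG: "deriv G holomorphic_on ball 0 R" using G by (rule holomorphic_deriv) simp
  have "isCont (deriv G) 0"
    using holomorphic_on_imp_continuous_on[OF dG] R by (simp add: continuous_on_eq_continuous_at)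
  then have lim: "((\<lambda>z. - 2 + z ^ 3 * deriv G z) \<longlongrightarrow> - 2 + 0 ^ 3 * deriv G 0) (at 0)"
    by (intro tendsto_intros) (simp add: isCont_def)
  have "- 2 + z ^ 3 * deriv G z = z ^ 3 * deriv wp z" if z: "z \<in> ball 0 R - {0}" for z
  proof -
    have "(G has_field_derivative deriv G z) (at z)"
      using G z by (intro holomorphic_derivI[of G "ball 0 R"]) auto
    then have "((\<lambda>z. 1 / z\<^sup>2 + G z) has_field_derivative - 2 / z ^ 3 + deriv G z) (at z)"
      using wp_term_deriv[of z 0 0] z by (intro DERIV_add) auto
    then have "(wp has_field_derivative - 2 / z ^ 3 + deriv G z) (at z)"
      by (rule has_field_derivative_transform_within_open[where S = "ball 0 R"]) (use z eq in auto)
    then have "deriv wp z = - 2 / z ^ 3 + deriv G z" by (rule DERIV_imp_deriv)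
    then have "z ^ 3 * deriv wp z = z ^ 3 * (- 2 / z ^ 3) + z ^ 3 * deriv G z" by (simp only: distrib_left)
    then show ?thesis using z by simp
  qed
  then have "\<forall>\<^sub>F z in at 0. - 2 + z ^ 3 * deriv G z = z ^ 3 * deriv wp z"
    using ev by (rule eventually_mono[rotated])
  from Lim_transform_eventually[OF lim this] show "((\<lambda>z. z ^ 3 * deriv wp z) \<longlongrightarrow> - 2) (at 0)"
    by simp
qed

end

subsection \<open>Elliptic functions\<close>

text \<open>Each point has a punctured neighbourhood free of \<open>H\<close>, so the one-point
  removable singularity theorem applies on small discs; on \<open>H\<close> the extension takes the
  limits as values. The exceptional sets in the applications are a lattice, half a lattice and a
  translate of the integers.\<close>

lemma removable_extension:
  fixes f :: "complex \<Rightarrow> complex"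
  assumes f: "f holomorphic_on - H" and H: "closed H"
    and disc: "\<And>z. \<forall>\<^sub>F w in at z. w \<notin> H"
    and lim: "\<And>z. z \<in> H \<Longrightarrow> \<exists>L. (f \<longlongrightarrow> L) (at z)"
  obtains g where "g holomorphic_on UNIV" "\<And>z. z \<notin> H \<Longrightarrow> g z = f z"
proof -
  define g where "g z = (if z \<in> H then Lim (at z) f else f z)" for z
  have "g field_differentiable at z" for z
  proof -
    obtain e where e: "e > 0" "\<And>w. w \<noteq> z \<Longrightarrow> dist w z < e \<Longrightarrow> w \<notin> H"
      using disc[of z] by (auto simp: eventually_at)
    have "(f \<longlongrightarrow> g z) (at z)"
    proof (cases "z \<in> H")
      case True
      then obtain L where "(f \<longlongrightarrow> L) (at z)" using lim by blast
      then show ?thesis using True by (simp add: g_def tendsto_Lim)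
    next
      case False
      then have "isCont f z"
        using holomorphic_on_imp_continuous_on[OF f] H
        by (simp add: continuous_on_eq_continuous_at open_Compl)
      then show ?thesis using False by (simp add: g_def isCont_def)
    qed
    then have lim: "(g \<longlongrightarrow> g z) (at z)"
      by (rule Lim_transform_eventually) (use disc[of z] in \<open>auto elim!: eventually_mono simp: g_def\<close>)
    have "g holomorphic_on ball z e"
    proof (rule no_isolated_singularity'[where K = "{z}"])
      show "(g \<longlongrightarrow> g w) (at w within ball z e)" if "w \<in> {z}" for w
        using lim that tendsto_within_subset[of g _ z UNIV] by auto
      show "g holomorphic_on ball z e - {z}"
      proof (rule holomorphic_transform)
        show "f holomorphic_on ball z e - {z}"
          using f by (rule holomorphic_on_subset) (use e in \<open>auto simp: dist_commute\<close>)
        show "f w = g w" if "w \<in> ball z e - {z}" for w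
          using that e by (auto simp: g_def dist_commute)
      qed
    qed auto
    then show ?thesis
      using e(1) by (simp add: holomorphic_on_imp_differentiable_at)
  qed
  then have "g holomorphic_on UNIV" by (simp add: holomorphic_on_def)
  then show ?thesis by (rule that) (simp add: g_def)
qed

lemma tendsto_shift:
  fixes f :: "complex \<Rightarrow> complex"
  shows "((\<lambda>z. f (z + a)) \<longlongrightarrow> L) (at b) \<longleftrightarrow> (f \<longlongrightarrow> L) (at (b + a))"
proof -
  have "at (b + a) = filtermap (\<lambda>z. z + a) (at b)"
    using filtermap_at_shift[of "- a" "b"] by simp
  then show ?thesis by (simp add: filterlim_filtermap)
qed

text \<open>Dividing once by \<open>z - a\<close> gives a holomorphic function with value
  \<open>deriv f a = 0\<close> at \<open>a\<close>; the limit is its derivative there. This is how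
  the double zero of \<open>\<wp>(z) - \<wp>(u)\<close> at a half period \<open>u\<close> cancels a
  double pole.\<close>

lemma double_zero_limit:
  fixes f :: "complex \<Rightarrow> complex"
  assumes f: "f holomorphic_on S" and S: "open S" "a \<in> S" and d: "deriv f a = 0"
  shows "\<exists>L. ((\<lambda>z. (f z - f a) / (z - a)\<^sup>2) \<longlongrightarrow> L) (at a)"
proof -
  define h where "h z = (if z = a then deriv f a else (f z - f a) / (z - a))" for z
  have "h holomorphic_on S" unfolding h_def
    by (rule pole_lemma[OF f]) (use S in \<open>simp add: interior_open\<close>)
  then have "(h has_field_derivative deriv h a) (at a)"
    using S by (rule holomorphic_derivI)
  then have lim: "((\<lambda>z. (h z - h a) / (z - a)) \<longlongrightarrow> deriv h a) (at a)"
    by (simp add: has_field_derivative_iff)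
  have ev: "\<forall>\<^sub>F z in at a. (h z - h a) / (z - a) = (f z - f a) / (z - a)\<^sup>2"
    unfolding eventually_at_filter by (auto simp: h_def d power2_eq_square)
  from Lim_transform_eventually[OF lim ev] show ?thesis by blast
qed

context upper_half_plane
begin

lemma eventually_not_lattice: "\<forall>\<^sub>F w in at z. w \<notin> \<Lambda>"
proof -
  define F where "F = \<Lambda> \<inter> cball 0 (norm z + 1)"
  have "open (- (F - {z}) \<inter> ball z 1)"
    by (intro open_Int open_Compl finite_imp_closed) (auto simp: F_def finite_lattice_cball)
  moreover have "z \<in> - (F - {z}) \<inter> ball z 1" by auto
  ultimately have "\<forall>\<^sub>F w in at z. w \<in> - (F - {z}) \<inter> ball z 1 - {z}"
    by (rule eventually_at_in_open)
  then show ?thesis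
  proof eventually_elim
    case (elim w)
    then have "norm (w - z) < 1" by (simp add: dist_norm norm_minus_commute)
    moreover have "norm w \<le> norm z + norm (w - z)"
      using norm_triangle_ineq[of z "w - z"] by simp
    ultimately have "w \<in> cball 0 (norm z + 1)" by simp
    with elim show ?case by (auto simp: F_def)
  qed
qed

definition half_lattice :: "complex set" where "half_lattice = {z. 2 * z \<in> \<Lambda>}"

lemma lattice_subset_half: "z \<in> \<Lambda> \<Longrightarrow> z \<in> half_lattice"
  unfolding half_lattice_def mem_Collect_eq mult_2 by (rule lattice_add)

lemma half_lattice_add: "u \<in> half_lattice \<Longrightarrow> z + u \<in> half_lattice \<longleftrightarrow> z \<in> half_lattice"
  by (simp add: half_lattice_def distrib_left lattice_add_iff)

lemma half_lattice_uminus: "- z \<in> half_lattice \<longleftrightarrow> z \<in> half_lattice"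
  by (simp add: half_lattice_def lattice_uminus_iff)

lemma closed_half_lattice: "closed half_lattice"
proof -
  have "half_lattice = (\<lambda>z. 2 * z) -` \<Lambda>" by (auto simp: half_lattice_def)
  then show ?thesis
    using closed_vimage[OF closed_lattice, of "\<lambda>z. 2 * z"] by (simp add: continuous_on_mult_left)
qed

lemma eventually_not_half_lattice: "\<forall>\<^sub>F w in at z. w \<notin> half_lattice"
proof -
  have "filterlim (\<lambda>w. 2 * w) (at (2 * z)) (at z)"
    by (rule filterlim_atI) (auto intro!: tendsto_intros simp: eventually_at_filter)
  from eventually_compose_filterlim[OF eventually_not_lattice this]
  show ?thesis by (simp add: half_lattice_def)
qed

lemma lattice_reduce:
  obtains w s t where "z = w + (complex_of_real s + complex_of_real t * \<tau>)"
    "w \<in> \<Lambda>" "0 \<le> s" "s \<le> 1" "0 \<le> t" "t \<le> 1"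
proof -
  define t where "t = Im z / Im \<tau>"
  define s where "s = Re z - t * Re \<tau>"
  have z: "z = complex_of_real s + complex_of_real t * \<tau>"
    using Im_pos by (auto simp: complex_eq_iff s_def t_def)
  have "z = (of_int \<lfloor>s\<rfloor> + of_int \<lfloor>t\<rfloor> * \<tau>) + (complex_of_real (frac s) + complex_of_real (frac t) * \<tau>)"
    unfolding z by (simp add: frac_def algebra_simps)
  moreover have "of_int \<lfloor>s\<rfloor> + of_int \<lfloor>t\<rfloor> * \<tau> \<in> \<Lambda>" by (auto simp: lattice_def)
  ultimately show ?thesis
    using that frac_ge_0 frac_lt_1 less_imp_le by metis
qed

lemma entire_periodic_constant:
  assumes g: "g holomorphic_on UNIV" and per: "\<And>z u. u \<in> \<Lambda> \<Longrightarrow> g (z + u) = g z"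
  obtains c where "\<And>z. g z = c"
proof -
  define K where "K = (\<lambda>(s, t). complex_of_real s + complex_of_real t * \<tau>) ` ({0..1} \<times> {0..1})"
  have "compact K" unfolding K_def case_prod_unfold
    by (intro compact_continuous_image compact_Times continuous_intros) auto
  then have "compact (g ` K)"
    using g by (intro compact_continuous_image) (auto intro: holomorphic_on_imp_continuous_on holomorphic_on_subset)
  moreover have "range g \<subseteq> g ` K"
  proof clarify
    fix z
    obtain w s t where z: "z = w + (complex_of_real s + complex_of_real t * \<tau>)"
      "w \<in> \<Lambda>" and st: "0 \<le> s" "s \<le> 1" "0 \<le> t" "t \<le> 1" by (rule lattice_reduce)
    have "g z = g (complex_of_real s + complex_of_real t * \<tau>)"
      unfolding z(1) by (subst add.commute) (rule per[OF z(2)])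
    moreover have "complex_of_real s + complex_of_real t * \<tau> \<in> K" using st by (force simp: K_def)
    ultimately show "g z \<in> g ` K" by auto
  qed
  ultimately have "bounded (range g)" using compact_imp_bounded bounded_subset by blast
  then have "g constant_on UNIV" using g by (rule Liouville_theorem[rotated])
  then show ?thesis using that by (auto simp: constant_on_def)
qed

lemma half_lattice_cases:
  assumes "z \<in> half_lattice"
  obtains w u where "z = u + w" "w \<in> \<Lambda>" "u \<in> {0, 1/2, \<tau>/2, (1 + \<tau>)/2}"
proof -
  obtain m n :: int where mn: "2 * z = of_int m + of_int n * \<tau>"
    using assms by (auto simp: half_lattice_def lattice_def)
  define w where "w = of_int (m div 2) + of_int (n div 2) * \<tau>"
  have "m = 2 * (m div 2) + m mod 2" "n = 2 * (n div 2) + n mod 2" by auto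
  then have "2 * z = of_int (2 * (m div 2) + m mod 2) + of_int (2 * (n div 2) + n mod 2) * \<tau>"
    using mn by simp
  then have "2 * z = (of_int (m mod 2) + of_int (n mod 2) * \<tau>) + 2 * w"
    by (simp only: w_def of_int_add of_int_mult of_int_numeral) (simp only: algebra_simps)
  moreover have "z = y / 2 + w" if "2 * z = y + 2 * w" for y
  proof -
    have "z = (2 * z) / 2" by simp
    then show ?thesis unfolding that by (simp only: add_divide_distrib) simp
  qed
  ultimately have "z = (of_int (m mod 2) + of_int (n mod 2) * \<tau>) / 2 + w" by blast
  moreover have "w \<in> \<Lambda>" by (auto simp: w_def lattice_def)
  moreover have "m mod 2 = 0 \<or> m mod 2 = 1" "n mod 2 = 0 \<or> n mod 2 = 1" by auto
  then have "(of_int (m mod 2) + of_int (n mod 2) * \<tau>) / 2 \<in> {0, 1/2, \<tau>/2, (1 + \<tau>)/2}" by auto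
  ultimately show ?thesis using that by blast
qed

text \<open>Periodicity transports the limits from four representatives to all half lattice points.
  The extension is then entire, periodic by continuity, and constant by compactness of a period
  parallelogram.\<close>

lemma elliptic_constant:
  assumes f: "f holomorphic_on - half_lattice"
    and per: "\<And>z u. u \<in> \<Lambda> \<Longrightarrow> z \<notin> half_lattice \<Longrightarrow> f (z + u) = f z"
    and lim: "\<And>u. u \<in> {0, 1/2, \<tau>/2, (1 + \<tau>)/2} \<Longrightarrow> \<exists>L. (f \<longlongrightarrow> L) (at u)"
  obtains c where "\<And>z. z \<notin> half_lattice \<Longrightarrow> f z = c"
proof -
  have lim': "\<exists>L. (f \<longlongrightarrow> L) (at z)" if z: "z \<in> half_lattice" for z
  proof -
    obtain w u where wu: "z = u + w" "w \<in> \<Lambda>" "u \<in> {0, 1/2, \<tau>/2, (1 + \<tau>)/2}"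
      using half_lattice_cases[OF z] by blast
    obtain L where "(f \<longlongrightarrow> L) (at u)" using lim[OF wu(3)] by blast
    then have "((\<lambda>z. f (z + w)) \<longlongrightarrow> L) (at u)"
      by (rule Lim_transform_eventually)
         (use eventually_not_half_lattice[of u] in \<open>auto elim!: eventually_mono simp: per[OF wu(2)]\<close>)
    then show ?thesis unfolding tendsto_shift wu(1) by blast
  qed
  obtain g where g: "g holomorphic_on UNIV" "\<And>z. z \<notin> half_lattice \<Longrightarrow> g z = f z"
    using removable_extension[OF f closed_half_lattice eventually_not_half_lattice lim'] by blast
  have "g (z + u) = g z" if u: "u \<in> \<Lambda>" for z u
  proof -
    have cont: "isCont g z" for z
      using holomorphic_on_imp_continuous_on[OF g(1)] by (simp add: continuous_on_eq_continuous_at)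
    have "(g \<longlongrightarrow> g (z + u)) (at (z + u))" using cont by (simp add: isCont_def)
    then have "((\<lambda>z. g (z + u)) \<longlongrightarrow> g (z + u)) (at z)" unfolding tendsto_shift .
    moreover have "\<forall>\<^sub>F w in at z. g (w + u) = g w"
      using eventually_not_half_lattice[of z]
    proof eventually_elim
      case (elim w)
      then have "w + u \<notin> half_lattice" using half_lattice_add[OF lattice_subset_half[OF u]] by simp
      then show ?case using elim per[OF u elim] g(2) by simp
    qed
    ultimately have "(g \<longlongrightarrow> g (z + u)) (at z)" by (rule Lim_transform_eventually)
    moreover have "(g \<longlongrightarrow> g z) (at z)" using cont by (simp add: isCont_def)
    ultimately show ?thesis using LIM_unique by blast
  qed
  then obtain c where "\<And>z. g z = c" using entire_periodic_constant[OF g(1)] by blast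
  then show ?thesis using that g(2) by metis
qed

lemma wp_isCont: "z \<notin> \<Lambda> \<Longrightarrow> isCont wp z"
  using wp_has_deriv(1) DERIV_isCont by blast

lemma wp_shift_holomorphic: "(\<lambda>z. wp (z + u)) holomorphic_on - ((\<lambda>z. z - u) ` \<Lambda>)"
proof -
  have "(wp \<circ> (\<lambda>z. z + u)) holomorphic_on - ((\<lambda>z. z - u) ` \<Lambda>)"
  proof (rule holomorphic_on_compose_gen[OF _ wp_holomorphic])
    show "(\<lambda>z. z + u) ` (- (\<lambda>z. z - u) ` \<Lambda>) \<subseteq> - \<Lambda>"
    proof clarify
      fix z assume z: "z \<notin> (\<lambda>z. z - u) ` \<Lambda>" "z + u \<in> \<Lambda>"
      then have "z \<in> (\<lambda>z. z - u) ` \<Lambda>" by (intro rev_image_eqI[of "z + u"]) auto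
      with z show False by simp
    qed
  qed (auto intro!: holomorphic_intros)
  then show ?thesis by (simp add: o_def)
qed

lemma wp_shift_holomorphic':
  assumes "u \<in> half_lattice"
  shows "(\<lambda>z. wp (z + u)) holomorphic_on - half_lattice"
  using wp_shift_holomorphic[of u]
proof (rule holomorphic_on_subset)
  show "- half_lattice \<subseteq> - ((\<lambda>z. z - u) ` \<Lambda>)"
  proof (rule subsetI)
    fix z assume z: "z \<in> - half_lattice"
    have "z \<noteq> w - u" if "w \<in> \<Lambda>" for w
      using z half_lattice_add[OF assms, of z] lattice_subset_half[OF that] by auto
    then show "z \<in> - ((\<lambda>z. z - u) ` \<Lambda>)" by blast
  qed
qed

lemma wp_tendsto_0: "((\<lambda>z. z\<^sup>2 * (wp z - e)) \<longlongrightarrow> 1) (at 0)"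
proof -
  have "((\<lambda>z. z\<^sup>2 * wp z - z\<^sup>2 * e) \<longlongrightarrow> 1 - 0\<^sup>2 * e) (at 0)"
    by (intro tendsto_intros tendsto_wp_0)
  then show ?thesis by (simp add: algebra_simps)
qed

lemma wp_eventually_neq: "\<forall>\<^sub>F z in at 0. wp z \<noteq> e"
proof -
  have "\<forall>\<^sub>F z in at 0. z\<^sup>2 * (wp z - e) \<noteq> 0"
    using wp_tendsto_0[of e] by (rule tendsto_imp_eventually_ne) simp
  then show ?thesis by eventually_elim auto
qed

text \<open>The classes of \<open>u\<close>, \<open>v\<close> and \<open>u + v\<close> modulo
  \<open>\<Lambda>\<close> are then the three nonzero points of order two, in any order. A formula
  proved for such a pair holds for all permutations of the three half periods.\<close>

definition half_frame :: "complex \<Rightarrow> complex \<Rightarrow> bool" where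
  "half_frame u v \<longleftrightarrow> u \<in> half_lattice \<and> v \<in> half_lattice \<and> u \<notin> \<Lambda> \<and> v \<notin> \<Lambda> \<and> u + v \<notin> \<Lambda>"

lemma half_frame_sym: "half_frame u v \<Longrightarrow> half_frame v u"
  by (simp add: half_frame_def add.commute)

lemma half_frame_add: "half_frame u v \<Longrightarrow> half_frame u (u + v)"
  unfolding half_frame_def
  using lattice_add_iff[of "2 * u" \<tau> v] half_lattice_add[of u v]
  by (auto simp: half_lattice_def algebra_simps)

lemma wp_period_half: "u \<in> half_lattice \<Longrightarrow> v \<notin> \<Lambda> \<Longrightarrow> wp (v + u + u) = wp v"
  using wp_periodic[of "2 * u" v] unfolding half_lattice_def mem_Collect_eq mult_2 add.assoc by simp

text \<open>In coordinates modulo 2, \<open>u\<close> and \<open>v\<close> are distinct nonzero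
  vectors of the plane over the field with two elements, so 0, \<open>u\<close>, \<open>v\<close>
  and \<open>u + v\<close> are all of its vectors.\<close>

lemma half_frame_cases:
  assumes "half_frame u v" "z \<in> half_lattice"
  obtains w x where "z = x + w" "w \<in> \<Lambda>" "x \<in> {0, u, v, u + v}"
proof -
  have "\<exists>x\<in>{0, u, v, u + v}. z - x \<in> \<Lambda>"
  proof -
    have red: "\<exists>a b::int. (a = 0 \<or> a = 1) \<and> (b = 0 \<or> b = 1) \<and> z - (of_int a + of_int b * \<tau>) / 2 \<in> \<Lambda>"
      if z: "z \<in> half_lattice" for z
    proof -
      obtain w u where wu: "z = u + w" "w \<in> \<Lambda>" "u \<in> {0, 1/2, \<tau>/2, (1 + \<tau>)/2}"
        using half_lattice_cases[OF z] by blast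
      from wu(3) consider "u = 0" | "u = 1/2" | "u = \<tau>/2" | "u = (1 + \<tau>)/2" by blast
      then show ?thesis
      proof cases
        case 1 show ?thesis using wu(2) unfolding wu(1) 1 by (rule_tac exI[of _ 0], rule_tac exI[of _ 0]) simp
      next
        case 2 show ?thesis using wu(2) unfolding wu(1) 2 by (rule_tac exI[of _ 1], rule_tac exI[of _ 0]) simp
      next
        case 3 show ?thesis using wu(2) unfolding wu(1) 3 by (rule_tac exI[of _ 0], rule_tac exI[of _ 1]) simp
      next
        case 4 show ?thesis using wu(2) unfolding wu(1) 4 by (rule_tac exI[of _ 1], rule_tac exI[of _ 1]) simp
      qed
    qed
    obtain a b :: int where ab: "a = 0 \<or> a = 1" "b = 0 \<or> b = 1" "z - (of_int a + of_int b * \<tau>) / 2 \<in> \<Lambda>"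
      using red[OF assms(2)] by blast
    obtain a1 b1 :: int where ab1: "a1 = 0 \<or> a1 = 1" "b1 = 0 \<or> b1 = 1" "u - (of_int a1 + of_int b1 * \<tau>) / 2 \<in> \<Lambda>"
      using red[of u] assms by (auto simp: half_frame_def)
    obtain a2 b2 :: int where ab2: "a2 = 0 \<or> a2 = 1" "b2 = 0 \<or> b2 = 1" "v - (of_int a2 + of_int b2 * \<tau>) / 2 \<in> \<Lambda>"
      using red[of v] assms by (auto simp: half_frame_def)
    have n1: "\<not> (a1 = 0 \<and> b1 = 0)" using ab1(3) assms by (auto simp: half_frame_def)
    have n2: "\<not> (a2 = 0 \<and> b2 = 0)" using ab2(3) assms by (auto simp: half_frame_def)
    have parity: "(of_int a + of_int b * \<tau>) / 2 \<in> \<Lambda>" if ev: "even a" "even b" for a b :: int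
    proof -
      obtain a' where "a = 2 * a'" using ev(1) by (elim dvdE)
      moreover obtain b' where "b = 2 * b'" using ev(2) by (elim dvdE)
      ultimately have "(of_int a + of_int b * \<tau>) / 2 = of_int a' + of_int b' * \<tau>"
        by (simp add: add_divide_distrib)
      then show ?thesis unfolding lattice_def by blast
    qed
    have n3: "\<not> (a1 = a2 \<and> b1 = b2)"
    proof
      assume eq: "a1 = a2 \<and> b1 = b2"
      have "u - (of_int a1 + of_int b1 * \<tau>) / 2 + (v - (of_int a2 + of_int b2 * \<tau>) / 2)
          + (of_int (2 * a1) + of_int (2 * b1) * \<tau>) / 2 \<in> \<Lambda>"
        by (intro lattice_add ab1 ab2 parity) auto
      moreover have "u - (of_int a1 + of_int b1 * \<tau>) / 2 + (v - (of_int a2 + of_int b2 * \<tau>) / 2)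
          + (of_int (2 * a1) + of_int (2 * b1) * \<tau>) / 2 = u + v"
        using eq by (simp add: add_divide_distrib)
      ultimately have "u + v \<in> \<Lambda>" by (simp only:)
      then show False using assms by (simp add: half_frame_def)
    qed
    have comb: "z - x \<in> \<Lambda>"
      if "x - (of_int c + of_int d * \<tau>) / 2 \<in> \<Lambda>" "even (a - c)" "even (b - d)" for x and c d :: int
    proof -
      have "z - (of_int a + of_int b * \<tau>) / 2 - (x - (of_int c + of_int d * \<tau>) / 2)
          + (of_int (a - c) + of_int (b - d) * \<tau>) / 2 \<in> \<Lambda>"
        by (intro lattice_add lattice_diff ab parity that)
      moreover have "z - (of_int a + of_int b * \<tau>) / 2 - (x - (of_int c + of_int d * \<tau>) / 2)
          + (of_int (a - c) + of_int (b - d) * \<tau>) / 2 = z - x"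
        by (simp add: add_divide_distrib diff_divide_distrib left_diff_distrib)
      ultimately show ?thesis by (simp only:)
    qed
    have sum: "u + v - (of_int (a1 + a2) + of_int (b1 + b2) * \<tau>) / 2 \<in> \<Lambda>"
    proof -
      have "u - (of_int a1 + of_int b1 * \<tau>) / 2 + (v - (of_int a2 + of_int b2 * \<tau>) / 2)
          = u + v - (of_int (a1 + a2) + of_int (b1 + b2) * \<tau>) / 2"
        by (simp add: add_divide_distrib distrib_right)
      with lattice_add[OF ab1(3) ab2(3)] show ?thesis by (simp only:)
    qed
    have zero: "0 - (of_int 0 + of_int 0 * \<tau>) / 2 \<in> \<Lambda>" using lattice_0 by simp
    have "(even (a - 0) \<and> even (b - 0)) \<or> (even (a - a1) \<and> even (b - b1)) \<or> (even (a - a2) \<and> even (b - b2))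
        \<or> (even (a - (a1 + a2)) \<and> even (b - (b1 + b2)))"
      using ab(1,2) ab1(1,2) ab2(1,2) n1 n2 n3 by (elim disjE) simp_all
    then show ?thesis
      using comb[OF zero] comb[OF ab1(3)] comb[OF ab2(3)] comb[OF sum] by blast
  qed
  then obtain x where x: "x \<in> {0, u, v, u + v}" "z - x \<in> \<Lambda>" by blast
  then show ?thesis using that[of x "z - x"] by simp
qed

lemma half_frames: "half_frame (1/2) (\<tau>/2)"
proof -
  have "1/2 + \<tau>/2 = (1 + \<tau>)/2" by (simp add: add_divide_distrib)
  then have "1/2 + \<tau>/2 \<notin> \<Lambda>" using half_notin(3) by metis
  then show ?thesis
    using half_notin lattice_1 lattice_tau by (simp add: half_frame_def half_lattice_def)
qed

lemma elliptic_constant':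
  assumes fr: "half_frame u v"
    and f: "f holomorphic_on - half_lattice"
    and per: "\<And>z w. w \<in> \<Lambda> \<Longrightarrow> z \<notin> half_lattice \<Longrightarrow> f (z + w) = f z"
    and lim: "\<And>x. x \<in> {0, u, v, u + v} \<Longrightarrow> \<exists>L. (f \<longlongrightarrow> L) (at x)"
  obtains c where "\<And>z. z \<notin> half_lattice \<Longrightarrow> f z = c"
proof (rule elliptic_constant[OF f per])
  show "\<exists>L. (f \<longlongrightarrow> L) (at y)" if "y \<in> {0, 1/2, \<tau>/2, (1 + \<tau>)/2}" for y
  proof -
    have "y \<in> half_lattice"
    proof -
      from that have "2 * y \<in> {2 * 0, 2 * (1/2), 2 * (\<tau>/2), 2 * ((1 + \<tau>)/2)}" by blast
      then have "2 * y \<in> {0, 1, \<tau>, 1 + \<tau>}" by simp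
      then show ?thesis
        using lattice_0[of \<tau>] lattice_1[of \<tau>] lattice_tau[of \<tau>] lattice_add[OF lattice_1 lattice_tau, of \<tau>]
        unfolding half_lattice_def mem_Collect_eq by (elim insertE emptyE) simp_all
    qed
    then obtain w x where wx: "y = x + w" "w \<in> \<Lambda>" "x \<in> {0, u, v, u + v}"
      using half_frame_cases[OF fr] by blast
    obtain L where "(f \<longlongrightarrow> L) (at x)" using lim[OF wx(3)] by blast
    then have "((\<lambda>z. f (z + w)) \<longlongrightarrow> L) (at x)"
      by (rule Lim_transform_eventually)
         (use eventually_not_half_lattice[of x] in \<open>auto elim!: eventually_mono simp: per[OF wx(2)]\<close>)
    then show ?thesis unfolding tendsto_shift wx(1) by blast
  qed
qed (use that in blast)+

end

lemma holomorphic_eventually_const: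
  assumes f: "f holomorphic_on S" "open S" "connected S" and "a \<in> S"
    and ev: "\<forall>\<^sub>F w in at a. f w = c" and z: "z \<in> S"
  shows "f z = c"
proof -
  have "\<exists>\<^sub>F w in at a. f w - c = 0"
    using ev by (intro eventually_frequently) (auto elim: eventually_mono)
  then have lim: "a islimpt {w \<in> S. f w - c = 0}"
    using f(2) \<open>a \<in> S\<close> ev
    unfolding islimpt_conv_frequently_at
    by (intro eventually_frequently eventually_conj[of "\<lambda>w. w \<in> S" _ "\<lambda>w. f w - c = 0", simplified])
       (auto elim: eventually_mono simp: eventually_at_topological)
  have "f z - c = 0"
    by (rule analytic_continuation[where f = "\<lambda>w. f w - c", OF _ f(2,3) _ \<open>a \<in> S\<close> lim _ z])
       (use f(1) in \<open>auto intro!: holomorphic_intros\<close>)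
  then show ?thesis by simp
qed

section \<open>Translation by half periods and the differential equation\<close>

context upper_half_plane
begin

lemma wp_not_eventually_const:
  assumes a: "a \<notin> \<Lambda>"
  shows "\<not> (\<forall>\<^sub>F z in at a. wp z = c)"
proof
  assume "\<forall>\<^sub>F z in at a. wp z = c"
  then have "wp z = c" if "z \<in> - \<Lambda>" for z
    using holomorphic_eventually_const[OF wp_holomorphic _ connected_Compl_lattice _ _ that]
      closed_lattice a by (auto simp: open_Compl)
  then have "\<forall>\<^sub>F z in at 0. wp z = c"
    using eventually_not_lattice[of 0] by (auto elim!: eventually_mono)
  with wp_eventually_neq[of c] have "\<forall>\<^sub>F z in at (0 :: complex). False"
    by eventually_elim simp
  then show False by simp
qed

lemma deriv_wp_half:
  assumes "u \<in> half_lattice" "u \<notin> \<Lambda>"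
  shows "deriv wp u = 0"
proof -
  have u: "2 * u \<in> \<Lambda>" "- u \<notin> \<Lambda>" using assms by (auto simp: half_lattice_def lattice_uminus_iff)
  have "deriv wp (- u + 2 * u) = deriv wp (- u)" using deriv_wp_periodic[OF u(2,1)] .
  then have "deriv wp u = - deriv wp u" using deriv_wp_uminus[OF assms(2)] by simp
  then show ?thesis by simp
qed

text \<open>The constant of the translation formula
  \<open>(\<wp>(z) - \<wp>(u)) (\<wp>(z + u) - \<wp>(u)) = const\<close>, found by setting
  \<open>z = v\<close>.\<close>

definition wp_const :: "complex \<Rightarrow> complex \<Rightarrow> complex" where
  "wp_const u v = (wp u - wp v) * (wp u - wp (u + v))"

text \<open>The double pole of one factor at 0 meets the double zero of the other, and the roles are
  exchanged at \<open>u\<close>; at \<open>v\<close> and \<open>u + v\<close> both factors are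
  finite. An elliptic function without poles is constant.\<close>

lemma wp_shift_product:
  assumes fr: "half_frame u v" and z: "z \<notin> half_lattice"
  shows "(wp z - wp u) * (wp (z + u) - wp u) = wp_const u v"
proof -
  define P where "P z = (wp z - wp u) * (wp (z + u) - wp u)" for z
  have u: "u \<in> half_lattice" "u \<notin> \<Lambda>" "v \<notin> \<Lambda>" "u + v \<notin> \<Lambda>" and v: "v \<in> half_lattice"
    using fr by (auto simp: half_frame_def)
  have hol: "P holomorphic_on - half_lattice"
    unfolding P_def using wp_shift_holomorphic'[OF u(1)] wp_holomorphic lattice_subset_half
    by (intro holomorphic_intros) (auto elim: holomorphic_on_subset)
  have per: "P (z + w) = P z" if w: "w \<in> \<Lambda>" and z: "z \<notin> half_lattice" for z w
  proof -
    have "z \<notin> \<Lambda>" "z + u \<notin> \<Lambda>" using z half_lattice_add[OF u(1)] lattice_subset_half by blast+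
    then have "wp (z + w) = wp z" "wp (z + u + w) = wp (z + u)" using wp_periodic[OF w] by auto
    then show ?thesis by (simp add: P_def add_ac)
  qed
  have perU: "P (z + u) = P z" if "z \<notin> half_lattice" for z
    using wp_period_half[OF u(1), of z] that lattice_subset_half[of z] by (auto simp: P_def)
  have "\<exists>L. ((\<lambda>z. (wp z - wp u) / (z - u)\<^sup>2) \<longlongrightarrow> L) (at u)"
    by (rule double_zero_limit[OF wp_holomorphic]) (use u closed_lattice deriv_wp_half in auto)
  then obtain L where "((\<lambda>z. (wp z - wp u) / (z - u)\<^sup>2) \<longlongrightarrow> L) (at (0 + u))" by auto
  then have L: "((\<lambda>z. (wp (z + u) - wp u) / z\<^sup>2) \<longlongrightarrow> L) (at 0)"
    unfolding tendsto_shift[symmetric] by simp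
  have "((\<lambda>z. (z\<^sup>2 * (wp z - wp u)) * ((wp (z + u) - wp u) / z\<^sup>2)) \<longlongrightarrow> 1 * L) (at 0)"
    by (intro tendsto_mult wp_tendsto_0 L)
  moreover have "\<forall>\<^sub>F z in at 0. (z\<^sup>2 * (wp z - wp u)) * ((wp (z + u) - wp u) / z\<^sup>2) = P z"
    by (auto simp: eventually_at_filter P_def)
  ultimately have "(P \<longlongrightarrow> 1 * L) (at 0)" by (rule Lim_transform_eventually)
  then have lim0: "(P \<longlongrightarrow> L) (at 0)" by simp
  then have "((\<lambda>z. P (z + u)) \<longlongrightarrow> L) (at 0)"
    by (rule Lim_transform_eventually)
       (use eventually_not_half_lattice[of 0] in \<open>auto elim!: eventually_mono simp: perU\<close>)
  then have limU: "(P \<longlongrightarrow> L) (at u)" unfolding tendsto_shift by simp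
  have cont: "(P \<longlongrightarrow> P x) (at x)" if "x \<notin> \<Lambda>" "x + u \<notin> \<Lambda>" for x
  proof -
    have "(wp \<longlongrightarrow> wp x) (at x)" using wp_isCont[OF that(1)] by (simp add: isCont_def)
    moreover have "(wp \<longlongrightarrow> wp (x + u)) (at (x + u))" using wp_isCont[OF that(2)] by (simp add: isCont_def)
    then have "((\<lambda>z. wp (z + u)) \<longlongrightarrow> wp (x + u)) (at x)" by (simp only: tendsto_shift)
    ultimately show ?thesis unfolding P_def by (intro tendsto_intros)
  qed
  have uv: "u + v + u \<notin> \<Lambda>"
    using half_frame_add[OF fr] by (simp add: half_frame_def add_ac)
  have "\<exists>L. (P \<longlongrightarrow> L) (at x)" if "x \<in> {0, u, v, u + v}" for x
    using that lim0 limU cont[OF u(3)] cont[OF u(4) uv] u(4) by (auto simp: add.commute)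
  then obtain c where c: "\<And>z. z \<notin> half_lattice \<Longrightarrow> P z = c"
    using elliptic_constant'[OF fr hol per] by blast
  have "(P \<longlongrightarrow> P v) (at v)" using cont u by (simp add: add.commute)
  moreover have "(P \<longlongrightarrow> c) (at v)"
    by (rule tendsto_eventually) (use eventually_not_half_lattice[of v] in \<open>auto elim!: eventually_mono simp: c\<close>)
  ultimately have "c = P v" using LIM_unique by blast
  also have "P v = wp_const u v" by (simp add: P_def wp_const_def algebra_simps)
  finally show ?thesis using c[OF z] by (simp add: P_def)
qed

text \<open>Near 0 one has \<open>\<wp>(z) \<noteq> \<wp>(u)\<close>, so a vanishing constant would
  make \<open>\<wp>\<close> constant near \<open>u\<close>. This takes the place of a count of zeros
  in showing that the three half-period values are distinct.\<close>

lemma wp_const_nonzero: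
  assumes fr: "half_frame u v"
  shows "wp_const u v \<noteq> 0"
proof
  assume 0: "wp_const u v = 0"
  have u: "u \<in> half_lattice" "u \<notin> \<Lambda>" using fr by (auto simp: half_frame_def)
  have "\<forall>\<^sub>F z in at 0. wp (z + u) = wp u"
    using wp_eventually_neq[of "wp u"] eventually_not_half_lattice[of 0]
  proof eventually_elim
    case (elim z)
    then show ?case using wp_shift_product[OF fr elim(2)] 0 by simp
  qed
  then have "\<forall>\<^sub>F z in at u. wp z = wp u"
    using eventually_filtermap[of "\<lambda>z. wp z = wp u" "\<lambda>z. z + u" "at 0"] filtermap_at_shift[of "- u" "0"] by simp
  then show False using wp_not_eventually_const[OF u(2)] by blast
qed

lemma wp_half_neq:
  assumes "half_frame u v"
  shows "wp u \<noteq> wp v" "wp u \<noteq> wp (u + v)" "wp v \<noteq> wp (u + v)"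
  using wp_const_nonzero[OF assms] wp_const_nonzero[OF half_frame_sym[OF assms]]
  by (auto simp: wp_const_def add.commute)

lemma wp_neq_half:
  assumes "half_frame u v" "z \<notin> half_lattice"
  shows "wp z \<noteq> wp u" "wp z \<noteq> wp v" "wp z \<noteq> wp (u + v)"
  using wp_const_nonzero wp_shift_product[OF _ assms(2)] assms(1)
    half_frame_sym half_frame_add
  by (metis diff_self mult_zero_left)+

lemma wp_add_half:
  assumes "half_frame u v" "z \<notin> half_lattice"
  shows "wp (z + u) = wp u + wp_const u v / (wp z - wp u)"
  using wp_shift_product[OF assms] wp_neq_half(1)[OF assms] by (simp add: field_simps)

lemma deriv_wp_add_half:
  assumes fr: "half_frame u v" and z: "z \<notin> half_lattice"
  shows "deriv wp (z + u) = - wp_const u v * deriv wp z / (wp z - wp u)\<^sup>2"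
proof -
  have u: "u \<in> half_lattice" using fr by (auto simp: half_frame_def)
  have zu: "z + u \<notin> \<Lambda>" "z \<notin> \<Lambda>" using z half_lattice_add[OF u] lattice_subset_half by blast+
  have "(wp has_field_derivative deriv wp (z + u)) (at (z + u))" using wp_has_deriv(1)[OF zu(1)] .
  then have "((\<lambda>z. wp (z + u)) has_field_derivative deriv wp (z + u)) (at z)"
    by (simp only: DERIV_shift)
  then have "((\<lambda>z. wp u + wp_const u v / (wp z - wp u)) has_field_derivative deriv wp (z + u)) (at z)"
    by (rule has_field_derivative_transform_within_open[where S = "- half_lattice"])
       (use z closed_half_lattice wp_add_half[OF fr] in auto)
  moreover have "((\<lambda>z. wp u + wp_const u v / (wp z - wp u)) has_field_derivative
      0 + (0 * (wp z - wp u) - wp_const u v * (deriv wp z - 0)) / ((wp z - wp u) * (wp z - wp u))) (at z)"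
    using wp_neq_half(1)[OF fr z] by (intro DERIV_add DERIV_divide DERIV_diff DERIV_const wp_has_deriv(1) zu) auto
  ultimately have "deriv wp (z + u) = 0 + (0 * (wp z - wp u) - wp_const u v * (deriv wp z - 0)) / ((wp z - wp u) * (wp z - wp u))"
    by (rule DERIV_unique)
  then show ?thesis by (simp add: power2_eq_square)
qed

text \<open>The quotient \<open>Q\<close> of \<open>(\<wp>')^2\<close> by the cubic is shown to be
  constant. It is regular off the half lattice and invariant under translation by half periods, so
  the single limit \<open>(-2)^2 / 1 = 4\<close> at 0 also provides the limits at the other three
  points.\<close>

lemma wp_ode:
  assumes fr: "half_frame u v" and z: "z \<notin> half_lattice"
  shows "(deriv wp z)\<^sup>2 = 4 * (wp z - wp u) * (wp z - wp v) * (wp z - wp (u + v))"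
proof -
  define D where "D z = (wp z - wp u) * (wp z - wp v) * (wp z - wp (u + v))" for z
  define Q where "Q z = (deriv wp z)\<^sup>2 / D z" for z
  have D0: "D z \<noteq> 0" if "z \<notin> half_lattice" for z
    using wp_neq_half[OF fr that] by (simp add: D_def)
  have h: "wp holomorphic_on - half_lattice"
    using wp_holomorphic lattice_subset_half by (auto elim: holomorphic_on_subset)
  moreover have "deriv wp holomorphic_on - half_lattice"
    using h closed_half_lattice by (intro holomorphic_deriv) auto
  ultimately have hol: "Q holomorphic_on - half_lattice"
    unfolding Q_def using D0 unfolding D_def
    by (intro holomorphic_intros) (auto simp: open_Compl closed_half_lattice)
  have per: "Q (z + w) = Q z" if w: "w \<in> \<Lambda>" and z: "z \<notin> half_lattice" for z w
  proof -
    have "z \<notin> \<Lambda>" using z lattice_subset_half by blast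
    then show ?thesis using wp_periodic[OF w] deriv_wp_periodic[OF _ w] by (simp add: Q_def D_def)
  qed
  have "((\<lambda>z. (z ^ 3 * deriv wp z)\<^sup>2 / ((z\<^sup>2 * (wp z - wp u)) * (z\<^sup>2 * (wp z - wp v)) * (z\<^sup>2 * (wp z - wp (u + v)))))
      \<longlongrightarrow> (- 2)\<^sup>2 / (1 * 1 * 1)) (at 0)"
    by (intro tendsto_intros wp_tendsto_0 tendsto_deriv_wp_0) auto
  then have "((\<lambda>z. (z ^ 3 * deriv wp z)\<^sup>2 / ((z\<^sup>2 * (wp z - wp u)) * (z\<^sup>2 * (wp z - wp v)) * (z\<^sup>2 * (wp z - wp (u + v)))))
      \<longlongrightarrow> 4) (at 0)" by simp
  moreover have "\<forall>\<^sub>F z in at 0. (z ^ 3 * deriv wp z)\<^sup>2 / ((z\<^sup>2 * (wp z - wp u)) * (z\<^sup>2 * (wp z - wp v)) * (z\<^sup>2 * (wp z - wp (u + v)))) = Q z"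
    using eventually_not_half_lattice[of 0]
  proof eventually_elim
    case (elim z)
    then have "z \<noteq> 0" using lattice_subset_half[OF lattice_0] by auto
    have "(z ^ 3 * deriv wp z)\<^sup>2 = z ^ 6 * (deriv wp z)\<^sup>2"
      by (simp add: power_mult_distrib flip: power_mult)
    moreover have "(z\<^sup>2 * (wp z - wp u)) * (z\<^sup>2 * (wp z - wp v)) * (z\<^sup>2 * (wp z - wp (u + v))) = z ^ 6 * D z"
      unfolding D_def by (simp add: power2_eq_square eval_nat_numeral mult_ac)
    ultimately show ?case using \<open>z \<noteq> 0\<close> by (simp add: Q_def)
  qed
  ultimately have lim0: "(Q \<longlongrightarrow> 4) (at 0)" by (rule Lim_transform_eventually)
  \<comment> \<open>Translation by \<open>a\<close> multiplies both \<open>(\<wp>')^2\<close> and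
    the cubic by \<open>wp_const a b ^ 2 / (\<wp>(z) - \<wp>(a)) ^ 4\<close>. The hypothesis
    \<open>perm\<close> rewrites the cubic with \<open>a\<close> as the distinguished root.\<close>
  have shift: "Q (z + a) = Q z" if fr': "half_frame a b" and z: "z \<notin> half_lattice"
    and perm: "D = (\<lambda>z. (wp z - wp a) * (wp z - wp b) * (wp z - wp (a + b)))" for a b z
  proof -
    define x d where "x = wp z" and "d = deriv wp z"
    define A B C where "A = wp a" and "B = wp b" and "C = wp (a + b)"
    have ne: "x - A \<noteq> 0" "x - B \<noteq> 0" "x - C \<noteq> 0" "A - B \<noteq> 0" "A - C \<noteq> 0"
      using wp_neq_half[OF fr' z] wp_half_neq[OF fr'] by (auto simp: x_def A_def B_def C_def)
    have x': "wp (z + a) = A + (A - B) * (A - C) / (x - A)"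
      using wp_add_half[OF fr' z] by (simp add: wp_const_def x_def A_def B_def C_def)
    have d': "deriv wp (z + a) = - ((A - B) * (A - C)) * d / (x - A)\<^sup>2"
      using deriv_wp_add_half[OF fr' z] by (simp add: wp_const_def x_def d_def A_def B_def C_def)
    have 1: "wp (z + a) - A = (A - B) * (A - C) / (x - A)" by (simp add: x')
    have 2: "wp (z + a) - B = (A - B) * (x - C) / (x - A)"
      unfolding x' using ne by (simp add: field_simps)
    have 3: "wp (z + a) - C = (A - C) * (x - B) / (x - A)"
      unfolding x' using ne by (simp add: field_simps)
    have "D (z + a) = ((A - B) * (A - C))\<^sup>2 * ((x - B) * (x - C)) / (x - A) ^ 3"
      unfolding perm A_def[symmetric] B_def[symmetric] C_def[symmetric] 1 2 3
      by (simp add: power2_eq_square power3_eq_cube mult_ac)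
    then have "Q (z + a) = (((A - B) * (A - C))\<^sup>2 * d\<^sup>2 / (x - A) ^ 4) / (((A - B) * (A - C))\<^sup>2 * ((x - B) * (x - C)) / (x - A) ^ 3)"
      unfolding Q_def d' by (simp add: power_mult_distrib power_divide flip: power_mult)
    also have "\<dots> = d\<^sup>2 / ((x - A) * (x - B) * (x - C))"
      using ne by (simp add: divide_simps power4_eq_xxxx power3_eq_cube)
    also have "\<dots> = Q z" by (simp add: Q_def perm x_def d_def A_def B_def C_def)
    finally show ?thesis .
  qed
  have limA: "(Q \<longlongrightarrow> 4) (at a)" if fr': "half_frame a b"
    and perm: "D = (\<lambda>z. (wp z - wp a) * (wp z - wp b) * (wp z - wp (a + b)))" for a b
  proof -
    from lim0 have "((\<lambda>z. Q (z + a)) \<longlongrightarrow> 4) (at 0)"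
      by (rule Lim_transform_eventually)
         (use eventually_not_half_lattice[of 0] in \<open>auto elim!: eventually_mono simp: shift[OF fr' _ perm]\<close>)
    then show ?thesis unfolding tendsto_shift by simp
  qed
  have wpv: "wp (u + (u + v)) = wp v" "wp (u + v + u) = wp v"
    using wp_period_half[of u v] fr by (auto simp: half_frame_def add_ac)
  have "D = (\<lambda>z. (wp z - wp u) * (wp z - wp v) * (wp z - wp (u + v)))"
    and "D = (\<lambda>z. (wp z - wp v) * (wp z - wp u) * (wp z - wp (v + u)))"
    and "D = (\<lambda>z. (wp z - wp (u + v)) * (wp z - wp u) * (wp z - wp (u + v + u)))"
    unfolding D_def wpv(2) add.commute[of v u] by (simp_all only: mult_ac)
  then have "(Q \<longlongrightarrow> 4) (at u)" "(Q \<longlongrightarrow> 4) (at v)" "(Q \<longlongrightarrow> 4) (at (u + v))"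
    using limA[OF fr] limA[OF half_frame_sym[OF fr]]
      limA[OF half_frame_sym[OF half_frame_add[OF fr]]] by blast+
  then have "(Q \<longlongrightarrow> 4) (at x)" if "x \<in> {0, u, v, u + v}" for x
    using that lim0 by blast
  then obtain c where c: "\<And>z. z \<notin> half_lattice \<Longrightarrow> Q z = c"
    using elliptic_constant'[OF fr hol per] by blast
  have "(Q \<longlongrightarrow> c) (at 0)"
    by (rule tendsto_eventually) (use eventually_not_half_lattice[of 0] in \<open>auto elim!: eventually_mono simp: c\<close>)
  then have "c = 4" using lim0 LIM_unique by blast
  then have "Q z = 4" using c z by simp
  then have "(deriv wp z)\<^sup>2 = 4 * D z"
    unfolding Q_def nonzero_divide_eq_eq[OF D0[OF z]] .
  then show ?thesis by (simp only: D_def mult.assoc)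
qed

lemma deriv_wp_nonzero:
  assumes "z \<notin> half_lattice"
  shows "deriv wp z \<noteq> 0"
  using wp_ode[OF half_frames assms] wp_neq_half[OF half_frames assms] by auto

text \<open>By the duplication formula, the square of this function is \<open>\<wp>(2z) - \<wp>(u)\<close>.\<close>

definition wp_sqrt :: "complex \<Rightarrow> complex \<Rightarrow> complex \<Rightarrow> complex" where
  "wp_sqrt u v z = ((wp z - wp u)\<^sup>2 - wp_const u v) / deriv wp z"

text \<open>Translation by \<open>u\<close> sends \<open>x = \<wp>(z) - \<wp>(u)\<close> to
  \<open>c / x\<close> and the derivative \<open>d\<close> to \<open>- c d / x^2\<close>; the
  expression \<open>(x^2 - c) / d\<close> is invariant under this.\<close>

lemma wp_sqrt_add_self:
  assumes fr: "half_frame u v" and z: "z \<notin> half_lattice"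
  shows "wp_sqrt u v (z + u) = wp_sqrt u v z"
proof -
  define x c d where "x = wp z - wp u" and "c = wp_const u v" and "d = deriv wp z"
  have ne: "x \<noteq> 0" "c \<noteq> 0" "d \<noteq> 0"
    using wp_neq_half(1)[OF fr z] wp_const_nonzero[OF fr] deriv_wp_nonzero[OF z] by (auto simp: x_def c_def d_def)
  have "wp_sqrt u v (z + u) = ((c / x)\<^sup>2 - c) / (- c * d / x\<^sup>2)"
    by (simp add: wp_sqrt_def wp_add_half[OF fr z] deriv_wp_add_half[OF fr z] x_def c_def d_def)
  also have "\<dots> = (x\<^sup>2 - c) / d"
    using ne by (simp add: divide_simps power2_eq_square)
  finally show ?thesis by (simp add: wp_sqrt_def x_def c_def d_def)
qed

text \<open>Translation by \<open>v\<close> multiplies the numerator by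
  \<open>(B - A) (B - C) / (x - B)^2\<close> and the derivative by the negative of the same
  factor.\<close>

lemma wp_sqrt_add_other:
  assumes fr: "half_frame u v" and z: "z \<notin> half_lattice"
  shows "wp_sqrt u v (z + v) = - wp_sqrt u v z"
proof -
  define x d where "x = wp z" and "d = deriv wp z"
  define A B C where "A = wp u" and "B = wp v" and "C = wp (u + v)"
  have fr': "half_frame v u" using half_frame_sym[OF fr] .
  have ne: "x - A \<noteq> 0" "x - B \<noteq> 0" "x - C \<noteq> 0" "A - B \<noteq> 0" "A - C \<noteq> 0" "B - A \<noteq> 0" "B - C \<noteq> 0" "d \<noteq> 0"
    using wp_neq_half[OF fr z] wp_half_neq[OF fr] deriv_wp_nonzero[OF z] by (auto simp: x_def A_def B_def C_def d_def)
  have x': "wp (z + v) = B + (B - A) * (B - C) / (x - B)"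
    using wp_add_half[OF fr' z] by (simp add: wp_const_def x_def A_def B_def C_def add.commute)
  have d': "deriv wp (z + v) = - ((B - A) * (B - C)) * d / (x - B)\<^sup>2"
    using deriv_wp_add_half[OF fr' z] by (simp add: wp_const_def x_def d_def A_def B_def C_def add.commute)
  have x'': "wp (z + v) - A = (B - A) * (x - C) / (x - B)"
    unfolding x' using ne by (simp add: field_simps)
  have "wp_sqrt u v (z + v) = (((B - A) * (x - C) / (x - B))\<^sup>2 - (A - B) * (A - C)) / (- ((B - A) * (B - C)) * d / (x - B)\<^sup>2)"
    unfolding wp_sqrt_def wp_const_def A_def[symmetric] B_def[symmetric] C_def[symmetric] x'' d' ..
  also have "((B - A) * (x - C) / (x - B))\<^sup>2 - (A - B) * (A - C) =
      ((B - A) * ((B - A) * (x - C)\<^sup>2 + (A - C) * (x - B)\<^sup>2)) / (x - B)\<^sup>2"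
    using ne by (simp add: divide_simps power2_eq_square) (simp add: algebra_simps)
  also have "(B - A) * (x - C)\<^sup>2 + (A - C) * (x - B)\<^sup>2 = (B - C) * ((x - A)\<^sup>2 - (A - B) * (A - C))"
    by (simp add: power2_eq_square algebra_simps)
  also have "(B - A) * ((B - C) * ((x - A)\<^sup>2 - (A - B) * (A - C))) / (x - B)\<^sup>2 / (- ((B - A) * (B - C)) * d / (x - B)\<^sup>2)
      = - (((x - A)\<^sup>2 - (A - B) * (A - C)) / d)"
    using ne by (simp add: divide_simps)
  finally show ?thesis by (simp add: wp_sqrt_def wp_const_def x_def d_def A_def B_def C_def)
qed

lemma wp_sqrt_alt:
  assumes "half_frame u v"
  shows "wp_sqrt u (u + v) = wp_sqrt u v"
proof -
  have "wp (u + (u + v)) = wp v" using wp_period_half[of u v] assms by (auto simp: half_frame_def add_ac)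
  then show ?thesis by (simp add: wp_sqrt_def wp_const_def fun_eq_iff mult.commute)
qed

text \<open>The difference of the squared numerators factors into \<open>2 (x - A) (x - B)\<close>
  and \<open>2 (B - A) (x - C)\<close>, and by the differential equation the product is
  \<open>B - A\<close> times the squared derivative.\<close>

lemma wp_sqrt_square_diff:
  assumes fr: "half_frame u v" and z: "z \<notin> half_lattice"
  shows "(wp_sqrt u v z)\<^sup>2 - (wp_sqrt v u z)\<^sup>2 = wp v - wp u"
proof -
  define x d where "x = wp z" and "d = deriv wp z"
  define A B C where "A = wp u" and "B = wp v" and "C = wp (u + v)"
  have d: "d \<noteq> 0" using deriv_wp_nonzero[OF z] by (simp add: d_def)
  have ode: "d\<^sup>2 = 4 * (x - A) * (x - B) * (x - C)"
    using wp_ode[OF fr z] by (simp add: x_def d_def A_def B_def C_def)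
  have "(wp_sqrt u v z)\<^sup>2 - (wp_sqrt v u z)\<^sup>2 =
      (((x - A)\<^sup>2 - (A - B) * (A - C))\<^sup>2 - ((x - B)\<^sup>2 - (B - A) * (B - C))\<^sup>2) / d\<^sup>2"
    unfolding wp_sqrt_def wp_const_def x_def[symmetric] d_def[symmetric] A_def[symmetric] B_def[symmetric]
      add.commute[of v u] C_def[symmetric]
    by (simp only: power_divide diff_divide_distrib[symmetric])
  also have "((x - A)\<^sup>2 - (A - B) * (A - C))\<^sup>2 - ((x - B)\<^sup>2 - (B - A) * (B - C))\<^sup>2 =
      (((x - A)\<^sup>2 - (A - B) * (A - C)) + ((x - B)\<^sup>2 - (B - A) * (B - C))) *
      (((x - A)\<^sup>2 - (A - B) * (A - C)) - ((x - B)\<^sup>2 - (B - A) * (B - C)))"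
    unfolding power2_eq_square[of "_ - _ * _"] by (rule square_diff_square_factored)
  also have "((x - A)\<^sup>2 - (A - B) * (A - C)) + ((x - B)\<^sup>2 - (B - A) * (B - C)) = 2 * ((x - A) * (x - B))"
    by (simp add: power2_eq_square algebra_simps)
  also have "((x - A)\<^sup>2 - (A - B) * (A - C)) - ((x - B)\<^sup>2 - (B - A) * (B - C)) = 2 * ((B - A) * (x - C))"
    by (simp add: power2_eq_square algebra_simps)
  also have "2 * ((x - A) * (x - B)) * (2 * ((B - A) * (x - C))) = (B - A) * d\<^sup>2"
    unfolding ode by simp
  also have "(B - A) * d\<^sup>2 / d\<^sup>2 = B - A" using d by simp
  finally show ?thesis by (simp add: A_def B_def)
qed

lemma wp_sqrt_uminus: "z \<notin> \<Lambda> \<Longrightarrow> wp_sqrt u v (- z) = - wp_sqrt u v z"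
  by (simp add: wp_sqrt_def wp_uminus deriv_wp_uminus)

lemma wp_sqrt_periodic: "z \<notin> \<Lambda> \<Longrightarrow> w \<in> \<Lambda> \<Longrightarrow> wp_sqrt u v (z + w) = wp_sqrt u v z"
  by (simp add: wp_sqrt_def wp_periodic deriv_wp_periodic)

lemma wp_sqrt_holomorphic: "wp_sqrt u v holomorphic_on - half_lattice"
proof -
  have h: "wp holomorphic_on - half_lattice"
    using wp_holomorphic lattice_subset_half by (auto elim: holomorphic_on_subset)
  moreover have "deriv wp holomorphic_on - half_lattice"
    using h closed_half_lattice by (intro holomorphic_deriv) auto
  ultimately show ?thesis
    unfolding wp_sqrt_def using deriv_wp_nonzero
    by (intro holomorphic_intros) (auto simp: open_Compl closed_half_lattice)
qed

text \<open>The value \<open>- 1 / 2\<close> records the branch of the square root: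
  \<open>\<wp>(2z) - \<wp>(u)\<close> has leading term \<open>1 / (4 z^2)\<close> at 0.\<close>

lemma wp_sqrt_tendsto_0: "((\<lambda>z. z * wp_sqrt u v z) \<longlongrightarrow> - 1 / 2) (at 0)"
proof -
  have "((\<lambda>z. ((z\<^sup>2 * (wp z - wp u))\<^sup>2 - z ^ 4 * wp_const u v) / (z ^ 3 * deriv wp z))
      \<longlongrightarrow> (1\<^sup>2 - 0 ^ 4 * wp_const u v) / (- 2)) (at 0)"
    by (intro tendsto_intros wp_tendsto_0 tendsto_deriv_wp_0) auto
  then have "((\<lambda>z. ((z\<^sup>2 * (wp z - wp u))\<^sup>2 - z ^ 4 * wp_const u v) / (z ^ 3 * deriv wp z)) \<longlongrightarrow> - 1 / 2) (at 0)"
    by simp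
  moreover have "\<forall>\<^sub>F z in at 0. ((z\<^sup>2 * (wp z - wp u))\<^sup>2 - z ^ 4 * wp_const u v) / (z ^ 3 * deriv wp z) = z * wp_sqrt u v z"
    using eventually_not_half_lattice[of 0]
  proof eventually_elim
    case (elim z)
    then have z: "z \<noteq> 0" using lattice_subset_half[OF lattice_0] by auto
    have "(z\<^sup>2 * (wp z - wp u))\<^sup>2 - z ^ 4 * wp_const u v = z ^ 3 * (z * ((wp z - wp u)\<^sup>2 - wp_const u v))"
      by (simp add: power2_eq_square power3_eq_cube power4_eq_xxxx algebra_simps)
    then show ?case using z by (simp add: wp_sqrt_def)
  qed
  ultimately show ?thesis by (rule Lim_transform_eventually)
qed

end

subsection \<open>Theta functions\<close>

lemma entire_primitive:
  fixes h :: "complex \<Rightarrow> complex"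
  assumes h: "h holomorphic_on UNIV"
  obtains P where "\<And>z. (P has_field_derivative h z) (at z)"
  using holomorphic_convex_primitive'[OF convex_UNIV open_UNIV h] by auto

definition period_integral :: "(complex \<Rightarrow> complex) \<Rightarrow> complex" where
  "period_integral h = contour_integral (linepath 0 1) h"

lemma entire_contour_integrable:
  "h holomorphic_on UNIV \<Longrightarrow> h contour_integrable_on (linepath a b)"
  by (rule contour_integrable_continuous_linepath) (meson holomorphic_on_imp_continuous_on holomorphic_on_subset subset_UNIV)

text \<open>For a primitive \<open>P\<close> the integral is \<open>P (w + 1) - P w\<close>, whose
  derivative \<open>h (w + 1) - h w\<close> vanishes. A period may therefore be integrated at any
  height.\<close>

lemma period_integral_shift:
  assumes h: "h holomorphic_on UNIV" and per: "\<And>z. h (z + 1) = h z"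
  shows "contour_integral (linepath w (w + 1)) h = period_integral h"
proof -
  obtain P where P: "\<And>z. (P has_field_derivative h z) (at z)"
    using entire_primitive[OF h] by blast
  have int: "contour_integral (linepath w (w + 1)) h = P (w + 1) - P w" for w
    using contour_integral_primitive[of UNIV P h "linepath w (w + 1)"] P
    by (intro contour_integral_unique) (auto intro: has_field_derivative_at_within)
  have "((\<lambda>w. P (w + 1) - P w) has_field_derivative 0) (at w)" for w
  proof -
    have "((\<lambda>w. P (w + 1)) has_field_derivative h (w + 1)) (at w)"
      using P[of "w + 1"] by (simp only: DERIV_shift)
    then have "((\<lambda>w. P (w + 1) - P w) has_field_derivative h (w + 1) - h w) (at w)"
      using P by (intro DERIV_diff)
    then show ?thesis using per by simp
  qed
  then obtain c where c: "\<And>w. P (w + 1) - P w = c"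
    using DERIV_zero_connected_constant[OF connected_UNIV open_UNIV finite.emptyI, of "\<lambda>w. P (w + 1) - P w"]
      DERIV_isCont[of "\<lambda>w. P (w + 1) - P w"] by (metis UNIV_I continuous_at_imp_continuous_on)
  show ?thesis using int[of w] int[of 0] c[of w] c[of 0] by (simp add: period_integral_def)
qed

definition two_pi_i :: complex where "two_pi_i = 2 * of_real pi * \<i>"

lemma exp_two_pi_i_add_int: "exp (two_pi_i * (z + of_int n)) = exp (two_pi_i * z)"
proof -
  have "exp (two_pi_i * of_int n) = 1"
    using exp_integer_2pi[of "of_int n"] by (simp add: two_pi_i_def mult_ac)
  then show ?thesis by (simp add: distrib_left exp_add)
qed

lemma exp_two_pi_i_eq_1: "exp (two_pi_i * z) = 1 \<longleftrightarrow> z \<in> \<int>"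
proof
  assume "exp (two_pi_i * z) = 1"
  then obtain n :: int where "Re (two_pi_i * z) = 0" "Im (two_pi_i * z) = of_int (2 * n) * pi"
    unfolding exp_eq_1 by blast
  then have "Im z = 0" "Re z = of_int n" by (auto simp: two_pi_i_def)
  then have "z = of_int n" by (simp add: complex_eq_iff)
  then show "z \<in> \<int>" by simp
next
  assume "z \<in> \<int>"
  then obtain n where "z = of_int n" by (elim Ints_cases)
  then show "exp (two_pi_i * z) = 1" using exp_two_pi_i_add_int[of 0 n] by simp
qed

lemma norm_exp_two_pi_i: "norm (exp (two_pi_i * z)) = exp (- 2 * pi * Im z)"
  by (simp add: two_pi_i_def)

text \<open>In the geometric expansion of \<open>1 / (1 - E)\<close> every term but the first
  integrates to zero. Working with finite sums and their remainder bounds the difference of the two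
  integrals by \<open>B |b - a| \<rho>^(n+1)\<close> for every \<open>n\<close>.\<close>

lemma integral_geometric_tail:
  fixes h E :: "complex \<Rightarrow> complex"
  assumes h: "continuous_on (closed_segment a b) h" and E: "continuous_on (closed_segment a b) E"
    and \<rho>: "\<rho> < 1" "\<And>z. z \<in> closed_segment a b \<Longrightarrow> norm (E z) \<le> \<rho>"
    and zero: "\<And>n. n > 0 \<Longrightarrow> contour_integral (linepath a b) (\<lambda>z. h z * E z ^ n) = 0"
  shows "contour_integral (linepath a b) (\<lambda>z. h z / (1 - E z)) = contour_integral (linepath a b) h"
proof -
  have ne: "1 - E z \<noteq> 0" if "z \<in> closed_segment a b" for z
    using \<rho>(1) \<rho>(2)[OF that] by auto
  have \<rho>0: "\<rho> \<ge> 0" using order_trans[OF norm_ge_zero \<rho>(2)[of a]] by simp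
  have c0: "continuous_on (closed_segment a b) (\<lambda>z. h z / (1 - E z))"
    using ne by (intro continuous_intros h E) auto
  have "bounded ((\<lambda>z. h z / (1 - E z)) ` closed_segment a b)"
    by (intro compact_imp_bounded compact_continuous_image c0 compact_segment)
  then obtain B where B: "B > 0" "\<And>z. z \<in> closed_segment a b \<Longrightarrow> norm (h z / (1 - E z)) \<le> B"
    by (auto simp: bounded_pos)
  let ?I = "contour_integral (linepath a b)"
  have split: "?I (\<lambda>z. h z / (1 - E z)) = ?I h + ?I (\<lambda>z. h z / (1 - E z) * E z ^ Suc n)" for n
  proof -
    have ci: "(\<lambda>z. h z * E z ^ k) contour_integrable_on linepath a b" for k
      by (intro contour_integrable_continuous_linepath continuous_intros h E)
    have ci': "(\<lambda>z. h z / (1 - E z) * E z ^ Suc n) contour_integrable_on linepath a b"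
      by (intro contour_integrable_continuous_linepath continuous_intros c0 E)
    have eq: "h z / (1 - E z) = (\<Sum>k\<le>n. h z * E z ^ k) + h z / (1 - E z) * E z ^ Suc n"
      if "z \<in> closed_segment a b" for z
    proof -
      have "(1 - E z) * (\<Sum>k\<le>n. E z ^ k) = 1 - E z ^ Suc n" by (rule sum_gp_basic)
      then have "(\<Sum>k\<le>n. E z ^ k) = (1 - E z ^ Suc n) / (1 - E z)"
        using ne[OF that] by (simp add: field_simps)
      then have "(\<Sum>k\<le>n. h z * E z ^ k) = h z * ((1 - E z ^ Suc n) / (1 - E z))"
        by (simp flip: sum_distrib_left)
      also have "\<dots> = h z / (1 - E z) - h z / (1 - E z) * E z ^ Suc n"
        by (simp only: times_divide_eq_right right_diff_distrib diff_divide_distrib mult_1_right times_divide_eq_left)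
      finally show ?thesis by simp
    qed
    have "?I (\<lambda>z. h z / (1 - E z)) = ?I (\<lambda>z. (\<Sum>k\<le>n. h z * E z ^ k) + h z / (1 - E z) * E z ^ Suc n)"
      by (rule contour_integral_eq) (rule eq, simp)
    also have "\<dots> = ?I (\<lambda>z. \<Sum>k\<le>n. h z * E z ^ k) + ?I (\<lambda>z. h z / (1 - E z) * E z ^ Suc n)"
      by (intro contour_integral_add contour_integrable_sum ci ci') auto
    also have "?I (\<lambda>z. \<Sum>k\<le>n. h z * E z ^ k) = (\<Sum>k\<le>n. ?I (\<lambda>z. h z * E z ^ k))"
      by (intro contour_integral_sum ci) auto
    also have "\<dots> = ?I (\<lambda>z. h z * E z ^ 0) + (\<Sum>k\<in>{..n} - {0}. ?I (\<lambda>z. h z * E z ^ k))"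
      by (subst sum.remove[of _ 0]) auto
    also have "(\<Sum>k\<in>{..n} - {0}. ?I (\<lambda>z. h z * E z ^ k)) = 0"
      by (intro sum.neutral ballI zero) auto
    finally show ?thesis by simp
  qed
  have bound: "norm (?I (\<lambda>z. h z / (1 - E z)) - ?I h) \<le> B * norm (b - a) * \<rho> ^ Suc n" for n
  proof -
    have "norm (?I (\<lambda>z. h z / (1 - E z) * E z ^ Suc n)) \<le> (B * \<rho> ^ Suc n) * norm (b - a)"
    proof (rule contour_integral_bound_linepath)
      show "(\<lambda>z. h z / (1 - E z) * E z ^ Suc n) contour_integrable_on linepath a b"
        by (intro contour_integrable_continuous_linepath continuous_intros c0 E)
      show "norm (h z / (1 - E z) * E z ^ Suc n) \<le> B * \<rho> ^ Suc n" if "z \<in> closed_segment a b" for z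
        unfolding norm_mult norm_power
        using B \<rho>(2)[OF that] that by (intro mult_mono power_mono) auto
    qed (use B \<rho>0 in auto)
    then show ?thesis using split[of n] by (simp add: mult_ac)
  qed
  have "(\<lambda>n. B * norm (b - a) * \<rho> ^ Suc n) \<longlonglongrightarrow> B * norm (b - a) * 0"
    by (rule tendsto_mult_left[OF LIMSEQ_Suc[OF LIMSEQ_realpow_zero[OF \<rho>0 \<rho>(1)]]])
  then have "norm (?I (\<lambda>z. h z / (1 - E z)) - ?I h) \<le> B * norm (b - a) * 0"
    by (rule LIMSEQ_le_const) (use bound in blast)
  then show ?thesis by simp
qed

text \<open>
  Uniqueness of Fourier coefficients: the function \<open>(f(z) - f(z\<^sub>0)) / (1 - e\<^sup>2\<^sup>\<pi>\<^sup>i\<^sup>(\<^sup>z\<^sup>0\<^sup>-\<^sup>z\<^sup>))\<close> is entire and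
  periodic. Its integral over a period is \<open>-f(z\<^sub>0)\<close> far below \<open>z\<^sub>0\<close> and \<open>0\<close> far above.
\<close>

lemma entire_periodic_zero:
  assumes f: "f holomorphic_on UNIV" and per: "\<And>z. f (z + 1) = f z"
    and zero: "\<And>n::int. period_integral (\<lambda>z. f z * exp (two_pi_i * (of_int n * z))) = 0"
  shows "f z0 = 0"
proof -
  define h where "h z = f z - f z0" for z
  define E where "E z = exp (two_pi_i * (z0 - z))" for z
  define H where "H = {z. z0 - z \<in> \<int>}"
  have h: "h holomorphic_on UNIV" unfolding h_def by (intro holomorphic_intros f)
  have Ehol: "E holomorphic_on S" for S unfolding E_def by (intro holomorphic_intros)
  have Eper: "E (z + 1) = E z" for z
    using exp_two_pi_i_add_int[of "z0 - z - 1" 1] by (simp add: E_def algebra_simps)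
  have E1: "E z = 1 \<longleftrightarrow> z \<in> H" for z by (simp add: E_def exp_two_pi_i_eq_1 H_def)
  have fint: "f (z + of_int n) = f z" for n z
  proof -
    have nat: "f (z + of_nat n) = f z" for n z
    proof (induction n)
      case (Suc n) then show ?case using per[of "z + of_nat n"] by (simp add: algebra_simps)
    qed simp
    show ?thesis using nat[of z "nat n"] nat[of "z + of_int n" "nat (- n)"] by (cases "n \<ge> 0") auto
  qed
  have hH: "h z = 0" if z: "z \<in> H" for z
  proof -
    obtain n where "z0 - z = of_int n" using z unfolding H_def by (auto elim: Ints_cases)
    then have "z0 = z + of_int n" by (simp add: algebra_simps)
    then show ?thesis using fint[of z n] by (simp add: h_def)
  qed
  have Hclosed: "closed H"
  proof -
    have "H = (\<lambda>z. z0 - z) -` \<int>" by (auto simp: H_def)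
    then show ?thesis by (simp add: closed_vimage closed_Ints continuous_intros)
  qed
  have disc: "\<forall>\<^sub>F w in at z. w \<notin> H" for z
  proof -
    have "open (ball z 1 - (H \<inter> cball z 1 - {z}))"
    proof (rule open_Diff[OF open_ball])
      have "H \<inter> cball z 1 \<subseteq> (\<lambda>n. z0 - of_int n) ` {\<lfloor>Re (z0 - z)\<rfloor> - 2..\<lfloor>Re (z0 - z)\<rfloor> + 2}"
      proof
        fix w assume w: "w \<in> H \<inter> cball z 1"
        then obtain n where n: "z0 - w = of_int n" unfolding H_def by (auto elim: Ints_cases)
        have "\<bar>Re (z - w)\<bar> \<le> norm (z - w)" by (rule abs_Re_le_cmod)
        then have "\<bar>Re (z - w)\<bar> \<le> 1" using w by (simp add: dist_norm)
        moreover have "Re (z - w) = of_int n - Re (z0 - z)" using arg_cong[OF n, of Re] by simp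
        ultimately have "\<lfloor>Re (z0 - z)\<rfloor> - 2 \<le> n" "n \<le> \<lfloor>Re (z0 - z)\<rfloor> + 2" by linarith+
        moreover have "w = z0 - of_int n" using n by (simp add: algebra_simps)
        ultimately show "w \<in> (\<lambda>n. z0 - of_int n) ` {\<lfloor>Re (z0 - z)\<rfloor> - 2..\<lfloor>Re (z0 - z)\<rfloor> + 2}" by auto
      qed
      then have "finite (H \<inter> cball z 1)" by (rule finite_subset) auto
      then show "closed (H \<inter> cball z 1 - {z})" by (intro finite_imp_closed) auto
    qed
    then have "\<forall>\<^sub>F w in at z. w \<in> (ball z 1 - (H \<inter> cball z 1 - {z})) - {z}"
      by (rule eventually_at_in_open) auto
    then show ?thesis by (rule eventually_mono) auto
  qed
  have "(\<lambda>z. h z / (1 - E z)) holomorphic_on - H"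
    using E1 by (intro holomorphic_intros Ehol holomorphic_on_subset[OF h]) auto
  moreover have "\<exists>L. ((\<lambda>z. h z / (1 - E z)) \<longlongrightarrow> L) (at z)" if z: "z \<in> H" for z
  proof -
    have "E z = 1" using z E1 by blast
    have dE: "(E has_field_derivative - two_pi_i) (at z)"
      using \<open>E z = 1\<close> unfolding E_def by (auto intro!: derivative_eq_intros)
    have "(h has_field_derivative deriv h z) (at z)"
      using h by (intro holomorphic_derivI[of _ UNIV]) auto
    then have "((\<lambda>w. (h w - h z) / (w - z)) \<longlongrightarrow> deriv h z) (at z)"
      by (simp only: has_field_derivative_iff)
    moreover have "((\<lambda>w. (E w - E z) / (w - z)) \<longlongrightarrow> - two_pi_i) (at z)"
      using dE by (simp only: has_field_derivative_iff)
    ultimately have "((\<lambda>w. ((h w - h z) / (w - z)) / - ((E w - E z) / (w - z))) \<longlongrightarrow> deriv h z / - (- two_pi_i)) (at z)"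
      by (intro tendsto_intros) (auto simp: two_pi_i_def)
    then have lim: "((\<lambda>w. ((h w - h z) / (w - z)) / - ((E w - E z) / (w - z))) \<longlongrightarrow> deriv h z / two_pi_i) (at z)"
      by simp
    have "\<forall>\<^sub>F w in at z. w \<noteq> z" by (simp add: eventually_at_filter)
    then have ev: "\<forall>\<^sub>F w in at z. ((h w - h z) / (w - z)) / - ((E w - E z) / (w - z)) = h w / (1 - E w)"
    proof eventually_elim
      case (elim w)
      have "- ((E w - E z) / (w - z)) = (1 - E w) / (w - z)"
        by (simp add: \<open>E z = 1\<close> minus_divide_left)
      then show ?case using elim hH[OF z] by simp
    qed
    from Lim_transform_eventually[OF lim ev] show ?thesis by blast
  qed
  ultimately obtain g where g: "g holomorphic_on UNIV" "\<And>z. z \<notin> H \<Longrightarrow> g z = h z / (1 - E z)"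
    using removable_extension[OF _ Hclosed disc] by blast
  have gper: "g (z + 1) = g z" for z
  proof -
    have cont: "isCont g z" for z
      using holomorphic_on_imp_continuous_on[OF g(1)] by (simp add: continuous_on_eq_continuous_at)
    have "(g \<longlongrightarrow> g (z + 1)) (at (z + 1))" using cont by (simp add: isCont_def)
    then have "((\<lambda>z. g (z + 1)) \<longlongrightarrow> g (z + 1)) (at z)" unfolding tendsto_shift .
    moreover have "\<forall>\<^sub>F w in at z. g (w + 1) = g w"
      using disc[of z]
    proof eventually_elim
      case (elim w)
      then have "w + 1 \<notin> H" using E1 Eper by metis
      then show ?case using elim g(2) per[of w] by (simp add: h_def Eper)
    qed
    ultimately have "(g \<longlongrightarrow> g (z + 1)) (at z)" by (rule Lim_transform_eventually)
    moreover have "(g \<longlongrightarrow> g z) (at z)" using cont by (simp add: isCont_def)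
    ultimately show ?thesis using LIM_unique by blast
  qed
  \<comment> \<open>By assumption \<open>f\<close> integrates to zero against these exponentials,
    and the constant \<open>- f z0\<close> in \<open>h\<close> contributes only for
    \<open>n = 0\<close>.\<close>
  have hE: "contour_integral (linepath w (w + 1)) (\<lambda>z. h z * exp (two_pi_i * (of_int n * (z0 - z))))
      = (if n = 0 then - f z0 else 0)" for n w
  proof -
    have c: "period_integral (\<lambda>z. exp (two_pi_i * (of_int n * (z0 - z)))) = (if n = 0 then 1 else 0)"
    proof (cases "n = 0")
      case True then show ?thesis by (simp add: period_integral_def)
    next
      case False
      define P where "P z = exp (two_pi_i * (of_int n * (z0 - z))) / (- two_pi_i * of_int n)" for z
      have "(P has_field_derivative exp (two_pi_i * (of_int n * (z0 - z)))) (at z)" for z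
        unfolding P_def using False by (auto intro!: derivative_eq_intros simp: two_pi_i_def)
      then have "period_integral (\<lambda>z. exp (two_pi_i * (of_int n * (z0 - z)))) = P 1 - P 0"
        unfolding period_integral_def
        using contour_integral_primitive[of UNIV P _ "linepath 0 1"]
        by (intro contour_integral_unique) (auto intro: has_field_derivative_at_within)
      moreover have "P 1 = P 0"
        using exp_two_pi_i_add_int[of "of_int n * (z0 - 1)" n] by (simp add: P_def algebra_simps)
      ultimately show ?thesis using False by simp
    qed
    let ?e = "\<lambda>z. exp (two_pi_i * (of_int n * (z0 - z)))"
    have e: "?e z = exp (two_pi_i * (of_int n * z0)) * exp (two_pi_i * (of_int (- n) * z))" for z
      by (simp add: algebra_simps flip: exp_add)
    have holo: "(\<lambda>z. f z * ?e z) holomorphic_on UNIV" "?e holomorphic_on UNIV" "(\<lambda>z. h z * ?e z) holomorphic_on UNIV"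
      by (intro holomorphic_intros f h)+
    have eper: "?e (z + 1) = ?e z" for z
      using exp_two_pi_i_add_int[of "of_int n * (z0 - z - 1)" n] by (simp add: algebra_simps)
    have "period_integral (\<lambda>z. f z * ?e z) =
        contour_integral (linepath 0 1) (\<lambda>z. exp (two_pi_i * (of_int n * z0)) * (f z * exp (two_pi_i * (of_int (- n) * z))))"
      unfolding period_integral_def by (rule contour_integral_eq) (simp only: e mult_ac)
    also have "\<dots> = exp (two_pi_i * (of_int n * z0)) * period_integral (\<lambda>z. f z * exp (two_pi_i * (of_int (- n) * z)))"
      unfolding period_integral_def
      by (intro contour_integral_lmul entire_contour_integrable holomorphic_intros f)
    also have "\<dots> = 0" by (simp only: zero mult_zero_right)
    finally have f0: "contour_integral (linepath 0 1) (\<lambda>z. f z * ?e z) = 0"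
      unfolding period_integral_def .
    have "contour_integral (linepath w (w + 1)) (\<lambda>z. h z * ?e z) = period_integral (\<lambda>z. h z * ?e z)"
      by (rule period_integral_shift[OF holo(3)]) (simp add: h_def per eper del: minus_diff_eq)
    also have "\<dots> = contour_integral (linepath 0 1) (\<lambda>z. f z * ?e z - f z0 * ?e z)"
      unfolding period_integral_def by (rule contour_integral_eq) (simp add: h_def left_diff_distrib)
    also have "\<dots> = contour_integral (linepath 0 1) (\<lambda>z. f z * ?e z) - contour_integral (linepath 0 1) (\<lambda>z. f z0 * ?e z)"
      by (intro contour_integral_diff entire_contour_integrable holo holomorphic_intros)
    also have "contour_integral (linepath 0 1) (\<lambda>z. f z0 * ?e z) = f z0 * period_integral ?e"
      unfolding period_integral_def by (intro contour_integral_lmul entire_contour_integrable holo)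
    finally show ?thesis unfolding f0 c by simp
  qed
  have seg: "Im z = Im w" if "z \<in> closed_segment w (w + 1)" for w z :: complex
    using that by (auto simp: closed_segment_def algebra_simps)
  have powE: "E z ^ n = exp (two_pi_i * (of_int (int n) * (z0 - z)))" for z n
    unfolding E_def exp_of_nat_mult[symmetric] by (simp add: mult_ac)
  have contE: "continuous_on S E" for S using Ehol holomorphic_on_imp_continuous_on by blast
  have conth: "continuous_on S h" for S
    using holomorphic_on_imp_continuous_on[OF h] continuous_on_subset by blast
  have gI: "contour_integral (linepath w (w + 1)) g = contour_integral (linepath w (w + 1)) (\<lambda>z. h z / (1 - E z))"
    if "Im w \<noteq> Im z0" for w
  proof (rule contour_integral_eq)
    fix z assume "z \<in> path_image (linepath w (w + 1))"
    then have "Im z \<noteq> Im z0" using seg that by simp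
    then have "z \<notin> H" unfolding H_def by (auto elim!: Ints_cases simp: complex_eq_iff)
    then show "g z = h z / (1 - E z)" by (rule g(2))
  qed
  have normE: "norm (E z) = exp (- 2 * pi * (Im z0 - Im z))" for z
    unfolding E_def norm_exp_two_pi_i by simp
  \<comment> \<open>One unit below \<open>z0\<close> the modulus of \<open>E\<close> is
    \<open>exp (- 2 * pi)\<close>, one unit above it is the reciprocal. Above, one expands in
    \<open>1 / E\<close> using \<open>h / (1 - E) = - (h / E) / (1 - 1 / E)\<close>, where every
    term has nonzero frequency.\<close>
  define w1 where "w1 = z0 - \<i>"
  define w2 where "w2 = z0 + \<i>"
  have "contour_integral (linepath w1 (w1 + 1)) (\<lambda>z. h z / (1 - E z)) = contour_integral (linepath w1 (w1 + 1)) h"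
  proof (rule integral_geometric_tail[where \<rho> = "exp (- 2 * pi)"])
    show "norm (E z) \<le> exp (- 2 * pi)" if "z \<in> closed_segment w1 (w1 + 1)" for z
      using seg[OF that] by (simp add: normE w1_def)
    show "contour_integral (linepath w1 (w1 + 1)) (\<lambda>z. h z * E z ^ n) = 0" if "n > 0" for n
      using hE[of w1 "int n"] that by (simp only: powE) simp
  qed (auto intro: conth contE)
  also have "\<dots> = - f z0" using hE[of w1 0] by simp
  finally have low: "period_integral g = - f z0"
    using gI[of w1] period_integral_shift[OF g(1) gper, of w1] by (simp add: w1_def)
  have inv: "inverse (E z) ^ n = exp (two_pi_i * (of_int (- int n) * (z0 - z)))" for z n
    by (simp add: power_inverse powE exp_minus)
  have Ene: "E z \<noteq> 0" for z by (simp add: E_def)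
  have "contour_integral (linepath w2 (w2 + 1)) (\<lambda>z. h z / (1 - E z)) =
      contour_integral (linepath w2 (w2 + 1)) (\<lambda>z. (- h z * inverse (E z)) / (1 - inverse (E z)))"
  proof (rule contour_integral_eq)
    fix z
    show "h z / (1 - E z) = (- h z * inverse (E z)) / (1 - inverse (E z))"
      using Ene[of z] by (cases "E z = 1") (auto simp: divide_simps algebra_simps)
  qed
  also have "\<dots> = contour_integral (linepath w2 (w2 + 1)) (\<lambda>z. - h z * inverse (E z))"
  proof (rule integral_geometric_tail[where \<rho> = "exp (- 2 * pi)"])
    show "norm (inverse (E z)) \<le> exp (- 2 * pi)" if "z \<in> closed_segment w2 (w2 + 1)" for z
      using seg[OF that] by (simp add: norm_inverse normE w2_def flip: exp_minus)
    show "contour_integral (linepath w2 (w2 + 1)) (\<lambda>z. - h z * inverse (E z) * inverse (E z) ^ n) = 0" if "n > 0" for n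
    proof -
      have "contour_integral (linepath w2 (w2 + 1)) (\<lambda>z. - (h z * inverse (E z) ^ Suc n)) = 0"
        using hE[of w2 "- int (Suc n)"] that by (simp only: inv contour_integral_neg) simp
      then show ?thesis by (simp add: mult_ac)
    qed
  qed (auto intro!: continuous_intros conth contE simp: Ene)
  also have "\<dots> = contour_integral (linepath w2 (w2 + 1)) (\<lambda>z. - (h z * inverse (E z) ^ 1))" by simp
  also have "\<dots> = 0" using hE[of w2 "- int 1"] by (simp only: inv contour_integral_neg) simp
  finally have "period_integral g = 0"
    using gI[of w2] period_integral_shift[OF g(1) gper, of w2] by (simp add: w2_def)
  with low show ?thesis by simp
qed

section \<open>Jacobi's theta function and theta functions of order two\<close>

context upper_half_plane
begin

text \<open>Jacobi's \<open>theta_3(z|\<tau>)\<close>, normalised to have period 1. Its values at 0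
  and, up to a factor, at \<open>\<tau> / 2\<close> are the theta constants in
  \<open>modular_lambda\<close>.\<close>

definition theta :: "complex \<Rightarrow> complex" where
  "theta z = (\<Sum>\<^sub>\<infinity>k\<in>(UNIV :: int set). exp (of_real pi * \<i> * \<tau> * (of_int k)\<^sup>2 + two_pi_i * (of_int k * z)))"

text \<open>Completing the square in \<open>- a x^2 + b x\<close> with
  \<open>a = pi Im \<tau>\<close> and \<open>b = 2 pi R + 1\<close> gives the constant factor; the 1
  in \<open>b\<close> pays for the decay \<open>exp (- |k|)\<close>.\<close>

definition theta_bound :: "real \<Rightarrow> int \<Rightarrow> real" where
  "theta_bound R k = exp ((2 * pi * R + 1)\<^sup>2 / (4 * pi * Im \<tau>)) * exp (- real (nat \<bar>k\<bar>))"

lemma theta_term_bound: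
  assumes "norm z \<le> R"
  shows "norm (exp (of_real pi * \<i> * \<tau> * (of_int k)\<^sup>2 + two_pi_i * (of_int k * z))) \<le> theta_bound R k"
proof -
  define a where "a = pi * Im \<tau>"
  define b where "b = 2 * pi * R + 1"
  define x where "x = \<bar>real_of_int k\<bar>"
  have a: "a > 0" using Im_pos by (simp add: a_def)
  have Re: "Re (of_real pi * \<i> * \<tau> * (of_int k)\<^sup>2 + two_pi_i * (of_int k * z)) = - (a * x\<^sup>2) + 2 * pi * (- (of_int k * Im z))"
    by (simp add: two_pi_i_def a_def x_def power2_eq_square)
  have "- (of_int k * Im z) \<le> x * \<bar>Im z\<bar>"
    using abs_ge_minus_self[of "of_int k * Im z"] by (simp only: x_def abs_mult)
  also have "x * \<bar>Im z\<bar> \<le> x * R"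
    using assms abs_Im_le_cmod[of z] by (intro mult_left_mono) (auto simp: x_def)
  finally have "2 * pi * (- (of_int k * Im z)) \<le> 2 * pi * (x * R)"
    by (rule mult_left_mono) simp
  then have "Re (of_real pi * \<i> * \<tau> * (of_int k)\<^sup>2 + two_pi_i * (of_int k * z)) \<le> - (a * x\<^sup>2) + 2 * pi * (x * R)"
    unfolding Re by simp
  also have "\<dots> = - (a * x\<^sup>2) + (b - 1) * x" by (simp add: b_def)
  also have "\<dots> \<le> b\<^sup>2 / (4 * a) - x"
  proof -
    have "0 \<le> (2 * a * x - b)\<^sup>2 / (4 * a)" using a by simp
    also have "\<dots> = a * x\<^sup>2 - b * x + b\<^sup>2 / (4 * a)"
    proof -
      have "(2 * a * x - b)\<^sup>2 = 4 * a * (a * x\<^sup>2 - b * x) + b\<^sup>2"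
        by (simp add: power2_eq_square algebra_simps)
      then show ?thesis using a by (simp add: add_divide_distrib)
    qed
    finally show ?thesis by (simp add: left_diff_distrib)
  qed
  finally have "Re (of_real pi * \<i> * \<tau> * (of_int k)\<^sup>2 + two_pi_i * (of_int k * z)) \<le> b\<^sup>2 / (4 * a) - x" .
  then have "norm (exp (of_real pi * \<i> * \<tau> * (of_int k)\<^sup>2 + two_pi_i * (of_int k * z))) \<le> exp (b\<^sup>2 / (4 * a) - x)"
    by (simp only: norm_exp_eq_Re exp_le_cancel_iff)
  also have "\<dots> = theta_bound R k"
  proof -
    have "4 * a = 4 * pi * Im \<tau>" "x = real (nat \<bar>k\<bar>)" by (simp_all add: a_def x_def)
    then show ?thesis by (simp only: theta_bound_def b_def diff_conv_add_uminus exp_add)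
  qed
  finally show ?thesis .
qed

lemma theta_bound_summable: "theta_bound R summable_on UNIV"
proof -
  have "summable (\<lambda>n. exp (- 1 :: real) ^ n)" by (rule summable_geometric) simp
  then have "summable (\<lambda>n. exp (- real n))" by (simp flip: exp_of_nat_mult)
  then show ?thesis unfolding theta_bound_def
    by (intro summable_on_cmult_right summable_on_int_abs) auto
qed

lemma theta_holomorphic: "theta holomorphic_on UNIV"
proof -
  have "\<exists>D. (theta has_field_derivative D) (at z)" for z
  proof -
    define R where "R = norm z + 1"
    have R: "R > 0" unfolding R_def by (intro add_nonneg_pos) auto
    have ulim: "uniform_limit (cball 0 R)
        (\<lambda>Y z. \<Sum>k\<in>Y. exp (of_real pi * \<i> * \<tau> * (of_int k)\<^sup>2 + two_pi_i * (of_int k * z))) theta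
        (finite_subsets_at_top UNIV)"
      unfolding theta_def
      by (rule Weierstrass_m_test_general[OF _ theta_bound_summable[of R]])
         (use theta_term_bound in auto)
    have ev: "\<forall>\<^sub>F Y in finite_subsets_at_top (UNIV :: int set).
        continuous_on (cball 0 R) (\<lambda>z. \<Sum>k\<in>Y. exp (of_real pi * \<i> * \<tau> * (of_int k)\<^sup>2 + two_pi_i * (of_int k * z))) \<and>
        (\<lambda>z. \<Sum>k\<in>Y. exp (of_real pi * \<i> * \<tau> * (of_int k)\<^sup>2 + two_pi_i * (of_int k * z))) holomorphic_on ball 0 R"
      by (intro always_eventually allI conjI continuous_intros holomorphic_intros)
    have "theta holomorphic_on ball 0 R"
      using holomorphic_uniform_limit[OF ev ulim finite_subsets_at_top_neq_bot] by metis
    then show ?thesis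
      using holomorphic_derivI[of theta "ball 0 R" z] by (auto simp: R_def)
  qed
  then show ?thesis by (simp add: holomorphic_on_open)
qed

lemma theta_add_1: "theta (z + 1) = theta z"
proof -
  have "of_real pi * \<i> * \<tau> * (of_int k)\<^sup>2 + two_pi_i * (of_int k * (z + 1)) =
      of_real pi * \<i> * \<tau> * (of_int k)\<^sup>2 + two_pi_i * (of_int k * z + of_int k)" for k
    by (simp add: algebra_simps)
  then show ?thesis by (simp only: theta_def exp_add exp_two_pi_i_add_int)
qed

lemma theta_uminus: "theta (- z) = theta z"
  unfolding theta_def
  by (rule infsum_reindex_bij_witness[where i = uminus and j = uminus]) auto

lemma theta_add_tau: "theta (z + \<tau>) = exp (- (two_pi_i * z) - of_real pi * \<i> * \<tau>) * theta z"
proof -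
  have "theta (z + \<tau>) = (\<Sum>\<^sub>\<infinity>k\<in>(UNIV :: int set). exp (- (two_pi_i * z) - of_real pi * \<i> * \<tau>) *
      exp (of_real pi * \<i> * \<tau> * (of_int k)\<^sup>2 + two_pi_i * (of_int k * z)))"
    unfolding theta_def
  proof (rule infsum_reindex_bij_witness[where i = "\<lambda>k. k - 1" and j = "\<lambda>k. k + 1"])
    fix k :: int
    have "- (two_pi_i * z) - of_real pi * \<i> * \<tau> + (of_real pi * \<i> * \<tau> * (of_int (k + 1))\<^sup>2 + two_pi_i * (of_int (k + 1) * z))
      = of_real pi * \<i> * \<tau> * (of_int k)\<^sup>2 + two_pi_i * (of_int k * (z + \<tau>))"
      by (simp add: two_pi_i_def power2_eq_square algebra_simps)
    then show "exp (- (two_pi_i * z) - of_real pi * \<i> * \<tau>) *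
        exp (of_real pi * \<i> * \<tau> * (of_int (k + 1))\<^sup>2 + two_pi_i * (of_int (k + 1) * z)) =
      exp (of_real pi * \<i> * \<tau> * (of_int k)\<^sup>2 + two_pi_i * (of_int k * (z + \<tau>)))"
      by (simp only: exp_add[symmetric])
  qed auto
  also have "\<dots> = exp (- (two_pi_i * z) - of_real pi * \<i> * \<tau>) * theta z"
    unfolding theta_def by (rule infsum_cmult_right')
  finally show ?thesis .
qed

lemma theta3_null_eq: "theta3_null \<tau> = theta 0"
  by (simp add: theta3_null_def theta_def)

lemma theta2_null_eq: "theta2_null \<tau> = exp (of_real pi * \<i> * \<tau> / 4) * theta (\<tau> / 2)"
proof -
  have "of_real pi * \<i> * \<tau> * (of_int k + 1 / 2)\<^sup>2 =
      of_real pi * \<i> * \<tau> / 4 + (of_real pi * \<i> * \<tau> * (of_int k)\<^sup>2 + two_pi_i * (of_int k * (\<tau> / 2)))" for k :: int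
  proof -
    have sq: "(of_int k + 1 / 2 :: complex)\<^sup>2 = (of_int k)\<^sup>2 + of_int k + 1 / 4"
      by (simp add: power2_sum power_divide)
    show ?thesis unfolding sq two_pi_i_def by (simp add: distrib_left)
  qed
  then show ?thesis
    unfolding theta2_null_def theta_def by (simp only: exp_add[of "of_real pi * \<i> * \<tau> / 4"] infsum_cmult_right')
qed

text \<open>At \<open>z = - (1 + \<tau>) / 2\<close> the shift by \<open>1 + \<tau>\<close>
  coincides with \<open>z \<mapsto> - z\<close>, and the factor of quasi-periodicity is
  \<open>exp (pi \<i>) = - 1\<close>. Since \<open>theta\<close> is even, it must vanish
  there.\<close>

lemma theta_half_period: "theta ((1 + \<tau>) / 2) = 0"
proof -
  define z where "z = - ((1 + \<tau>) / 2)"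
  have "theta (z + \<tau> + 1) = exp (- (two_pi_i * z) - of_real pi * \<i> * \<tau>) * theta z"
    by (simp only: theta_add_1 theta_add_tau)
  moreover have z2: "- (2 * z) = 1 + \<tau>" by (simp add: z_def)
  then have "z + \<tau> + 1 = z + - (2 * z)" by simp
  then have "z + \<tau> + 1 = - z" by simp
  moreover have "- (two_pi_i * z) - of_real pi * \<i> * \<tau> = of_real pi * \<i> * (- (2 * z) - \<tau>)"
    by (simp add: two_pi_i_def right_diff_distrib)
  then have "- (two_pi_i * z) - of_real pi * \<i> * \<tau> = of_real pi * \<i>"
    unfolding z2 by simp
  ultimately have "theta z = - theta z" by (simp add: theta_uminus exp_pi_i)
  then have "theta z = 0" by simp
  then show ?thesis using theta_uminus[of z] by (simp add: z_def)
qed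

text \<open>Theta functions of order two, i.e. sections of the square of the line bundle of \<open>theta\<close>.\<close>

definition theta2_space :: "(complex \<Rightarrow> complex) set" where
  "theta2_space = {f. f holomorphic_on UNIV \<and> (\<forall>z. f (z + 1) = f z) \<and>
     (\<forall>z. f (z + \<tau>) = exp (- (two_pi_i * (2 * z + \<tau>))) * f z)}"

text \<open>With this sign of the exponent, index \<open>n\<close> denotes the coefficient of
  \<open>exp (- 2 pi \<i> n z)\<close>.\<close>

definition fourier_coeff :: "(complex \<Rightarrow> complex) \<Rightarrow> int \<Rightarrow> complex" where
  "fourier_coeff f n = period_integral (\<lambda>z. f z * exp (two_pi_i * (of_int n * z)))"

text \<open>Moving the path of integration up by \<open>\<tau>\<close> and applying
  quasi-periodicity relates the indices \<open>n\<close> and \<open>n - 2\<close>. The coefficients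
  of index 0 and 1 thus determine all others, and the space has dimension at most two.\<close>

lemma fourier_coeff_rec:
  assumes f: "f \<in> theta2_space"
  shows "fourier_coeff f n = exp (two_pi_i * (of_int (n - 1) * \<tau>)) * fourier_coeff f (n - 2)"
proof -
  have hol: "f holomorphic_on UNIV" and per: "\<And>z. f (z + 1) = f z"
    and tau: "\<And>z. f (z + \<tau>) = exp (- (two_pi_i * (2 * z + \<tau>))) * f z"
    using f by (auto simp: theta2_space_def)
  let ?h = "\<lambda>z. f z * exp (two_pi_i * (of_int n * z))"
  have h: "?h holomorphic_on UNIV" by (intro holomorphic_intros hol)
  have hper: "?h (z + 1) = ?h z" for z
    using exp_two_pi_i_add_int[of "of_int n * z" n] by (simp add: per distrib_left)
  obtain P where P: "\<And>z. (P has_field_derivative ?h z) (at z)"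
    using entire_primitive[OF h] by blast
  have int: "(?h has_contour_integral P b - P a) (linepath a b)" for a b
    using contour_integral_primitive[of UNIV P ?h "linepath a b"] P
    by (auto intro: has_field_derivative_at_within)
  have "((\<lambda>z. P (z + \<tau>)) has_field_derivative ?h (z + \<tau>)) (at z)" for z
    using P[of "z + \<tau>"] by (simp only: DERIV_shift)
  then have "((\<lambda>z. ?h (z + \<tau>)) has_contour_integral P (1 + \<tau>) - P (0 + \<tau>)) (linepath 0 1)"
    using contour_integral_primitive[of UNIV "\<lambda>z. P (z + \<tau>)" "\<lambda>z. ?h (z + \<tau>)" "linepath 0 1"]
    by (auto intro: has_field_derivative_at_within)
  then have "contour_integral (linepath 0 1) (\<lambda>z. ?h (z + \<tau>)) = P (1 + \<tau>) - P (0 + \<tau>)"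
    by (rule contour_integral_unique)
  also have "\<dots> = contour_integral (linepath \<tau> (\<tau> + 1)) ?h"
    using contour_integral_unique[OF int[of "\<tau> + 1" \<tau>]] by (simp add: add.commute)
  also have "\<dots> = fourier_coeff f n"
    unfolding fourier_coeff_def by (rule period_integral_shift[OF h hper])
  also have "contour_integral (linepath 0 1) (\<lambda>z. ?h (z + \<tau>)) =
      contour_integral (linepath 0 1) (\<lambda>z. exp (two_pi_i * (of_int (n - 1) * \<tau>)) * (f z * exp (two_pi_i * (of_int (n - 2) * z))))"
  proof (rule contour_integral_eq)
    fix z
    have "- (two_pi_i * (2 * z + \<tau>)) + two_pi_i * (of_int n * (z + \<tau>)) =
        two_pi_i * (of_int (n - 1) * \<tau>) + two_pi_i * (of_int (n - 2) * z)"
      by (simp add: algebra_simps)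
    then have eq: "exp (- (two_pi_i * (2 * z + \<tau>))) * exp (two_pi_i * (of_int n * (z + \<tau>))) =
        exp (two_pi_i * (of_int (n - 1) * \<tau>)) * exp (two_pi_i * (of_int (n - 2) * z))"
      by (simp only: exp_add[symmetric])
    have "?h (z + \<tau>) = (exp (- (two_pi_i * (2 * z + \<tau>))) * exp (two_pi_i * (of_int n * (z + \<tau>)))) * f z"
      unfolding tau by (simp only: mult_ac)
    also have "\<dots> = exp (two_pi_i * (of_int (n - 1) * \<tau>)) * (f z * exp (two_pi_i * (of_int (n - 2) * z)))"
      unfolding eq by (simp only: mult_ac)
    finally show "?h (z + \<tau>) = exp (two_pi_i * (of_int (n - 1) * \<tau>)) * (f z * exp (two_pi_i * (of_int (n - 2) * z)))" .
  qed
  also have "\<dots> = exp (two_pi_i * (of_int (n - 1) * \<tau>)) * fourier_coeff f (n - 2)"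
    unfolding fourier_coeff_def period_integral_def
    by (intro contour_integral_lmul entire_contour_integrable holomorphic_intros hol)
  finally show ?thesis by simp
qed

lemma theta2_space_eq_0:
  assumes f: "f \<in> theta2_space" and 0: "fourier_coeff f 0 = 0" "fourier_coeff f 1 = 0"
  shows "f z = 0"
proof -
  have up: "fourier_coeff f (int n) = 0 \<and> fourier_coeff f (int n + 1) = 0" for n
  proof (induction n)
    case (Suc n)
    then show ?case using fourier_coeff_rec[OF f, of "int (Suc n) + 1"] by (simp add: algebra_simps)
  qed (use 0 in simp)
  have down: "fourier_coeff f (- int n) = 0 \<and> fourier_coeff f (- int n + 1) = 0" for n
  proof (induction n)
    case (Suc n)
    have "fourier_coeff f (- int n + 1) = exp (two_pi_i * (of_int (- int n + 1 - 1) * \<tau>)) * fourier_coeff f (- int n + 1 - 2)"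
      by (rule fourier_coeff_rec[OF f])
    moreover have "- int n + 1 - 2 = - int (Suc n)" by simp
    ultimately have "fourier_coeff f (- int (Suc n)) = 0" using Suc by (simp only:) simp
    moreover have "- int (Suc n) + 1 = - int n" by simp
    ultimately show ?case using Suc by (simp only:)
  qed (use 0 in simp)
  have "fourier_coeff f n = 0" for n
    by (cases n rule: int_cases2) (use up down in auto)
  then have "period_integral (\<lambda>z. f z * exp (two_pi_i * (of_int n * z))) = 0" for n
    by (simp only: fourier_coeff_def)
  then show ?thesis
    using f unfolding theta2_space_def mem_Collect_eq by (blast intro: entire_periodic_zero)
qed

lemma fourier_coeff_lincomb:
  assumes "f \<in> theta2_space" "g \<in> theta2_space"
  shows "fourier_coeff (\<lambda>z. a * f z + b * g z) n = a * fourier_coeff f n + b * fourier_coeff g n"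
proof -
  have hol: "f holomorphic_on UNIV" "g holomorphic_on UNIV" using assms by (auto simp: theta2_space_def)
  have "fourier_coeff (\<lambda>z. a * f z + b * g z) n = contour_integral (linepath 0 1)
      (\<lambda>z. a * (f z * exp (two_pi_i * (of_int n * z))) + b * (g z * exp (two_pi_i * (of_int n * z))))"
    unfolding fourier_coeff_def period_integral_def
    by (rule contour_integral_eq) (simp add: algebra_simps)
  also have "\<dots> = contour_integral (linepath 0 1) (\<lambda>z. a * (f z * exp (two_pi_i * (of_int n * z)))) +
      contour_integral (linepath 0 1) (\<lambda>z. b * (g z * exp (two_pi_i * (of_int n * z))))"
    by (intro contour_integral_add entire_contour_integrable holomorphic_intros hol)
  also have "\<dots> = a * fourier_coeff f n + b * fourier_coeff g n"
    unfolding fourier_coeff_def period_integral_def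
    by (intro arg_cong2[where f = "(+)"] contour_integral_lmul entire_contour_integrable holomorphic_intros hol)
  finally show ?thesis .
qed

lemma theta2_space_lincomb:
  "f \<in> theta2_space \<Longrightarrow> g \<in> theta2_space \<Longrightarrow> (\<lambda>z. a * f z + b * g z) \<in> theta2_space"
  unfolding theta2_space_def mem_Collect_eq
  by (intro conjI holomorphic_intros allI) (simp_all add: distrib_left mult.left_commute)

lemma homogeneous_2x3_solution:
  fixes a1 b1 c1 a2 b2 c2 :: complex
  obtains x y z where "(x, y, z) \<noteq> (0, 0, 0)" "x * a1 + y * b1 + z * c1 = 0" "x * a2 + y * b2 + z * c2 = 0"
proof (cases "b1 * c2 - c1 * b2 = 0 \<and> c1 * a2 - a1 * c2 = 0 \<and> a1 * b2 - b1 * a2 = 0")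
  case False
  show ?thesis
    by (rule that[of "b1 * c2 - c1 * b2" "c1 * a2 - a1 * c2" "a1 * b2 - b1 * a2"])
       (use False in \<open>auto simp: algebra_simps\<close>)
next
  case True
  then have d: "b1 * c2 = c1 * b2" "c1 * a2 = a1 * c2" "a1 * b2 = b1 * a2" by auto
  show ?thesis
  proof (cases "a1 = 0 \<and> b1 = 0")
    case False
    then show ?thesis by (intro that[of "- b1" a1 0]) (use d in \<open>auto simp: algebra_simps\<close>)
  next
    case ab: True
    show ?thesis
    proof (cases "a2 = 0 \<and> b2 = 0")
      case False
      then show ?thesis by (intro that[of "- b2" a2 0]) (use ab in \<open>auto simp: algebra_simps\<close>)
    next
      case True
      then show ?thesis by (intro that[of 1 0 0]) (use ab in auto)
    qed
  qed
qed

text \<open>The vanishing of the coefficients of index 0 and 1 imposes two linear conditions on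
  three unknowns, and an element of the space with both coefficients zero is zero.\<close>

lemma theta2_space_dependent:
  assumes f: "f \<in> theta2_space" "g \<in> theta2_space" "h \<in> theta2_space"
  obtains x y w where "(x, y, w) \<noteq> (0, 0, 0)" "\<And>z. x * f z + y * g z + w * h z = 0"
proof -
  obtain x y w where xyw: "(x, y, w) \<noteq> (0, 0, 0)"
    "x * fourier_coeff f 0 + y * fourier_coeff g 0 + w * fourier_coeff h 0 = 0"
    "x * fourier_coeff f 1 + y * fourier_coeff g 1 + w * fourier_coeff h 1 = 0"
    by (rule homogeneous_2x3_solution)
  have fg: "(\<lambda>z. x * f z + y * g z) \<in> theta2_space" using f by (intro theta2_space_lincomb)
  have comb: "(\<lambda>z. 1 * (x * f z + y * g z) + w * h z) \<in> theta2_space"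
    using fg f(3) by (rule theta2_space_lincomb)
  have "1 * (x * f z + y * g z) + w * h z = 0" for z
    by (rule theta2_space_eq_0[OF comb]; subst fourier_coeff_lincomb[OF fg f(3)];
        subst fourier_coeff_lincomb[OF f(1,2)]; subst mult_1_left; rule xyw)
  then show ?thesis using that xyw(1) by simp
qed

lemma theta_sq_in_space: "(\<lambda>z. (theta z)\<^sup>2) \<in> theta2_space"
proof -
  have "(theta (z + \<tau>))\<^sup>2 = exp (- (two_pi_i * (2 * z + \<tau>))) * (theta z)\<^sup>2" for z
  proof -
    have "(exp (- (two_pi_i * z) - of_real pi * \<i> * \<tau>))\<^sup>2 = exp (- (two_pi_i * (2 * z + \<tau>)))"
      unfolding exp_double[symmetric] by (rule arg_cong[where f = exp]) (simp add: two_pi_i_def algebra_simps)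
    then show ?thesis by (simp add: theta_add_tau power_mult_distrib)
  qed
  then show ?thesis
    unfolding theta2_space_def using theta_holomorphic
    by (simp add: theta_add_1 holomorphic_on_power)
qed

lemma entire_shift: "f holomorphic_on UNIV \<Longrightarrow> (\<lambda>z. f (z + a)) holomorphic_on UNIV" for f :: "complex \<Rightarrow> complex"
  using holomorphic_on_compose_gen[of "\<lambda>z. z + a" UNIV f UNIV, OF holomorphic_on_add[OF holomorphic_on_ident holomorphic_on_const]]
  by (simp add: o_def)

lemma theta_shift_sq_in_space: "(\<lambda>z. (theta (z + 1/2))\<^sup>2) \<in> theta2_space"
proof -
  let ?f = "\<lambda>z. (theta z)\<^sup>2"
  have f: "?f holomorphic_on UNIV" "\<And>z. ?f (z + 1) = ?f z"
      "\<And>z. ?f (z + \<tau>) = exp (- (two_pi_i * (2 * z + \<tau>))) * ?f z"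
    using theta_sq_in_space by (auto simp: theta2_space_def)
  have "?f (z + \<tau> + 1/2) = exp (- (two_pi_i * (2 * z + \<tau>))) * ?f (z + 1/2)" for z
  proof -
    have "exp (- (two_pi_i * (2 * (z + 1/2) + \<tau>))) = exp (- (two_pi_i * (2 * z + \<tau>)))"
    proof -
      have "- (two_pi_i * (2 * (z + 1/2) + \<tau>)) = two_pi_i * (- (2 * z + \<tau>) + of_int (- 1))"
        by (simp add: algebra_simps)
      then show ?thesis by (simp only: exp_two_pi_i_add_int mult_minus_right)
    qed
    then show ?thesis using f(3)[of "z + 1/2"] by (simp add: add_ac)
  qed
  then show ?thesis
    unfolding theta2_space_def using entire_shift[OF f(1), of "1/2"] f(2)[of "_ + 1/2"] by (simp add: add_ac)
qed

text \<open>Up to a constant, the square of Jacobi's \<open>theta_1\<close>. The shift by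
  \<open>(1 + \<tau>) / 2\<close> moves a zero of \<open>theta\<close> to 0, and the exponential
  restores the quasi-periodicity required in \<open>theta2_space\<close>.\<close>

definition theta1_sq :: "complex \<Rightarrow> complex" where
  "theta1_sq z = exp (two_pi_i * z) * (theta (z + (1 + \<tau>) / 2))\<^sup>2"

lemma theta1_sq_in_space: "theta1_sq \<in> theta2_space"
proof -
  let ?f = "\<lambda>z. (theta z)\<^sup>2"
  let ?u = "(1 + \<tau>) / 2"
  have f: "?f holomorphic_on UNIV" "\<And>z. ?f (z + 1) = ?f z"
      "\<And>z. ?f (z + \<tau>) = exp (- (two_pi_i * (2 * z + \<tau>))) * ?f z"
    using theta_sq_in_space by (auto simp: theta2_space_def)
  have 1: "theta1_sq holomorphic_on UNIV"
    unfolding theta1_sq_def using entire_shift[OF theta_holomorphic, of ?u] by (intro holomorphic_intros)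
  have 2: "theta1_sq (z + 1) = theta1_sq z" for z
    using exp_two_pi_i_add_int[of z 1] f(2)[of "z + ?u"] by (simp add: theta1_sq_def add_ac)
  have 3: "theta1_sq (z + \<tau>) = exp (- (two_pi_i * (2 * z + \<tau>))) * theta1_sq z" for z
  proof -
    have eq: "exp (two_pi_i * (z + \<tau>)) * exp (- (two_pi_i * (2 * (z + ?u) + \<tau>))) =
        exp (- (two_pi_i * (2 * z + \<tau>))) * exp (two_pi_i * z)"
    proof -
      have "2 * (z + ?u) = 2 * z + 1 + \<tau>" by (simp add: distrib_left)
      then have "two_pi_i * (z + \<tau>) + - (two_pi_i * (2 * (z + ?u) + \<tau>)) = two_pi_i * (- z - \<tau> + of_int (- 1))"
        by (simp only: algebra_simps) simp
      then have "exp (two_pi_i * (z + \<tau>) + - (two_pi_i * (2 * (z + ?u) + \<tau>))) = exp (two_pi_i * (- z - \<tau>))"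
        by (simp only: exp_two_pi_i_add_int)
      also have "two_pi_i * (- z - \<tau>) = - (two_pi_i * (2 * z + \<tau>)) + two_pi_i * z"
        by (simp add: algebra_simps)
      finally show ?thesis by (simp only: exp_add)
    qed
    have "theta1_sq (z + \<tau>) = exp (two_pi_i * (z + \<tau>)) * ?f (z + ?u + \<tau>)" by (simp add: theta1_sq_def add_ac)
    also have "\<dots> = exp (two_pi_i * (z + \<tau>)) * exp (- (two_pi_i * (2 * (z + ?u) + \<tau>))) * ?f (z + ?u)"
      by (simp only: f(3) mult.assoc)
    finally show ?thesis unfolding eq by (simp add: theta1_sq_def)
  qed
  show ?thesis using 1 2 3 by (simp add: theta2_space_def)
qed

text \<open>The squared zero of \<open>theta1_sq\<close> cancels the double pole of
  \<open>\<wp>\<close> at 0. The functional equations carry the limit at 0 to all lattice points and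
  pass to the extension by continuity.\<close>

lemma wp_theta_in_space:
  assumes "u \<notin> \<Lambda>"
  obtains g where "g \<in> theta2_space" "\<And>z. z \<notin> \<Lambda> \<Longrightarrow> g z = (wp z - wp u) * theta1_sq z"
proof -
  let ?f = "\<lambda>z. (wp z - wp u) * theta1_sq z"
  have C: "theta1_sq holomorphic_on UNIV" "\<And>z. theta1_sq (z + 1) = theta1_sq z"
      "\<And>z. theta1_sq (z + \<tau>) = exp (- (two_pi_i * (2 * z + \<tau>))) * theta1_sq z"
    using theta1_sq_in_space by (auto simp: theta2_space_def)
  have hol: "?f holomorphic_on - \<Lambda>"
    using C(1) by (intro holomorphic_intros wp_holomorphic) (auto elim: holomorphic_on_subset)
  have per1: "?f (z + 1) = ?f z" if "z \<notin> \<Lambda>" for z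
    using wp_periodic[OF lattice_1 that] C(2) by simp
  have per\<tau>: "?f (z + \<tau>) = exp (- (two_pi_i * (2 * z + \<tau>))) * ?f z" if "z \<notin> \<Lambda>" for z
    using wp_periodic[OF lattice_tau that] C(3) by simp
  have lim0: "\<exists>L. (?f \<longlongrightarrow> L) (at 0)"
  proof -
    let ?s = "\<lambda>z. theta (z + (1 + \<tau>) / 2)"
    have "?s holomorphic_on UNIV" by (rule entire_shift[OF theta_holomorphic])
    then have "(?s has_field_derivative deriv ?s 0) (at 0)"
      by (rule holomorphic_derivI) auto
    then have "((\<lambda>z. (?s z - ?s 0) / (z - 0)) \<longlongrightarrow> deriv ?s 0) (at 0)"
      by (simp only: has_field_derivative_iff)
    then have s: "((\<lambda>z. ?s z / z) \<longlongrightarrow> deriv ?s 0) (at 0)" by (simp add: theta_half_period)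
    have "((\<lambda>z. (z\<^sup>2 * (wp z - wp u)) * (exp (two_pi_i * z) * (?s z / z)\<^sup>2)) \<longlongrightarrow>
        1 * (exp (two_pi_i * 0) * (deriv ?s 0)\<^sup>2)) (at 0)"
      by (intro tendsto_intros wp_tendsto_0 s)
    moreover have "\<forall>\<^sub>F z in at 0. (z\<^sup>2 * (wp z - wp u)) * (exp (two_pi_i * z) * (?s z / z)\<^sup>2) = ?f z"
      by (auto simp: eventually_at_filter theta1_sq_def power_divide)
    ultimately show ?thesis by (blast intro: Lim_transform_eventually)
  qed
  have stepL: "(\<exists>L. (?f \<longlongrightarrow> L) (at (z + 1))) \<longleftrightarrow> (\<exists>L. (?f \<longlongrightarrow> L) (at z))" for z
  proof -
    have "(?f \<longlongrightarrow> L) (at (z + 1)) \<longleftrightarrow> (?f \<longlongrightarrow> L) (at z)" for L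
      unfolding tendsto_shift[symmetric]
      by (rule tendsto_cong) (use eventually_not_lattice[of z] per1 in \<open>auto elim: eventually_mono\<close>)
    then show ?thesis by blast
  qed
  have step\<tau>: "(\<exists>L. (?f \<longlongrightarrow> L) (at (z + \<tau>))) \<longleftrightarrow> (\<exists>L. (?f \<longlongrightarrow> L) (at z))" for z
  proof
    assume "\<exists>L. (?f \<longlongrightarrow> L) (at (z + \<tau>))"
    then obtain L where "((\<lambda>z. ?f (z + \<tau>)) \<longlongrightarrow> L) (at z)" unfolding tendsto_shift[symmetric] by blast
    then have "((\<lambda>z. exp (two_pi_i * (2 * z + \<tau>)) * ?f (z + \<tau>)) \<longlongrightarrow> exp (two_pi_i * (2 * z + \<tau>)) * L) (at z)"
      by (intro tendsto_intros)
    moreover have "\<forall>\<^sub>F z in at z. exp (two_pi_i * (2 * z + \<tau>)) * ?f (z + \<tau>) = ?f z"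
      using eventually_not_lattice[of z]
    proof eventually_elim
      case (elim z)
      have "exp (two_pi_i * (2 * z + \<tau>)) * exp (- (two_pi_i * (2 * z + \<tau>))) = 1" by (simp flip: exp_add)
      then show ?case unfolding per\<tau>[OF elim] mult.assoc[symmetric] by (simp only: mult_1_left)
    qed
    ultimately show "\<exists>L. (?f \<longlongrightarrow> L) (at z)" by (blast intro: Lim_transform_eventually)
  next
    assume "\<exists>L. (?f \<longlongrightarrow> L) (at z)"
    then obtain L where "(?f \<longlongrightarrow> L) (at z)" by blast
    then have "((\<lambda>z. exp (- (two_pi_i * (2 * z + \<tau>))) * ?f z) \<longlongrightarrow> exp (- (two_pi_i * (2 * z + \<tau>))) * L) (at z)"
      by (intro tendsto_intros)
    moreover have "\<forall>\<^sub>F z in at z. exp (- (two_pi_i * (2 * z + \<tau>))) * ?f z = ?f (z + \<tau>)"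
      using eventually_not_lattice[of z] by eventually_elim (rule per\<tau>[symmetric])
    ultimately have "((\<lambda>z. ?f (z + \<tau>)) \<longlongrightarrow> exp (- (two_pi_i * (2 * z + \<tau>))) * L) (at z)"
      by (rule Lim_transform_eventually)
    then show "\<exists>L. (?f \<longlongrightarrow> L) (at (z + \<tau>))"
      using tendsto_shift[of ?f \<tau> "exp (- (two_pi_i * (2 * z + \<tau>))) * L" z] by blast
  qed
  have nat: "\<exists>L. (?f \<longlongrightarrow> L) (at (z + of_nat m))" "\<exists>L. (?f \<longlongrightarrow> L) (at (z + of_nat m * \<tau>))"
    if "\<exists>L. (?f \<longlongrightarrow> L) (at z)" for z m
  proof -
    show "\<exists>L. (?f \<longlongrightarrow> L) (at (z + of_nat m))"
      by (induction m) (use that stepL[of "z + of_nat _"] in \<open>auto simp: add_ac\<close>)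
    show "\<exists>L. (?f \<longlongrightarrow> L) (at (z + of_nat m * \<tau>))"
      by (induction m) (use that step\<tau>[of "z + of_nat _ * \<tau>"] in \<open>auto simp: algebra_simps\<close>)
  qed
  have neg: "\<exists>L. (?f \<longlongrightarrow> L) (at (z - of_nat m))" "\<exists>L. (?f \<longlongrightarrow> L) (at (z - of_nat m * \<tau>))"
    if "\<exists>L. (?f \<longlongrightarrow> L) (at z)" for z m
  proof -
    show "\<exists>L. (?f \<longlongrightarrow> L) (at (z - of_nat m))"
    proof (induction m)
      case (Suc m)
      have "z - of_nat (Suc m) + 1 = z - of_nat m" by simp
      then show ?case using Suc stepL[of "z - of_nat (Suc m)"] by (simp only:)
    qed (use that in simp)
    show "\<exists>L. (?f \<longlongrightarrow> L) (at (z - of_nat m * \<tau>))"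
    proof (induction m)
      case (Suc m)
      have "z - of_nat (Suc m) * \<tau> + \<tau> = z - of_nat m * \<tau>" by (simp add: algebra_simps)
      then show ?case using Suc step\<tau>[of "z - of_nat (Suc m) * \<tau>"] by (simp only:)
    qed (use that in simp)
  qed
  have lim: "\<exists>L. (?f \<longlongrightarrow> L) (at z)" if zL: "z \<in> \<Lambda>" for z
  proof -
    obtain m n :: int where z: "z = of_int m + of_int n * \<tau>" using zL by (auto simp: lattice_def)
    have m: "\<exists>L. (?f \<longlongrightarrow> L) (at (of_int m))"
      using nat(1)[OF lim0, of "nat m"] neg(1)[OF lim0, of "nat (- m)"] by (cases "m \<ge> 0") auto
    show ?thesis unfolding z
      using nat(2)[OF m, of "nat n"] neg(2)[OF m, of "nat (- n)"] by (cases "n \<ge> 0") auto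
  qed
  obtain g where g: "g holomorphic_on UNIV" "\<And>z. z \<notin> \<Lambda> \<Longrightarrow> g z = ?f z"
    using removable_extension[OF hol closed_lattice eventually_not_lattice lim] by blast
  have cont: "isCont g z" for z
    using holomorphic_on_imp_continuous_on[OF g(1)] by (simp add: continuous_on_eq_continuous_at)
  have eq_ext: "F z = G z" if "isCont F z" "isCont G z" "\<And>w. w \<notin> \<Lambda> \<Longrightarrow> F w = G w" for F G :: "complex \<Rightarrow> complex" and z
  proof -
    have "(F \<longlongrightarrow> G z) (at z)"
      using that(2) unfolding isCont_def
      by (rule Lim_transform_eventually) (use eventually_not_lattice[of z] that(3) in \<open>auto elim!: eventually_mono\<close>)
    then show ?thesis using that(1) LIM_unique unfolding isCont_def by blast
  qed
  have "g (z + 1) = g z" for z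
  proof (rule eq_ext[where F = "\<lambda>z. g (z + 1)" and G = g and z = z])
    show "g (w + 1) = g w" if "w \<notin> \<Lambda>" for w
      using that g(2) lattice_add_iff[OF lattice_1, of w \<tau>] per1 by simp
  qed (auto intro!: continuous_intros isCont_o2[OF _ cont] cont)
  moreover have "g (z + \<tau>) = exp (- (two_pi_i * (2 * z + \<tau>))) * g z" for z
  proof (rule eq_ext[where F = "\<lambda>z. g (z + \<tau>)" and G = "\<lambda>z. exp (- (two_pi_i * (2 * z + \<tau>))) * g z" and z = z])
    show "g (w + \<tau>) = exp (- (two_pi_i * (2 * w + \<tau>))) * g w" if "w \<notin> \<Lambda>" for w
      using that g(2) lattice_add_iff[OF lattice_tau, of w] per\<tau> by simp
  qed (auto intro!: continuous_intros isCont_o2[OF _ cont] cont)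
  ultimately have "g \<in> theta2_space" using g(1) by (simp add: theta2_space_def)
  then show ?thesis using that g(2) by blast
qed

text \<open>The functions \<open>theta(z)^2\<close>, \<open>theta(z + 1/2)^2\<close> and
  \<open>(\<wp>(z) - \<wp>(\<tau>/2)) theta_1(z)^2\<close> are linearly dependent. At
  \<open>\<tau> / 2\<close> the last two vanish and the first does not, so its coefficient is zero
  and the other two are proportional. Evaluation at \<open>1/2\<close> and
  \<open>(1 + \<tau>)/2\<close> and elimination of the coefficients give the ratio.\<close>

lemma theta_cross_ratio:
  assumes "theta2_null \<tau> \<noteq> 0" "theta3_null \<tau> \<noteq> 0"
  shows "(wp ((1 + \<tau>) / 2) - wp (\<tau> / 2)) * theta3_null \<tau> ^ 4 = (wp (1 / 2) - wp (\<tau> / 2)) * theta2_null \<tau> ^ 4"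
proof -
  define t0 th where "t0 = theta 0" and "th = theta (\<tau> / 2)"
  have nz: "t0 \<noteq> 0" "th \<noteq> 0" using assms by (auto simp: theta2_null_eq theta3_null_eq t0_def th_def)
  obtain g where g: "g \<in> theta2_space" "\<And>z. z \<notin> \<Lambda> \<Longrightarrow> g z = (wp z - wp (\<tau> / 2)) * theta1_sq z"
    using wp_theta_in_space[OF half_notin(2)] by blast
  obtain x y w where xyw: "(x, y, w) \<noteq> (0, 0, 0)"
    "\<And>z. x * (theta z)\<^sup>2 + y * (theta (z + 1/2))\<^sup>2 + w * g z = 0"
    using theta2_space_dependent[OF theta_sq_in_space theta_shift_sq_in_space g(1)] by metis
  have half: "theta (\<tau> / 2 + 1 / 2) = 0" using theta_half_period by (simp add: add_divide_distrib add.commute)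
  have "x * th\<^sup>2 = 0" using xyw(2)[of "\<tau> / 2"] half g(2)[OF half_notin(2)] by (simp add: th_def)
  then have x: "x = 0" using nz by simp
  have t1: "theta 1 = t0" using theta_add_1[of 0] by (simp add: t0_def)
  have th1: "theta (1 + \<tau> / 2) = th" using theta_add_1[of "\<tau> / 2"] by (simp add: th_def add.commute)
  have e1: "exp (two_pi_i * (1 / 2)) = - 1" by (simp add: two_pi_i_def exp_pi_i)
  have "theta1_sq (1 / 2) = - th\<^sup>2"
  proof -
    have "1 / 2 + (1 + \<tau>) / 2 = 1 + \<tau> / 2" by (simp add: add_divide_distrib)
    then show ?thesis unfolding theta1_sq_def e1 by (simp add: th1)
  qed
  then have E1: "y * t0\<^sup>2 = w * (wp (1 / 2) - wp (\<tau> / 2)) * th\<^sup>2"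
    using xyw(2)[of "1 / 2"] g(2)[OF half_notin(1)] x t1 by (simp add: algebra_simps)
  have "theta1_sq ((1 + \<tau>) / 2) = - exp (- (of_real pi * \<i> * \<tau>)) * t0\<^sup>2"
  proof -
    have "(1 + \<tau>) / 2 + (1 + \<tau>) / 2 = 0 + \<tau> + 1" by simp
    then have "theta ((1 + \<tau>) / 2 + (1 + \<tau>) / 2) = exp (- (of_real pi * \<i> * \<tau>)) * t0"
      by (simp only: theta_add_1 theta_add_tau) (simp add: t0_def)
    moreover have "exp (two_pi_i * ((1 + \<tau>) / 2)) = - exp (of_real pi * \<i> * \<tau>)"
    proof -
      have "two_pi_i * ((1 + \<tau>) / 2) = two_pi_i * (1 / 2) + of_real pi * \<i> * \<tau>"
        by (simp add: two_pi_i_def add_divide_distrib distrib_left)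
      then show ?thesis by (simp only: exp_add e1) simp
    qed
    moreover have "exp (of_real pi * \<i> * \<tau>) * exp (- (of_real pi * \<i> * \<tau>)) = 1" by (simp flip: exp_add)
    ultimately show ?thesis unfolding theta1_sq_def
      by (simp only: power2_eq_square) (simp add: mult_ac)
  qed
  moreover have "theta ((1 + \<tau>) / 2 + 1 / 2) = th"
  proof -
    have "(1 + \<tau>) / 2 + 1 / 2 = 1 + \<tau> / 2" by (simp add: add_divide_distrib)
    then show ?thesis by (simp only: th1)
  qed
  ultimately have E2: "y * th\<^sup>2 = w * (wp ((1 + \<tau>) / 2) - wp (\<tau> / 2)) * exp (- (of_real pi * \<i> * \<tau>)) * t0\<^sup>2"
    using xyw(2)[of "(1 + \<tau>) / 2"] g(2)[OF half_notin(3)] x by (simp add: algebra_simps)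
  have w: "w \<noteq> 0"
  proof
    assume "w = 0"
    then have "y = 0" using E1 nz by simp
    with x \<open>w = 0\<close> xyw(1) show False by simp
  qed
  have "w * ((wp (1 / 2) - wp (\<tau> / 2)) * th ^ 4) = (y * t0\<^sup>2) * th\<^sup>2"
    unfolding E1 by (simp add: power2_eq_square power4_eq_xxxx)
  also have "\<dots> = (y * th\<^sup>2) * t0\<^sup>2" by simp
  also have "\<dots> = w * ((wp ((1 + \<tau>) / 2) - wp (\<tau> / 2)) * exp (- (of_real pi * \<i> * \<tau>)) * t0 ^ 4)"
    unfolding E2 by (simp add: power2_eq_square power4_eq_xxxx)
  finally have main: "(wp (1 / 2) - wp (\<tau> / 2)) * th ^ 4 =
      (wp ((1 + \<tau>) / 2) - wp (\<tau> / 2)) * exp (- (of_real pi * \<i> * \<tau>)) * t0 ^ 4"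
    using w by simp
  have "exp (of_real pi * \<i> * \<tau> / 4) ^ 4 = exp (of_real pi * \<i> * \<tau>)"
    by (simp flip: exp_of_nat_mult)
  then have "theta2_null \<tau> ^ 4 = exp (of_real pi * \<i> * \<tau>) * th ^ 4"
    by (simp add: theta2_null_eq th_def power_mult_distrib)
  then have "(wp (1 / 2) - wp (\<tau> / 2)) * theta2_null \<tau> ^ 4 =
      exp (of_real pi * \<i> * \<tau>) * ((wp (1 / 2) - wp (\<tau> / 2)) * th ^ 4)" by simp
  also have "\<dots> = (exp (of_real pi * \<i> * \<tau>) * exp (- (of_real pi * \<i> * \<tau>))) *
      ((wp ((1 + \<tau>) / 2) - wp (\<tau> / 2)) * t0 ^ 4)" unfolding main by simp
  also have "exp (of_real pi * \<i> * \<tau>) * exp (- (of_real pi * \<i> * \<tau>)) = 1" by (simp flip: exp_add)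
  finally show ?thesis by (simp add: theta3_null_eq t0_def)
qed

end

subsection \<open>Square roots of the Weierstrass function\<close>

lemma meromorphic_on_UNIV_I:
  fixes f :: "complex \<Rightarrow> complex"
  assumes f: "f holomorphic_on - H" and H: "closed H" and disc: "\<And>z. \<forall>\<^sub>F w in at z. w \<notin> H"
    and lim: "\<And>u. u \<in> H \<Longrightarrow> \<exists>n L. ((\<lambda>z. (z - u) ^ n * f z) \<longlongrightarrow> L) (at u)"
  shows "f meromorphic_on UNIV"
proof -
  have "f meromorphic_on {u}" for u
  proof (cases "u \<in> H")
    case False
    have "f analytic_on - H" using f H by (simp add: analytic_on_open open_Compl)
    then have "f analytic_on {u}" using False analytic_on_subset by blast
    then show ?thesis by (rule analytic_on_imp_meromorphic_on)
  next
    case True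
    then obtain n L where L: "((\<lambda>z. (z - u) ^ n * f z) \<longlongrightarrow> L) (at u)" using lim by blast
    define g where "g z = (z - u) ^ n * f z" for z
    obtain e where e: "e > 0" "\<And>w. w \<noteq> u \<Longrightarrow> dist w u < e \<Longrightarrow> w \<notin> H"
      using disc[of u] by (auto simp: eventually_at)
    have "g holomorphic_on ball u e - {u}"
      unfolding g_def by (intro holomorphic_intros holomorphic_on_subset[OF f]) (use e in \<open>auto simp: dist_commute\<close>)
    then have "g analytic_on ball u e - {u}" by (simp add: analytic_on_open open_delete)
    then have "isolated_singularity_at g u" using e(1) unfolding isolated_singularity_at_def by blast
    moreover have "(g \<longlongrightarrow> L) (at u)" using L by (simp add: g_def[abs_def])
    then have "not_essential g u" unfolding not_essential_def by blast
    ultimately have "g meromorphic_on {u}" by (simp add: meromorphic_at_iff)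
    then have "(\<lambda>z. g z / (z - u) ^ n) meromorphic_on {u}" by (intro meromorphic_intros)
    also have "?this \<longleftrightarrow> ?thesis"
      by (rule meromorphic_on_cong) (auto simp: g_def eventually_at_filter)
    finally show ?thesis .
  qed
  then show ?thesis using meromorphic_on_meromorphic_at by blast
qed

lemma meromorphic_pole_limit:
  fixes f :: "complex \<Rightarrow> complex"
  assumes "f meromorphic_on UNIV"
  obtains n L where "((\<lambda>z. z ^ n * f z) \<longlongrightarrow> L) (at 0)"
proof -
  obtain F where F: "(\<lambda>w. f (0 + w)) has_laurent_expansion F"
    using assms unfolding meromorphic_on_def by blast
  define n where "n = nat (- fls_subdegree F)"
  have "(\<lambda>w. w ^ n * f (0 + w)) has_laurent_expansion fls_X ^ n * F"
    by (intro laurent_expansion_intros F)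
  moreover have "fls_subdegree (fls_X ^ n * F) \<ge> 0"
  proof (cases "F = 0")
    case False
    then have "fls_subdegree (fls_X ^ n * F) = int n + fls_subdegree F"
      by (subst fls_subdegree_mult) (auto simp: fls_subdegree_pow)
    then show ?thesis by (simp add: n_def)
  qed simp
  ultimately have "((\<lambda>w. w ^ n * f (0 + w)) \<longlongrightarrow> fls_nth (fls_X ^ n * F) 0) (at 0)"
    by (rule has_laurent_expansion_imp_tendsto_0)
  then show ?thesis using that by simp
qed

text \<open>At a double pole with nonzero leading coefficient \<open>q\<close> eventually avoids
  each of the finitely many roots of a nonzero polynomial.\<close>

lemma poly_eq_0_at_pole:
  fixes p :: "complex poly"
  assumes ev: "\<forall>\<^sub>F z in at (0::complex). poly p (q z) = 0"
    and lim: "((\<lambda>z. z\<^sup>2 * q z) \<longlongrightarrow> c) (at 0)" and c: "c \<noteq> 0"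
  shows "p = 0"
proof (rule ccontr)
  assume "p \<noteq> 0"
  then have fin: "finite {t. poly p t = 0}" by (rule poly_roots_finite)
  have "\<forall>\<^sub>F z in at 0. q z \<noteq> t" for t
  proof -
    have "((\<lambda>z. z\<^sup>2 * q z - z\<^sup>2 * t) \<longlongrightarrow> c - 0\<^sup>2 * t) (at 0)" by (intro tendsto_intros lim)
    then have "\<forall>\<^sub>F z in at 0. z\<^sup>2 * q z - z\<^sup>2 * t \<noteq> 0"
      by (rule tendsto_imp_eventually_ne) (use c in simp)
    then show ?thesis by eventually_elim auto
  qed
  then have "\<forall>\<^sub>F z in at 0. \<forall>t\<in>{t. poly p t = 0}. q z \<noteq> t"
    using fin by (intro eventually_ball_finite) auto
  with ev have "\<forall>\<^sub>F z in at (0::complex). False" by eventually_elim auto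
  then show False by simp
qed

context upper_half_plane
begin

lemma lattice_periodicI:
  assumes H: "\<And>z u. u \<in> \<Lambda> \<Longrightarrow> z \<notin> H \<Longrightarrow> z + u \<notin> H"
    and one: "\<And>z. z \<notin> H \<Longrightarrow> f (z + 1) = f z" and tau: "\<And>z. z \<notin> H \<Longrightarrow> f (z + \<tau>) = f z"
    and u: "u \<in> \<Lambda>" and z: "z \<notin> H"
  shows "f (z + u) = f z"
proof -
  have inL: "of_int m + of_int n * \<tau> \<in> \<Lambda>" for m n by (auto simp: lattice_def)
  have L1: "of_int m \<in> \<Lambda>" and L2: "of_int m * \<tau> \<in> \<Lambda>" for m :: int
    using inL[of m 0] inL[of 0 m] by auto
  have 1: "f (z + of_int n) = f z" if z: "z \<notin> H" for z and n :: int
  proof (induction n rule: int_induct[where k = 0])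
    case (step1 i)
    then show ?case using one[OF H[OF L1 z, of i]] by (simp add: add.assoc)
  next
    case (step2 i)
    have "z + of_int (i - 1) + 1 = z + of_int i" by simp
    then show ?case using one[OF H[OF L1 z, of "i - 1"]] step2 by (simp only:)
  qed simp
  have 2: "f (z + of_int n * \<tau>) = f z" if z: "z \<notin> H" for z and n :: int
  proof (induction n rule: int_induct[where k = 0])
    case (step1 i)
    have "z + of_int i * \<tau> + \<tau> = z + of_int (i + 1) * \<tau>" by (simp add: distrib_right)
    then show ?case using tau[OF H[OF L2 z, of i]] step1 by (simp only:)
  next
    case (step2 i)
    have "z + of_int (i - 1) * \<tau> + \<tau> = z + of_int i * \<tau>" by (simp add: left_diff_distrib)
    then show ?case using tau[OF H[OF L2 z, of "i - 1"]] step2 by (simp only:)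
  qed simp
  obtain m n :: int where "u = of_int m + of_int n * \<tau>" using u unfolding lattice_def by blast
  then show ?thesis using 1[OF H[OF L2 z, of n], of m] 2[OF z, of n] by (simp add: add_ac)
qed

lemma wp_meromorphic: "wp meromorphic_on UNIV"
proof (rule meromorphic_on_UNIV_I[OF wp_holomorphic closed_lattice eventually_not_lattice])
  fix u assume u: "u \<in> \<Lambda>"
  have "\<forall>\<^sub>F z in at 0. z\<^sup>2 * wp z = (z + u - u)\<^sup>2 * wp (z + u)"
    using eventually_not_lattice[of 0] by eventually_elim (simp add: wp_periodic[OF u])
  with tendsto_wp_0 have "((\<lambda>z. (z + u - u)\<^sup>2 * wp (z + u)) \<longlongrightarrow> 1) (at 0)"
    by (rule Lim_transform_eventually)
  then have "((\<lambda>z. (z - u)\<^sup>2 * wp z) \<longlongrightarrow> 1) (at (0 + u))"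
    using tendsto_shift[of "\<lambda>z. (z - u)\<^sup>2 * wp z" u 1 0] by simp
  then show "\<exists>n L. ((\<lambda>z. (z - u) ^ n * wp z) \<longlongrightarrow> L) (at u)" by auto
qed

lemma wp_sqrt_meromorphic: "wp_sqrt u v meromorphic_on UNIV"
  unfolding wp_sqrt_def by (intro meromorphic_intros wp_meromorphic)

end

text \<open>The affine map \<open>x \<mapsto> \<kappa>^2 x + \<beta>\<close> carries the half-period
  values to \<open>r\<close>. Their order \<open>1/2\<close>, \<open>(1 + \<tau>)/2\<close>,
  \<open>\<tau>/2\<close> is dictated by the theta quotient: in this order
  \<open>modular_lambda\<close> is \<open>(e_2 - e_3) / (e_1 - e_3)\<close>.\<close>

locale weierstrass_curve = upper_half_plane +
  fixes r :: "3 \<Rightarrow> complex" and \<kappa> \<beta> :: complex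
  assumes \<kappa>: "\<kappa> \<noteq> 0"
    and r1: "r 1 = \<kappa>\<^sup>2 * wp (1/2) + \<beta>" and r2: "r 2 = \<kappa>\<^sup>2 * wp (1/2 + \<tau>/2) + \<beta>" and r3: "r 3 = \<kappa>\<^sup>2 * wp (\<tau>/2) + \<beta>"
begin

definition lam :: "3 \<Rightarrow> complex \<Rightarrow> complex" where
  "lam k z = \<kappa> * (if k = 1 then wp_sqrt (1/2) (\<tau>/2) z else if k = 2 then wp_sqrt (1/2 + \<tau>/2) (1/2) z
     else wp_sqrt (\<tau>/2) (1/2) z)"

definition xl :: "complex \<Rightarrow> complex" where "xl z = (lam 1 z)\<^sup>2 + r 1"

text \<open>The signs by which \<open>t_1\<close> (and below, in \<open>sg2\<close>,
  \<open>t_2\<close>) acts on \<open>v_k\<close>; translation by the corresponding half period acts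
  on \<open>\<lambda>_k\<close> by the same signs, which makes
  \<open>v_k \<otimes> \<lambda>_k\<close> invariant.\<close>

definition sg1 :: "3 \<Rightarrow> complex" where "sg1 k = (if k = 1 then 1 else - 1)"
definition sg2 :: "3 \<Rightarrow> complex" where "sg2 k = (if k = 3 then 1 else - 1)"

lemma frame13: "half_frame (1/2) (\<tau>/2)" by (rule half_frames)
lemma frame31: "half_frame (\<tau>/2) (1/2)" by (rule half_frame_sym[OF half_frames])
lemma frame21: "half_frame (1/2 + \<tau>/2) (1/2)" by (rule half_frame_sym[OF half_frame_add[OF half_frames]])

lemma frame23: "half_frame (1/2 + \<tau>/2) (\<tau>/2)"
  using half_frame_sym[OF half_frame_add[OF frame31]] by (simp only: add.commute)

text \<open>The second argument of \<open>wp_sqrt\<close> may be replaced by the other complementary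
  half period, so the sign rule for translation by that argument covers both \<open>1/2\<close> and
  \<open>\<tau>/2\<close>.\<close>

lemma lam2_alt: "wp_sqrt (1/2 + \<tau>/2) (1/2) = wp_sqrt (1/2 + \<tau>/2) (\<tau>/2)"
proof -
  have u: "1/2 \<in> half_lattice" "\<tau>/2 \<in> half_lattice" "1/2 \<notin> \<Lambda>" "\<tau>/2 \<notin> \<Lambda>"
    using frame13 by (auto simp: half_frame_def)
  from wp_period_half[OF u(1,4)] have 1: "wp (1/2 + \<tau>/2 + 1/2) = wp (\<tau>/2)"
    by (simp only: add.commute[of "1/2" "\<tau>/2"])
  have 2: "wp (1/2 + \<tau>/2 + \<tau>/2) = wp (1/2)" by (rule wp_period_half[OF u(2,3)])
  then show ?thesis by (simp only: wp_sqrt_def wp_const_def 1 2 fun_eq_iff mult.commute simp_thms)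
qed

lemma lam_sq:
  assumes z: "z \<notin> half_lattice"
  shows "(lam k z)\<^sup>2 + r k = xl z"
proof -
  have "(wp_sqrt (1/2) (\<tau>/2) z)\<^sup>2 - (wp_sqrt (\<tau>/2) (1/2) z)\<^sup>2 = wp (\<tau>/2) - wp (1/2)"
    by (rule wp_sqrt_square_diff[OF frame13 z])
  then have 3: "(lam 1 z)\<^sup>2 - (lam 3 z)\<^sup>2 = r 3 - r 1"
    by (simp add: lam_def r1 r3 power_mult_distrib flip: right_diff_distrib)
  have "(wp_sqrt (1/2) (1/2 + \<tau>/2) z)\<^sup>2 - (wp_sqrt (1/2 + \<tau>/2) (1/2) z)\<^sup>2 = wp (1/2 + \<tau>/2) - wp (1/2)"
    by (rule wp_sqrt_square_diff[OF half_frame_add[OF frame13] z])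
  then have "(wp_sqrt (1/2) (\<tau>/2) z)\<^sup>2 - (wp_sqrt (1/2 + \<tau>/2) (1/2) z)\<^sup>2 = wp (1/2 + \<tau>/2) - wp (1/2)"
    by (simp only: wp_sqrt_alt[OF frame13])
  then have 2: "(lam 1 z)\<^sup>2 - (lam 2 z)\<^sup>2 = r 2 - r 1"
    by (simp add: lam_def r1 r2 power_mult_distrib flip: right_diff_distrib)
  show ?thesis using 2 3 exhaust_3[of k] by (auto simp: xl_def algebra_simps)
qed

lemma lam_shift:
  assumes z: "z \<notin> half_lattice"
  shows "lam k (z + 1/2) = sg1 k * lam k z" "lam k (z + \<tau>/2) = sg2 k * lam k z"
proof -
  note s = wp_sqrt_add_self[OF frame13 z] wp_sqrt_add_other[OF frame13 z]
    wp_sqrt_add_self[OF frame31 z] wp_sqrt_add_other[OF frame31 z]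
    wp_sqrt_add_other[OF frame21 z] wp_sqrt_add_other[OF frame23 z, folded lam2_alt]
  show "lam k (z + 1/2) = sg1 k * lam k z" "lam k (z + \<tau>/2) = sg2 k * lam k z"
    using exhaust_3[of k] by (auto simp only: lam_def sg1_def sg2_def s) auto
qed

text \<open>The product of two of the three nontrivial characters of \<open>D_2\<close> is the
  third, so \<open>\<lambda>_i \<lambda>_j\<close> transforms like \<open>\<lambda>_k\<close>. The
  last implication expresses nontriviality, which later excludes nonzero constants.\<close>

lemma sg_mult: "sg1 (k + 1) * sg1 (k + 2) = sg1 k" "sg2 (k + 1) * sg2 (k + 2) = sg2 k"
  "sg1 k * sg1 k = 1" "sg2 k * sg2 k = 1" "sg1 k = 1 \<Longrightarrow> sg2 k = - 1"
  using exhaust_3[of k] by (auto simp: sg1_def sg2_def)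

lemma lam_uminus:
  assumes "z \<notin> half_lattice"
  shows "lam k (- z) = - lam k z"
proof -
  have "z \<notin> \<Lambda>" using assms lattice_subset_half by blast
  then show ?thesis by (simp add: lam_def wp_sqrt_uminus)
qed

lemma lam_periodic:
  assumes "z \<notin> half_lattice" "w \<in> \<Lambda>"
  shows "lam k (z + w) = lam k z"
proof -
  have "z \<notin> \<Lambda>" using assms lattice_subset_half by blast
  then show ?thesis using assms(2) by (simp add: lam_def wp_sqrt_periodic)
qed

lemma lam_holomorphic: "lam k holomorphic_on - half_lattice"
  using exhaust_3[of k] unfolding lam_def by (auto intro!: holomorphic_intros wp_sqrt_holomorphic)

lemma lam_meromorphic: "lam k meromorphic_on UNIV"
  using exhaust_3[of k] unfolding lam_def by (auto intro!: meromorphic_intros wp_sqrt_meromorphic)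

lemma lam_tendsto: "((\<lambda>z. z * lam k z) \<longlongrightarrow> - \<kappa> / 2) (at 0)"
proof -
  have "((\<lambda>z. \<kappa> * (z * wp_sqrt u v z)) \<longlongrightarrow> \<kappa> * (- 1 / 2)) (at 0)" for u v
    by (intro tendsto_mult_left wp_sqrt_tendsto_0)
  then have "((\<lambda>z. z * (\<kappa> * wp_sqrt u v z)) \<longlongrightarrow> - \<kappa> / 2) (at 0)" for u v
    by (simp add: mult.left_commute)
  then show ?thesis using exhaust_3[of k] unfolding lam_def by auto
qed

lemma xl_holomorphic: "xl holomorphic_on - half_lattice"
  unfolding xl_def by (intro holomorphic_intros lam_holomorphic)

lemma xl_meromorphic: "xl meromorphic_on UNIV"
  unfolding xl_def by (intro meromorphic_intros lam_meromorphic)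

lemma xl_tendsto: "((\<lambda>z. z\<^sup>2 * xl z) \<longlongrightarrow> (\<kappa> / 2)\<^sup>2) (at 0)"
proof -
  have "((\<lambda>z. (z * lam 1 z)\<^sup>2 + z\<^sup>2 * r 1) \<longlongrightarrow> (- \<kappa> / 2)\<^sup>2 + 0\<^sup>2 * r 1) (at 0)"
    by (intro tendsto_intros lam_tendsto)
  then show ?thesis by (simp add: xl_def power_mult_distrib distrib_left)
qed

lemma xl_shift: "z \<notin> half_lattice \<Longrightarrow> xl (z + 1/2) = xl z" "z \<notin> half_lattice \<Longrightarrow> xl (z + \<tau>/2) = xl z"
  by (simp_all add: xl_def lam_shift power_mult_distrib sg1_def sg2_def)

lemma xl_uminus: "z \<notin> half_lattice \<Longrightarrow> xl (- z) = xl z"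
  by (simp add: xl_def lam_uminus)

lemma xl_periodic: "z \<notin> half_lattice \<Longrightarrow> w \<in> \<Lambda> \<Longrightarrow> xl (z + w) = xl z"
  by (simp add: xl_def lam_periodic)

text \<open>
  The functions \<open>\<lambda>\<^sub>k x\<^sup>m\<close> and \<open>\<lambda>\<^sub>i\<lambda>\<^sub>j x\<^sup>m\<close> have poles of order \<open>2m+1\<close> and \<open>2m+2\<close> at 0, so that any pole can be
  removed. What remains is constant by Liouville's theorem, and zero because its character is nontrivial.
\<close>

lemma eigenfunction_expansion:
  assumes f: "f holomorphic_on - half_lattice"
    and s1: "\<And>z. z \<notin> half_lattice \<Longrightarrow> f (z + 1/2) = sg1 k * f z"
    and s2: "\<And>z. z \<notin> half_lattice \<Longrightarrow> f (z + \<tau>/2) = sg2 k * f z"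
    and lim: "((\<lambda>z. z ^ n * f z) \<longlongrightarrow> L) (at 0)"
  shows "\<exists>a b. \<forall>z. z \<notin> half_lattice \<longrightarrow>
    f z = lam k z * poly a (xl z) + lam (k + 1) z * lam (k + 2) z * poly b (xl z)"
  using assms
proof (induction n arbitrary: f L)
  case (0 f)
  have hl: "1/2 \<in> half_lattice" "\<tau>/2 \<in> half_lattice"
    using frame13 by (auto simp: half_frame_def)
  have per1: "f (z + 1) = f z" if z: "z \<notin> half_lattice" for z
  proof -
    have "f (z + 1/2 + 1/2) = sg1 k * (sg1 k * f z)"
      using 0(2)[OF z] 0(2)[of "z + 1/2"] z half_lattice_add[OF hl(1)] by simp
    then show ?thesis using sg_mult(3)[of k] by (simp add: mult.assoc[symmetric] add.assoc)
  qed
  have per2: "f (z + \<tau>) = f z" if z: "z \<notin> half_lattice" for z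
  proof -
    have "f (z + \<tau>/2 + \<tau>/2) = sg2 k * (sg2 k * f z)"
      using 0(3)[OF z] 0(3)[of "z + \<tau>/2"] z half_lattice_add[OF hl(2)] by simp
    then show ?thesis using sg_mult(4)[of k] by (simp add: mult.assoc[symmetric] add.assoc)
  qed
  have per: "f (z + w) = f z" if "w \<in> \<Lambda>" "z \<notin> half_lattice" for z w
    by (rule lattice_periodicI[where H = half_lattice and f = f, OF _ per1 per2 that])
       (simp add: half_lattice_add lattice_subset_half)
  have shift: "\<exists>L. (f \<longlongrightarrow> L) (at (u + v))"
    if L: "\<exists>L. (f \<longlongrightarrow> L) (at u)" and c: "\<And>z. z \<notin> half_lattice \<Longrightarrow> f (z + v) = c * f z" for u v c
  proof -
    obtain L where "(f \<longlongrightarrow> L) (at u)" using L by blast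
    then have "((\<lambda>z. c * f z) \<longlongrightarrow> c * L) (at u)" by (rule tendsto_mult_left)
    moreover have "\<forall>\<^sub>F z in at u. c * f z = f (z + v)"
      using eventually_not_half_lattice[of u] by eventually_elim (simp add: c)
    ultimately have "((\<lambda>z. f (z + v)) \<longlongrightarrow> c * L) (at u)" by (rule Lim_transform_eventually)
    then show ?thesis unfolding tendsto_shift by blast
  qed
  have l0: "\<exists>L. (f \<longlongrightarrow> L) (at 0)" using 0(4) by auto
  have l1: "\<exists>L. (f \<longlongrightarrow> L) (at (0 + 1/2))" by (rule shift[OF l0 0(2)])
  have l2: "\<exists>L. (f \<longlongrightarrow> L) (at (0 + \<tau>/2))" by (rule shift[OF l0 0(3)])
  have l3: "\<exists>L. (f \<longlongrightarrow> L) (at (0 + 1/2 + \<tau>/2))" by (rule shift[OF l1 0(3)])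
  obtain c where c: "\<And>z. z \<notin> half_lattice \<Longrightarrow> f z = c"
    using elliptic_constant'[OF frame13 0(1) per] l0 l1 l2 l3 by (metis add_0 empty_iff insert_iff)
  obtain z0 where z0: "z0 \<notin> half_lattice"
    using eventually_happens[OF eventually_not_half_lattice[of 0]] by auto
  have "c = sg1 k * c" "c = sg2 k * c"
    using 0(2)[OF z0] 0(3)[OF z0] c z0 half_lattice_add[OF hl(1)] half_lattice_add[OF hl(2)] by auto
  then have "c = 0" using sg_mult(5)[of k] by (cases "sg1 k = 1") (auto simp: sg1_def split: if_splits)
  then show ?case using c by (intro exI[of _ 0]) simp
next
  case (Suc n f L)
  define m where "m = n div 2"
  define h where "h z = (if even n then lam k z else lam (k + 1) z * lam (k + 2) z) * xl z ^ m" for z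
  \<comment> \<open>The nonzero leading coefficient of \<open>h\<close> at its pole of order
    \<open>n + 1\<close>. Subtracting \<open>L / M\<close> times \<open>h\<close> removes the
    leading term of \<open>f\<close>.\<close>
  define M where "M = (if even n then - \<kappa> / 2 else (- \<kappa> / 2) * (- \<kappa> / 2)) * ((\<kappa> / 2)\<^sup>2) ^ m"
  have M: "M \<noteq> 0" using \<kappa> by (simp add: M_def)
  have n: "Suc n = (if even n then 1 else 2) + 2 * m" by (auto simp: m_def elim!: evenE oddE)
  have hlim: "((\<lambda>z. z ^ Suc n * h z) \<longlongrightarrow> M) (at 0)"
  proof -
    have "((\<lambda>z. (if even n then z * lam k z else (z * lam (k + 1) z) * (z * lam (k + 2) z)) * (z\<^sup>2 * xl z) ^ m) \<longlongrightarrow> M) (at 0)"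
      unfolding M_def by (cases "even n") (simp_all only: if_True if_False, (intro tendsto_intros lam_tendsto xl_tendsto)+)
    moreover have "(if even n then z * lam k z else (z * lam (k + 1) z) * (z * lam (k + 2) z)) * (z\<^sup>2 * xl z) ^ m = z ^ Suc n * h z" for z
      unfolding n h_def by (simp add: power_add power_mult power_mult_distrib power2_eq_square mult_ac del: power_Suc)
    ultimately show ?thesis by (simp only:)
  qed
  have hhol: "h holomorphic_on - half_lattice"
    unfolding h_def by (cases "even n") (auto intro!: holomorphic_intros lam_holomorphic xl_holomorphic)
  have hs: "h (z + 1/2) = sg1 k * h z" "h (z + \<tau>/2) = sg2 k * h z" if z: "z \<notin> half_lattice" for z
    unfolding h_def lam_shift[OF z] xl_shift[OF z]
    using sg_mult(1,2)[of k] by (auto simp: mult_ac)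
  define g where "g z = f z - L / M * h z" for z
  have "((\<lambda>z. z ^ Suc n * f z - L / M * (z ^ Suc n * h z)) \<longlongrightarrow> L - L / M * M) (at 0)"
    by (intro tendsto_intros Suc.prems(4) hlim)
  then have glim: "((\<lambda>z. z ^ Suc n * g z) \<longlongrightarrow> 0) (at 0)"
    using M by (simp add: g_def algebra_simps)
  have ghol: "g holomorphic_on - half_lattice"
    unfolding g_def by (intro holomorphic_intros Suc.prems(1) hhol)
  \<comment> \<open>As \<open>z^(n+1) g(z)\<close> tends to 0, its extension \<open>G\<close> is
    holomorphic with \<open>G 0 = 0\<close>, and the difference quotient of \<open>G\<close> at 0 is
    \<open>z^n g(z)\<close>: the order of the pole has dropped by one.\<close>
  have "\<exists>L'. ((\<lambda>z. z ^ n * g z) \<longlongrightarrow> L') (at 0)"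
  proof -
    obtain e where e: "e > 0" "\<And>w. w \<noteq> 0 \<Longrightarrow> dist w 0 < e \<Longrightarrow> w \<notin> half_lattice"
      using eventually_not_half_lattice[of 0] by (auto simp: eventually_at)
    define G where "G z = (if z = 0 then 0 else z ^ Suc n * g z)" for z
    have "\<forall>\<^sub>F z in at 0. z ^ Suc n * g z = G z" by (simp add: eventually_at_filter G_def)
    with glim have G0: "(G \<longlongrightarrow> 0) (at 0)" by (rule Lim_transform_eventually)
    have "G holomorphic_on ball 0 e"
    proof (rule no_isolated_singularity'[where K = "{0}"])
      show "(G \<longlongrightarrow> G w) (at w within ball 0 e)" if "w \<in> {0}" for w
        using that Lim_at_imp_Lim_at_within[OF G0] by (simp add: G_def)
      show "G holomorphic_on ball 0 e - {0}"
      proof (rule holomorphic_transform)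
        show "(\<lambda>z. z ^ Suc n * g z) holomorphic_on ball 0 e - {0}"
          by (intro holomorphic_intros holomorphic_on_subset[OF ghol]) (use e in \<open>auto simp: dist_commute\<close>)
      qed (simp add: G_def)
    qed auto
    then have "(G has_field_derivative deriv G 0) (at 0)" using e(1) by (intro holomorphic_derivI[of G "ball 0 e"]) auto
    then have "((\<lambda>z. (G z - G 0) / (z - 0)) \<longlongrightarrow> deriv G 0) (at 0)" by (simp only: has_field_derivative_iff)
    moreover have "\<forall>\<^sub>F z in at 0. (G z - G 0) / (z - 0) = z ^ n * g z"
      by (simp add: eventually_at_filter G_def)
    ultimately show ?thesis by (blast intro: Lim_transform_eventually)
  qed
  then obtain L' where L': "((\<lambda>z. z ^ n * g z) \<longlongrightarrow> L') (at 0)" by blast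
  have "\<exists>a b. \<forall>z. z \<notin> half_lattice \<longrightarrow> g z = lam k z * poly a (xl z) + lam (k + 1) z * lam (k + 2) z * poly b (xl z)"
    by (rule Suc.IH[OF ghol _ _ L']) (auto simp: g_def Suc.prems(2,3) hs right_diff_distrib)
  then obtain a b where ab: "\<And>z. z \<notin> half_lattice \<Longrightarrow>
      g z = lam k z * poly a (xl z) + lam (k + 1) z * lam (k + 2) z * poly b (xl z)" by blast
  have fg: "f z = g z + L / M * h z" for z by (simp add: g_def)
  show ?case
  proof (cases "even n")
    case True
    show ?thesis
      by (rule exI[of _ "a + monom (L / M) m"], rule exI[of _ b])
         (simp add: fg ab h_def True poly_monom distrib_left mult_ac)
  next
    case False
    show ?thesis
      by (rule exI[of _ a], rule exI[of _ "b + monom (L / M) m"])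
         (simp add: fg ab h_def False poly_monom distrib_left mult_ac)
  qed
qed

text \<open>The first summand is odd in \<open>z\<close> and the second even, so both vanish
  separately; near 0 the factors \<open>\<lambda>\<close> are nonzero and \<open>x\<close> has a
  pole.\<close>

lemma expansion_unique:
  assumes eq: "\<And>z. z \<notin> half_lattice \<Longrightarrow> lam k z * poly a (xl z) + lam (k + 1) z * lam (k + 2) z * poly b (xl z) = 0"
  shows "a = 0" "b = 0"
proof -
  have c: "(\<kappa> / 2)\<^sup>2 \<noteq> 0" using \<kappa> by simp
  have nz: "\<forall>\<^sub>F z in at 0. lam j z \<noteq> 0" for j
  proof -
    have "\<forall>\<^sub>F z in at 0. z * lam j z \<noteq> 0"
      using lam_tendsto[of j] by (rule tendsto_imp_eventually_ne) (use \<kappa> in simp)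
    then show ?thesis by eventually_elim auto
  qed
  have neg: "p = 0 \<and> q = 0" if "- p + q = 0" "p + q = 0" for p q :: complex
  proof -
    have "2 * q = (- p + q) + (p + q)" by simp
    then show ?thesis using that by simp
  qed
  have both: "lam k z * poly a (xl z) = 0 \<and> lam (k + 1) z * lam (k + 2) z * poly b (xl z) = 0"
    if z: "z \<notin> half_lattice" for z
  proof -
    have "- z \<notin> half_lattice" using z by (simp add: half_lattice_uminus)
    from eq[OF this] have "- (lam k z * poly a (xl z)) + lam (k + 1) z * lam (k + 2) z * poly b (xl z) = 0"
      by (simp add: lam_uminus[OF z] xl_uminus[OF z])
    then show ?thesis using eq[OF z]
      by (rule neg)
  qed
  have "\<forall>\<^sub>F z in at 0. poly a (xl z) = 0"
    using nz[of k] eventually_not_half_lattice[of 0] by eventually_elim (use both in auto)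
  then show "a = 0" by (rule poly_eq_0_at_pole[OF _ xl_tendsto c])
  have "\<forall>\<^sub>F z in at 0. poly b (xl z) = 0"
    using nz[of "k + 1"] nz[of "k + 2"] eventually_not_half_lattice[of 0] by eventually_elim (use both in auto)
  then show "b = 0" by (rule poly_eq_0_at_pole[OF _ xl_tendsto c])
qed

end

subsection \<open>A polynomial model\<close>

notation vec_nth (infixl \<open>\<sharp>\<close> 90)

section \<open>Modules and Lie algebras over the complex numbers\<close>

lemma carrier_complex_field [simp]: "carrier complex_field = UNIV"
  and mult_complex_field [simp]: "x \<otimes>\<^bsub>complex_field\<^esub> y = x * y"
  and add_complex_field [simp]: "x \<oplus>\<^bsub>complex_field\<^esub> y = x + y"
  and one_complex_field [simp]: "\<one>\<^bsub>complex_field\<^esub> = 1"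
  and zero_complex_field [simp]: "\<zero>\<^bsub>complex_field\<^esub> = 0"
  by (simp_all add: ring_of_type_algebra_def)

lemma cring_complex_field: "cring complex_field"
  by (rule cring_from_type_algebra)

lemma complex_moduleI:
  fixes M :: "(complex, 'b, 'm) module_scheme"
  assumes add_closed: "\<And>x y. x \<in> carrier M \<Longrightarrow> y \<in> carrier M \<Longrightarrow> x \<oplus>\<^bsub>M\<^esub> y \<in> carrier M"
    and zero_closed: "\<zero>\<^bsub>M\<^esub> \<in> carrier M"
    and smult_closed: "\<And>c x. x \<in> carrier M \<Longrightarrow> c \<odot>\<^bsub>M\<^esub> x \<in> carrier M"
    and assoc: "\<And>x y z. x \<in> carrier M \<Longrightarrow> y \<in> carrier M \<Longrightarrow> z \<in> carrier M \<Longrightarrow>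
      x \<oplus>\<^bsub>M\<^esub> y \<oplus>\<^bsub>M\<^esub> z = x \<oplus>\<^bsub>M\<^esub> (y \<oplus>\<^bsub>M\<^esub> z)"
    and comm: "\<And>x y. x \<in> carrier M \<Longrightarrow> y \<in> carrier M \<Longrightarrow> x \<oplus>\<^bsub>M\<^esub> y = y \<oplus>\<^bsub>M\<^esub> x"
    and zero: "\<And>x. x \<in> carrier M \<Longrightarrow> \<zero>\<^bsub>M\<^esub> \<oplus>\<^bsub>M\<^esub> x = x"
    and neg: "\<And>x. x \<in> carrier M \<Longrightarrow> (- 1) \<odot>\<^bsub>M\<^esub> x \<oplus>\<^bsub>M\<^esub> x = \<zero>\<^bsub>M\<^esub>"
    and distr_l: "\<And>c d x. x \<in> carrier M \<Longrightarrow> (c + d) \<odot>\<^bsub>M\<^esub> x = c \<odot>\<^bsub>M\<^esub> x \<oplus>\<^bsub>M\<^esub> d \<odot>\<^bsub>M\<^esub> x"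
    and distr_r: "\<And>c x y. x \<in> carrier M \<Longrightarrow> y \<in> carrier M \<Longrightarrow>
      c \<odot>\<^bsub>M\<^esub> (x \<oplus>\<^bsub>M\<^esub> y) = c \<odot>\<^bsub>M\<^esub> x \<oplus>\<^bsub>M\<^esub> c \<odot>\<^bsub>M\<^esub> y"
    and smult_assoc: "\<And>c d x. x \<in> carrier M \<Longrightarrow> (c * d) \<odot>\<^bsub>M\<^esub> x = c \<odot>\<^bsub>M\<^esub> (d \<odot>\<^bsub>M\<^esub> x)"
    and one: "\<And>x. x \<in> carrier M \<Longrightarrow> 1 \<odot>\<^bsub>M\<^esub> x = x"
  shows "Module.module complex_field M"
proof (rule moduleI)
  show "cring complex_field" by (rule cring_complex_field)
  show "abelian_group M"
  proof (rule abelian_groupI)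
    show "\<exists>y\<in>carrier M. y \<oplus>\<^bsub>M\<^esub> x = \<zero>\<^bsub>M\<^esub>" if "x \<in> carrier M" for x
      using neg[OF that] smult_closed[OF that] by (rule rev_bexI[rotated])
  qed (fact add_closed zero_closed assoc comm zero)+
qed (simp_all add: smult_closed distr_l distr_r smult_assoc one)

text \<open>Nothing but the operations of \<open>L\<close> is given in advance. Its carrier is the
  image of \<open>h\<close>, so every axiom of \<open>L\<close> is the image of an axiom of
  \<open>M\<close>; the Lie laws of the quotients and subalgebras in the theorem are obtained in
  this way.\<close>

lemma lie_transport:
  fixes M :: "(complex, 'b, 'm) lie_alg_scheme" and L :: "(complex, 'c, 'n) lie_alg_scheme"
  assumes M: "complex_lie_algebra M" and bij: "bij_betw h (carrier M) (carrier L)"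
    and add: "\<And>x y. x \<in> carrier M \<Longrightarrow> y \<in> carrier M \<Longrightarrow> h (x \<oplus>\<^bsub>M\<^esub> y) = h x \<oplus>\<^bsub>L\<^esub> h y"
    and zero: "h \<zero>\<^bsub>M\<^esub> = \<zero>\<^bsub>L\<^esub>"
    and smult: "\<And>c x. x \<in> carrier M \<Longrightarrow> h (c \<odot>\<^bsub>M\<^esub> x) = c \<odot>\<^bsub>L\<^esub> h x"
    and bracket: "\<And>x y. x \<in> carrier M \<Longrightarrow> y \<in> carrier M \<Longrightarrow> h (lie_bracket M x y) = lie_bracket L (h x) (h y)"
  shows "complex_lie_algebra L" "M \<cong>\<^sub>L L" "L \<cong>\<^sub>L M"
proof -
  interpret M: complex_lie_algebra M by (rule M)
  have img: "carrier L = h ` carrier M" using bij by (simp add: bij_betw_def)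
  have all: "(\<forall>y\<in>carrier L. P y) \<longleftrightarrow> (\<forall>x\<in>carrier M. P (h x))" for P unfolding img by blast
  have smc: "c \<odot>\<^bsub>M\<^esub> x \<in> carrier M" if "x \<in> carrier M" for c x
    using M.smult_closed[of c x] that by simp
  have neg: "(- 1) \<odot>\<^bsub>M\<^esub> x \<oplus>\<^bsub>M\<^esub> x = \<zero>\<^bsub>M\<^esub>" if x: "x \<in> carrier M" for x
  proof -
    have "(- 1) \<odot>\<^bsub>M\<^esub> x \<oplus>\<^bsub>M\<^esub> 1 \<odot>\<^bsub>M\<^esub> x = (- 1 + 1) \<odot>\<^bsub>M\<^esub> x"
      using M.smult_l_distr[of "- 1" 1 x] x by simp
    moreover have "0 \<odot>\<^bsub>M\<^esub> x = \<zero>\<^bsub>M\<^esub>" using M.smult_l_null[OF x] by simp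
    moreover have "1 \<odot>\<^bsub>M\<^esub> x = x" using M.smult_one[OF x] by simp
    ultimately show ?thesis by simp
  qed
  have mod: "Module.module complex_field L"
  proof (rule complex_moduleI)
    show "\<zero>\<^bsub>L\<^esub> \<in> carrier L" unfolding zero[symmetric] img by simp
    have "\<forall>x\<in>carrier L. \<forall>y\<in>carrier L. x \<oplus>\<^bsub>L\<^esub> y \<in> carrier L"
      unfolding all by (simp add: add[symmetric] img)
    then show "x \<oplus>\<^bsub>L\<^esub> y \<in> carrier L" if "x \<in> carrier L" "y \<in> carrier L" for x y using that by blast
    have "\<forall>x\<in>carrier L. c \<odot>\<^bsub>L\<^esub> x \<in> carrier L" for c
      unfolding all using smc by (simp add: smult[symmetric] img)
    then show "c \<odot>\<^bsub>L\<^esub> x \<in> carrier L" if "x \<in> carrier L" for c x using that by blast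
    have "\<forall>x\<in>carrier L. \<forall>y\<in>carrier L. \<forall>z\<in>carrier L. x \<oplus>\<^bsub>L\<^esub> y \<oplus>\<^bsub>L\<^esub> z = x \<oplus>\<^bsub>L\<^esub> (y \<oplus>\<^bsub>L\<^esub> z)"
      unfolding all by (simp add: add[symmetric] M.a_assoc)
    then show "x \<oplus>\<^bsub>L\<^esub> y \<oplus>\<^bsub>L\<^esub> z = x \<oplus>\<^bsub>L\<^esub> (y \<oplus>\<^bsub>L\<^esub> z)"
      if "x \<in> carrier L" "y \<in> carrier L" "z \<in> carrier L" for x y z using that by blast
    have "\<forall>x\<in>carrier L. \<forall>y\<in>carrier L. x \<oplus>\<^bsub>L\<^esub> y = y \<oplus>\<^bsub>L\<^esub> x"
      unfolding all by (simp add: add[symmetric] M.a_comm)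
    then show "x \<oplus>\<^bsub>L\<^esub> y = y \<oplus>\<^bsub>L\<^esub> x" if "x \<in> carrier L" "y \<in> carrier L" for x y using that by blast
    have "\<forall>x\<in>carrier L. \<zero>\<^bsub>L\<^esub> \<oplus>\<^bsub>L\<^esub> x = x"
      unfolding all zero[symmetric] by (simp add: add[symmetric])
    then show "\<zero>\<^bsub>L\<^esub> \<oplus>\<^bsub>L\<^esub> x = x" if "x \<in> carrier L" for x using that by blast
    have "\<forall>x\<in>carrier L. (- 1) \<odot>\<^bsub>L\<^esub> x \<oplus>\<^bsub>L\<^esub> x = \<zero>\<^bsub>L\<^esub>"
      unfolding all zero[symmetric] using smc by (simp add: add[symmetric] smult[symmetric] neg)
    then show "(- 1) \<odot>\<^bsub>L\<^esub> x \<oplus>\<^bsub>L\<^esub> x = \<zero>\<^bsub>L\<^esub>" if "x \<in> carrier L" for x using that by blast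
    have "\<forall>x\<in>carrier L. (c + d) \<odot>\<^bsub>L\<^esub> x = c \<odot>\<^bsub>L\<^esub> x \<oplus>\<^bsub>L\<^esub> d \<odot>\<^bsub>L\<^esub> x" for c d
      unfolding all using smc M.smult_l_distr[of c d] by (simp add: add[symmetric] smult[symmetric])
    then show "(c + d) \<odot>\<^bsub>L\<^esub> x = c \<odot>\<^bsub>L\<^esub> x \<oplus>\<^bsub>L\<^esub> d \<odot>\<^bsub>L\<^esub> x" if "x \<in> carrier L" for c d x using that by blast
    have "\<forall>x\<in>carrier L. \<forall>y\<in>carrier L. c \<odot>\<^bsub>L\<^esub> (x \<oplus>\<^bsub>L\<^esub> y) = c \<odot>\<^bsub>L\<^esub> x \<oplus>\<^bsub>L\<^esub> c \<odot>\<^bsub>L\<^esub> y" for c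
      unfolding all using smc M.smult_r_distr[of c] by (simp add: add[symmetric] smult[symmetric])
    then show "c \<odot>\<^bsub>L\<^esub> (x \<oplus>\<^bsub>L\<^esub> y) = c \<odot>\<^bsub>L\<^esub> x \<oplus>\<^bsub>L\<^esub> c \<odot>\<^bsub>L\<^esub> y"
      if "x \<in> carrier L" "y \<in> carrier L" for c x y using that by blast
    have "\<forall>x\<in>carrier L. (c * d) \<odot>\<^bsub>L\<^esub> x = c \<odot>\<^bsub>L\<^esub> (d \<odot>\<^bsub>L\<^esub> x)" for c d
      unfolding all using smc M.smult_assoc1[of c d] by (simp add: smult[symmetric])
    then show "(c * d) \<odot>\<^bsub>L\<^esub> x = c \<odot>\<^bsub>L\<^esub> (d \<odot>\<^bsub>L\<^esub> x)" if "x \<in> carrier L" for c d x using that by blast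
    have "\<forall>x\<in>carrier L. 1 \<odot>\<^bsub>L\<^esub> x = x"
      unfolding all using M.smult_one by (simp add: smult[symmetric])
    then show "1 \<odot>\<^bsub>L\<^esub> x = x" if "x \<in> carrier L" for x using that by blast
  qed
  show L: "complex_lie_algebra L"
  proof (rule complex_lie_algebra.intro[OF mod complex_lie_algebra_axioms.intro])
    have "\<forall>x\<in>carrier L. \<forall>y\<in>carrier L. lie_bracket L x y \<in> carrier L"
      unfolding all by (simp add: bracket[symmetric] img M.bracket_closed)
    then show "lie_bracket L x y \<in> carrier L" if "x \<in> carrier L" "y \<in> carrier L" for x y using that by blast
    have "\<forall>x\<in>carrier L. \<forall>y\<in>carrier L. \<forall>z\<in>carrier L.
        lie_bracket L (x \<oplus>\<^bsub>L\<^esub> y) z = lie_bracket L x z \<oplus>\<^bsub>L\<^esub> lie_bracket L y z"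
      unfolding all by (simp add: add[symmetric] bracket[symmetric] M.bracket_closed M.bracket_add_left)
    then show "lie_bracket L (x \<oplus>\<^bsub>L\<^esub> y) z = lie_bracket L x z \<oplus>\<^bsub>L\<^esub> lie_bracket L y z"
      if "x \<in> carrier L" "y \<in> carrier L" "z \<in> carrier L" for x y z using that by blast
    have "\<forall>x\<in>carrier L. \<forall>y\<in>carrier L. \<forall>z\<in>carrier L.
        lie_bracket L x (y \<oplus>\<^bsub>L\<^esub> z) = lie_bracket L x y \<oplus>\<^bsub>L\<^esub> lie_bracket L x z"
      unfolding all by (simp add: add[symmetric] bracket[symmetric] M.bracket_closed M.bracket_add_right)
    then show "lie_bracket L x (y \<oplus>\<^bsub>L\<^esub> z) = lie_bracket L x y \<oplus>\<^bsub>L\<^esub> lie_bracket L x z"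
      if "x \<in> carrier L" "y \<in> carrier L" "z \<in> carrier L" for x y z using that by blast
    have "\<forall>x\<in>carrier L. \<forall>y\<in>carrier L. lie_bracket L (c \<odot>\<^bsub>L\<^esub> x) y = c \<odot>\<^bsub>L\<^esub> lie_bracket L x y" for c
      unfolding all using smc by (simp add: smult[symmetric] bracket[symmetric] M.bracket_closed M.bracket_smult_left)
    then show "lie_bracket L (c \<odot>\<^bsub>L\<^esub> x) y = c \<odot>\<^bsub>L\<^esub> lie_bracket L x y"
      if "x \<in> carrier L" "y \<in> carrier L" for c x y using that by blast
    have "\<forall>x\<in>carrier L. \<forall>y\<in>carrier L. lie_bracket L x (c \<odot>\<^bsub>L\<^esub> y) = c \<odot>\<^bsub>L\<^esub> lie_bracket L x y" for c
      unfolding all using smc by (simp add: smult[symmetric] bracket[symmetric] M.bracket_closed M.bracket_smult_right)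
    then show "lie_bracket L x (c \<odot>\<^bsub>L\<^esub> y) = c \<odot>\<^bsub>L\<^esub> lie_bracket L x y"
      if "x \<in> carrier L" "y \<in> carrier L" for c x y using that by blast
    have "\<forall>x\<in>carrier L. lie_bracket L x x = \<zero>\<^bsub>L\<^esub>"
      unfolding all by (simp add: bracket[symmetric] M.bracket_self zero)
    then show "lie_bracket L x x = \<zero>\<^bsub>L\<^esub>" if "x \<in> carrier L" for x using that by blast
    have "\<forall>x\<in>carrier L. \<forall>y\<in>carrier L. \<forall>z\<in>carrier L.
        lie_bracket L x (lie_bracket L y z) \<oplus>\<^bsub>L\<^esub> lie_bracket L y (lie_bracket L z x)
          \<oplus>\<^bsub>L\<^esub> lie_bracket L z (lie_bracket L x y) = \<zero>\<^bsub>L\<^esub>"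
      unfolding all zero[symmetric] by (simp add: add[symmetric] bracket[symmetric] M.bracket_closed M.jacobi)
    then show "lie_bracket L x (lie_bracket L y z) \<oplus>\<^bsub>L\<^esub> lie_bracket L y (lie_bracket L z x)
          \<oplus>\<^bsub>L\<^esub> lie_bracket L z (lie_bracket L x y) = \<zero>\<^bsub>L\<^esub>"
      if "x \<in> carrier L" "y \<in> carrier L" "z \<in> carrier L" for x y z using that by blast
  qed
  have "h \<in> lie_iso M L" using bij add smult bracket by (simp add: lie_iso_def)
  then show "M \<cong>\<^sub>L L" using M L by (auto simp: lie_isomorphic_def)
  define g where "g = inv_into (carrier M) h"
  have g: "g (h x) = x" if "x \<in> carrier M" for x
    using that bij by (simp add: g_def bij_betw_inv_into_left)
  have "bij_betw g (carrier L) (carrier M)" using bij by (simp add: g_def bij_betw_inv_into)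
  moreover have "\<forall>x\<in>carrier L. \<forall>y\<in>carrier L. g (x \<oplus>\<^bsub>L\<^esub> y) = g x \<oplus>\<^bsub>M\<^esub> g y"
    unfolding all by (simp add: add[symmetric] g)
  moreover have "\<forall>c. \<forall>x\<in>carrier L. g (c \<odot>\<^bsub>L\<^esub> x) = c \<odot>\<^bsub>M\<^esub> g x"
    unfolding all using smc by (simp add: smult[symmetric] g)
  moreover have "\<forall>x\<in>carrier L. \<forall>y\<in>carrier L. g (lie_bracket L x y) = lie_bracket M (g x) (g y)"
    unfolding all by (simp add: bracket[symmetric] g M.bracket_closed)
  ultimately have "g \<in> lie_iso L M" by (simp add: lie_iso_def)
  then show "L \<cong>\<^sub>L M" using M L by (auto simp: lie_isomorphic_def)
qed

lemma lie_isomorphic_trans: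
  assumes "L \<cong>\<^sub>L M" "M \<cong>\<^sub>L N"
  shows "L \<cong>\<^sub>L N"
proof -
  obtain f g where f: "f \<in> lie_iso L M" and g: "g \<in> lie_iso M N"
    using assms by (auto simp: lie_isomorphic_def)
  have fc: "f x \<in> carrier M" if "x \<in> carrier L" for x
    using f that by (auto simp: lie_iso_def bij_betw_def)
  have "bij_betw (g \<circ> f) (carrier L) (carrier N)"
    using f g by (auto simp: lie_iso_def intro: bij_betw_trans)
  then have "g \<circ> f \<in> lie_iso L N"
    using f g fc by (simp add: lie_iso_def)
  then show ?thesis using assms by (auto simp: lie_isomorphic_def)
qed

section \<open>The Lie algebra structure of the model\<close>

type_synonym curve_vec = "((complex poly)^3) \<times> ((complex poly)^3)"

definition lin :: "(3 \<Rightarrow> complex) \<Rightarrow> 3 \<Rightarrow> complex poly" where "lin r k = [:- r k, 1:]"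

text \<open>
  The pair \<open>(a, b)\<close> stands for \<open>\<Sum>\<^sub>k v\<^sub>k \<otimes> (\<lambda>\<^sub>k a\<^sub>k(x) + \<lambda>\<^sub>i\<lambda>\<^sub>j b\<^sub>k(x))\<close>, where \<open>(i, j, k)\<close> is cyclic and
  \<open>x = \<lambda>\<^sub>k\<^sup>2 + r\<^sub>k\<close>.
\<close>

definition curve_bracket :: "(3 \<Rightarrow> complex) \<Rightarrow> curve_vec \<Rightarrow> curve_vec \<Rightarrow> curve_vec" where
  "curve_bracket r m n = (case (m, n) of ((a, b), (c, d)) \<Rightarrow>
     (\<chi> k. lin r (k + 1) * (a \<sharp> (k + 1) * d \<sharp> (k + 2) - b \<sharp> (k + 2) * c \<sharp> (k + 1))
         + lin r (k + 2) * (b \<sharp> (k + 1) * c \<sharp> (k + 2) - a \<sharp> (k + 2) * d \<sharp> (k + 1)),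
      \<chi> k. a \<sharp> (k + 1) * c \<sharp> (k + 2) - a \<sharp> (k + 2) * c \<sharp> (k + 1)
         + lin r k * (b \<sharp> (k + 1) * d \<sharp> (k + 2) - b \<sharp> (k + 2) * d \<sharp> (k + 1))))"

definition curve_scale :: "complex \<Rightarrow> curve_vec \<Rightarrow> curve_vec" where
  "curve_scale c m = (\<chi> k. smult c (fst m \<sharp> k), \<chi> k. smult c (snd m \<sharp> k))"

definition curve_lie :: "(3 \<Rightarrow> complex) \<Rightarrow> (complex, curve_vec) lie_alg" where
  "curve_lie r = \<lparr>carrier = UNIV, monoid.mult = undefined, one = undefined, zero = 0, add = (+),
     module.smult = curve_scale, lie_bracket = curve_bracket r\<rparr>"

text \<open>The coefficient of \<open>v_k\<close> at the point \<open>s\<close> of the curve, with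
  \<open>x\<close> the common value of \<open>s_k^2 + r_k\<close>.\<close>

definition curve_eval :: "curve_vec \<Rightarrow> (3 \<Rightarrow> complex) \<Rightarrow> complex \<Rightarrow> 3 \<Rightarrow> complex" where
  "curve_eval m s x k = s k * poly (fst m \<sharp> k) x + s (k + 1) * s (k + 2) * poly (snd m \<sharp> k) x"

lemma cyclic_sum_3:
  fixes k :: 3
  shows "k + 1 + 1 = k + 2" "k + 1 + 2 = k" "k + 2 + 1 = k" "k + 2 + 2 = k + 1"
  by (simp_all add: add.assoc)

lemma add_3: "1 + 1 = (2 :: 3)" "1 + 2 = (3 :: 3)" "2 + 1 = (3 :: 3)" "2 + 2 = (1 :: 3)" "3 + 1 = (1 :: 3)" "3 + 2 = (2 :: 3)"
  by simp_all

text \<open>Valid in every commutative ring because the deviations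
  \<open>\<lambda>_i^2 - X_i\<close> are kept as explicit error terms. At points of the curve these
  terms vanish; in the polynomial ring they lie in the ideal of the curve.\<close>

lemma curve_bracket_identity:
  fixes li :: "'a :: comm_ring_1"
  shows "(li * ai + lj * lk * bi) * (lj * cj + lk * li * dj) - (lj * aj + lk * li * bj) * (li * ci + lj * lk * di)
    = lk * (Xi * (ai * dj - bj * ci) + Xj * (bi * cj - aj * di))
      + li * lj * (ai * cj - aj * ci + Xk * (bi * dj - bj * di))
      + ((li * li - Xi) * (lk * (ai * dj - bj * ci)) + (lj * lj - Xj) * (lk * (bi * cj - aj * di))
      + (lk * lk - Xk) * (li * lj * (bi * dj - bj * di)))"
  by (simp add: algebra_simps)

lemma curve_eval_bracket:
  assumes "\<And>k. (s k)\<^sup>2 + r k = x"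
  shows "curve_eval (curve_bracket r m n) s x k =
    curve_eval m s x (k + 1) * curve_eval n s x (k + 2) - curve_eval m s x (k + 2) * curve_eval n s x (k + 1)"
proof -
  obtain a b c d where mn: "m = (a, b)" "n = (c, d)" by (metis surj_pair)
  have lin: "poly (lin r k) x = s k * s k" for k
    using assms[of k] by (simp add: lin_def power2_eq_square algebra_simps)
  show ?thesis
    unfolding curve_eval_def curve_bracket_def mn
    using curve_bracket_identity[of "s (k + 1)" "poly (a \<sharp> (k + 1)) x" "s (k + 2)" "s k" "poly (b \<sharp> (k + 1)) x"
        "poly (c \<sharp> (k + 2)) x" "poly (d \<sharp> (k + 2)) x" "poly (a \<sharp> (k + 2)) x" "poly (b \<sharp> (k + 2)) x"
        "poly (c \<sharp> (k + 1)) x" "poly (d \<sharp> (k + 1)) x" "poly (lin r (k + 1)) x" "poly (lin r (k + 2)) x" "poly (lin r k) x"]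
    by (simp add: lin cyclic_sum_3)
qed

lemma curve_eval_add: "curve_eval (m + n) s x k = curve_eval m s x k + curve_eval n s x k"
  by (simp add: curve_eval_def algebra_simps)

lemma curve_eval_scale: "curve_eval (curve_scale c m) s x k = c * curve_eval m s x k"
  by (simp add: curve_eval_def curve_scale_def algebra_simps)

lemma curve_eval_diff: "curve_eval (m - n) s x k = curve_eval m s x k - curve_eval n s x k"
  by (simp add: curve_eval_def algebra_simps)

lemma neq_cyclic_3: "k + 1 \<noteq> (k :: 3)" "k + 2 \<noteq> (k :: 3)" "k + 1 \<noteq> k + (2 :: 3)"
  by simp_all

lemma poly_eq_0_cofinite:
  fixes p :: "complex poly"
  assumes "finite A" "\<And>t. t \<notin> A \<Longrightarrow> poly p t = 0"
  shows "p = 0"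
proof (rule ccontr)
  assume "p \<noteq> 0"
  then have "finite {t. poly p t = 0}" by (rule poly_roots_finite)
  moreover have "- A \<subseteq> {t. poly p t = 0}" using assms(2) by auto
  ultimately have "finite (- A)" using finite_subset by blast
  with assms(1) have "finite (UNIV :: complex set)" by (metis Compl_partition finite_UnI)
  then show False using infinite_UNIV_char_0 by blast
qed

text \<open>Changing the sign of \<open>s_k\<close> alone gives another point of the curve and
  separates the two summands. Outside the finite set \<open>range r\<close> no coordinate vanishes,
  so both polynomials have cofinitely many zeros.\<close>

lemma curve_eval_eq_0:
  assumes "\<And>s x k. (\<And>k. (s k)\<^sup>2 + r k = x) \<Longrightarrow> curve_eval m s x k = 0"
  shows "m = 0"
proof -
  have "fst m \<sharp> k = 0 \<and> snd m \<sharp> k = 0" for k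
  proof -
    have "poly (fst m \<sharp> k) t = 0 \<and> poly (snd m \<sharp> k) t = 0" if t: "t \<notin> range r" for t
    proof -
      define s where "s j = csqrt (t - r j)" for j
      define s' where "s' = s(k := - s k)"
      have s: "(s j)\<^sup>2 + r j = t" for j by (simp add: s_def)
      have s': "(s' j)\<^sup>2 + r j = t" for j using s by (simp add: s'_def)
      have nz: "s j \<noteq> 0" for j using t by (auto simp: s_def)
      have "curve_eval m s t k = 0" "curve_eval m s' t k = 0"
        using assms[OF s] assms[OF s'] by auto
      then show ?thesis
        using nz neq_cyclic_3[of k] by (auto simp: curve_eval_def s'_def)
    qed
    then show ?thesis by (auto intro!: poly_eq_0_cofinite[of "range r"])
  qed
  then show ?thesis by (simp add: prod_eq_iff vec_eq_iff)
qed

lemma curve_eval_inject: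
  assumes "\<And>s x k. (\<And>k. (s k)\<^sup>2 + r k = x) \<Longrightarrow> curve_eval m s x k = curve_eval n s x k"
  shows "m = n"
  using curve_eval_eq_0[of r "m - n"] assms by (simp add: curve_eval_diff)

lemma curve_lie_sel [simp]:
  "carrier (curve_lie r) = UNIV" "\<zero>\<^bsub>curve_lie r\<^esub> = 0" "x \<oplus>\<^bsub>curve_lie r\<^esub> y = x + y"
  "c \<odot>\<^bsub>curve_lie r\<^esub> x = curve_scale c x" "lie_bracket (curve_lie r) = curve_bracket r"
  by (simp_all add: curve_lie_def)

text \<open>By \<open>curve_eval_inject\<close> the laws of the bracket may be checked at points of
  the curve, where it is the cross product on \<open>\<complex>^3\<close>.\<close>

lemma complex_lie_algebra_curve_lie: "complex_lie_algebra (curve_lie r)"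
proof (rule complex_lie_algebra.intro)
  show "Module.module complex_field (curve_lie r)"
    by (rule complex_moduleI)
       (simp_all add: curve_scale_def prod_eq_iff vec_eq_iff smult_add_left smult_add_right algebra_simps)
  note eval = curve_eval_bracket curve_eval_add curve_eval_scale
  show "complex_lie_algebra_axioms (curve_lie r)"
    by unfold_locales
       (simp_all, (rule curve_eval_inject[of r], simp add: eval cyclic_sum_3,
         simp add: curve_eval_def algebra_simps)+)
qed

lemma curve_bracket_simps:
  "curve_bracket r (m + m') n = curve_bracket r m n + curve_bracket r m' n"
  "curve_bracket r m (n + n') = curve_bracket r m n + curve_bracket r m n'"
  "curve_bracket r (curve_scale c m) n = curve_scale c (curve_bracket r m n)"
  "curve_bracket r m (curve_scale c n) = curve_scale c (curve_bracket r m n)"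
  "curve_bracket r m m = 0"
proof -
  interpret complex_lie_algebra "curve_lie r" by (rule complex_lie_algebra_curve_lie)
  show "curve_bracket r (m + m') n = curve_bracket r m n + curve_bracket r m' n"
    using bracket_add_left[of m m' n] by simp
  show "curve_bracket r m (n + n') = curve_bracket r m n + curve_bracket r m n'"
    using bracket_add_right[of m n n'] by simp
  show "curve_bracket r (curve_scale c m) n = curve_scale c (curve_bracket r m n)"
    using bracket_smult_left[of m n c] by simp
  show "curve_bracket r m (curve_scale c n) = curve_scale c (curve_bracket r m n)"
    using bracket_smult_right[of m n c] by simp
  show "curve_bracket r m m = 0" using bracket_self[of m] by simp
qed

definition oddv :: "3 \<Rightarrow> complex poly \<Rightarrow> curve_vec" where "oddv i p = (axis i p, 0)"
definition evenv :: "3 \<Rightarrow> complex poly \<Rightarrow> curve_vec" where "evenv i p = (0, axis i p)"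

lemma three_cases: "k = i \<or> k = i + 1 \<or> k = i + 2" for k i :: 3
  using exhaust_3[of k] exhaust_3[of i] by auto

lemma curve_vec_eqI:
  assumes "\<And>k. fst m \<sharp> k = fst n \<sharp> k" "\<And>k. snd m \<sharp> k = snd n \<sharp> k"
  shows "m = (n :: curve_vec)"
  using assms by (simp add: prod_eq_iff vec_eq_iff)

lemma bracket_odd_odd: "curve_bracket r (oddv (i + 1) 1) (oddv (i + 2) p) = evenv i p"
  by (rule curve_vec_eqI; use three_cases[of _ i] in \<open>auto simp: curve_bracket_def oddv_def evenv_def axis_def cyclic_sum_3\<close>)

lemma bracket_odd_even: "curve_bracket r (oddv (i + 1) 1) (evenv (i + 2) p) = oddv i (lin r (i + 1) * p)"
  by (rule curve_vec_eqI; use three_cases[of _ i] in \<open>auto simp: curve_bracket_def oddv_def evenv_def axis_def cyclic_sum_3\<close>)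

lemma curve_vec_decompose:
  "(m :: curve_vec) = oddv 1 (fst m \<sharp> 1) + oddv 2 (fst m \<sharp> 2) + oddv 3 (fst m \<sharp> 3)
     + evenv 1 (snd m \<sharp> 1) + evenv 2 (snd m \<sharp> 2) + evenv 3 (snd m \<sharp> 3)"
  by (rule curve_vec_eqI; use exhaust_3 in \<open>auto simp: oddv_def evenv_def axis_def\<close>)

text \<open>Bracketing with a generator turns \<open>\<lambda>_{i+2} p\<close> into
  \<open>\<lambda>_{i+1} \<lambda>_{i+2} p\<close>, and another such bracket leads back to a single
  \<open>\<lambda>\<close> while multiplying the polynomial by some \<open>x - r_j\<close>.
  Induction on the polynomial reaches everything.\<close>

lemma curve_vec_generated:
  assumes add: "\<And>x y. x \<in> A \<Longrightarrow> y \<in> A \<Longrightarrow> x + y \<in> A"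
    and scale: "\<And>c x. x \<in> A \<Longrightarrow> curve_scale c x \<in> A"
    and bracket: "\<And>x y. x \<in> A \<Longrightarrow> y \<in> A \<Longrightarrow> curve_bracket r x y \<in> A"
    and gen: "\<And>i. oddv i 1 \<in> A"
  shows "m \<in> A"
proof -
  have odd: "\<forall>i. oddv i p \<in> A" for p
  proof (induction p)
    case 0
    have "oddv i 0 = curve_scale 0 (oddv i 1)" for i
      by (rule curve_vec_eqI) (simp_all add: oddv_def curve_scale_def axis_def)
    then show ?case using scale[OF gen] by simp
  next
    case (pCons c p)
    show ?case
    proof
      fix i
      have "curve_bracket r (oddv (i + 2 + 1) 1) (oddv (i + 2 + 2) p) \<in> A"
        using pCons by (intro bracket gen) blast
      then have "evenv (i + 2) p \<in> A" unfolding bracket_odd_odd .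
      then have "oddv i (lin r (i + 1) * p) \<in> A"
        using bracket[OF gen, of "evenv (i + 2) p" "i + 1"] by (simp add: bracket_odd_even)
      \<comment> \<open>Here \<open>pCons c p\<close> is \<open>c + x p\<close>, and
        \<open>x p\<close> is split as \<open>(x - r_{i+1}) p + r_{i+1} p\<close>.\<close>
      then have "oddv i (lin r (i + 1) * p) + curve_scale (r (i + 1)) (oddv i p) + curve_scale c (oddv i 1) \<in> A"
        using pCons by (intro add scale gen) auto
      moreover have "oddv i (lin r (i + 1) * p) + curve_scale (r (i + 1)) (oddv i p) + curve_scale c (oddv i 1)
          = oddv i (pCons c p)"
        by (rule curve_vec_eqI) (simp_all add: oddv_def curve_scale_def axis_def lin_def)
      ultimately show "oddv i (pCons c p) \<in> A" by simp
    qed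
  qed
  have even: "evenv i p \<in> A" for i p
    using bracket[OF gen, of "oddv (i + 2) p" "i + 1"] odd by (simp add: bracket_odd_odd)
  show ?thesis
    by (subst curve_vec_decompose) (use odd even in \<open>auto intro!: add\<close>)
qed

section \<open>Lie algebras satisfying the relations: a spanning set\<close>

locale lie_space = vector_space scale
  for scale :: "complex \<Rightarrow> 'a :: ab_group_add \<Rightarrow> 'a" +
  fixes br :: "'a \<Rightarrow> 'a \<Rightarrow> 'a"
  assumes br_add_left: "br (x + y) z = br x z + br y z"
    and br_add_right: "br x (y + z) = br x y + br x z"
    and br_scale_left: "br (scale c x) y = scale c (br x y)"
    and br_scale_right: "br x (scale c y) = scale c (br x y)"
    and br_self: "br x x = 0"
    and br_jacobi: "br x (br y z) + br y (br z x) + br z (br x y) = 0"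
begin

lemma br_zero: "br 0 x = 0" "br x 0 = 0"
  using br_add_left[of 0 0 x] br_add_right[of x 0 0] by simp_all

lemma br_minus_left: "br (- x) y = - br x y"
  using br_add_left[of x "- x" y] by (simp add: br_zero eq_neg_iff_add_eq_0 add.commute)

lemma br_minus_right: "br x (- y) = - br x y"
  using br_add_right[of x y "- y"] by (simp add: br_zero eq_neg_iff_add_eq_0 add.commute)

lemma br_diff: "br (x - y) z = br x z - br y z" "br x (y - z) = br x y - br x z"
  using br_add_left[of x "- y" z] br_add_right[of x y "- z"] by (simp_all add: br_minus_left br_minus_right)

lemma br_antisym: "br y x = - br x y"
proof -
  have "br (x + y) (x + y) = 0" by (rule br_self)
  then have "br x y + br y x = 0" unfolding br_add_left br_add_right by (simp add: br_self add.commute)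
  then show ?thesis by (simp add: eq_neg_iff_add_eq_0 add.commute)
qed

lemma br_leibniz: "br x (br y z) = br (br x y) z + br y (br x z)"
  using br_jacobi[of x y z] br_antisym[of z "br x y"] br_antisym[of x z]
  by (simp add: br_minus_right algebra_simps)

end

text \<open>The computation takes place in a Lie algebra on a whole type, modulo an ideal
  \<open>I\<close> containing the relators; this keeps spans and subspaces available. The
  application is to the free Lie algebra.\<close>

locale p_relations_space = lie_space scale br
  for scale :: "complex \<Rightarrow> 'a :: ab_group_add \<Rightarrow> 'a" and br +
  fixes I :: "'a set" and a :: "3 \<Rightarrow> 'a" and r :: "3 \<Rightarrow> complex"
  assumes I: "subspace I" and ideal: "y \<in> I \<Longrightarrow> br x y \<in> I"
    and rel1: "br (a i) (br (a (i + 1)) (a (i + 2))) \<in> I"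
    and rel2: "br (a i) (br (a i) (a (i + 2))) - br (a (i + 1)) (br (a (i + 1)) (a (i + 2)))
      - scale (r (i + 1) - r i) (a (i + 2)) \<in> I"
begin

text \<open>\<open>e n i\<close> plays the role of \<open>v\<^sub>i \<otimes> t\<^sup>n\<^sup>+\<^sup>1\<close>.\<close>

fun e :: "nat \<Rightarrow> 3 \<Rightarrow> 'a" where
  "e 0 i = a i"
| "e (Suc n) i = br (a (i + 1)) (e n (i + 2))"

text \<open>An increasing filtration modulo \<open>I\<close> with at most three new elements per
  step. The bound on the presented algebra amounts to every Lie word lying in some step.\<close>

definition S :: "nat \<Rightarrow> 'a set" where
  "S n = span (I \<union> {e m i | m i. m < n})"

lemma subspace_S: "subspace (S n)" unfolding S_def by (rule subspace_span)

lemmas S_add = subspace_add[OF subspace_S] and S_diff = subspace_diff[OF subspace_S]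
  and S_scale = subspace_scale[OF subspace_S] and S_0 = subspace_0[OF subspace_S]
  and S_neg = subspace_neg[OF subspace_S]

lemma S_mono: "m \<le> n \<Longrightarrow> x \<in> S m \<Longrightarrow> x \<in> S n"
  unfolding S_def using span_mono[of "I \<union> {e k i | k i. k < m}" "I \<union> {e k i | k i. k < n}"] by fastforce

lemma I_S: "x \<in> I \<Longrightarrow> x \<in> S n" unfolding S_def by (rule span_base) simp

lemma e_S: "m < n \<Longrightarrow> e m i \<in> S n" unfolding S_def by (rule span_base) blast

text \<open>In the associated graded algebra the elements should multiply like
  \<open>v_i \<otimes> t^(m+1)\<close>. Since \<open>t^(m+1) t^(l+1) = t^((m+l+1)+1)\<close>,
  brackets of indices \<open>m\<close> and \<open>l\<close> have index
  \<open>Suc (m + l)\<close>.\<close>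

definition graded :: "nat \<Rightarrow> bool" where
  "graded N \<longleftrightarrow> (\<forall>m l i. Suc (m + l) = N \<longrightarrow>
     br (e m i) (e l (i + 1)) - e N (i + 2) \<in> S N \<and> br (e m i) (e l i) \<in> S N)"

lemma gradedD:
  assumes "graded (Suc (m + l))"
  shows "br (e m i) (e l (i + 1)) - e (Suc (m + l)) (i + 2) \<in> S (Suc (m + l))"
    "br (e m i) (e l (i + 2)) + e (Suc (m + l)) (i + 1) \<in> S (Suc (m + l))"
    "br (e m i) (e l i) \<in> S (Suc (m + l))"
proof -
  show "br (e m i) (e l (i + 1)) - e (Suc (m + l)) (i + 2) \<in> S (Suc (m + l))"
    "br (e m i) (e l i) \<in> S (Suc (m + l))"
    using assms unfolding graded_def by blast+
  have "br (e l (i + 2)) (e m (i + 2 + 1)) - e (Suc (m + l)) (i + 2 + 2) \<in> S (Suc (m + l))"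
    using assms unfolding graded_def by (metis add.commute)
  then have "- (br (e l (i + 2)) (e m i) - e (Suc (m + l)) (i + 1)) \<in> S (Suc (m + l))"
    by (intro S_neg) (simp add: cyclic_sum_3)
  then show "br (e m i) (e l (i + 2)) + e (Suc (m + l)) (i + 1) \<in> S (Suc (m + l))"
    using br_antisym[of "e m i" "e l (i + 2)"] by simp
qed

lemma br_e_S:
  assumes g: "\<And>K. K \<le> m + q \<Longrightarrow> graded K" and y: "y \<in> S q"
  shows "br (e m i) y \<in> S (Suc (m + q))"
  using y unfolding S_def[of q]
proof (induction rule: span_induct_alt)
  case base
  then show ?case by (simp add: br_zero S_0)
next
  case (step c x y)
  have "br (e m i) x \<in> S (Suc (m + q))"
  proof (cases "x \<in> I")
    case True then show ?thesis by (intro I_S ideal)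
  next
    case False
    then obtain l j where x: "x = e l j" "l < q" using step by blast
    have g': "graded (Suc (m + l))" using x by (intro g) simp
    have up: "z \<in> S (Suc (m + l)) \<Longrightarrow> z \<in> S (Suc (m + q))" for z using x by (elim S_mono[rotated]) simp
    have eS: "e (Suc (m + l)) k \<in> S (Suc (m + q))" for k using x by (intro e_S) simp
    consider "j = i" | "j = i + 1" | "j = i + 2" using three_cases[of j i] by blast
    then show ?thesis
    proof cases
      case 1 then show ?thesis using gradedD(3)[OF g'] up by (simp add: x)
    next
      case 2 then show ?thesis using S_add[OF up[OF gradedD(1)[OF g', of i]] eS[of "i + 2"]] by (simp add: x del: e.simps)
    next
      case 3 then show ?thesis using S_diff[OF up[OF gradedD(2)[OF g', of i]] eS[of "i + 1"]] by (simp add: x del: e.simps)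
    qed
  qed
  then show ?case using step by (simp add: br_add_right br_scale_right S_add S_scale)
qed

lemma br_S_e:
  assumes g: "\<And>K. K \<le> m + q \<Longrightarrow> graded K" and y: "y \<in> S q"
  shows "br y (e m i) \<in> S (Suc (m + q))"
  using S_neg[OF br_e_S[OF assms]] br_antisym[of y "e m i"] by simp

text \<open>Congruence modulo lower order terms in the brackets of total order \<open>N\<close>.\<close>

lemma br_cong_right:
  assumes g: "\<And>K. K < N \<Longrightarrow> graded K" and "y - y' \<in> S q" "Suc (m + q) = N"
  shows "br (e m i) y - br (e m i) y' \<in> S N"
  using br_e_S[of m q "y - y'" i] assms by (auto simp: br_diff)

lemma br_cong_left:
  assumes g: "\<And>K. K < N \<Longrightarrow> graded K" and "y - y' \<in> S q" "Suc (m + q) = N"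
  shows "br y (e m i) - br y' (e m i) \<in> S N"
  using br_S_e[of m q "y - y'" i] assms by (auto simp: br_diff)

lemma S_trans: "x - y \<in> S N \<Longrightarrow> y - z \<in> S N \<Longrightarrow> x - z \<in> S N"
  using S_add[of "x - y" N "y - z"] by simp

text \<open>Up to lower order, \<open>e (Suc (p + q)) k\<close> is the bracket of
  \<open>e p (k + 1)\<close> and \<open>e q (k + 2)\<close>, and also minus that of
  \<open>e p (k + 2)\<close> and \<open>e q (k + 1)\<close>. The bracket with \<open>e m k\<close>
  is a derivation, so each form yields one relation among diagonal brackets.\<close>

lemma diag_relation:
  assumes g: "\<And>K. K < N \<Longrightarrow> graded K" and N: "m + p + q + 2 = N"
  shows "br (e m k) (e (Suc (p + q)) k)
     - (br (e (Suc (m + p)) (k + 2)) (e q (k + 2)) - br (e p (k + 1)) (e (Suc (m + q)) (k + 1))) \<in> S N"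
    "br (e m k) (e (Suc (p + q)) k)
     - (br (e (Suc (m + p)) (k + 1)) (e q (k + 1)) - br (e p (k + 2)) (e (Suc (m + q)) (k + 2))) \<in> S N"
proof -
  have gl: "graded (Suc (p + q))" "graded (Suc (m + p))" "graded (Suc (m + q))" using N by (auto intro!: g)
  have "br (e p (k + 1)) (e q (k + 2)) - e (Suc (p + q)) k \<in> S (Suc (p + q))"
    using gradedD(1)[OF gl(1), of "k + 1"] by (simp add: cyclic_sum_3)
  then have "e (Suc (p + q)) k - br (e p (k + 1)) (e q (k + 2)) \<in> S (Suc (p + q))"
    using S_neg by fastforce
  then have 1: "br (e m k) (e (Suc (p + q)) k) - br (e m k) (br (e p (k + 1)) (e q (k + 2))) \<in> S N"
    by (rule br_cong_right[OF g, rotated]) (use N in auto)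
  have 2: "br (br (e m k) (e p (k + 1))) (e q (k + 2)) - br (e (Suc (m + p)) (k + 2)) (e q (k + 2)) \<in> S N"
    by (rule br_cong_left[OF g gradedD(1)[OF gl(2)]]) (use N in auto)
  have "br (e m k) (e q (k + 2)) - (- e (Suc (m + q)) (k + 1)) \<in> S (Suc (m + q))"
    using gradedD(2)[OF gl(3), of k] by simp
  then have 3: "br (e p (k + 1)) (br (e m k) (e q (k + 2))) - br (e p (k + 1)) (- e (Suc (m + q)) (k + 1)) \<in> S N"
    by (rule br_cong_right[OF g, rotated]) (use N in auto)
  show "br (e m k) (e (Suc (p + q)) k)
     - (br (e (Suc (m + p)) (k + 2)) (e q (k + 2)) - br (e p (k + 1)) (e (Suc (m + q)) (k + 1))) \<in> S N"
    using S_trans[OF 1, of "br (e (Suc (m + p)) (k + 2)) (e q (k + 2)) - br (e p (k + 1)) (e (Suc (m + q)) (k + 1))"]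
      S_add[OF 2 3] br_leibniz[of "e m k" "e p (k + 1)" "e q (k + 2)"]
    by (simp add: br_minus_right algebra_simps)
  have "br (e p (k + 2)) (e q (k + 1)) + e (Suc (p + q)) k \<in> S (Suc (p + q))"
    using gradedD(2)[OF gl(1), of "k + 2"] by (simp add: cyclic_sum_3)
  then have "e (Suc (p + q)) k - (- br (e p (k + 2)) (e q (k + 1))) \<in> S (Suc (p + q))"
    by (simp add: add.commute)
  then have 1: "br (e m k) (e (Suc (p + q)) k) - br (e m k) (- br (e p (k + 2)) (e q (k + 1))) \<in> S N"
    by (rule br_cong_right[OF g, rotated]) (use N in auto)
  have "br (e m k) (e p (k + 2)) - (- e (Suc (m + p)) (k + 1)) \<in> S (Suc (m + p))"
    using gradedD(2)[OF gl(2), of k] by simp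
  then have 2: "br (br (e m k) (e p (k + 2))) (e q (k + 1)) - br (- e (Suc (m + p)) (k + 1)) (e q (k + 1)) \<in> S N"
    by (rule br_cong_left[OF g, rotated]) (use N in auto)
  have 3: "br (e p (k + 2)) (br (e m k) (e q (k + 1))) - br (e p (k + 2)) (e (Suc (m + q)) (k + 2)) \<in> S N"
    by (rule br_cong_right[OF g gradedD(1)[OF gl(3)]]) (use N in auto)
  show "br (e m k) (e (Suc (p + q)) k)
     - (br (e (Suc (m + p)) (k + 1)) (e q (k + 1)) - br (e p (k + 2)) (e (Suc (m + q)) (k + 2))) \<in> S N"
    using S_trans[OF 1, of "br (e (Suc (m + p)) (k + 1)) (e q (k + 1)) - br (e p (k + 2)) (e (Suc (m + q)) (k + 2))"]
      S_neg[OF S_add[OF 2 3]] br_leibniz[of "e m k" "e p (k + 2)" "e q (k + 1)"]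
    by (simp add: br_minus_right br_minus_left algebra_simps)
qed

text \<open>Modulo \<open>S N\<close> the diagonal brackets satisfy
  \<open>f k m + f i p = f j (m + p + 1)\<close> for distinct \<open>i\<close>, \<open>j\<close>,
  \<open>k\<close>. Hence \<open>f i 0\<close> does not depend on \<open>i\<close> and
  \<open>f i m = (m + 1) f 0 0\<close>, whereas antisymmetry gives
  \<open>f 0 (N - 1) = - f 0 0\<close>. Together, \<open>(N + 1) f 0 0 = 0\<close>. The relations
  with index 2 require \<open>N \<ge> 3\<close>.\<close>

lemma diag_in_S:
  assumes g: "\<And>K. K < N \<Longrightarrow> graded K" and N: "N \<ge> 3" and m: "Suc (m + l) = N"
  shows "br (e m i) (e l i) \<in> S N"
proof -
  define f where "f i m = br (e m i) (e (N - 1 - m) i)" for i m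
  have rel: "f k m + f i p - f j (Suc (m + p)) \<in> S N"
    if "m + p + 2 \<le> N" "(i = k + 1 \<and> j = k + 2) \<or> (i = k + 2 \<and> j = k + 1)" for k i j m p
  proof -
    define q where "q = N - 2 - m - p"
    have q: "m + p + q + 2 = N" using that by (simp add: q_def)
    have idx: "N - 1 - m = Suc (p + q)" "N - 1 - p = Suc (m + q)" "N - 1 - Suc (m + p) = q"
      using q by auto
    show ?thesis
      unfolding f_def idx using diag_relation[OF g q, of k] that(2) by (auto simp: algebra_simps)
  qed
  have "scale 2 (f i 0 - f k 0) \<in> S N" if "(i = k + 1 \<and> j = k + 2) \<or> (i = k + 2 \<and> j = k + 1)" for i j k
  proof -
    have perm: "(k = j + 1 \<and> i = j + 2) \<or> (k = j + 2 \<and> i = j + 1)"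
      "(j = i + 1 \<and> k = i + 2) \<or> (j = i + 2 \<and> k = i + 1)"
      "(i = j + 1 \<and> k = j + 2) \<or> (i = j + 2 \<and> k = j + 1)"
      "(j = k + 1 \<and> i = k + 2) \<or> (j = k + 2 \<and> i = k + 1)"
      "(k = i + 1 \<and> j = i + 2) \<or> (k = i + 2 \<and> j = i + 1)"
      using that by (auto simp: cyclic_sum_3)
    \<comment> \<open>In \<open>A - B + C - D\<close> the terms with index 1 and 2 and the terms
      \<open>f j 0\<close> cancel; twice the difference \<open>f i 0 - f k 0\<close>
      remains.\<close>
    have A: "f k 1 + f i 0 - f j 2 \<in> S N" using rel[of 1 0 i k j] that N by (simp add: numeral_2_eq_2)
    have B: "f k 0 + f i 1 - f j 2 \<in> S N" using rel[of 0 1 i k j] that N by (simp add: numeral_2_eq_2)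
    have C: "f i 0 + f j 0 - f k 1 \<in> S N" using rel[of 0 0 j i k] perm N by auto
    have D: "f k 0 + f j 0 - f i 1 \<in> S N" using rel[of 0 0 j k i] perm N by auto
    have "(f k 1 + f i 0 - f j 2) - (f k 0 + f i 1 - f j 2) + (f i 0 + f j 0 - f k 1) - (f k 0 + f j 0 - f i 1) \<in> S N"
      by (intro S_add S_diff A B C D)
    also have "(f k 1 + f i 0 - f j 2) - (f k 0 + f i 1 - f j 2) + (f i 0 + f j 0 - f k 1) - (f k 0 + f j 0 - f i 1)
        = (f i 0 - f k 0) + (f i 0 - f k 0)" by (simp add: algebra_simps)
    also have "\<dots> = scale 2 (f i 0 - f k 0)"
      using scale_left_distrib[of 1 1 "f i 0 - f k 0"] by simp
    finally show ?thesis .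
  qed
  then have half: "f i 0 - f k 0 \<in> S N" if "(i = k + 1 \<and> j = k + 2) \<or> (i = k + 2 \<and> j = k + 1)" for i j k
    using S_scale[of "scale 2 (f i 0 - f k 0)" N "1/2"] that by auto
  have eq0: "f i 0 - f k 0 \<in> S N" for i k
    using half[of i k "k + 1"] half[of i k "k + 2"] three_cases[of i k] by (auto simp: S_0)
  have lin: "m < N \<Longrightarrow> f i m - scale (of_nat (Suc m)) (f 0 0) \<in> S N" for i m
  proof (induction m arbitrary: i)
    case 0
    then show ?case using eq0 by simp
  next
    case (Suc m)
    have A: "f (i + 1) m - scale (of_nat (Suc m)) (f 0 0) \<in> S N" using Suc by simp
    have B: "f (i + 1) m + f (i + 2) 0 - f i (Suc m) \<in> S N"
      using rel[of m 0 "i + 2" "i + 1" i] Suc.prems by (simp add: cyclic_sum_3)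
    have "(f (i + 1) m - scale (of_nat (Suc m)) (f 0 0)) + (f (i + 2) 0 - f 0 0)
        - (f (i + 1) m + f (i + 2) 0 - f i (Suc m)) \<in> S N"
      by (intro S_add S_diff A B eq0)
    moreover have "scale (of_nat (Suc (Suc m))) (f 0 0) = scale (of_nat (Suc m)) (f 0 0) + f 0 0"
      using scale_left_distrib[of "of_nat (Suc m)" 1 "f 0 0"] by (simp add: add.commute)
    ultimately show ?case by (simp add: algebra_simps)
  qed
  have "f 0 (N - 1) - scale (of_nat N) (f 0 0) \<in> S N"
    using lin[of "N - 1" 0] N by (simp add: of_nat_diff)
  moreover have "f 0 (N - 1) = - f 0 0"
    using br_antisym[of "e 0 0" "e (N - 1) 0"] N by (simp add: f_def)
  ultimately have "- (f 0 0) - scale (of_nat N) (f 0 0) \<in> S N" by simp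
  then have "scale (- 1 / of_nat (Suc N)) (- (f 0 0) - scale (of_nat N) (f 0 0)) \<in> S N" by (rule S_scale)
  moreover have "- (f 0 0) - scale (of_nat N) (f 0 0) = scale (- of_nat (Suc N)) (f 0 0)"
    using scale_left_distrib[of "- 1" "- of_nat N" "f 0 0"] by simp
  ultimately have f00: "f 0 0 \<in> S N"
    by (simp del: of_nat_Suc) 
  have "f i m \<in> S N"
    using S_add[OF lin[of m i] S_scale[OF f00, of "of_nat (Suc m)"]] m by simp
  then show ?thesis using m by (auto simp: f_def)
qed

text \<open>All brackets \<open>G m\<close> agree with \<open>G 0\<close>, which is
  \<open>e N (i + 2)\<close> by definition. By the Jacobi identity, and because
  \<open>[e m i, e q i]\<close> is of lower order, \<open>G m = G q\<close> modulo
  \<open>S N\<close> whenever \<open>m + q + 2 \<le> N\<close>; this leaves out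
  \<open>m = N - 1\<close>.\<close>

lemma off_diag_in_S:
  assumes g: "\<And>K. K < N \<Longrightarrow> graded K" and N: "N \<ge> 3" and m: "Suc (m + l) = N"
  shows "br (e m i) (e l (i + 1)) - e N (i + 2) \<in> S N"
proof -
  define G where "G m = br (e m i) (e (N - 1 - m) (i + 1))" for m
  have G0: "G 0 = e N (i + 2)"
  proof -
    obtain n where n: "N = Suc n" using N by (cases N) auto
    show ?thesis by (simp add: G_def n cyclic_sum_3)
  qed
  have A: "G m - G q \<in> S N" if "m + q + 2 \<le> N" for m q
  proof -
    define p where "p = N - 2 - m - q"
    have p: "m + p + q + 2 = N" using that by (simp add: p_def)
    have idx: "N - 1 - m = Suc (p + q)" "N - 1 - q = Suc (m + p)" using p by auto
    have gl: "graded (Suc (p + q))" "graded (Suc (m + p))" "graded (Suc (m + q))" using p by (auto intro!: g)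
    have "br (e p (i + 2)) (e q i) - e (Suc (p + q)) (i + 1) \<in> S (Suc (p + q))"
      using gradedD(1)[OF gl(1), of "i + 2"] by (simp add: cyclic_sum_3)
    then have "e (Suc (p + q)) (i + 1) - br (e p (i + 2)) (e q i) \<in> S (Suc (p + q))" using S_neg by fastforce
    then have 1: "br (e m i) (e (Suc (p + q)) (i + 1)) - br (e m i) (br (e p (i + 2)) (e q i)) \<in> S N"
      by (rule br_cong_right[OF g, rotated]) (use p in auto)
    have "br (e m i) (e p (i + 2)) - (- e (Suc (m + p)) (i + 1)) \<in> S (Suc (m + p))"
      using gradedD(2)[OF gl(2), of i] by simp
    then have 2: "br (br (e m i) (e p (i + 2))) (e q i) - br (- e (Suc (m + p)) (i + 1)) (e q i) \<in> S N"
      by (rule br_cong_left[OF g, rotated]) (use p in auto)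
    have "br (e m i) (e q i) - 0 \<in> S (Suc (m + q))" using gradedD(3)[OF gl(3)] by simp
    then have 3: "br (e p (i + 2)) (br (e m i) (e q i)) - br (e p (i + 2)) 0 \<in> S N"
      by (rule br_cong_right[OF g, rotated]) (use p in auto)
    show ?thesis
      unfolding G_def idx
      using S_trans[OF 1, of "br (e q i) (e (Suc (m + p)) (i + 1))"] S_add[OF 2 3]
        br_leibniz[of "e m i" "e p (i + 2)" "e q i"] br_antisym[of "e (Suc (m + p)) (i + 1)" "e q i"]
      by (simp add: br_minus_left br_zero algebra_simps)
  qed
  \<comment> \<open>For the missing index the first factor \<open>e (N - 1) i\<close> is itself
    expanded as a bracket, and the Jacobi identity leads to \<open>G 1\<close>, which is in the
    range of \<open>A\<close> since \<open>N \<ge> 3\<close>.\<close>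
  have B: "G (N - 1) - G 1 \<in> S N"
  proof -
    define p where "p = N - 2"
    have p: "Suc (Suc p) = N" "N - 1 = Suc p" "N - 1 - 1 = p" "N - 1 - (N - 1) = 0" using N by (auto simp: p_def)
    have gl: "graded (Suc p)" "graded (Suc (0 + p))" "graded (Suc (0 + 0))" using p by (auto intro!: g)
    have "br (e p (i + 1)) (e 0 (i + 2)) - e (Suc (p + 0)) i \<in> S (Suc (p + 0))"
      using gradedD(1)[of p 0 "i + 1"] gl by (simp add: cyclic_sum_3)
    then have "e (Suc p) i - br (e p (i + 1)) (e 0 (i + 2)) \<in> S (Suc p)" using S_neg by fastforce
    then have 1: "br (e (Suc p) i) (e 0 (i + 1)) - br (br (e p (i + 1)) (e 0 (i + 2))) (e 0 (i + 1)) \<in> S N"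
      by (rule br_cong_left[OF g, rotated]) (use p in auto)
    have "br (e 0 (i + 1)) (e p (i + 1)) - 0 \<in> S (Suc p)" using gradedD(3)[OF gl(2)] by simp
    then have 2: "br (br (e 0 (i + 1)) (e p (i + 1))) (e 0 (i + 2)) - br 0 (e 0 (i + 2)) \<in> S N"
      by (rule br_cong_left[OF g, rotated]) (use p in auto)
    have "br (e 0 (i + 1)) (e 0 (i + 2)) - e (Suc (0 + 0)) i \<in> S (Suc (0 + 0))"
      using gradedD(1)[OF gl(3), of "i + 1"] by (simp add: cyclic_sum_3)
    then have 3: "br (e p (i + 1)) (br (e 0 (i + 1)) (e 0 (i + 2))) - br (e p (i + 1)) (e (Suc 0) i) \<in> S N"
      by (intro br_cong_right[OF g]) (use p in \<open>auto simp: numeral_2_eq_2\<close>)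
    have "br (br (e p (i + 1)) (e 0 (i + 2))) (e 0 (i + 1)) - br (e (Suc 0) i) (e p (i + 1)) =
        - ((br (br (e 0 (i + 1)) (e p (i + 1))) (e 0 (i + 2)) - br 0 (e 0 (i + 2)))
        + (br (e p (i + 1)) (br (e 0 (i + 1)) (e 0 (i + 2))) - br (e p (i + 1)) (e (Suc 0) i)))"
      unfolding br_antisym[of "br (e p (i + 1)) (e 0 (i + 2))" "e 0 (i + 1)"] br_antisym[of "e p (i + 1)" "e (Suc 0) i"]
        br_leibniz[of "e 0 (i + 1)" "e p (i + 1)" "e 0 (i + 2)"] br_zero
      by (simp del: e.simps)
    then have "br (br (e p (i + 1)) (e 0 (i + 2))) (e 0 (i + 1)) - br (e (Suc 0) i) (e p (i + 1)) \<in> S N"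
      using S_neg[OF S_add[OF 2 3]] by simp
    moreover have "G (N - 1) = br (e (Suc p) i) (e 0 (i + 1))" "G 1 = br (e (Suc 0) i) (e p (i + 1))"
      using p by (simp_all add: G_def del: e.simps)
    ultimately show ?thesis using S_trans[OF 1] by simp
  qed
  have Gm: "G m = br (e m i) (e l (i + 1))" using m by (auto simp: G_def simp del: e.simps)
  have "G m - G 0 \<in> S N"
  proof (cases "m = N - 1")
    case True
    have "G 1 - G 0 \<in> S N" using A[of 1 0] N by simp
    then show ?thesis using True S_trans[OF B] by simp
  next
    case False
    then show ?thesis using A[of m 0] m by simp
  qed
  then show ?thesis unfolding Gm G0 .
qed

text \<open>Index 1 is the definition of \<open>e\<close> together with antisymmetry, index 2 is
  where the relations enter, and from index 3 on the Jacobi identity determines the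
  brackets.\<close>

lemma graded: "graded N"
proof (induction N rule: less_induct)
  case (less N)
  consider "N \<le> 1" | "N = 2" | "N \<ge> 3" by linarith
  then show ?case
  proof cases
    case 1
    then show ?thesis
      unfolding graded_def by (auto simp: le_Suc_eq br_self S_0 cyclic_sum_3)
  next
    case 2
    have ml: "(m = 0 \<and> l = 1) \<or> (m = 1 \<and> l = 0)" if "Suc (m + l) = 2" for m l :: nat using that by auto
    have d1: "br (a i) (e 1 i) \<in> S 2" for i using rel1[of i] I_S by simp
    have d2: "br (e 1 i) (a i) \<in> S 2" for i using S_neg[OF d1[of i]] br_antisym[of "e 1 i" "a i"] by simp
    have o1: "br (a i) (e 1 (i + 1)) - e 2 (i + 2) \<in> S 2" for i
      by (simp add: numeral_2_eq_2 cyclic_sum_3 S_0)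
    \<comment> \<open>The right-hand side \<open>(r_j - r_i) a_k\<close> has index 0, so modulo
      \<open>S 2\<close> the second relation says that the two double brackets agree; one is
      \<open>- e 2 (i + 2)\<close>, the other, up to sign, the bracket of \<open>e 1 i\<close> and
      \<open>a (i + 1)\<close>.\<close>
    have o2: "br (e 1 i) (a (i + 1)) - e 2 (i + 2) \<in> S 2" for i
    proof -
      have "e 0 (i + 2) \<in> S 2" by (rule e_S) simp
      then have "br (a i) (br (a i) (a (i + 2))) - br (a (i + 1)) (br (a (i + 1)) (a (i + 2)))
          - scale (r (i + 1) - r i) (a (i + 2)) + scale (r (i + 1) - r i) (a (i + 2)) \<in> S 2"
        using S_add[OF I_S[OF rel2[of i]] S_scale[of "e 0 (i + 2)" 2 "r (i + 1) - r i"]] by simp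
      moreover have "br (e 1 i) (a (i + 1)) = - br (a (i + 1)) (br (a (i + 1)) (a (i + 2)))"
        using br_antisym[of "e 1 i" "a (i + 1)"] by simp
      moreover have "e 2 (i + 2) = - br (a i) (br (a i) (a (i + 2)))"
        using br_antisym[of "a (i + 2)" "a i"] by (simp add: numeral_2_eq_2 cyclic_sum_3 br_minus_right)
      ultimately show ?thesis by simp
    qed
    show ?thesis
      unfolding graded_def 2 using ml d1 d2 o1 o2 by fastforce
  next
    case 3
    then show ?thesis
      unfolding graded_def using diag_in_S[OF less] off_diag_in_S[OF less] by blast
  qed
qed

text \<open>Compatibility of the bracket with the filtration; it lets the steps \<open>S n\<close>
  absorb every Lie word.\<close>

lemma br_S_S:
  assumes "x \<in> S p" "y \<in> S q"
  shows "br x y \<in> S (Suc (p + q))"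
  using assms(1) unfolding S_def[of p]
proof (induction rule: span_induct_alt)
  case base
  then show ?case by (simp add: br_zero S_0)
next
  case (step c x x')
  have "br x y \<in> S (Suc (p + q))"
  proof (cases "x \<in> I")
    case True
    then show ?thesis using I_S[OF ideal[OF True, of "- y"]] br_antisym[of x y] by (simp add: br_minus_left)
  next
    case False
    then obtain l j where x: "x = e l j" "l < p" using step by blast
    then show ?thesis using br_e_S[OF graded assms(2), of l j] S_mono[of "Suc (l + q)" "Suc (p + q)"] by simp
  qed
  then show ?case using step by (simp add: br_add_left br_scale_left S_add S_scale)
qed

end

subsection \<open>Tensor products with the special linear Lie algebra\<close>

text \<open>Operations on quotients are defined as unions over representatives. Once the sets in
  such a union are known to be equal, the union over a nonempty index set is that common
  set.\<close>

lemma UN_const: "x \<in> U \<Longrightarrow> (\<And>x. x \<in> U \<Longrightarrow> F x = C) \<Longrightarrow> (\<Union>x\<in>U. F x) = C"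
  by (auto simp del: SUP_constant)

lemma UN2_const:
  "x \<in> U \<Longrightarrow> y \<in> V \<Longrightarrow> (\<And>x y. x \<in> U \<Longrightarrow> y \<in> V \<Longrightarrow> F x y = C) \<Longrightarrow>
    (\<Union>x\<in>U. \<Union>y\<in>V. F x y) = C"
  by (rule UN_const, assumption, rule UN_const)

lemma lookup_fscale [simp]: "Poly_Mapping.lookup (fscale c x) k = c * Poly_Mapping.lookup x k"
  by (simp add: fscale_def Poly_Mapping.map.rep_eq when_def)

lemma vector_space_fscale: "vector_space (fscale :: complex \<Rightarrow> ('k \<Rightarrow>\<^sub>0 complex) \<Rightarrow> _)"
  by unfold_locales (auto intro!: poly_mapping_eqI simp: lookup_add algebra_simps)

interpretation fscale: vector_space fscale by (rule vector_space_fscale)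

lemma keys_fscale: "Poly_Mapping.keys (fscale c x) \<subseteq> Poly_Mapping.keys x"
  by (auto simp: in_keys_iff)

lemma pure_decompose: "x = (\<Sum>k\<in>Poly_Mapping.keys x. fscale (Poly_Mapping.lookup x k) (pure (fst k) (snd k)))"
proof -
  have "x = (\<Sum>k\<in>Poly_Mapping.keys x. Poly_Mapping.single k (Poly_Mapping.lookup x k))"
    by (rule poly_mapping_eqI) (simp add: lookup_sum lookup_single when_def in_keys_iff)
  also have "\<dots> = (\<Sum>k\<in>Poly_Mapping.keys x. fscale (Poly_Mapping.lookup x k) (pure (fst k) (snd k)))"
    by (intro sum.cong refl poly_mapping_eqI) (simp_all add: pure_def lookup_single when_def)
  finally show ?thesis .
qed

text \<open>The linear extension of a map on basis elements. Formal brackets, tensor maps,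
  functionals on tensors and evaluation of polynomials are all of this kind, so linearity is proved
  once.\<close>

definition lext :: "(complex \<Rightarrow> 'v \<Rightarrow> 'v) \<Rightarrow> ('k \<Rightarrow> 'v) \<Rightarrow> ('k \<Rightarrow>\<^sub>0 complex) \<Rightarrow> 'v :: ab_group_add" where
  "lext s h x = (\<Sum>k\<in>Poly_Mapping.keys x. s (Poly_Mapping.lookup x k) (h k))"

lemma lext_superset:
  fixes scale :: "complex \<Rightarrow> 'b :: ab_group_add \<Rightarrow> 'b"
  assumes vs: "vector_space scale" and "finite S" "Poly_Mapping.keys x \<subseteq> S"
  shows "lext scale h x = (\<Sum>k\<in>S. scale (Poly_Mapping.lookup x k) (h k))"
proof -
  interpret v: vector_space scale by (rule vs)
  show ?thesis
    unfolding lext_def using assms(2,3)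
    by (intro sum.mono_neutral_left) (auto simp: in_keys_iff v.scale_zero_left)
qed

lemma lext_linear:
  fixes scale :: "complex \<Rightarrow> 'b :: ab_group_add \<Rightarrow> 'b"
  assumes vs: "vector_space scale"
  shows "lext scale h (x + y) = lext scale h x + lext scale h y"
    "lext scale h (fscale c x) = scale c (lext scale h x)"
    "lext scale h (x - y) = lext scale h x - lext scale h y"
    "lext scale h 0 = 0"
proof -
  interpret v: vector_space scale by (rule vs)
  let ?S = "Poly_Mapping.keys x \<union> Poly_Mapping.keys y"
  have sup: "lext scale h z = (\<Sum>k\<in>?S. scale (Poly_Mapping.lookup z k) (h k))" if "Poly_Mapping.keys z \<subseteq> ?S" for z
    by (rule lext_superset[OF vs _ that]) simp
  show "lext scale h (x + y) = lext scale h x + lext scale h y"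
    using Poly_Mapping.keys_add[of x y]
    by (simp add: sup lookup_add v.scale_left_distrib sum.distrib)
  show "lext scale h (x - y) = lext scale h x - lext scale h y"
    using keys_diff[of x y] by (simp add: sup lookup_minus v.scale_left_diff_distrib sum_subtractf)
  have "lext scale h (fscale c x) = (\<Sum>k\<in>Poly_Mapping.keys x. scale (c * Poly_Mapping.lookup x k) (h k))"
    using lext_superset[OF vs finite_keys keys_fscale, of h c x] by simp
  then show "lext scale h (fscale c x) = scale c (lext scale h x)"
    by (simp add: lext_def v.scale_sum_right)
  show "lext scale h 0 = 0" by (simp add: lext_def)
qed

lemma lext_pure:
  fixes scale :: "complex \<Rightarrow> 'b :: ab_group_add \<Rightarrow> 'b"
  assumes vs: "vector_space scale"
  shows "lext scale h (pure a b) = h (a, b)"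
proof -
  interpret v: vector_space scale by (rule vs)
  show ?thesis by (simp add: lext_def pure_def)
qed

lemma lext_sum:
  fixes scale :: "complex \<Rightarrow> 'b :: ab_group_add \<Rightarrow> 'b"
  assumes vs: "vector_space scale"
  shows "lext scale h (\<Sum>i\<in>I. x i) = (\<Sum>i\<in>I. lext scale h (x i))"
  by (induction I rule: infinite_finite_induct) (simp_all add: lext_linear[OF vs])

lemma vector_space_times: "vector_space ((*) :: complex \<Rightarrow> complex \<Rightarrow> complex)"
  by unfold_locales (simp_all add: algebra_simps)

section \<open>A basis of the special linear Lie algebra\<close>

definition basis_vec :: "3 \<Rightarrow> complex^2^2" where
  "basis_vec k = (if k = 1 then v\<^sub>1 else if k = 2 then v\<^sub>2 else v\<^sub>3)"

definition basis_coord :: "complex^2^2 \<Rightarrow> 3 \<Rightarrow> complex" where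
  "basis_coord A k = (if k = 1 then - 2 * \<i> * (A \<sharp> 1 \<sharp> 1) else if k = 2 then A \<sharp> 1 \<sharp> 2 - A \<sharp> 2 \<sharp> 1
     else - \<i> * (A \<sharp> 1 \<sharp> 2 + A \<sharp> 2 \<sharp> 1))"

lemma sl2_sel [simp]:
  "A \<in> carrier sl2 \<longleftrightarrow> trace A = 0" "A \<oplus>\<^bsub>sl2\<^esub> B = A + B" "\<zero>\<^bsub>sl2\<^esub> = 0"
  "c \<odot>\<^bsub>sl2\<^esub> A = (\<chi> i j. c * A \<sharp> i \<sharp> j)" "lie_bracket sl2 A B = A ** B - B ** A"
  by (simp_all add: sl2_def)

lemma mat2_nth [simp]:
  "mat2 a b c d \<sharp> 1 \<sharp> 1 = a" "mat2 a b c d \<sharp> 1 \<sharp> 2 = b" "mat2 a b c d \<sharp> 2 \<sharp> 1 = c" "mat2 a b c d \<sharp> 2 \<sharp> 2 = d"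
  by (simp_all add: mat2_def)

lemma mat_eq_iff_2: "(A :: complex^2^2) = B \<longleftrightarrow>
    A \<sharp> 1 \<sharp> 1 = B \<sharp> 1 \<sharp> 1 \<and> A \<sharp> 1 \<sharp> 2 = B \<sharp> 1 \<sharp> 2 \<and> A \<sharp> 2 \<sharp> 1 = B \<sharp> 2 \<sharp> 1 \<and> A \<sharp> 2 \<sharp> 2 = B \<sharp> 2 \<sharp> 2"
  by (auto simp: vec_eq_iff forall_2)

lemma matrix_mult_nth_2: "((A :: complex^2^2) ** B) \<sharp> i \<sharp> j = A \<sharp> i \<sharp> 1 * B \<sharp> 1 \<sharp> j + A \<sharp> i \<sharp> 2 * B \<sharp> 2 \<sharp> j"
  by (simp add: matrix_matrix_mult_def sum_2)

lemma trace_2: "trace (A :: complex^2^2) = A \<sharp> 1 \<sharp> 1 + A \<sharp> 2 \<sharp> 2"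
  by (simp add: trace_def sum_2)

lemma basis_vec_carrier: "basis_vec k \<in> carrier sl2"
  by (simp add: basis_vec_def v\<^sub>1_def v\<^sub>2_def v\<^sub>3_def trace_2)

lemma basis_coord_vec: "basis_coord (basis_vec j) k = (if j = k then 1 else 0)"
  using exhaust_3[of j] exhaust_3[of k]
  by (auto simp: basis_coord_def basis_vec_def v\<^sub>1_def v\<^sub>2_def v\<^sub>3_def)

lemma basis_expand:
  assumes "A \<in> carrier sl2"
  shows "A = basis_coord A 1 \<odot>\<^bsub>sl2\<^esub> basis_vec 1 \<oplus>\<^bsub>sl2\<^esub> basis_coord A 2 \<odot>\<^bsub>sl2\<^esub> basis_vec 2
    \<oplus>\<^bsub>sl2\<^esub> basis_coord A 3 \<odot>\<^bsub>sl2\<^esub> basis_vec 3"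
proof -
  have "A \<sharp> 2 \<sharp> 2 = - A \<sharp> 1 \<sharp> 1" using assms by (simp add: trace_2 eq_neg_iff_add_eq_0 add.commute)
  then show ?thesis
    by (simp add: mat_eq_iff_2 basis_coord_def basis_vec_def v\<^sub>1_def v\<^sub>2_def v\<^sub>3_def field_simps)
qed

text \<open>The structure constants of the cross product. Multiples by \<open>- 1\<close> and 0 are
  written with the scalar action so that the tensor relators can move the scalars.\<close>

lemma basis_bracket:
  "lie_bracket sl2 (basis_vec (k + 1)) (basis_vec (k + 2)) = basis_vec k"
  "lie_bracket sl2 (basis_vec (k + 2)) (basis_vec (k + 1)) = (- 1) \<odot>\<^bsub>sl2\<^esub> basis_vec k"
  "lie_bracket sl2 (basis_vec k) (basis_vec k) = 0 \<odot>\<^bsub>sl2\<^esub> basis_vec k"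
  using exhaust_3[of k]
  by (auto simp: mat_eq_iff_2 matrix_mult_nth_2 basis_vec_def v\<^sub>1_def v\<^sub>2_def v\<^sub>3_def)

text \<open>Closure and bilinearity of the product make the bracket on
  \<open>sl2 \<otimes> A\<close> well defined. The Lie laws of the tensor products in question are
  obtained later by transport from the model.\<close>

locale tensor_algebra =
  fixes A :: "(complex, 'w, 'n) module_scheme"
  assumes closed: "f \<in> carrier A \<Longrightarrow> g \<in> carrier A \<Longrightarrow> f \<oplus>\<^bsub>A\<^esub> g \<in> carrier A"
      "f \<in> carrier A \<Longrightarrow> c \<odot>\<^bsub>A\<^esub> f \<in> carrier A"
      "f \<in> carrier A \<Longrightarrow> g \<in> carrier A \<Longrightarrow> f \<otimes>\<^bsub>A\<^esub> g \<in> carrier A"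
      "\<zero>\<^bsub>A\<^esub> \<in> carrier A"
    and mult_add: "f \<in> carrier A \<Longrightarrow> f' \<in> carrier A \<Longrightarrow> g \<in> carrier A \<Longrightarrow>
        (f \<oplus>\<^bsub>A\<^esub> f') \<otimes>\<^bsub>A\<^esub> g = f \<otimes>\<^bsub>A\<^esub> g \<oplus>\<^bsub>A\<^esub> f' \<otimes>\<^bsub>A\<^esub> g"
      "f \<in> carrier A \<Longrightarrow> g \<in> carrier A \<Longrightarrow> g' \<in> carrier A \<Longrightarrow>
        f \<otimes>\<^bsub>A\<^esub> (g \<oplus>\<^bsub>A\<^esub> g') = f \<otimes>\<^bsub>A\<^esub> g \<oplus>\<^bsub>A\<^esub> f \<otimes>\<^bsub>A\<^esub> g'"
    and mult_smult: "f \<in> carrier A \<Longrightarrow> g \<in> carrier A \<Longrightarrow> (c \<odot>\<^bsub>A\<^esub> f) \<otimes>\<^bsub>A\<^esub> g = c \<odot>\<^bsub>A\<^esub> (f \<otimes>\<^bsub>A\<^esub> g)"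
      "f \<in> carrier A \<Longrightarrow> g \<in> carrier A \<Longrightarrow> f \<otimes>\<^bsub>A\<^esub> (c \<odot>\<^bsub>A\<^esub> g) = c \<odot>\<^bsub>A\<^esub> (f \<otimes>\<^bsub>A\<^esub> g)"
begin

abbreviation "null \<equiv> tensor_null sl2 A"
abbreviation "cls \<equiv> tensor_class sl2 A"

lemma null_subspace: "fscale.subspace null"
  unfolding tensor_null_def by (rule fscale.subspace_span)

lemmas null_add = fscale.subspace_add[OF null_subspace] and null_diff = fscale.subspace_diff[OF null_subspace]
  and null_scale = fscale.subspace_scale[OF null_subspace] and null_0 = fscale.subspace_0[OF null_subspace]

lemma cls_eq_iff: "cls x = cls y \<longleftrightarrow> x - y \<in> null"
proof
  assume "cls x = cls y"
  moreover have "x \<in> cls x" unfolding tensor_class_def using null_0 by (auto intro: rev_image_eqI)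
  ultimately obtain n where "x = y + n" "n \<in> null" by (auto simp: tensor_class_def)
  then show "x - y \<in> null" by simp
next
  assume xy: "x - y \<in> null"
  show "cls x = cls y"
    unfolding tensor_class_def
  proof (intro equalityI subsetI; elim imageE)
    fix z n assume "z = x + n" "n \<in> null"
    then show "z \<in> (+) y ` null"
      using null_add[OF xy, of n] by (intro rev_image_eqI[of "x - y + n"]) auto
  next
    fix z n assume "z = y + n" "n \<in> null"
    then show "z \<in> (+) x ` null"
      using null_diff[OF _ xy, of n] by (intro rev_image_eqI[of "n - (x - y)"]) auto
  qed
qed

lemma self_in_cls: "x \<in> cls x"
  unfolding tensor_class_def using null_0 by (auto intro: rev_image_eqI)

lemma in_clsD: "y \<in> cls x \<Longrightarrow> y - x \<in> null"
  by (auto simp: tensor_class_def)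

lemma relators:
  assumes "v \<in> carrier sl2" "w \<in> carrier A"
  shows "v' \<in> carrier sl2 \<Longrightarrow> pure (v \<oplus>\<^bsub>sl2\<^esub> v') w - pure v w - pure v' w \<in> null"
    "w' \<in> carrier A \<Longrightarrow> pure v (w \<oplus>\<^bsub>A\<^esub> w') - pure v w - pure v w' \<in> null"
    "pure (c \<odot>\<^bsub>sl2\<^esub> v) w - fscale c (pure v w) \<in> null"
    "pure v (c \<odot>\<^bsub>A\<^esub> w) - fscale c (pure v w) \<in> null"
  unfolding tensor_null_def using assms
  by (intro fscale.span_base; unfold tensor_relators_def; blast)+

lemma null_induct [consumes 1, case_names zero lin add_left add_right smult_left smult_right]:
  assumes "x \<in> null" and zero: "P 0"
    and lin: "\<And>c x y. P x \<Longrightarrow> P y \<Longrightarrow> P (fscale c x + y)"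
    and "\<And>v v' w. v \<in> carrier sl2 \<Longrightarrow> v' \<in> carrier sl2 \<Longrightarrow> w \<in> carrier A \<Longrightarrow>
      P (pure (v \<oplus>\<^bsub>sl2\<^esub> v') w - pure v w - pure v' w)"
    and "\<And>v w w'. v \<in> carrier sl2 \<Longrightarrow> w \<in> carrier A \<Longrightarrow> w' \<in> carrier A \<Longrightarrow>
      P (pure v (w \<oplus>\<^bsub>A\<^esub> w') - pure v w - pure v w')"
    and "\<And>c v w. v \<in> carrier sl2 \<Longrightarrow> w \<in> carrier A \<Longrightarrow> P (pure (c \<odot>\<^bsub>sl2\<^esub> v) w - fscale c (pure v w))"
    and "\<And>c v w. v \<in> carrier sl2 \<Longrightarrow> w \<in> carrier A \<Longrightarrow> P (pure v (c \<odot>\<^bsub>A\<^esub> w) - fscale c (pure v w))"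
  shows "P x"
  using assms(1) unfolding tensor_null_def
proof (induction rule: fscale.span_induct_alt)
  case base show ?case by (rule zero)
next
  case (step c x y)
  have "P x" using step(1) unfolding tensor_relators_def using assms(4-7) by blast
  then show ?case using step lin by blast
qed

abbreviation "sl2_dom \<equiv> carrier sl2 \<times> carrier A"

lemma sl2_closed: "v \<in> carrier sl2 \<Longrightarrow> v' \<in> carrier sl2 \<Longrightarrow> v \<oplus>\<^bsub>sl2\<^esub> v' \<in> carrier sl2"
  "v \<in> carrier sl2 \<Longrightarrow> c \<odot>\<^bsub>sl2\<^esub> v \<in> carrier sl2"
  "lie_bracket sl2 v v' \<in> carrier sl2"
  by (simp_all add: trace_2 matrix_mult_nth_2 algebra_simps flip: distrib_left)

lemma keys_pure: "Poly_Mapping.keys (pure v w) = {(v, w)}"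
  by (simp add: pure_def)

lemma keys_lin_subset:
  "Poly_Mapping.keys x \<subseteq> D \<Longrightarrow> Poly_Mapping.keys y \<subseteq> D \<Longrightarrow> Poly_Mapping.keys (x + y) \<subseteq> D"
  "Poly_Mapping.keys x \<subseteq> D \<Longrightarrow> Poly_Mapping.keys y \<subseteq> D \<Longrightarrow> Poly_Mapping.keys (x - y) \<subseteq> D"
  "Poly_Mapping.keys x \<subseteq> D \<Longrightarrow> Poly_Mapping.keys (fscale c x) \<subseteq> D"
  using Poly_Mapping.keys_add[of x y] keys_diff[of x y] keys_fscale[of c x] by blast+

lemma keys_pure_subset:
  "v \<in> carrier sl2 \<Longrightarrow> w \<in> carrier A \<Longrightarrow> Poly_Mapping.keys (pure v w) \<subseteq> sl2_dom"
  by (simp add: keys_pure)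

text \<open>Relators are supported on the carriers, so a coset of a supported function contains only
  supported functions. The unions over representatives thus stay where the bracket respects the
  relators.\<close>

lemma keys_null: "x \<in> null \<Longrightarrow> Poly_Mapping.keys x \<subseteq> sl2_dom"
proof (induction rule: null_induct)
  case (lin c x y)
  then show ?case by (intro keys_lin_subset)
qed (simp, (intro keys_lin_subset keys_pure_subset sl2_closed closed; assumption)+)

lemma keys_cls: "x \<in> cls y \<Longrightarrow> Poly_Mapping.keys y \<subseteq> sl2_dom \<Longrightarrow> Poly_Mapping.keys x \<subseteq> sl2_dom"
  using keys_lin_subset(1)[OF keys_null[OF in_clsD]] by force

lemma formal_bracket_lext:
  "formal_bracket sl2 A x y =
     lext fscale (\<lambda>(a, f). lext fscale (\<lambda>(b, g). pure (lie_bracket sl2 a b) (f \<otimes>\<^bsub>A\<^esub> g)) y) x"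
  unfolding formal_bracket_def lext_def
  by (intro sum.cong refl) (auto simp: fscale.scale_sum_right intro!: sum.cong)

lemma formal_bracket_lext':
  "formal_bracket sl2 A x y =
     lext fscale (\<lambda>(b, g). lext fscale (\<lambda>(a, f). pure (lie_bracket sl2 a b) (f \<otimes>\<^bsub>A\<^esub> g)) x) y"
  unfolding formal_bracket_def lext_def case_prod_unfold
  by (subst sum.swap) (auto simp: fscale.scale_sum_right mult.commute intro!: sum.cong)

lemma formal_bracket_linear:
  "formal_bracket sl2 A (x + x') y = formal_bracket sl2 A x y + formal_bracket sl2 A x' y"
  "formal_bracket sl2 A (x - x') y = formal_bracket sl2 A x y - formal_bracket sl2 A x' y"
  "formal_bracket sl2 A (fscale c x) y = fscale c (formal_bracket sl2 A x y)"
  "formal_bracket sl2 A x (y + y') = formal_bracket sl2 A x y + formal_bracket sl2 A x y'"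
  "formal_bracket sl2 A x (y - y') = formal_bracket sl2 A x y - formal_bracket sl2 A x y'"
  "formal_bracket sl2 A x (fscale c y) = fscale c (formal_bracket sl2 A x y)"
  "formal_bracket sl2 A 0 y = 0" "formal_bracket sl2 A x 0 = 0"
  "formal_bracket sl2 A (pure a f) (pure b g) = pure (lie_bracket sl2 a b) (f \<otimes>\<^bsub>A\<^esub> g)"
proof -
  note lin = lext_linear[OF vector_space_fscale]
  show "formal_bracket sl2 A (x + x') y = formal_bracket sl2 A x y + formal_bracket sl2 A x' y"
    "formal_bracket sl2 A (x - x') y = formal_bracket sl2 A x y - formal_bracket sl2 A x' y"
    "formal_bracket sl2 A (fscale c x) y = fscale c (formal_bracket sl2 A x y)"
    "formal_bracket sl2 A 0 y = 0"
    by (simp_all only: formal_bracket_lext lin)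
  show "formal_bracket sl2 A x (y + y') = formal_bracket sl2 A x y + formal_bracket sl2 A x y'"
    "formal_bracket sl2 A x (y - y') = formal_bracket sl2 A x y - formal_bracket sl2 A x y'"
    "formal_bracket sl2 A x (fscale c y) = fscale c (formal_bracket sl2 A x y)"
    "formal_bracket sl2 A x 0 = 0"
    by (simp_all only: formal_bracket_lext' lin)
  show "formal_bracket sl2 A (pure a f) (pure b g) = pure (lie_bracket sl2 a b) (f \<otimes>\<^bsub>A\<^esub> g)"
    by (simp add: formal_bracket_lext lext_pure[OF vector_space_fscale])
qed

lemma sl2_bracket_linear:
  "lie_bracket sl2 (v \<oplus>\<^bsub>sl2\<^esub> v') b = lie_bracket sl2 v b \<oplus>\<^bsub>sl2\<^esub> lie_bracket sl2 v' b"
  "lie_bracket sl2 b (v \<oplus>\<^bsub>sl2\<^esub> v') = lie_bracket sl2 b v \<oplus>\<^bsub>sl2\<^esub> lie_bracket sl2 b v'"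
  "lie_bracket sl2 (c \<odot>\<^bsub>sl2\<^esub> v) b = c \<odot>\<^bsub>sl2\<^esub> lie_bracket sl2 v b"
  "lie_bracket sl2 b (c \<odot>\<^bsub>sl2\<^esub> v) = c \<odot>\<^bsub>sl2\<^esub> lie_bracket sl2 b v"
  by (simp_all add: mat_eq_iff_2 matrix_mult_nth_2 algebra_simps)

lemma formal_bracket_null_left:
  assumes x: "x \<in> null" and y: "Poly_Mapping.keys y \<subseteq> sl2_dom"
  shows "formal_bracket sl2 A x y \<in> null"
proof -
  have pure: "formal_bracket sl2 A x (pure b g) \<in> null" if b: "b \<in> carrier sl2" "g \<in> carrier A" for b g
    using x
  proof (induction rule: null_induct)
    case zero show ?case by (simp add: formal_bracket_linear null_0)
  next
    case (lin c x y) then show ?case by (simp add: formal_bracket_linear null_add null_scale)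
  qed (simp_all only: formal_bracket_linear sl2_bracket_linear mult_add mult_smult b
        relators sl2_closed closed)
  have "formal_bracket sl2 A x y = (\<Sum>k\<in>Poly_Mapping.keys y. fscale (Poly_Mapping.lookup y k) (formal_bracket sl2 A x (pure (fst k) (snd k))))"
    unfolding formal_bracket_lext' lext_pure[OF vector_space_fscale] lext_def[of _ _ y] by (simp add: case_prod_unfold)
  also have "\<dots> \<in> null"
    using y by (intro fscale.subspace_sum[OF null_subspace] null_scale pure) auto
  finally show ?thesis .
qed

lemma formal_bracket_null_right:
  assumes y: "y \<in> null" and x: "Poly_Mapping.keys x \<subseteq> sl2_dom"
  shows "formal_bracket sl2 A x y \<in> null"
proof -
  have pure: "formal_bracket sl2 A (pure b g) y \<in> null" if b: "b \<in> carrier sl2" "g \<in> carrier A" for b g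
    using y
  proof (induction rule: null_induct)
    case zero show ?case by (simp add: formal_bracket_linear null_0)
  next
    case (lin c x y) then show ?case by (simp add: formal_bracket_linear null_add null_scale)
  qed (simp_all only: formal_bracket_linear sl2_bracket_linear mult_add mult_smult b
        relators sl2_closed closed)
  have "formal_bracket sl2 A x y = (\<Sum>k\<in>Poly_Mapping.keys x. fscale (Poly_Mapping.lookup x k) (formal_bracket sl2 A (pure (fst k) (snd k)) y))"
    unfolding formal_bracket_lext lext_pure[OF vector_space_fscale] lext_def[of _ _ x] by (simp add: case_prod_unfold)
  also have "\<dots> \<in> null"
    using x by (intro fscale.subspace_sum[OF null_subspace] null_scale pure) auto
  finally show ?thesis .
qed

lemma tensor_lie_add: "cls x \<oplus>\<^bsub>tensor_lie sl2 A\<^esub> cls y = cls (x + y)"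
proof -
  have "(\<Union>x\<in>cls x. \<Union>y\<in>cls y. cls (x + y)) = cls (x + y)"
  proof (rule UN2_const[OF self_in_cls self_in_cls])
    fix x' y' assume "x' \<in> cls x" "y' \<in> cls y"
    then have "(x' - x) + (y' - y) \<in> null" by (intro null_add in_clsD)
    then show "cls (x' + y') = cls (x + y)" by (simp add: cls_eq_iff algebra_simps)
  qed
  then show ?thesis by (simp add: tensor_lie_def)
qed

lemma tensor_lie_smult: "c \<odot>\<^bsub>tensor_lie sl2 A\<^esub> cls x = cls (fscale c x)"
proof -
  have "(\<Union>x\<in>cls x. cls (fscale c x)) = cls (fscale c x)"
  proof (rule UN_const[OF self_in_cls])
    fix x' assume "x' \<in> cls x"
    then have "fscale c (x' - x) \<in> null" by (intro null_scale in_clsD)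
    then show "cls (fscale c x') = cls (fscale c x)" by (simp add: cls_eq_iff fscale.scale_right_diff_distrib)
  qed
  then show ?thesis by (simp add: tensor_lie_def)
qed

lemma tensor_lie_bracket:
  assumes "Poly_Mapping.keys x \<subseteq> sl2_dom" "Poly_Mapping.keys y \<subseteq> sl2_dom"
  shows "lie_bracket (tensor_lie sl2 A) (cls x) (cls y) = cls (formal_bracket sl2 A x y)"
proof -
  have "(\<Union>x\<in>cls x. \<Union>y\<in>cls y. cls (formal_bracket sl2 A x y)) = cls (formal_bracket sl2 A x y)"
  proof (rule UN2_const[OF self_in_cls self_in_cls])
    fix x' y' assume *: "x' \<in> cls x" "y' \<in> cls y"
    have "formal_bracket sl2 A (x' - x) y' + formal_bracket sl2 A x (y' - y) \<in> null"
      using * assms by (intro null_add formal_bracket_null_left formal_bracket_null_right in_clsD) (auto dest: keys_cls)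
    then show "cls (formal_bracket sl2 A x' y') = cls (formal_bracket sl2 A x y)"
      by (simp add: cls_eq_iff formal_bracket_linear)
  qed
  then show ?thesis by (simp add: tensor_lie_def)
qed

lemma tensor_lie_zero: "\<zero>\<^bsub>tensor_lie sl2 A\<^esub> = cls 0"
  by (simp add: tensor_lie_def)

text \<open>The normal form \<open>\<Sum> v_k \<otimes> f_k\<close>. In these coordinates
  \<open>sl2 \<otimes> A\<close> is the module of triples over \<open>A\<close>, with the cross
  product as bracket.\<close>

definition nf :: "(3 \<Rightarrow> 'w) \<Rightarrow> (complex^2^2, 'w) tensor" where
  "nf f = cls (\<Sum>k\<in>UNIV. pure (basis_vec k) (f k))"

lemma nf_add:
  assumes "\<And>k. f k \<in> carrier A" "\<And>k. g k \<in> carrier A"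
  shows "nf f \<oplus>\<^bsub>tensor_lie sl2 A\<^esub> nf g = nf (\<lambda>k. f k \<oplus>\<^bsub>A\<^esub> g k)"
proof -
  have "(\<Sum>k\<in>UNIV. pure (basis_vec k) (f k \<oplus>\<^bsub>A\<^esub> g k) - pure (basis_vec k) (f k) - pure (basis_vec k) (g k)) \<in> null"
    by (intro fscale.subspace_sum[OF null_subspace] relators basis_vec_carrier assms)
  then have "(\<Sum>k\<in>UNIV. pure (basis_vec k) (f k \<oplus>\<^bsub>A\<^esub> g k))
      - ((\<Sum>k\<in>UNIV. pure (basis_vec k) (f k)) + (\<Sum>k\<in>UNIV. pure (basis_vec k) (g k))) \<in> null"
    by (simp only: sum_subtractf diff_diff_eq sum.distrib)
  then show ?thesis unfolding nf_def tensor_lie_add by (rule cls_eq_iff[THEN iffD2, symmetric])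
qed

lemma nf_smult:
  assumes "\<And>k. f k \<in> carrier A"
  shows "c \<odot>\<^bsub>tensor_lie sl2 A\<^esub> nf f = nf (\<lambda>k. c \<odot>\<^bsub>A\<^esub> f k)"
proof -
  have "(\<Sum>k\<in>UNIV. pure (basis_vec k) (c \<odot>\<^bsub>A\<^esub> f k) - fscale c (pure (basis_vec k) (f k))) \<in> null"
    by (intro fscale.subspace_sum[OF null_subspace] relators basis_vec_carrier assms)
  then have "(\<Sum>k\<in>UNIV. pure (basis_vec k) (c \<odot>\<^bsub>A\<^esub> f k)) - fscale c (\<Sum>k\<in>UNIV. pure (basis_vec k) (f k)) \<in> null"
    by (simp only: sum_subtractf fscale.scale_sum_right)
  then show ?thesis unfolding nf_def tensor_lie_smult by (rule cls_eq_iff[THEN iffD2, symmetric])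
qed

lemma keys_nf_sum:
  assumes "\<And>k. f k \<in> carrier A"
  shows "Poly_Mapping.keys (\<Sum>k\<in>(UNIV :: 3 set). pure (basis_vec k) (f k)) \<subseteq> sl2_dom"
  unfolding sum_3 using assms basis_vec_carrier by (intro keys_lin_subset) (auto simp: keys_pure simp del: sl2_sel)

lemma sum_shift_3:
  fixes G :: "3 \<Rightarrow> 3 \<Rightarrow> 'b :: comm_monoid_add"
  shows "(\<Sum>i\<in>UNIV. \<Sum>j\<in>UNIV. G i j) = (\<Sum>k\<in>UNIV. G (k + 1) (k + 2) + G (k + 2) (k + 1) + G k k)"
proof -
  show ?thesis unfolding sum_3 add_3 by (simp only: add_ac)
qed

lemma nf_bracket:
  assumes f: "\<And>k. f k \<in> carrier A" and g: "\<And>k. g k \<in> carrier A"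
  shows "lie_bracket (tensor_lie sl2 A) (nf f) (nf g) =
    nf (\<lambda>k. f (k + 1) \<otimes>\<^bsub>A\<^esub> g (k + 2) \<oplus>\<^bsub>A\<^esub> (- 1) \<odot>\<^bsub>A\<^esub> (f (k + 2) \<otimes>\<^bsub>A\<^esub> g (k + 1)))"
proof -
  let ?p = "\<lambda>f. \<Sum>k\<in>UNIV. pure (basis_vec k) (f k)"
  let ?F = "\<lambda>i j. pure (lie_bracket sl2 (basis_vec i) (basis_vec j)) (f i \<otimes>\<^bsub>A\<^esub> g j)"
  let ?h = "\<lambda>k. f (k + 1) \<otimes>\<^bsub>A\<^esub> g (k + 2) \<oplus>\<^bsub>A\<^esub> (- 1) \<odot>\<^bsub>A\<^esub> (f (k + 2) \<otimes>\<^bsub>A\<^esub> g (k + 1))"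
  have "formal_bracket sl2 A (?p f) (?p g) = (\<Sum>i\<in>UNIV. \<Sum>j\<in>UNIV. ?F i j)"
    by (simp only: sum_3 formal_bracket_linear add_ac)
  also have "\<dots> = (\<Sum>k\<in>UNIV. ?F (k + 1) (k + 2) + ?F (k + 2) (k + 1) + ?F k k)"
    by (rule sum_shift_3)
  finally have fb: "formal_bracket sl2 A (?p f) (?p g) = (\<Sum>k\<in>UNIV. ?F (k + 1) (k + 2) + ?F (k + 2) (k + 1) + ?F k k)" .
  have "?F (k + 1) (k + 2) + ?F (k + 2) (k + 1) + ?F k k - pure (basis_vec k) (?h k) \<in> null" for k
  proof -
    let ?v = "basis_vec k" and ?a = "f (k + 1) \<otimes>\<^bsub>A\<^esub> g (k + 2)" and ?b = "f (k + 2) \<otimes>\<^bsub>A\<^esub> g (k + 1)"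
      and ?c = "f k \<otimes>\<^bsub>A\<^esub> g k"
    have ab: "?a \<in> carrier A" "?b \<in> carrier A" "?c \<in> carrier A" "(- 1) \<odot>\<^bsub>A\<^esub> ?b \<in> carrier A"
      using f g closed by auto
    \<comment> \<open>This combination of relators telescopes to the difference: the scalars
      \<open>- 1\<close> and 0 leave the first factor, the scalar \<open>- 1\<close> enters the
      second factor, and the two remaining terms are merged.\<close>
    have "(pure ((- 1) \<odot>\<^bsub>sl2\<^esub> ?v) ?b - fscale (- 1) (pure ?v ?b)) + (pure (0 \<odot>\<^bsub>sl2\<^esub> ?v) ?c - fscale 0 (pure ?v ?c))
        - (pure ?v (?a \<oplus>\<^bsub>A\<^esub> (- 1) \<odot>\<^bsub>A\<^esub> ?b) - pure ?v ?a - pure ?v ((- 1) \<odot>\<^bsub>A\<^esub> ?b))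
        - (pure ?v ((- 1) \<odot>\<^bsub>A\<^esub> ?b) - fscale (- 1) (pure ?v ?b)) \<in> null"
      by (intro null_add null_diff relators basis_vec_carrier ab)
    then show ?thesis unfolding basis_bracket by (simp add: algebra_simps del: sl2_sel)
  qed
  then have "(\<Sum>k\<in>UNIV. ?F (k + 1) (k + 2) + ?F (k + 2) (k + 1) + ?F k k - pure (basis_vec k) (?h k)) \<in> null"
    by (intro fscale.subspace_sum[OF null_subspace])
  then have "formal_bracket sl2 A (?p f) (?p g) - ?p ?h \<in> null" unfolding fb sum_subtractf .
  then show ?thesis
    unfolding nf_def tensor_lie_bracket[OF keys_nf_sum[OF f] keys_nf_sum[OF g]] cls_eq_iff .
qed

text \<open>A pure tensor is expanded in the basis and its scalars are moved into the second factor;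
  sums and multiples of normal forms are again normal forms.\<close>

lemma carrier_tensor_lie: "carrier (tensor_lie sl2 A) = {nf f | f. \<forall>k. f k \<in> carrier A}"
proof -
  have "cls x \<in> {nf f | f. \<forall>k. f k \<in> carrier A}" if x: "Poly_Mapping.keys x \<subseteq> sl2_dom" for x
  proof -
    have pure: "\<exists>f. (\<forall>k. f k \<in> carrier A) \<and> cls (pure v w) = nf f"
      if v: "v \<in> carrier sl2" and w: "w \<in> carrier A" for v w
    proof (intro exI conjI allI)
      let ?c = "basis_coord v" and ?e = basis_vec
      let ?s = "\<lambda>k. ?c k \<odot>\<^bsub>sl2\<^esub> ?e k"
      show "?c k \<odot>\<^bsub>A\<^esub> w \<in> carrier A" for k using w by (rule closed)
      have s: "?s k \<in> carrier sl2" for k by (intro sl2_closed basis_vec_carrier)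
      have s12: "?s 1 \<oplus>\<^bsub>sl2\<^esub> ?s 2 \<in> carrier sl2" by (intro sl2_closed s)
      have "(pure (?s 1 \<oplus>\<^bsub>sl2\<^esub> ?s 2 \<oplus>\<^bsub>sl2\<^esub> ?s 3) w - pure (?s 1 \<oplus>\<^bsub>sl2\<^esub> ?s 2) w - pure (?s 3) w)
          + (pure (?s 1 \<oplus>\<^bsub>sl2\<^esub> ?s 2) w - pure (?s 1) w - pure (?s 2) w)
          + (\<Sum>k\<in>UNIV. (pure (?s k) w - fscale (?c k) (pure (?e k) w))
             - (pure (?e k) (?c k \<odot>\<^bsub>A\<^esub> w) - fscale (?c k) (pure (?e k) w))) \<in> null"
        by (intro null_add null_diff fscale.subspace_sum[OF null_subspace] relators s s12 basis_vec_carrier w)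
      then have "pure (?s 1 \<oplus>\<^bsub>sl2\<^esub> ?s 2 \<oplus>\<^bsub>sl2\<^esub> ?s 3) w - (\<Sum>k\<in>UNIV. pure (?e k) (?c k \<odot>\<^bsub>A\<^esub> w)) \<in> null"
        by (simp add: sum_3 algebra_simps del: sl2_sel)
      then show "cls (pure v w) = nf (\<lambda>k. ?c k \<odot>\<^bsub>A\<^esub> w)"
        unfolding nf_def cls_eq_iff basis_expand[OF v, symmetric] .
    qed
    have "\<exists>f. (\<forall>k. f k \<in> carrier A) \<and> cls (\<Sum>k\<in>K. fscale (c k) (pure (fst k) (snd k))) = nf f"
      if "finite K" "K \<subseteq> sl2_dom" for K c
      using that
    proof (induction K)
      case empty
      obtain f where f: "\<forall>k. f k \<in> carrier A" "cls (pure 0 \<zero>\<^bsub>A\<^esub>) = nf f"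
        using pure[of 0 "\<zero>\<^bsub>A\<^esub>"] closed by (auto simp: trace_2)
      have "cls 0 = 0 \<odot>\<^bsub>tensor_lie sl2 A\<^esub> nf f"
        unfolding f(2)[symmetric] tensor_lie_smult by simp
      also have "\<dots> = nf (\<lambda>k. 0 \<odot>\<^bsub>A\<^esub> f k)" using f(1) by (intro nf_smult) auto
      finally show ?case using f(1) closed by (intro exI[of _ "\<lambda>k. 0 \<odot>\<^bsub>A\<^esub> f k"]) auto
    next
      case (insert p K)
      obtain f where f: "\<forall>k. f k \<in> carrier A" "cls (pure (fst p) (snd p)) = nf f"
        using pure[of "fst p" "snd p"] insert.prems by auto
      obtain g where g: "\<forall>k. g k \<in> carrier A" "cls (\<Sum>k\<in>K. fscale (c k) (pure (fst k) (snd k))) = nf g"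
        using insert by auto
      have "cls (\<Sum>k\<in>insert p K. fscale (c k) (pure (fst k) (snd k))) =
          c p \<odot>\<^bsub>tensor_lie sl2 A\<^esub> nf f \<oplus>\<^bsub>tensor_lie sl2 A\<^esub> nf g"
        unfolding f(2)[symmetric] g(2)[symmetric] tensor_lie_smult tensor_lie_add using insert by simp
      also have "\<dots> = nf (\<lambda>k. c p \<odot>\<^bsub>A\<^esub> f k \<oplus>\<^bsub>A\<^esub> g k)"
        using f g closed by (simp add: nf_smult nf_add)
      finally show ?case using f g closed by (intro exI[of _ "\<lambda>k. c p \<odot>\<^bsub>A\<^esub> f k \<oplus>\<^bsub>A\<^esub> g k"]) auto
    qed
    from this[of "Poly_Mapping.keys x" "Poly_Mapping.lookup x"] x show ?thesis
      unfolding pure_decompose[symmetric] by auto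
  qed
  moreover have "nf f \<in> carrier (tensor_lie sl2 A)" if "\<forall>k. f k \<in> carrier A" for f
    using keys_nf_sum[of f] that by (auto simp: tensor_lie_def tensor_carrier_def nf_def)
  ultimately show ?thesis by (auto simp: tensor_lie_def tensor_carrier_def)
qed

text \<open>A character of \<open>A\<close> induces linear functionals on the tensor product.\<close>

lemma nf_eqD:
  fixes ev :: "'w \<Rightarrow> complex"
  assumes add: "\<And>f g. f \<in> carrier A \<Longrightarrow> g \<in> carrier A \<Longrightarrow> ev (f \<oplus>\<^bsub>A\<^esub> g) = ev f + ev g"
    and smult: "\<And>c f. f \<in> carrier A \<Longrightarrow> ev (c \<odot>\<^bsub>A\<^esub> f) = c * ev f"
    and eq: "nf f = nf g"
  shows "ev (f k) = ev (g k)"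
proof -
  let ?E = "lext (*) (\<lambda>(v, w). basis_coord v k * ev w)"
  have E0: "?E x = 0" if "x \<in> null" for x
    using that
  proof (induction rule: null_induct)
    case (lin c x y) then show ?case by (simp add: lext_linear[OF vector_space_times])
  qed (simp_all add: lext_linear[OF vector_space_times] lext_pure[OF vector_space_times] add smult basis_coord_def algebra_simps)
  have val: "?E (\<Sum>j\<in>UNIV. pure (basis_vec j) (f j)) = ev (f k)" for f
    by (simp add: lext_sum[OF vector_space_times] lext_pure[OF vector_space_times] basis_coord_vec if_distrib[of "\<lambda>x. x * _"] cong: if_cong)
  have "?E ((\<Sum>j\<in>UNIV. pure (basis_vec j) (f j)) - (\<Sum>j\<in>UNIV. pure (basis_vec j) (g j))) = 0"
    using eq by (intro E0) (simp add: nf_def cls_eq_iff)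
  then show ?thesis by (simp add: lext_linear(3)[OF vector_space_times] val)
qed

text \<open>Eigenvalues of \<open>\<phi>\<close> on the basis can be moved into the second factor,
  so the map acts on each coordinate separately.\<close>

lemma tensor_map_nf:
  assumes f: "\<And>k. f k \<in> carrier A"
    and \<phi>: "\<And>v. v \<in> carrier sl2 \<Longrightarrow> \<phi> v \<in> carrier sl2"
      "\<And>v v'. \<phi> (v \<oplus>\<^bsub>sl2\<^esub> v') = \<phi> v \<oplus>\<^bsub>sl2\<^esub> \<phi> v'" "\<And>c v. \<phi> (c \<odot>\<^bsub>sl2\<^esub> v) = c \<odot>\<^bsub>sl2\<^esub> \<phi> v"
    and \<psi>: "\<And>w. w \<in> carrier A \<Longrightarrow> \<psi> w \<in> carrier A"
      "\<And>w w'. w \<in> carrier A \<Longrightarrow> w' \<in> carrier A \<Longrightarrow> \<psi> (w \<oplus>\<^bsub>A\<^esub> w') = \<psi> w \<oplus>\<^bsub>A\<^esub> \<psi> w'"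
      "\<And>c w. w \<in> carrier A \<Longrightarrow> \<psi> (c \<odot>\<^bsub>A\<^esub> w) = c \<odot>\<^bsub>A\<^esub> \<psi> w"
    and eig: "\<And>k. \<phi> (basis_vec k) = \<epsilon> k \<odot>\<^bsub>sl2\<^esub> basis_vec k"
  shows "tensor_map sl2 A \<phi> \<psi> (nf f) = nf (\<lambda>k. \<epsilon> k \<odot>\<^bsub>A\<^esub> \<psi> (f k))"
proof -
  let ?T = "lext fscale (\<lambda>(v, w). pure (\<phi> v) (\<psi> w))"
  have T: "(\<Sum>(v, w)\<in>Poly_Mapping.keys x. fscale (Poly_Mapping.lookup x (v, w)) (pure (\<phi> v) (\<psi> w))) = ?T x" for x
    by (simp add: lext_def case_prod_unfold)
  note lin = lext_linear[OF vector_space_fscale] lext_pure[OF vector_space_fscale]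
  have T0: "?T x \<in> null" if "x \<in> null" for x
    using that
  proof (induction rule: null_induct)
    case zero show ?case by (simp add: lin null_0)
  next
    case (lin c x y) then show ?case by (simp add: lext_linear[OF vector_space_fscale] null_add null_scale)
  qed (simp_all only: lin prod.case \<phi> \<psi> relators)
  let ?p = "\<Sum>k\<in>UNIV. pure (basis_vec k) (f k)"
  have "tensor_map sl2 A \<phi> \<psi> (nf f) = cls (?T ?p)"
    unfolding tensor_map_def T nf_def
  proof (rule UN_const[OF self_in_cls])
    fix x assume "x \<in> cls ?p"
    then have "?T (x - ?p) \<in> null" by (intro T0 in_clsD)
    then show "cls (?T x) = cls (?T ?p)" by (simp only: lin cls_eq_iff)
  qed
  also have "?T ?p = (\<Sum>k\<in>UNIV. pure (\<phi> (basis_vec k)) (\<psi> (f k)))"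
    by (simp add: lext_sum[OF vector_space_fscale] lin)
  also have "cls \<dots> = nf (\<lambda>k. \<epsilon> k \<odot>\<^bsub>A\<^esub> \<psi> (f k))"
  proof -
    have "(\<Sum>k\<in>UNIV. (pure (\<epsilon> k \<odot>\<^bsub>sl2\<^esub> basis_vec k) (\<psi> (f k)) - fscale (\<epsilon> k) (pure (basis_vec k) (\<psi> (f k))))
        - (pure (basis_vec k) (\<epsilon> k \<odot>\<^bsub>A\<^esub> \<psi> (f k)) - fscale (\<epsilon> k) (pure (basis_vec k) (\<psi> (f k))))) \<in> null"
      by (intro fscale.subspace_sum[OF null_subspace] null_diff relators basis_vec_carrier \<psi> f)
    then show ?thesis
      unfolding nf_def cls_eq_iff eig by (simp only: sum_subtractf diff_diff_eq2 diff_add_cancel)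
  qed
  finally show ?thesis .
qed

end

subsection \<open>The presented algebra\<close>

\<comment> \<open>The free Lie algebra on three generators, as a type, so that the vector space
  locales apply. The relations are accounted for by an ideal of it.\<close>
quotient_type free_lie = "3 lie_term" / "lie_cong {}"
  by (rule equivpI) (auto simp: reflp_def symp_def transp_def intro: lie_cong.intros)

lemma abs_rep_free_lie: "abs_free_lie (rep_free_lie x) = x"
  by (rule Quotient3_abs_rep[OF Quotient3_free_lie])

instantiation free_lie :: ab_group_add
begin

lift_definition zero_free_lie :: free_lie is LZero .
lift_definition plus_free_lie :: "free_lie \<Rightarrow> free_lie \<Rightarrow> free_lie" is LAdd by (rule lie_cong.cong_add)
lift_definition uminus_free_lie :: "free_lie \<Rightarrow> free_lie" is "LScale (- 1)" by (rule lie_cong.cong_scale)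
lift_definition minus_free_lie :: "free_lie \<Rightarrow> free_lie \<Rightarrow> free_lie" is LDiff
  by (intro lie_cong.cong_add lie_cong.cong_scale)

instance
proof
  fix x y z :: free_lie
  show "x + y + z = x + (y + z)" by transfer (rule lie_cong.add_assoc)
  show "x + y = y + x" by transfer (rule lie_cong.add_comm)
  show "0 + x = x" by transfer (rule lie_cong.add_zero)
  show "- x + x = 0" by transfer (rule lie_cong.trans[OF lie_cong.add_comm lie_cong.add_inverse])
  show "x - y = x + - y" by transfer (rule lie_cong.refl)
qed

end

lift_definition free_scale :: "complex \<Rightarrow> free_lie \<Rightarrow> free_lie" is LScale by (rule lie_cong.cong_scale)
lift_definition free_bracket :: "free_lie \<Rightarrow> free_lie \<Rightarrow> free_lie" is LBracket by (rule lie_cong.cong_bracket)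
lift_definition free_gen :: "3 \<Rightarrow> free_lie" is LGen .

lemma vector_space_free_lie: "vector_space free_scale"
proof
  fix c d :: complex and x y :: free_lie
  show "free_scale c (x + y) = free_scale c x + free_scale c y" by transfer (rule lie_cong.scale_add_right)
  show "free_scale (c + d) x = free_scale c x + free_scale d x" by transfer (rule lie_cong.scale_add_left)
  show "free_scale c (free_scale d x) = free_scale (c * d) x" by transfer (rule lie_cong.scale_scale)
  show "free_scale 1 x = x" by transfer (rule lie_cong.scale_one)
qed

interpretation free_lie: lie_space free_scale free_bracket
proof (rule lie_space.intro[OF vector_space_free_lie lie_space_axioms.intro])
  fix c :: complex and x y z :: free_lie
  show "free_bracket (x + y) z = free_bracket x z + free_bracket y z" by transfer (rule lie_cong.bracket_add_left)
  show "free_bracket x (y + z) = free_bracket x y + free_bracket x z" by transfer (rule lie_cong.bracket_add_right)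
  show "free_bracket (free_scale c x) y = free_scale c (free_bracket x y)" by transfer (rule lie_cong.bracket_scale_left)
  show "free_bracket x (free_scale c y) = free_scale c (free_bracket x y)" by transfer (rule lie_cong.bracket_scale_right)
  show "free_bracket x x = 0" by transfer (rule lie_cong.bracket_self)
  show "free_bracket x (free_bracket y z) + free_bracket y (free_bracket z x) + free_bracket z (free_bracket x y) = 0"
    by transfer (rule lie_cong.jacobi)
qed

lemma lie_cong_mono: "lie_cong {} s t \<Longrightarrow> lie_cong R s t"
  by (induction rule: lie_cong.induct) (auto intro: lie_cong.intros)

lemma abs_free_lie_simps:
  "abs_free_lie (LAdd s t) = abs_free_lie s + abs_free_lie t"
  "abs_free_lie (LScale c s) = free_scale c (abs_free_lie s)"
  "abs_free_lie (LBracket s t) = free_bracket (abs_free_lie s) (abs_free_lie t)"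
  "abs_free_lie LZero = 0" "abs_free_lie (LGen i) = free_gen i"
  by (simp_all add: plus_free_lie.abs_eq free_scale.abs_eq free_bracket.abs_eq zero_free_lie_def free_gen.abs_eq)

definition rel_ideal :: "(3 lie_term \<times> 3 lie_term) set \<Rightarrow> free_lie set" where
  "rel_ideal R = {abs_free_lie t | t. lie_cong R t LZero}"

lemma abs_in_rel_ideal: "abs_free_lie t \<in> rel_ideal R \<longleftrightarrow> lie_cong R t LZero"
proof
  assume "abs_free_lie t \<in> rel_ideal R"
  then obtain s where s: "abs_free_lie t = abs_free_lie s" "lie_cong R s LZero" by (auto simp: rel_ideal_def)
  then have "lie_cong {} t s" by (simp add: free_lie.abs_eq_iff)
  then show "lie_cong R t LZero" using s(2) lie_cong.trans lie_cong_mono by blast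
qed (auto simp: rel_ideal_def)

text \<open>A congruence is determined by the class of zero. This connects the inductively defined
  congruence of the presentation with the ideal to which the filtration argument applies.\<close>

lemma lie_cong_via_ideal: "lie_cong R s t \<longleftrightarrow> abs_free_lie s - abs_free_lie t \<in> rel_ideal R"
proof -
  have "abs_free_lie s - abs_free_lie t = abs_free_lie (LDiff s t)"
    by (simp add: minus_free_lie.abs_eq)
  moreover have "lie_cong R (LDiff s t) LZero \<longleftrightarrow> lie_cong R s t"
  proof
    assume "lie_cong R s t"
    then have "lie_cong R (LDiff s t) (LDiff t t)" by (intro lie_cong.cong_add lie_cong.refl)
    then show "lie_cong R (LDiff s t) LZero" using lie_cong.add_inverse lie_cong.trans by blast
  next
    assume *: "lie_cong R (LDiff s t) LZero"
    have "abs_free_lie s = abs_free_lie (LAdd (LDiff s t) t)"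
      by (simp add: abs_free_lie_simps)
    then have "lie_cong {} s (LAdd (LDiff s t) t)" by (simp only: free_lie.abs_eq_iff)
    then have "lie_cong R s (LAdd (LDiff s t) t)" by (rule lie_cong_mono)
    moreover have "lie_cong R (LAdd (LDiff s t) t) (LAdd LZero t)"
      using * by (intro lie_cong.cong_add lie_cong.refl)
    moreover have "lie_cong R (LAdd LZero t) t" by (rule lie_cong.add_zero)
    ultimately show "lie_cong R s t" by (blast intro: lie_cong.trans)
  qed
  ultimately show ?thesis by (simp add: abs_in_rel_ideal)
qed

lemma rel_ideal_subspace: "free_lie.subspace (rel_ideal R)"
proof -
  have "0 \<in> rel_ideal R" using abs_in_rel_ideal[of LZero] by (simp add: abs_free_lie_simps lie_cong.refl)
  moreover have "x + y \<in> rel_ideal R" if xy: "x \<in> rel_ideal R" "y \<in> rel_ideal R" for x y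
  proof -
    obtain s t where st: "x = abs_free_lie s" "lie_cong R s LZero" "y = abs_free_lie t" "lie_cong R t LZero"
      using xy by (auto simp: rel_ideal_def)
    then have "lie_cong R (LAdd s t) (LAdd LZero LZero)" by (intro lie_cong.cong_add)
    then have "lie_cong R (LAdd s t) LZero" using lie_cong.add_zero lie_cong.trans by blast
    then show ?thesis using st by (auto simp: rel_ideal_def abs_free_lie_simps[symmetric])
  qed
  moreover have "free_scale c x \<in> rel_ideal R" if x: "x \<in> rel_ideal R" for c x
  proof -
    obtain s where s: "x = abs_free_lie s" "lie_cong R s LZero" using x by (auto simp: rel_ideal_def)
    then have "lie_cong R (LScale c s) (LScale c LZero)" by (intro lie_cong.cong_scale)
    moreover have "abs_free_lie (LScale c LZero) = abs_free_lie LZero"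
      by (simp add: abs_free_lie_simps free_lie.scale_zero_right)
    then have "lie_cong R (LScale c LZero) LZero" by (simp only: free_lie.abs_eq_iff lie_cong_mono)
    ultimately have "lie_cong R (LScale c s) LZero" by (rule lie_cong.trans)
    then show ?thesis using s by (auto simp: rel_ideal_def abs_free_lie_simps[symmetric])
  qed
  ultimately show ?thesis by (auto simp: free_lie.subspace_def)
qed

lemma rel_ideal_ideal: "y \<in> rel_ideal R \<Longrightarrow> free_bracket x y \<in> rel_ideal R"
proof -
  assume "y \<in> rel_ideal R"
  then obtain t where t: "y = abs_free_lie t" "lie_cong R t LZero" by (auto simp: rel_ideal_def)
  obtain s where s: "x = abs_free_lie s" using abs_rep_free_lie[of x] by metis
  have "lie_cong R (LBracket s t) (LBracket s LZero)" using t by (intro lie_cong.cong_bracket lie_cong.refl)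
  moreover have "abs_free_lie (LBracket s LZero) = abs_free_lie LZero"
    by (simp add: abs_free_lie_simps free_lie.br_zero)
  then have "lie_cong R (LBracket s LZero) LZero" by (simp only: free_lie.abs_eq_iff lie_cong_mono)
  ultimately have "lie_cong R (LBracket s t) LZero" by (rule lie_cong.trans)
  then show ?thesis using s t by (auto simp: rel_ideal_def abs_free_lie_simps[symmetric])
qed

lemma cyclic_triples_iff: "(i, j, k) \<in> cyclic_triples \<longleftrightarrow> j = i + 1 \<and> k = i + 2"
  using exhaust_3[of i] by (auto simp: cyclic_triples_def)

lemma p_relations_space_free_lie:
  "p_relations_space free_scale free_bracket (rel_ideal (p_relations r)) free_gen r"
proof (rule p_relations_space.intro[OF free_lie.lie_space_axioms p_relations_space_axioms.intro])
  fix i :: 3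
  have "lie_cong (p_relations r) (LBracket (LGen i) (LBracket (LGen (i + 1)) (LGen (i + 2)))) LZero"
    by (rule lie_cong.relation) (auto simp: p_relations_def cyclic_triples_iff)
  then show "free_bracket (free_gen i) (free_bracket (free_gen (i + 1)) (free_gen (i + 2))) \<in> rel_ideal (p_relations r)"
    by (simp add: abs_free_lie_simps[symmetric] abs_in_rel_ideal)
  have "lie_cong (p_relations r) (LDiff (LBracket (LGen i) (LBracket (LGen i) (LGen (i + 2))))
      (LBracket (LGen (i + 1)) (LBracket (LGen (i + 1)) (LGen (i + 2))))) (LScale (r (i + 1) - r i) (LGen (i + 2)))"
    by (rule lie_cong.relation) (auto simp: p_relations_def cyclic_triples_iff)
  then show "free_bracket (free_gen i) (free_bracket (free_gen i) (free_gen (i + 2)))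
      - free_bracket (free_gen (i + 1)) (free_bracket (free_gen (i + 1)) (free_gen (i + 2)))
      - free_scale (r (i + 1) - r i) (free_gen (i + 2)) \<in> rel_ideal (p_relations r)"
    unfolding lie_cong_via_ideal
    by (simp add: abs_free_lie_simps free_lie.scale_minus_left)
qed (auto intro: rel_ideal_subspace rel_ideal_ideal)

text \<open>
  The factor \<open>\<i>\<close> reverses the sign of the right-hand side \<open>(r\<^sub>i - r\<^sub>j) p\<^sub>k\<close> that the elements \<open>v\<^sub>k \<otimes> \<lambda>\<^sub>k\<close>
  themselves satisfy.
\<close>

primrec term_eval :: "(3 \<Rightarrow> complex) \<Rightarrow> 3 lie_term \<Rightarrow> curve_vec" where
  "term_eval r (LGen i) = curve_scale \<i> (oddv i 1)"
| "term_eval r LZero = 0"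
| "term_eval r (LAdd s t) = term_eval r s + term_eval r t"
| "term_eval r (LScale c s) = curve_scale c (term_eval r s)"
| "term_eval r (LBracket s t) = curve_bracket r (term_eval r s) (term_eval r t)"

lemma curve_scale_minus_one: "curve_scale (- 1) m = - m"
  by (rule curve_vec_eqI) (simp_all add: curve_scale_def)

lemma curve_eval_oddv: "curve_eval (oddv i 1) s x k = (if k = i then s i else 0)"
  by (simp add: curve_eval_def oddv_def axis_def)

text \<open>At a point of the curve the generators become \<open>\<i> s_k\<close> times the unit
  vectors, with the cross product as bracket. A double bracket with \<open>p_i\<close> multiplies
  \<open>p_k\<close> by \<open>s_i^2\<close>, and \<open>s_i^2 - s_j^2 = r_j - r_i\<close>.\<close>

lemma p_relations_eval:
  assumes "(s, t) \<in> p_relations r"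
  shows "term_eval r s = term_eval r t"
proof (rule curve_eval_inject[of r])
  fix v x and k :: 3
  assume v: "\<And>k. (v k)\<^sup>2 + r k = x"
  note eval = curve_eval_bracket[OF v] curve_eval_add curve_eval_scale curve_eval_oddv
  from assms obtain i where
    "(s, t) = (LBracket (LGen i) (LBracket (LGen (i + 1)) (LGen (i + 2))), LZero) \<or>
     (s, t) = (LDiff (LBracket (LGen i) (LBracket (LGen i) (LGen (i + 2))))
       (LBracket (LGen (i + 1)) (LBracket (LGen (i + 1)) (LGen (i + 2)))), LScale (r (i + 1) - r i) (LGen (i + 2)))"
    by (auto simp: p_relations_def cyclic_triples_iff)
  then show "curve_eval (term_eval r s) v x k = curve_eval (term_eval r t) v x k"
  proof
    assume st: "(s, t) = (LBracket (LGen i) (LBracket (LGen (i + 1)) (LGen (i + 2))), LZero)"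
    show ?thesis
      using st three_cases[of k i]
      by (elim disjE) (simp_all add: eval cyclic_sum_3 curve_eval_def[of 0])
  next
    assume st: "(s, t) = (LDiff (LBracket (LGen i) (LBracket (LGen i) (LGen (i + 2))))
       (LBracket (LGen (i + 1)) (LBracket (LGen (i + 1)) (LGen (i + 2)))), LScale (r (i + 1) - r i) (LGen (i + 2)))"
    have r: "r (i + 1) - r i = v i * v i - v (i + 1) * v (i + 1)"
      using v[of i] v[of "i + 1"] by (simp add: power2_eq_square algebra_simps)
    have ii: "\<i> * (\<i> * z) = - z" for z by (simp flip: mult.assoc)
    show ?thesis
      using st three_cases[of k i]
      by (elim disjE) (simp_all add: eval cyclic_sum_3 r, simp_all add: ii algebra_simps)
  qed
qed

lemma term_eval_sound: "lie_cong (p_relations r) s t \<Longrightarrow> term_eval r s = term_eval r t"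
proof (induction rule: lie_cong.induct)
  case (relation s t)
  then show ?case by (rule p_relations_eval)
next
  case (jacobi s t u)
  interpret complex_lie_algebra "curve_lie r" by (rule complex_lie_algebra_curve_lie)
  show ?case using jacobi[of "term_eval r s" "term_eval r t" "term_eval r u"] by simp
qed (simp_all add: curve_bracket_simps curve_scale_minus_one,
     (rule curve_vec_eqI; simp add: curve_scale_def smult_add_left smult_add_right)+)

section \<open>Injectivity of the map from the presented algebra to the model\<close>

definition free_eval :: "(3 \<Rightarrow> complex) \<Rightarrow> free_lie \<Rightarrow> curve_vec" where
  "free_eval r x = term_eval r (rep_free_lie x)"

lemma free_eval_abs: "free_eval r (abs_free_lie t) = term_eval r t"
proof -
  have "abs_free_lie (rep_free_lie (abs_free_lie t)) = abs_free_lie t" by (rule abs_rep_free_lie)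
  then have "lie_cong {} (rep_free_lie (abs_free_lie t)) t" by (simp only: free_lie.abs_eq_iff)
  from term_eval_sound[OF lie_cong_mono[OF this]] show ?thesis unfolding free_eval_def .
qed

lemma free_eval_simps:
  "free_eval r (x + y) = free_eval r x + free_eval r y"
  "free_eval r (free_scale c x) = curve_scale c (free_eval r x)"
  "free_eval r (free_bracket x y) = curve_bracket r (free_eval r x) (free_eval r y)"
  "free_eval r 0 = 0" "free_eval r (free_gen i) = curve_scale \<i> (oddv i 1)"
proof -
  note abs = free_eval_abs[of r "LAdd (rep_free_lie x) (rep_free_lie y)"]
    free_eval_abs[of r "LScale c (rep_free_lie x)"]
    free_eval_abs[of r "LBracket (rep_free_lie x) (rep_free_lie y)"]
    free_eval_abs[of r LZero] free_eval_abs[of r "LGen i"]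
  show "free_eval r (x + y) = free_eval r x + free_eval r y"
    "free_eval r (free_scale c x) = curve_scale c (free_eval r x)"
    "free_eval r (free_bracket x y) = curve_bracket r (free_eval r x) (free_eval r y)"
    "free_eval r 0 = 0" "free_eval r (free_gen i) = curve_scale \<i> (oddv i 1)"
    using abs by (simp_all add: abs_free_lie_simps abs_rep_free_lie free_eval_def)
qed

lemma free_eval_ideal: "x \<in> rel_ideal (p_relations r) \<Longrightarrow> free_eval r x = 0"
  unfolding rel_ideal_def by (auto simp: free_eval_abs dest: term_eval_sound)

text \<open>The coefficient in degree \<open>n + 1\<close>, where \<open>\<lambda>\<close> has degree 1 and \<open>x\<close> has degree 2.\<close>

definition graded_coeff :: "nat \<Rightarrow> 3 \<Rightarrow> curve_vec \<Rightarrow> complex" where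
  "graded_coeff n k m = (if even n then coeff (fst m \<sharp> k) (n div 2) else coeff (snd m \<sharp> k) (n div 2))"

lemma graded_coeff_linear:
  "graded_coeff n k (x + y) = graded_coeff n k x + graded_coeff n k y"
  "graded_coeff n k (curve_scale c x) = c * graded_coeff n k x"
  by (simp_all add: graded_coeff_def curve_scale_def)

lemma coeff_lin_mult: "coeff (lin r k * p) (Suc n) = coeff p n - r k * coeff p (Suc n)"
  by (simp add: lin_def)

text \<open>Bracketing with \<open>v_i \<lambda>_i\<close> raises the degree by one. From an odd
  index \<open>n\<close> the polynomial is multiplied by \<open>x - r_i\<close>; the correction by
  \<open>r_i\<close> involves the coefficient two degrees higher, which is zero at the top
  degree.\<close>

lemma graded_coeff_bracket:
  "graded_coeff (Suc n) (i + 2) (curve_bracket r (oddv i 1) y) =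
     graded_coeff n (i + 1) y - (if odd n then r i * graded_coeff (Suc (Suc n)) (i + 1) y else 0)"
  "graded_coeff (Suc n) (i + 1) (curve_bracket r (oddv i 1) y) =
     - (graded_coeff n (i + 2) y - (if odd n then r i * graded_coeff (Suc (Suc n)) (i + 2) y else 0))"
  "graded_coeff (Suc n) i (curve_bracket r (oddv i 1) y) = 0"
  by (auto simp: graded_coeff_def curve_bracket_def oddv_def axis_def cyclic_sum_3 coeff_lin_mult
      split: prod.splits elim!: oddE evenE)

context
  fixes r :: "3 \<Rightarrow> complex"
begin

interpretation p_relations_space free_scale free_bracket "rel_ideal (p_relations r)" free_gen r
  by (rule p_relations_space_free_lie)

text \<open>The image of \<open>e m i\<close> has its leading term in direction \<open>i\<close>
  only, with coefficient \<open>\<i>^(m+1)\<close>. Images of different elements are therefore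
  linearly independent.\<close>

lemma graded_coeff_e:
  "n \<ge> m \<Longrightarrow> graded_coeff n k (free_eval r (e m i)) = (if n = m \<and> k = i then \<i> ^ Suc m else 0)"
proof (induction m arbitrary: n k i)
  case 0
  then show ?case
    by (cases "n = 0") (auto simp: graded_coeff_def free_eval_simps curve_scale_def oddv_def axis_def coeff_1)
next
  case (Suc m)
  obtain n' where n: "n = Suc n'" "n' \<ge> m" using Suc.prems by (cases n) auto
  have IH: "graded_coeff n' k (free_eval r (e m (i + 2))) = (if n' = m \<and> k = i + 2 then \<i> ^ Suc m else 0)"
    "graded_coeff (Suc (Suc n')) k (free_eval r (e m (i + 2))) = 0" for k
    using n by (simp_all add: Suc.IH)
  have IH2: "graded_coeff (Suc (Suc m)) k (free_eval r (e m (i + 2))) = 0" for k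
    by (simp add: Suc.IH)
  have ev: "free_eval r (e (Suc m) i) = curve_scale \<i> (curve_bracket r (oddv (i + 1) 1) (free_eval r (e m (i + 2))))"
    by (simp add: free_eval_simps curve_bracket_simps)
  note br = graded_coeff_bracket[of n' "i + 1" r, unfolded cyclic_sum_3]
  show ?case
    using three_cases[of k i]
    by (elim disjE) (simp_all add: ev n(1) graded_coeff_linear br IH IH2 del: e.simps)
qed

text \<open>Layers are removed from the top: up to the factor \<open>\<i>^(n+1)\<close> the leading
  coefficients of the image are the coordinates of the top layer, so a zero image makes that layer
  vanish. At the bottom the ideal is left.\<close>

lemma free_eval_S_inject:
  assumes "x \<in> S n" "free_eval r x = 0"
  shows "x \<in> rel_ideal (p_relations r)"
  using assms
proof (induction n arbitrary: x)
  case 0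
  have sp: "free_lie.span (rel_ideal (p_relations r)) = rel_ideal (p_relations r)"
    using free_lie.span_eq_iff rel_ideal_subspace by blast
  have "S 0 = free_lie.span (rel_ideal (p_relations r))" by (simp add: S_def)
  then show ?case using 0(1) unfolding sp by simp
next
  case (Suc n)
  have "\<exists>y c. y \<in> S n \<and> x = y + (\<Sum>i\<in>UNIV. free_scale (c i) (e n i))"
    using Suc.prems(1) unfolding S_def[of "Suc n"]
  proof (induction rule: free_lie.span_induct_alt)
    case base
    show ?case by (rule exI[of _ 0], rule exI[of _ "\<lambda>_. 0"]) (simp add: S_0)
  next
    case (step c x y)
    obtain z d where z: "z \<in> S n" "y = z + (\<Sum>i\<in>UNIV. free_scale (d i) (e n i))" using step by blast
    show ?case
    proof (cases "x \<in> S n")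
      case True
      then show ?thesis
        using z by (intro exI[of _ "free_scale c x + z"] exI[of _ d]) (simp add: S_add S_scale add.assoc)
    next
      case False
      then obtain m j where x: "x = e m j" "m < Suc n" "x \<notin> S n" using step(1) I_S[of x n] by blast
      then have m: "m = n" using e_S[of m n j] by (cases "m = n") auto
      have "(\<Sum>i\<in>UNIV. free_scale ((d(j := d j + c)) i) (e n i)) =
          (\<Sum>i\<in>UNIV. free_scale (d i) (e n i) + (if i = j then free_scale c (e n j) else 0))"
        by (rule sum.cong) (auto simp: free_lie.scale_left_distrib)
      also have "\<dots> = (\<Sum>i\<in>UNIV. free_scale (d i) (e n i)) + free_scale c (e n j)"
        by (simp add: sum.distrib)
      finally show ?thesis
        using z x m by (intro exI[of _ z] exI[of _ "d(j := d j + c)"]) (simp add: algebra_simps)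
    qed
  qed
  then obtain y c where y: "y \<in> S n" "x = y + (\<Sum>i\<in>UNIV. free_scale (c i) (e n i))" by blast
  have low: "graded_coeff n k (free_eval r y) = 0" for k
    using y(1) unfolding S_def
  proof (induction rule: free_lie.span_induct_alt)
    case base then show ?case by (simp add: free_eval_simps graded_coeff_def)
  next
    case (step c x y)
    have "graded_coeff n k (free_eval r x) = 0"
      using step(1) free_eval_ideal[of x r] graded_coeff_e by (auto simp: graded_coeff_def[of _ _ 0])
    then show ?case using step by (simp add: free_eval_simps graded_coeff_linear)
  qed
  have sum: "free_eval r (\<Sum>i\<in>UNIV. free_scale (c i) (e n i)) = (\<Sum>i\<in>UNIV. curve_scale (c i) (free_eval r (e n i)))"
    by (simp only: sum_3 free_eval_simps)
  have "c k = 0" for k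
  proof -
    have "0 = graded_coeff n k (free_eval r x)" using Suc.prems(2) by (simp add: graded_coeff_def)
    also have "\<dots> = (\<Sum>i\<in>UNIV. c i * graded_coeff n k (free_eval r (e n i)))"
      unfolding y(2) free_eval_simps graded_coeff_linear low sum by (simp add: sum_3 graded_coeff_linear)
    also have "\<dots> = c k * \<i> ^ Suc n"
      using exhaust_3[of k] by (auto simp: graded_coeff_e sum_3)
    finally show ?thesis by simp
  qed
  then have "x = y" using y(2) by (simp add: free_lie.scale_zero_left)
  then show ?case using Suc y(1) by blast
qed

lemma abs_in_S: "\<exists>n. abs_free_lie t \<in> S n"
proof (induction t)
  case (LGen i)
  have "e 0 i \<in> S 1" by (rule e_S) simp
  then show ?case by (auto simp: abs_free_lie_simps)
next
  case LZero
  then show ?case by (auto simp: abs_free_lie_simps S_0)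
next
  case (LAdd s t)
  then obtain m n where "abs_free_lie s \<in> S m" "abs_free_lie t \<in> S n" by blast
  then have "abs_free_lie s \<in> S (m + n)" "abs_free_lie t \<in> S (m + n)"
    using S_mono[of m "m + n"] S_mono[of n "m + n"] by auto
  then show ?case by (auto simp: abs_free_lie_simps intro: S_add)
next
  case (LScale c t)
  then show ?case by (auto simp: abs_free_lie_simps intro: S_scale)
next
  case (LBracket s t)
  then show ?case by (auto simp: abs_free_lie_simps intro: br_S_S)
qed

lemma term_eval_eq_iff: "term_eval r s = term_eval r t \<longleftrightarrow> lie_cong (p_relations r) s t"
proof
  assume eq: "term_eval r s = term_eval r t"
  obtain n where n: "abs_free_lie (LDiff s t) \<in> S n" using abs_in_S by blast
  have "free_eval r (abs_free_lie (LDiff s t)) = 0"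
    using eq by (simp add: free_eval_abs curve_scale_minus_one)
  with n have "abs_free_lie (LDiff s t) \<in> rel_ideal (p_relations r)" by (rule free_eval_S_inject)
  then show "lie_cong (p_relations r) s t"
    by (simp add: lie_cong_via_ideal minus_free_lie.abs_eq)
qed (rule term_eval_sound)

end

lemma term_eval_surj: "\<exists>t. term_eval r t = m"
proof -
  have "m \<in> range (term_eval r)"
  proof (rule curve_vec_generated[where r = r])
    show "oddv i 1 \<in> range (term_eval r)" for i
    proof (rule range_eqI)
      show "oddv i 1 = term_eval r (LScale (- \<i>) (LGen i))"
        by (rule curve_vec_eqI) (simp_all add: curve_scale_def)
    qed
  qed (auto, (metis rangeI term_eval.simps)+)
  then show ?thesis by auto
qed

lemma lie_class_eq_iff: "lie_class R s = lie_class R t \<longleftrightarrow> lie_cong R s t"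
  unfolding lie_class_def by (auto intro: lie_cong.refl lie_cong.sym lie_cong.trans)

lemma p_algebra_iso: "complex_lie_algebra (p_algebra r)" "curve_lie r \<cong>\<^sub>L p_algebra r" "p_algebra r \<cong>\<^sub>L curve_lie r"
proof -
  let ?R = "p_relations r"
  \<comment> \<open>Any term with value \<open>m\<close> will do, since by
    \<open>term_eval_eq_iff\<close> all of them are congruent.\<close>
  define h where "h m = lie_class ?R (SOME t. term_eval r t = m)" for m
  have h: "h (term_eval r t) = lie_class ?R t" for t
  proof -
    have "term_eval r (SOME t'. term_eval r t' = term_eval r t) = term_eval r t"
      by (rule someI_ex) blast
    then show ?thesis unfolding h_def lie_class_eq_iff term_eval_eq_iff .
  qed
  have self: "s \<in> lie_class ?R s" for s by (simp add: lie_class_def lie_cong.refl)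
  have mem: "lie_cong ?R s' s" if "s' \<in> lie_class ?R s" for s s'
    using that by (simp add: lie_class_def lie_cong.sym)
  have add: "lie_class ?R s \<oplus>\<^bsub>p_algebra r\<^esub> lie_class ?R t = lie_class ?R (LAdd s t)" for s t
    unfolding p_algebra_def presented_lie_algebra_def ring_record_simps
    by (rule UN2_const[OF self self]) (simp add: lie_class_eq_iff lie_cong.cong_add mem)
  have bracket: "lie_bracket (p_algebra r) (lie_class ?R s) (lie_class ?R t) = lie_class ?R (LBracket s t)" for s t
    unfolding p_algebra_def presented_lie_algebra_def lie_alg.simps
    by (rule UN2_const[OF self self]) (simp add: lie_class_eq_iff lie_cong.cong_bracket mem)
  have smult: "c \<odot>\<^bsub>p_algebra r\<^esub> lie_class ?R s = lie_class ?R (LScale c s)" for c s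
    unfolding p_algebra_def presented_lie_algebra_def module.simps
    by (rule UN_const[OF self]) (simp add: lie_class_eq_iff lie_cong.cong_scale mem)
  have all: "(\<And>t. P (term_eval r t)) \<Longrightarrow> P m" for P m using term_eval_surj[of r m] by auto
  have "bij_betw h (carrier (curve_lie r)) (carrier (p_algebra r))"
    unfolding bij_betw_def
  proof
    have "h m = h n \<longrightarrow> m = n" for m n
    proof (rule all[of _ m], rule all[of _ n])
      show "h (term_eval r s) = h (term_eval r t) \<longrightarrow> term_eval r s = term_eval r t" for s t
        by (simp add: h lie_class_eq_iff term_eval_eq_iff)
    qed
    then show "inj_on h (carrier (curve_lie r))" by (auto intro: inj_onI)
    have "h m \<in> range (lie_class ?R)" for m by (auto simp: h_def)
    moreover have "lie_class ?R t \<in> range h" for t by (metis h rangeI)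
    ultimately show "h ` carrier (curve_lie r) = carrier (p_algebra r)"
      by (auto simp: p_algebra_def presented_lie_algebra_def)
  qed
  moreover have "h (x + y) = h x \<oplus>\<^bsub>p_algebra r\<^esub> h y" for x y
  proof (rule all[of _ x], rule all[of _ y])
    show "h (term_eval r s + term_eval r t) = h (term_eval r s) \<oplus>\<^bsub>p_algebra r\<^esub> h (term_eval r t)" for s t
      using h[of "LAdd s t"] by (simp add: h add)
  qed
  moreover have "h 0 = \<zero>\<^bsub>p_algebra r\<^esub>"
    using h[of LZero] by (simp add: p_algebra_def presented_lie_algebra_def)
  moreover have "h (curve_scale c x) = c \<odot>\<^bsub>p_algebra r\<^esub> h x" for c x
  proof (rule all[of _ x])
    show "h (curve_scale c (term_eval r s)) = c \<odot>\<^bsub>p_algebra r\<^esub> h (term_eval r s)" for s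
      using h[of "LScale c s"] by (simp add: h smult)
  qed
  moreover have "h (curve_bracket r x y) = lie_bracket (p_algebra r) (h x) (h y)" for x y
  proof (rule all[of _ x], rule all[of _ y])
    show "h (curve_bracket r (term_eval r s) (term_eval r t)) = lie_bracket (p_algebra r) (h (term_eval r s)) (h (term_eval r t))" for s t
      using h[of "LBracket s t"] by (simp add: h bracket)
  qed
  ultimately show "complex_lie_algebra (p_algebra r)" "curve_lie r \<cong>\<^sub>L p_algebra r" "p_algebra r \<cong>\<^sub>L curve_lie r"
    using lie_transport[OF complex_lie_algebra_curve_lie, of h r "p_algebra r"] by simp_all
qed

subsection \<open>The algebra of the curve\<close>

lemma poly_mapping_monomials: "f = (\<Sum>k\<in>Poly_Mapping.keys f. Poly_Mapping.single k (Poly_Mapping.lookup f k))"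
  by (rule poly_mapping_eqI) (simp add: lookup_sum lookup_single when_def in_keys_iff)

definition eval3 :: "(3 \<Rightarrow> complex) \<Rightarrow> poly3 \<Rightarrow> complex" where
  "eval3 s f = lext (*) (\<lambda>m. \<Prod>k\<in>UNIV. s k ^ Poly_Mapping.lookup m k) f"

lemma eval3_linear: "eval3 s (f + g) = eval3 s f + eval3 s g" "eval3 s (f - g) = eval3 s f - eval3 s g" "eval3 s 0 = 0"
  by (simp_all add: eval3_def lext_linear[OF vector_space_times])

lemma eval3_sum: "eval3 s (\<Sum>i\<in>I. f i) = (\<Sum>i\<in>I. eval3 s (f i))"
  by (induction I rule: infinite_finite_induct) (simp_all add: eval3_linear)

lemma eval3_single: "eval3 s (Poly_Mapping.single m a) = a * (\<Prod>k\<in>UNIV. s k ^ Poly_Mapping.lookup m k)"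
  by (simp add: eval3_def lext_def)

lemma eval3_mult: "eval3 s (f * g) = eval3 s f * eval3 s g"
proof -
  have "f * g = (\<Sum>m\<in>Poly_Mapping.keys f. \<Sum>n\<in>Poly_Mapping.keys g.
      Poly_Mapping.single m (Poly_Mapping.lookup f m) * Poly_Mapping.single n (Poly_Mapping.lookup g n))"
    by (subst poly_mapping_monomials[of f], subst poly_mapping_monomials[of g]) (rule sum_product)
  then have "eval3 s (f * g) = (\<Sum>m\<in>Poly_Mapping.keys f. \<Sum>n\<in>Poly_Mapping.keys g.
      eval3 s (Poly_Mapping.single m (Poly_Mapping.lookup f m)) * eval3 s (Poly_Mapping.single n (Poly_Mapping.lookup g n)))"
    by (simp add: eval3_sum mult_single eval3_single lookup_add power_add prod.distrib mult_ac)
  also have "\<dots> = (\<Sum>m\<in>Poly_Mapping.keys f. eval3 s (Poly_Mapping.single m (Poly_Mapping.lookup f m))) *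
      (\<Sum>n\<in>Poly_Mapping.keys g. eval3 s (Poly_Mapping.single n (Poly_Mapping.lookup g n)))"
    by (rule sum_product[symmetric])
  also have "\<dots> = eval3 s f * eval3 s g"
    unfolding eval3_sum[symmetric] poly_mapping_monomials[symmetric] ..
  finally show ?thesis .
qed

lemma eval3_var: "eval3 s (var3 i) = s i"
proof -
  have "(\<Prod>k\<in>UNIV. s k ^ Poly_Mapping.lookup (Poly_Mapping.single i (1 :: nat)) k) = (\<Prod>k\<in>UNIV. if k = i then s i else 1)"
    by (rule prod.cong) (auto simp: lookup_single when_def)
  then show ?thesis by (simp add: var3_def eval3_single)
qed

lemma eval3_const: "eval3 s (const3 c) = c"
  by (simp add: const3_def eval3_single)

lemma const3_hom: "const3 (a + b) = const3 a + const3 b" "const3 (a * b) = const3 a * const3 b"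
  "const3 0 = 0" "const3 1 = 1" "const3 (- a) = - const3 a"
  by (simp_all add: const3_def single_add mult_single single_uminus)

text \<open>The variable \<open>x\<close> is represented by \<open>\<lambda>_1^2 + r_1\<close>;
  modulo the ideal of the curve the other two indices give the same class.\<close>

definition subst3 :: "(3 \<Rightarrow> complex) \<Rightarrow> complex poly \<Rightarrow> poly3" where
  "subst3 r p = poly (map_poly const3 p) ((var3 1)\<^sup>2 + const3 (r 1))"

lemma subst3_pCons: "subst3 r (pCons a p) = const3 a + ((var3 1)\<^sup>2 + const3 (r 1)) * subst3 r p"
  by (simp add: subst3_def map_poly_pCons const3_hom)

lemma subst3_0: "subst3 r 0 = 0" by (simp add: subst3_def)

lemma subst3_add: "subst3 r (p + q) = subst3 r p + subst3 r q"
  by (induction p q rule: poly_induct2) (simp_all add: subst3_0 subst3_pCons const3_hom algebra_simps)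

lemma subst3_smult: "subst3 r (smult c p) = const3 c * subst3 r p"
  by (induction p) (simp_all add: subst3_0 subst3_pCons const3_hom algebra_simps)

lemma subst3_mult: "subst3 r (p * q) = subst3 r p * subst3 r q"
  by (induction p) (simp_all add: subst3_0 subst3_pCons subst3_add subst3_smult const3_hom algebra_simps)

lemma subst3_diff: "subst3 r (p - q) = subst3 r p - subst3 r q"
  using subst3_add[of r "p - q" q] by simp

lemma eval3_subst3: "(s 1)\<^sup>2 + r 1 = x \<Longrightarrow> eval3 s (subst3 r p) = poly p x"
  by (induction p)
     (simp_all add: subst3_0 subst3_pCons eval3_linear eval3_mult eval3_const eval3_var power2_eq_square)

lemma subst3_lin: "subst3 r (lin r k) = (var3 1)\<^sup>2 + const3 (r 1) - const3 (r k)"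
  by (simp add: lin_def subst3_pCons subst3_0 const3_hom)

context
  fixes r :: "3 \<Rightarrow> complex"
begin

lemma poly3_ring_sel [simp]:
  "carrier poly3_ring = UNIV" "x \<otimes>\<^bsub>poly3_ring\<^esub> y = x * y" "x \<oplus>\<^bsub>poly3_ring\<^esub> y = x + y" "\<zero>\<^bsub>poly3_ring\<^esub> = 0"
  by (simp_all add: poly3_ring_def ring_of_type_algebra_def)

interpretation poly3: cring poly3_ring
  unfolding poly3_ring_def by (rule cring_from_type_algebra)

interpretation I: ideal "curve_ideal r" poly3_ring
  unfolding curve_ideal_def by (rule poly3.genideal_ideal) simp

lemma curve_class_eq_iff: "curve_class r f = curve_class r g \<longleftrightarrow> f - g \<in> curve_ideal r"
proof -
  have "f \<ominus>\<^bsub>poly3_ring\<^esub> g = f - g"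
  proof -
    have "\<ominus>\<^bsub>poly3_ring\<^esub> g = - g" by (rule poly3.minus_equality) auto
    then show ?thesis by (simp add: a_minus_def)
  qed
  then show ?thesis
    using poly3.quotient_eq_iff_same_a_r_cos[OF I.ideal_axioms, of f g] by (simp add: curve_class_def)
qed

lemma curve_ideal_closed:
  "f \<in> curve_ideal r \<Longrightarrow> g \<in> curve_ideal r \<Longrightarrow> f + g \<in> curve_ideal r"
  "f \<in> curve_ideal r \<Longrightarrow> f * g \<in> curve_ideal r"
  using I.a_closed[of f g] I.I_r_closed[of f g] by simp_all

lemma curve_ideal_gen: "(var3 i)\<^sup>2 - (var3 j)\<^sup>2 - const3 (r j) + const3 (r i) \<in> curve_ideal r"
  unfolding curve_ideal_def by (rule subsetD[OF poly3.genideal_self]) auto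

lemma curve_ideal_eval:
  assumes s: "\<And>k. (s k)\<^sup>2 + r k = x" and f: "f \<in> curve_ideal r"
  shows "eval3 s f = 0"
proof -
  have "ideal {f. eval3 s f = 0} poly3_ring"
  proof (rule idealI)
    show "ring poly3_ring" by (rule poly3.ring_axioms)
    show "subgroup {f. eval3 s f = 0} (add_monoid poly3_ring)"
    proof (rule poly3.add.subgroupI)
      show "\<ominus>\<^bsub>poly3_ring\<^esub> a \<in> {f. eval3 s f = 0}" if "a \<in> {f. eval3 s f = 0}" for a
      proof -
        have "\<ominus>\<^bsub>poly3_ring\<^esub> a = - a" by (rule poly3.minus_equality) auto
        then show ?thesis using that eval3_linear(2)[of s 0 a] by (simp add: eval3_linear)
      qed
    qed (auto simp: eval3_linear intro: exI[of _ 0])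
  qed (simp_all add: eval3_mult)
  moreover have "{(var3 i)\<^sup>2 - (var3 j)\<^sup>2 - const3 (r j) + const3 (r i) | i j. True} \<subseteq> {f. eval3 s f = 0}"
  proof clarsimp
    fix i j
    have "(s i)\<^sup>2 + r i = (s j)\<^sup>2 + r j" using s by simp
    then have "s i * s i - s j * s j - r j + r i = 0" by (simp add: power2_eq_square algebra_simps)
    then show "eval3 s ((var3 i)\<^sup>2 - (var3 j)\<^sup>2 - const3 (r j) + const3 (r i)) = 0"
      by (simp add: power2_eq_square eval3_linear eval3_mult eval3_var eval3_const)
  qed
  ultimately have "curve_ideal r \<subseteq> {f. eval3 s f = 0}"
    unfolding curve_ideal_def by (rule poly3.genideal_minimal)
  then show ?thesis using f by auto
qed

lemma coordinate_ring_sel: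
  "carrier (coordinate_ring r) = range (curve_class r)"
  "curve_class r f \<oplus>\<^bsub>coordinate_ring r\<^esub> curve_class r g = curve_class r (f + g)"
  "curve_class r f \<otimes>\<^bsub>coordinate_ring r\<^esub> curve_class r g = curve_class r (f * g)"
  "c \<odot>\<^bsub>coordinate_ring r\<^esub> curve_class r f = curve_class r (const3 c * f)"
  "\<zero>\<^bsub>coordinate_ring r\<^esub> = curve_class r 0"
proof -
  have mult: "rcoset_mult poly3_ring (curve_ideal r) (curve_class r f) (curve_class r g) = curve_class r (f * g)" for f g
    using I.rcoset_mult_add[of f g] by (simp add: curve_class_def)
  show "carrier (coordinate_ring r) = range (curve_class r)"
    by (auto simp: coordinate_ring_def Let_def FactRing_def A_RCOSETS_def' curve_class_def)
  show "curve_class r f \<oplus>\<^bsub>coordinate_ring r\<^esub> curve_class r g = curve_class r (f + g)"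
    using I.a_rcos_sum[of f g] by (simp add: coordinate_ring_def Let_def FactRing_def curve_class_def)
  show "curve_class r f \<otimes>\<^bsub>coordinate_ring r\<^esub> curve_class r g = curve_class r (f * g)"
    "c \<odot>\<^bsub>coordinate_ring r\<^esub> curve_class r f = curve_class r (const3 c * f)"
    by (simp_all add: coordinate_ring_def Let_def FactRing_def mult)
  have "curve_ideal r = curve_class r 0"
    using I.a_rcos_const[of 0] I.zero_closed by (simp add: curve_class_def)
  then show "\<zero>\<^bsub>coordinate_ring r\<^esub> = curve_class r 0"
    by (simp add: coordinate_ring_def Let_def FactRing_def)
qed

interpretation tensor_algebra "coordinate_ring r"
  by unfold_locales
     (auto simp: coordinate_ring_sel const3_hom algebra_simps)

definition curve_coord :: "curve_vec \<Rightarrow> 3 \<Rightarrow> poly3" where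
  "curve_coord m k = var3 k * subst3 r (fst m \<sharp> k) + var3 (k + 1) * var3 (k + 2) * subst3 r (snd m \<sharp> k)"

definition curve_embed :: "curve_vec \<Rightarrow> (complex^2^2, poly3 set) tensor" where
  "curve_embed m = nf (\<lambda>k. curve_class r (curve_coord m k))"

text \<open>The universal bracket identity leaves three error terms, each with a factor
  \<open>\<lambda>_i^2 - (x - r_i)\<close>, and these factors lie in the ideal of the curve.\<close>

lemma curve_coord_bracket:
  "curve_class r (curve_coord (curve_bracket r m n) k) = curve_class r
    (curve_coord m (k + 1) * curve_coord n (k + 2) - curve_coord m (k + 2) * curve_coord n (k + 1))"
proof -
  obtain a b c d where mn: "m = (a, b)" "n = (c, d)" by (metis surj_pair)
  have sq: "var3 i * var3 i - subst3 r (lin r i) \<in> curve_ideal r" for i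
    using curve_ideal_gen[of i 1] by (simp add: subst3_lin power2_eq_square algebra_simps)
  let ?S = "subst3 r"
  define E where "E = (var3 (k + 1) * var3 (k + 1) - ?S (lin r (k + 1))) * (var3 k * (?S (a \<sharp> (k + 1)) * ?S (d \<sharp> (k + 2)) - ?S (b \<sharp> (k + 2)) * ?S (c \<sharp> (k + 1))))
     + (var3 (k + 2) * var3 (k + 2) - ?S (lin r (k + 2))) * (var3 k * (?S (b \<sharp> (k + 1)) * ?S (c \<sharp> (k + 2)) - ?S (a \<sharp> (k + 2)) * ?S (d \<sharp> (k + 1))))
     + (var3 k * var3 k - ?S (lin r k)) * (var3 (k + 1) * var3 (k + 2) * (?S (b \<sharp> (k + 1)) * ?S (d \<sharp> (k + 2)) - ?S (b \<sharp> (k + 2)) * ?S (d \<sharp> (k + 1))))"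
  have E: "E \<in> curve_ideal r" unfolding E_def by (intro curve_ideal_closed sq)
  have "curve_coord m (k + 1) * curve_coord n (k + 2) - curve_coord m (k + 2) * curve_coord n (k + 1)
      = curve_coord (curve_bracket r m n) k + E"
    unfolding E_def curve_coord_def curve_bracket_def mn
    using curve_bracket_identity[of "var3 (k + 1)" "?S (a \<sharp> (k + 1))" "var3 (k + 2)" "var3 k" "?S (b \<sharp> (k + 1))"
        "?S (c \<sharp> (k + 2))" "?S (d \<sharp> (k + 2))" "?S (a \<sharp> (k + 2))" "?S (b \<sharp> (k + 2))"
        "?S (c \<sharp> (k + 1))" "?S (d \<sharp> (k + 1))" "?S (lin r (k + 1))" "?S (lin r (k + 2))" "?S (lin r k)"]
    by (simp add: cyclic_sum_3 subst3_add subst3_diff subst3_mult)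
  then show ?thesis
    unfolding curve_class_eq_iff using curve_ideal_closed(2)[OF E, of "- 1"] by simp
qed

lemma curve_embed_hom:
  "curve_embed (m + n) = curve_embed m \<oplus>\<^bsub>sl2_curve r\<^esub> curve_embed n"
  "curve_embed (curve_scale c m) = c \<odot>\<^bsub>sl2_curve r\<^esub> curve_embed m"
  "curve_embed (curve_bracket r m n) = lie_bracket (sl2_curve r) (curve_embed m) (curve_embed n)"
proof -
  have C: "curve_class r f \<in> carrier (coordinate_ring r)" for f by (simp add: coordinate_ring_sel)
  show "curve_embed (m + n) = curve_embed m \<oplus>\<^bsub>sl2_curve r\<^esub> curve_embed n"
    unfolding curve_embed_def sl2_curve_def nf_add[OF C C] coordinate_ring_sel
    by (simp add: curve_coord_def subst3_add algebra_simps)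
  show "curve_embed (curve_scale c m) = c \<odot>\<^bsub>sl2_curve r\<^esub> curve_embed m"
    unfolding curve_embed_def sl2_curve_def nf_smult[OF C] coordinate_ring_sel
    by (simp add: curve_coord_def curve_scale_def subst3_smult algebra_simps)
  show "curve_embed (curve_bracket r m n) = lie_bracket (sl2_curve r) (curve_embed m) (curve_embed n)"
    unfolding curve_embed_def sl2_curve_def nf_bracket[OF C C] coordinate_ring_sel
    by (simp add: curve_coord_bracket const3_hom)
qed

text \<open>Evaluation at a point of the curve is well defined on the coordinate ring and induces
  functionals on the tensor product. On the model these are the values \<open>curve_eval\<close>,
  which separate its elements.\<close>

lemma curve_embed_inject:
  assumes "curve_embed m = curve_embed n"
  shows "m = n"
proof (rule curve_eval_inject[of r])
  fix s x and k :: 3 assume s: "\<And>k. (s k)\<^sup>2 + r k = x"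
  define ev where "ev U = eval3 s (SOME f. U = curve_class r f)" for U
  have ev: "ev (curve_class r f) = eval3 s f" for f
  proof -
    have "curve_class r f = curve_class r (SOME g. curve_class r f = curve_class r g)"
      by (rule someI_ex) blast
    then have "f - (SOME g. curve_class r f = curve_class r g) \<in> curve_ideal r"
      by (simp only: curve_class_eq_iff)
    from curve_ideal_eval[OF s this] show ?thesis by (simp add: ev_def eval3_linear)
  qed
  have "ev (curve_class r (curve_coord m k)) = ev (curve_class r (curve_coord n k))"
  proof (rule nf_eqD)
    show "nf (\<lambda>k. curve_class r (curve_coord m k)) = nf (\<lambda>k. curve_class r (curve_coord n k))"
      using assms by (simp add: curve_embed_def)
  qed (auto simp: coordinate_ring_sel ev eval3_linear eval3_mult eval3_const)
  then show "curve_eval m s x k = curve_eval n s x k"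
    by (simp add: ev curve_coord_def eval3_linear eval3_mult eval3_var eval3_subst3[OF s] curve_eval_def)
qed

lemma curve_embed_oddv: "curve_embed (oddv i 1) = curve_generator r (basis_vec i) i"
proof -
  let ?z = "curve_class r 0"
  have z: "?z \<in> carrier (coordinate_ring r)" by (simp add: coordinate_ring_sel)
  have pure0: "pure (basis_vec k) ?z \<in> null" for k
    using relators(4)[OF basis_vec_carrier z, of k 0] by (simp add: coordinate_ring_sel)
  have coord: "curve_coord (oddv i 1) k = (if k = i then var3 i else 0)" for k
    by (simp add: curve_coord_def oddv_def axis_def subst3_0 one_pCons subst3_pCons const3_hom)
  have "(\<Sum>k\<in>UNIV. pure (basis_vec k) (curve_class r (curve_coord (oddv i 1) k)))
      = pure (basis_vec i) (curve_class r (var3 i)) + (\<Sum>k\<in>UNIV - {i}. pure (basis_vec k) ?z)"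
    by (subst sum.remove[of _ i]) (auto simp: coord intro!: sum.cong)
  moreover have "(\<Sum>k\<in>UNIV - {i}. pure (basis_vec k) ?z) \<in> null"
    by (intro fscale.subspace_sum[OF null_subspace] pure0)
  ultimately show ?thesis
    by (simp add: curve_embed_def nf_def curve_generator_def pure_tensor_def cls_eq_iff)
qed

text \<open>The image of the model is closed under the operations and contains the generators;
  conversely, the model is generated by the elements mapped to them.\<close>

lemma curve_algebra_iso:
  "curve_lie r \<cong>\<^sub>L lie_subalgebra_generated (sl2_curve r)
     {curve_generator r v\<^sub>1 1, curve_generator r v\<^sub>2 2, curve_generator r v\<^sub>3 3}"
  "lie_subalgebra_generated (sl2_curve r)
     {curve_generator r v\<^sub>1 1, curve_generator r v\<^sub>2 2, curve_generator r v\<^sub>3 3} \<cong>\<^sub>L curve_lie r"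
proof -
  let ?G = "{curve_generator r v\<^sub>1 1, curve_generator r v\<^sub>2 2, curve_generator r v\<^sub>3 3}"
  let ?L = "sl2_curve r"
  have G: "?G = (\<lambda>i. curve_embed (oddv i 1)) ` UNIV"
    unfolding UNIV_3 image_insert image_empty curve_embed_oddv by (simp add: basis_vec_def)
  have embed_0: "curve_embed 0 = \<zero>\<^bsub>?L\<^esub>"
  proof -
    have "curve_embed 0 = curve_embed (curve_scale 0 0)"
      by (rule arg_cong[where f = curve_embed], rule curve_vec_eqI) (simp_all add: curve_scale_def)
    also have "\<dots> = 0 \<odot>\<^bsub>?L\<^esub> curve_embed 0" by (rule curve_embed_hom)
    also have "\<dots> = \<zero>\<^bsub>?L\<^esub>"
      by (simp add: sl2_curve_def curve_embed_def nf_def tensor_lie_smult tensor_lie_zero)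
    finally show ?thesis .
  qed
  have in_span: "m \<in> {m. curve_embed m \<in> lie_span ?L ?G}" for m
  proof (rule curve_vec_generated[where r = r]; unfold mem_Collect_eq curve_embed_hom)
    show "curve_embed (oddv i 1) \<in> lie_span ?L ?G" for i
      unfolding G by (rule lie_span.incl) blast
  qed (fact lie_span.add lie_span.smult lie_span.bracket)+
  have span_in: "\<exists>m. U = curve_embed m" if "U \<in> lie_span ?L ?G" for U
    using that
  proof (induction rule: lie_span.induct)
    case zero show ?case using embed_0[symmetric] by (rule exI)
  next
    case (incl x) then show ?case unfolding G by (elim imageE) (rule exI)
  next
    case (add x y)
    then obtain m n where "x = curve_embed m" "y = curve_embed n" by blast
    then have "x \<oplus>\<^bsub>?L\<^esub> y = curve_embed (m + n)" by (simp only: curve_embed_hom)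
    then show ?case by blast
  next
    case (smult x c)
    then obtain m where "x = curve_embed m" by blast
    then have "c \<odot>\<^bsub>?L\<^esub> x = curve_embed (curve_scale c m)" by (simp only: curve_embed_hom)
    then show ?case by blast
  next
    case (bracket x y)
    then obtain m n where "x = curve_embed m" "y = curve_embed n" by blast
    then have "lie_bracket ?L x y = curve_embed (curve_bracket r m n)" by (simp only: curve_embed_hom)
    then show ?case by blast
  qed
  have "range curve_embed = lie_span ?L ?G"
  proof (intro equalityI subsetI)
    fix U assume "U \<in> range curve_embed"
    then obtain m where "U = curve_embed m" by (elim imageE)
    then show "U \<in> lie_span ?L ?G" using in_span[of m] by simp
  next
    fix U assume "U \<in> lie_span ?L ?G"
    then obtain m where "U = curve_embed m" by (elim exE[OF span_in])
    then show "U \<in> range curve_embed" by (rule range_eqI)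
  qed
  moreover have "inj curve_embed" by (rule injI) (rule curve_embed_inject)
  ultimately have "bij_betw curve_embed UNIV (lie_span ?L ?G)" by (rule bij_betw_imageI[rotated])
  then show "curve_lie r \<cong>\<^sub>L lie_subalgebra_generated ?L ?G" "lie_subalgebra_generated ?L ?G \<cong>\<^sub>L curve_lie r"
    using lie_transport[OF complex_lie_algebra_curve_lie, of curve_embed r "lie_subalgebra_generated ?L ?G"]
    by (simp_all add: lie_subalgebra_generated_def curve_embed_hom embed_0)
qed

end

subsection \<open>A frame over the quotient torus\<close>

lemma add_diff_eq_0:
  fixes p q :: complex
  assumes "p + q = 0" "p - q = 0"
  shows "p = 0 \<and> q = 0"
proof -
  have "2 * p = (p + q) + (p - q)" by simp
  then show ?thesis using assms by simp
qed

text \<open>The normal form \<open>p(x) + y q(x)\<close> in \<open>\<complex>[x, y]\<close>, where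
  \<open>y = \<lambda>_1 \<lambda>_2 \<lambda>_3\<close> and \<open>y^2\<close> is a polynomial in
  \<open>x\<close>.\<close>

definition pair_eval :: "complex poly \<times> complex poly \<Rightarrow> complex \<Rightarrow> complex \<Rightarrow> complex" where
  "pair_eval c x y = poly (fst c) x + y * poly (snd c) x"

lemma ex_curve_point: "\<exists>s. (\<forall>k :: 3. (s k)\<^sup>2 + r k = (x :: complex))"
  by (rule exI[of _ "\<lambda>k. csqrt (x - r k)"]) simp

lemma pair_eval_inject:
  fixes r :: "3 \<Rightarrow> complex"
  assumes eq: "\<And>s x. (\<And>k. (s k)\<^sup>2 + r k = x) \<Longrightarrow> pair_eval c x (s 1 * s 2 * s 3) = pair_eval c' x (s 1 * s 2 * s 3)"
  shows "c = c'"
proof -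
  have pt: "poly (fst c - fst c') x = 0 \<and> poly (snd c - snd c') x = 0" if x: "x \<notin> range r" for x
  proof -
    obtain s :: "3 \<Rightarrow> complex" where s: "\<And>k. (s k)\<^sup>2 + r k = x" using ex_curve_point by blast
    define y where "y = s 1 * s 2 * s 3"
    have "s k \<noteq> 0" for k using s[of k] x by (metis add_0 power_zero_numeral rangeI)
    then have y: "y \<noteq> 0" by (simp add: y_def)
    have s': "((s(1 := - s 1)) k)\<^sup>2 + r k = x" for k using s[of k] s[of 1] by simp
    have 1: "poly (fst c - fst c') x + y * poly (snd c - snd c') x = 0"
      using eq[OF s] by (simp add: pair_eval_def y_def algebra_simps)
    have 2: "poly (fst c - fst c') x - y * poly (snd c - snd c') x = 0"
      using eq[OF s'] by (simp add: pair_eval_def y_def algebra_simps)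
    from add_diff_eq_0[OF 1 2] show ?thesis using y by simp
  qed
  have fin: "finite (range r)" by simp
  have "fst c - fst c' = 0" by (rule poly_eq_0_cofinite[OF fin]) (use pt in blast)
  moreover have "snd c - snd c' = 0" by (rule poly_eq_0_cofinite[OF fin]) (use pt in blast)
  ultimately show ?thesis by (simp add: prod_eq_iff)
qed

text \<open>The bilinear form with orthonormal \<open>v_1, v_2, v_3\<close>. Its values lie in
  \<open>\<complex>[x, y]\<close> because \<open>\<lambda>_j^2\<close> is a polynomial in
  \<open>x\<close> and the mixed products are multiples of \<open>y\<close>.\<close>

definition curve_dot :: "(3 \<Rightarrow> complex) \<Rightarrow> curve_vec \<Rightarrow> curve_vec \<Rightarrow> complex poly \<times> complex poly" where
  "curve_dot r m n =
    (\<Sum>j\<in>UNIV. lin r j * fst m \<sharp> j * fst n \<sharp> j + lin r (j + 1) * lin r (j + 2) * snd m \<sharp> j * snd n \<sharp> j,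
     \<Sum>j\<in>UNIV. fst m \<sharp> j * snd n \<sharp> j + snd m \<sharp> j * fst n \<sharp> j)"

definition curve_smul :: "(3 \<Rightarrow> complex) \<Rightarrow> complex poly \<times> complex poly \<Rightarrow> curve_vec \<Rightarrow> curve_vec" where
  "curve_smul r c m =
    (\<chi> k. fst c * fst m \<sharp> k + snd c * lin r (k + 1) * lin r (k + 2) * snd m \<sharp> k,
     \<chi> k. fst c * snd m \<sharp> k + snd c * lin r k * fst m \<sharp> k)"

lemma prod_3_cyclic: "s (k :: 3) * s (k + 1) * s (k + 2) = s 1 * s 2 * s (3 :: 3)" for s :: "3 \<Rightarrow> complex"
proof -
  show ?thesis using exhaust_3[of k] by (elim disjE) (simp_all only: add_3 mult_ac)
qed

context
  fixes s r :: "3 \<Rightarrow> complex" and x :: complex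
  assumes s: "\<And>k. (s k)\<^sup>2 + r k = x"
begin

lemma poly_lin: "poly (lin r k) x = s k * s k"
  using s[of k] by (simp add: lin_def power2_eq_square algebra_simps)

lemma pair_eval_dot:
  "pair_eval (curve_dot r m n) x (s 1 * s 2 * s 3) = (\<Sum>j\<in>UNIV. curve_eval m s x j * curve_eval n s x j)"
proof -
  have "curve_eval m s x j * curve_eval n s x j =
      poly (lin r j * fst m \<sharp> j * fst n \<sharp> j + lin r (j + 1) * lin r (j + 2) * snd m \<sharp> j * snd n \<sharp> j) x
      + (s 1 * s 2 * s 3) * poly (fst m \<sharp> j * snd n \<sharp> j + snd m \<sharp> j * fst n \<sharp> j) x" for j
    unfolding prod_3_cyclic[of s j, symmetric] curve_eval_def by (simp add: poly_lin algebra_simps)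
  then show ?thesis by (simp add: pair_eval_def curve_dot_def poly_sum sum.distrib sum_distrib_left distrib_left)
qed

lemma curve_eval_smul:
  "curve_eval (curve_smul r c m) s x k = pair_eval c x (s 1 * s 2 * s 3) * curve_eval m s x k"
  unfolding prod_3_cyclic[of s k, symmetric] curve_eval_def pair_eval_def curve_smul_def
  by (simp add: poly_lin algebra_simps)

end

text \<open>
  On the curve, \<open>E = \<Sum> d\<^sub>k \<lambda>\<^sub>k v\<^sub>k\<close>, \<open>H = \<Sum> d\<^sub>k \<lambda>\<^sub>i\<lambda>\<^sub>j v\<^sub>k\<close> and \<open>F = \<Sum> d\<^sub>k (\<lambda>\<^sub>i\<^sup>2 + \<lambda>\<^sub>j\<^sup>2 - \<lambda>\<^sub>k\<^sup>2) \<lambda>\<^sub>k v\<^sub>k\<close>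
  form an \<open>sl\<^sub>2\<close>-triple over \<open>\<complex>[x, \<lambda>\<^sub>1\<lambda>\<^sub>2\<lambda>\<^sub>3]\<close> up to scalars: \<open>[H, E] = D E\<close>, \<open>[H, F] = - D F\<close>,
  \<open>[E, F] = - 2 D H\<close> with \<open>D = d\<^sub>1d\<^sub>2d\<^sub>3\<close>. The frame consists of the corresponding normalisations of
  \<open>H\<close>, \<open>E + F\<close> and \<open>E - F\<close>; it trivialises the bundle of Lie algebras on the quotient torus.
\<close>

locale curve_frame =
  fixes r d :: "3 \<Rightarrow> complex"
  assumes d_sq: "d k * d k = r (k + 1) - r (k + 2)" and d_nz: "d k \<noteq> 0"
begin

definition D :: complex where "D = d 1 * d 2 * d 3"

text \<open>On the curve \<open>x + 2 r_j - (r_1 + r_2 + r_3)\<close> is the sum of the squares of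
  the other two coordinates minus \<open>\<lambda>_j^2\<close>, so the three vectors are
  \<open>- \<i> H / D\<close>, \<open>(E + F) / (2D)\<close> and
  \<open>- \<i> (E - F) / (2D)\<close>. The choice \<open>d_k^2 = r_{k+1} - r_{k+2}\<close> makes
  \<open>E\<close> isotropic: \<open>\<Sum> d_k^2 \<lambda>_k^2\<close> vanishes identically in
  \<open>x\<close>.\<close>

definition frame :: "3 \<Rightarrow> curve_vec" where
  "frame k =
    (if k = 1 then (0, \<chi> j. [:- \<i> * d j / D:])
     else if k = 2 then (\<chi> j. smult (d j / (2 * D)) [:1 + 2 * r j - (r 1 + r 2 + r 3), 1:], 0)
     else (\<chi> j. smult (- \<i> * d j / (2 * D)) [:1 - 2 * r j + (r 1 + r 2 + r 3), - 1:], 0))"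

definition coord :: "curve_vec \<Rightarrow> 3 \<Rightarrow> complex poly \<times> complex poly" where
  "coord m k = curve_dot r m (frame k)"

lemma D_nz: "D \<noteq> 0" by (simp add: D_def d_nz)

lemma D_cyclic: "D = d k * d (k + 1) * d (k + 2)"
  by (simp only: D_def prod_3_cyclic)

context
  fixes s :: "3 \<Rightarrow> complex" and x :: complex
  assumes s: "\<And>k. (s k)\<^sup>2 + r k = x"
begin

abbreviation W where "W k j \<equiv> curve_eval (frame k) s x j"

definition g where "g j = (s 1)\<^sup>2 + (s 2)\<^sup>2 + (s 3)\<^sup>2 - 2 * (s j)\<^sup>2"

lemma r_eq: "r k = x - (s k)\<^sup>2" using s[of k] by (simp add: algebra_simps)

lemma W_eq: "W 1 j = - \<i> * d j / D * (s (j + 1) * s (j + 2))" "W 2 j = d j / (2 * D) * ((1 + g j) * s j)"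
  "W 3 j = - \<i> * d j / (2 * D) * ((1 - g j) * s j)"
  by (simp_all add: curve_eval_def frame_def g_def r_eq algebra_simps)

lemma dd: "d k * d k = (s (k + 2))\<^sup>2 - (s (k + 1))\<^sup>2"
  by (simp add: d_sq r_eq)

text \<open>Naming the data by cyclic position relative to \<open>j\<close> leaves one identity for
  each \<open>k\<close>; each follows by writing the squares of \<open>d\<close> as differences of
  squares of coordinates.\<close>

lemma W_cross: "W (k + 1) (j + 1) * W (k + 2) (j + 2) - W (k + 1) (j + 2) * W (k + 2) (j + 1) = W k j"
proof -
  note 3 = add_3
  define a b c where "a = d j" and "b = d (j + 1)" and "c = d (j + 2)"
  have D: "D = a * b * c" and nz: "a \<noteq> 0" "b \<noteq> 0" "c \<noteq> 0"
    by (simp_all add: a_def b_def c_def D_cyclic[of j] d_nz)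
  define p q u where "p = s j" and "q = s (j + 1)" and "u = s (j + 2)"
  have sq: "a * a = u\<^sup>2 - q\<^sup>2" "b * b = p\<^sup>2 - u\<^sup>2" "c * c = q\<^sup>2 - p\<^sup>2"
    using dd[of j] dd[of "j + 1"] dd[of "j + 2"] by (simp_all add: a_def b_def c_def p_def q_def u_def cyclic_sum_3)
  have G: "(s 1)\<^sup>2 + (s 2)\<^sup>2 + (s 3)\<^sup>2 = p\<^sup>2 + q\<^sup>2 + u\<^sup>2"
    using exhaust_3[of j] unfolding p_def q_def u_def by (elim disjE) (simp_all only: 3, simp_all)
  have g: "g j = q\<^sup>2 + u\<^sup>2 - p\<^sup>2" "g (j + 1) = p\<^sup>2 + u\<^sup>2 - q\<^sup>2" "g (j + 2) = p\<^sup>2 + q\<^sup>2 - u\<^sup>2"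
    unfolding g_def G by (simp_all add: p_def q_def u_def)
  note defs = a_def[symmetric] b_def[symmetric] c_def[symmetric] p_def[symmetric] q_def[symmetric] u_def[symmetric]
  have 1: "W 2 (j + 1) * W 3 (j + 2) - W 2 (j + 2) * W 3 (j + 1) = W 1 j"
  proof -
    have "W 2 (j + 1) * W 3 (j + 2) - W 2 (j + 2) * W 3 (j + 1)
        = - \<i> * b * c * q * u / (4 * D\<^sup>2) * ((1 + g (j + 1)) * (1 - g (j + 2)) - (1 + g (j + 2)) * (1 - g (j + 1)))"
      unfolding W_eq cyclic_sum_3 defs using D_nz by (simp add: power2_eq_square field_simps)
    also have "(1 + g (j + 1)) * (1 - g (j + 2)) - (1 + g (j + 2)) * (1 - g (j + 1)) = 4 * (a * a)"
      unfolding g sq by (simp add: algebra_simps)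
    also have "- \<i> * b * c * q * u / (4 * D\<^sup>2) * (4 * (a * a)) = - \<i> * a / D * (q * u)"
      unfolding D using nz by (simp add: divide_simps power2_eq_square)
    finally show ?thesis unfolding W_eq defs .
  qed
  have 2: "W 3 (j + 1) * W 1 (j + 2) - W 3 (j + 2) * W 1 (j + 1) = W 2 j"
  proof -
    have "W 3 (j + 1) * W 1 (j + 2) - W 3 (j + 2) * W 1 (j + 1)
        = - b * c * p / (2 * D\<^sup>2) * ((1 - g (j + 1)) * q\<^sup>2 - (1 - g (j + 2)) * u\<^sup>2)"
      unfolding W_eq cyclic_sum_3 defs using D_nz by (simp add: power2_eq_square field_simps)
    also have "(1 - g (j + 1)) * q\<^sup>2 - (1 - g (j + 2)) * u\<^sup>2 = - (a * a) * (1 + g j)"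
      unfolding g sq by (simp add: algebra_simps power2_eq_square)
    also have "- b * c * p / (2 * D\<^sup>2) * (- (a * a) * (1 + g j)) = a / (2 * D) * ((1 + g j) * p)"
      unfolding D using nz by (simp add: divide_simps power2_eq_square)
    finally show ?thesis unfolding W_eq defs .
  qed
  have 3: "W 1 (j + 1) * W 2 (j + 2) - W 1 (j + 2) * W 2 (j + 1) = W 3 j"
  proof -
    have "W 1 (j + 1) * W 2 (j + 2) - W 1 (j + 2) * W 2 (j + 1)
        = - \<i> * b * c * p / (2 * D\<^sup>2) * ((1 + g (j + 2)) * u\<^sup>2 - (1 + g (j + 1)) * q\<^sup>2)"
      unfolding W_eq cyclic_sum_3 defs using D_nz by (simp add: power2_eq_square field_simps)
    also have "(1 + g (j + 2)) * u\<^sup>2 - (1 + g (j + 1)) * q\<^sup>2 = (a * a) * (1 - g j)"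
      unfolding g sq by (simp add: algebra_simps power2_eq_square)
    also have "- \<i> * b * c * p / (2 * D\<^sup>2) * ((a * a) * (1 - g j)) = - \<i> * a / (2 * D) * ((1 - g j) * p)"
      unfolding D using nz by (simp add: divide_simps power2_eq_square)
    finally show ?thesis unfolding W_eq defs .
  qed
  show ?thesis using exhaust_3[of k] 1 2 3 by (elim disjE) (simp_all only: add_3)
qed

text \<open>Every sum has the form \<open>\<Sum> d_j^2 \<alpha>_j \<beta>_j\<close> up to a scalar.
  The diagonal ones are multiples of \<open>D^2\<close>, the product of the three differences of
  squares; the others vanish identically.\<close>

lemma W_orthonormal: "(\<Sum>j\<in>UNIV. W k j * W l j) = (if k = l then 1 else 0)"
proof -
  note 3 = add_3
  define p q u where "p = s 1" and "q = s 2" and "u = s 3"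
  note defs = p_def[symmetric] q_def[symmetric] u_def[symmetric]
  have sq: "d 1 * d 1 = u\<^sup>2 - q\<^sup>2" "d 2 * d 2 = p\<^sup>2 - u\<^sup>2" "d 3 * d 3 = q\<^sup>2 - p\<^sup>2"
    using dd[of 1] dd[of 2] dd[of 3] by (simp_all only: p_def q_def u_def 3)
  have g: "g 1 = q\<^sup>2 + u\<^sup>2 - p\<^sup>2" "g 2 = p\<^sup>2 + u\<^sup>2 - q\<^sup>2" "g 3 = p\<^sup>2 + q\<^sup>2 - u\<^sup>2"
    by (simp_all add: p_def q_def u_def g_def)
  have DD: "D\<^sup>2 = (u\<^sup>2 - q\<^sup>2) * (p\<^sup>2 - u\<^sup>2) * (q\<^sup>2 - p\<^sup>2)"
    unfolding sq[symmetric] D_def by (simp add: power2_eq_square mult_ac)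
  have sum: "(\<Sum>j\<in>UNIV. (e * d j / N * \<alpha> j) * (e' * d j / N' * \<beta> j)) =
      e * e' / (N * N') * ((u\<^sup>2 - q\<^sup>2) * \<alpha> 1 * \<beta> 1 + (p\<^sup>2 - u\<^sup>2) * \<alpha> 2 * \<beta> 2 + (q\<^sup>2 - p\<^sup>2) * \<alpha> 3 * \<beta> 3)"
    for e e' N N' :: complex and \<alpha> \<beta> :: "3 \<Rightarrow> complex"
    unfolding sum_3 sq[symmetric] by (simp add: algebra_simps)
  have 11: "(\<Sum>j\<in>UNIV. W 1 j * W 1 j) = 1"
  proof -
    have "(u\<^sup>2 - q\<^sup>2) * (q * u) * (q * u) + (p\<^sup>2 - u\<^sup>2) * (u * p) * (u * p) + (q\<^sup>2 - p\<^sup>2) * (p * q) * (p * q) = - (D\<^sup>2)"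
      unfolding DD by (simp add: algebra_simps power2_eq_square)
    with sum[of "- \<i>" D "\<lambda>j. s (j + 1) * s (j + 2)" "- \<i>" D "\<lambda>j. s (j + 1) * s (j + 2)"]
    show ?thesis using D_nz by (simp only: W_eq 3 defs mult_1) (simp add: power2_eq_square)
  qed
  have 22: "(\<Sum>j\<in>UNIV. W 2 j * W 2 j) = 1"
  proof -
    have "(u\<^sup>2 - q\<^sup>2) * ((1 + g 1) * p) * ((1 + g 1) * p) + (p\<^sup>2 - u\<^sup>2) * ((1 + g 2) * q) * ((1 + g 2) * q)
        + (q\<^sup>2 - p\<^sup>2) * ((1 + g 3) * u) * ((1 + g 3) * u) = 4 * D\<^sup>2"
      unfolding DD g by (simp add: algebra_simps power2_eq_square)
    with sum[of 1 "2 * D" "\<lambda>j. (1 + g j) * s j" 1 "2 * D" "\<lambda>j. (1 + g j) * s j"]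
    show ?thesis using D_nz by (simp only: W_eq defs mult_1) (simp add: power2_eq_square)
  qed
  have 33: "(\<Sum>j\<in>UNIV. W 3 j * W 3 j) = 1"
  proof -
    have "(u\<^sup>2 - q\<^sup>2) * ((1 - g 1) * p) * ((1 - g 1) * p) + (p\<^sup>2 - u\<^sup>2) * ((1 - g 2) * q) * ((1 - g 2) * q)
        + (q\<^sup>2 - p\<^sup>2) * ((1 - g 3) * u) * ((1 - g 3) * u) = - 4 * D\<^sup>2"
      unfolding DD g by (simp add: algebra_simps power2_eq_square)
    with sum[of "- \<i>" "2 * D" "\<lambda>j. (1 - g j) * s j" "- \<i>" "2 * D" "\<lambda>j. (1 - g j) * s j"]
    show ?thesis using D_nz by (simp only: W_eq defs) (simp add: power2_eq_square)
  qed
  have 12: "(\<Sum>j\<in>UNIV. W 1 j * W 2 j) = 0"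
  proof -
    have "(u\<^sup>2 - q\<^sup>2) * (q * u) * ((1 + g 1) * p) + (p\<^sup>2 - u\<^sup>2) * (u * p) * ((1 + g 2) * q)
        + (q\<^sup>2 - p\<^sup>2) * (p * q) * ((1 + g 3) * u) = 0"
      unfolding g by (simp add: algebra_simps power2_eq_square)
    with sum[of "- \<i>" D "\<lambda>j. s (j + 1) * s (j + 2)" 1 "2 * D" "\<lambda>j. (1 + g j) * s j"]
    show ?thesis by (simp only: W_eq 3 defs mult_1 mult_zero_right)
  qed
  have 13: "(\<Sum>j\<in>UNIV. W 1 j * W 3 j) = 0"
  proof -
    have "(u\<^sup>2 - q\<^sup>2) * (q * u) * ((1 - g 1) * p) + (p\<^sup>2 - u\<^sup>2) * (u * p) * ((1 - g 2) * q)
        + (q\<^sup>2 - p\<^sup>2) * (p * q) * ((1 - g 3) * u) = 0"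
      unfolding g by (simp add: algebra_simps power2_eq_square)
    with sum[of "- \<i>" D "\<lambda>j. s (j + 1) * s (j + 2)" "- \<i>" "2 * D" "\<lambda>j. (1 - g j) * s j"]
    show ?thesis by (simp only: W_eq 3 defs mult_1 mult_zero_right)
  qed
  have 23: "(\<Sum>j\<in>UNIV. W 2 j * W 3 j) = 0"
  proof -
    have "(u\<^sup>2 - q\<^sup>2) * ((1 + g 1) * p) * ((1 - g 1) * p) + (p\<^sup>2 - u\<^sup>2) * ((1 + g 2) * q) * ((1 - g 2) * q)
        + (q\<^sup>2 - p\<^sup>2) * ((1 + g 3) * u) * ((1 - g 3) * u) = 0"
      unfolding g by (simp add: algebra_simps power2_eq_square)
    with sum[of 1 "2 * D" "\<lambda>j. (1 + g j) * s j" "- \<i>" "2 * D" "\<lambda>j. (1 - g j) * s j"]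
    show ?thesis by (simp only: W_eq defs mult_1 mult_zero_right)
  qed
  have ne: "(1 :: 3) \<noteq> 2" "(1 :: 3) \<noteq> 3" "(2 :: 3) \<noteq> 3" by simp_all
  have comm: "(\<Sum>j\<in>UNIV. W k j * W l j) = (\<Sum>j\<in>UNIV. W l j * W k j)" for k l by (simp only: mult.commute)
  show ?thesis
    using exhaust_3[of k] exhaust_3[of l] 11 22 33 12 13 23 12[unfolded comm[of 1 2]] 13[unfolded comm[of 1 3]] 23[unfolded comm[of 2 3]]
    by (elim disjE) (simp_all only: ne ne[symmetric] if_True if_False simp_thms)
qed

text \<open>A one-sided inverse of a square matrix is two-sided, so orthonormal rows give
  orthonormal columns; this is what turns dot products with the frame into an expansion.\<close>

lemma W_orthonormal': "(\<Sum>k\<in>UNIV. W k i * W k j) = (if i = j then 1 else 0)"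
proof -
  define M :: "complex^3^3" where "M = (\<chi> k j. W k j)"
  have "M ** transpose M = mat 1"
    by (simp add: vec_eq_iff matrix_matrix_mult_def transpose_def M_def mat_def W_orthonormal)
  then have "transpose M ** M = mat 1" by (simp add: matrix_left_right_inverse)
  then have "(transpose M ** M) \<sharp> i \<sharp> j = mat 1 \<sharp> i \<sharp> j" by simp
  then show ?thesis by (simp add: matrix_matrix_mult_def transpose_def M_def mat_def)
qed

lemma pair_eval_coord: "pair_eval (coord m k) x (s 1 * s 2 * s 3) = (\<Sum>j\<in>UNIV. curve_eval m s x j * W k j)"
  unfolding coord_def by (rule pair_eval_dot[OF s])

lemma curve_eval_coord: "curve_eval m s x j = (\<Sum>k\<in>UNIV. pair_eval (coord m k) x (s 1 * s 2 * s 3) * W k j)"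
proof -
  have "(\<Sum>k\<in>UNIV. pair_eval (coord m k) x (s 1 * s 2 * s 3) * W k j)
      = (\<Sum>i\<in>UNIV. curve_eval m s x i * (\<Sum>k\<in>UNIV. W k i * W k j))"
    unfolding pair_eval_coord by (simp add: sum_distrib_left sum_distrib_right mult.assoc) (rule sum.swap)
  then show ?thesis by (simp add: W_orthonormal' if_distrib[of "(*) _"] cong: if_cong)
qed

lemma pair_eval_coord_bracket:
  fixes m n k
  defines "c \<equiv> \<lambda>m k. pair_eval (coord m k) x (s 1 * s 2 * s 3)"
  shows "c (curve_bracket r m n) k = c m (k + 1) * c n (k + 2) - c m (k + 2) * c n (k + 1)"
proof -
  note 3 = add_3
  show ?thesis
    unfolding c_def pair_eval_coord curve_eval_bracket[OF s] W_cross[of k, symmetric] sum_3 3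
    by (simp add: algebra_simps)
qed

end

lemma coord_inject:
  assumes "\<And>k. coord m k = coord n k"
  shows "m = n"
  by (rule curve_eval_inject[of r]) (simp add: curve_eval_coord assms)

lemma coord_surj: "\<exists>m. \<forall>k. coord m k = c k"
proof (rule exI[of _ "\<Sum>k\<in>UNIV. curve_smul r (c k) (frame k)"], rule allI)
  fix l
  show "coord (\<Sum>k\<in>UNIV. curve_smul r (c k) (frame k)) l = c l"
  proof (rule pair_eval_inject[of r])
    fix s x assume s: "\<And>k. (s k)\<^sup>2 + r k = x"
    have "curve_eval (\<Sum>k\<in>UNIV. curve_smul r (c k) (frame k)) s x j
        = (\<Sum>k\<in>UNIV. pair_eval (c k) x (s 1 * s 2 * s 3) * curve_eval (frame k) s x j)" for j
      by (simp add: sum_3 curve_eval_add curve_eval_smul[OF s])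
    then have "pair_eval (coord (\<Sum>k\<in>UNIV. curve_smul r (c k) (frame k)) l) x (s 1 * s 2 * s 3)
        = (\<Sum>k\<in>UNIV. pair_eval (c k) x (s 1 * s 2 * s 3) * (\<Sum>j\<in>UNIV. curve_eval (frame k) s x j * curve_eval (frame l) s x j))"
      unfolding pair_eval_coord[OF s] by (simp add: sum_distrib_left sum_distrib_right mult.assoc) (rule sum.swap)
    then show "pair_eval (coord (\<Sum>k\<in>UNIV. curve_smul r (c k) (frame k)) l) x (s 1 * s 2 * s 3)
        = pair_eval (c l) x (s 1 * s 2 * s 3)"
      by (simp add: W_orthonormal[OF s] if_distrib[of "(*) _"] cong: if_cong)
  qed
qed

end

subsection \<open>Functions on punctured tori\<close>

context tensor_algebra
begin

text \<open>Common to both algebras on the torus: \<open>G\<close> lists the coordinates of an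
  embedding of the model into \<open>sl2 \<otimes> A\<close>, and the functionals in
  \<open>E\<close>, point evaluations in both uses, prove it injective.\<close>

lemma curve_lie_iso:
  assumes G: "\<And>m k. G m k \<in> carrier A"
    and E: "\<And>e f g. e \<in> E \<Longrightarrow> f \<in> carrier A \<Longrightarrow> g \<in> carrier A \<Longrightarrow> e (f \<oplus>\<^bsub>A\<^esub> g) = e f + (e g :: complex)"
      "\<And>e c f. e \<in> E \<Longrightarrow> f \<in> carrier A \<Longrightarrow> e (c \<odot>\<^bsub>A\<^esub> f) = c * e f"
    and inj: "\<And>m n. (\<And>e k. e \<in> E \<Longrightarrow> e (G m k) = e (G n k)) \<Longrightarrow> m = n"
    and add: "\<And>m n k. G (m + n) k = G m k \<oplus>\<^bsub>A\<^esub> G n k"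
    and scale: "\<And>c m k. G (curve_scale c m) k = c \<odot>\<^bsub>A\<^esub> G m k"
    and bracket: "\<And>m n k. G (curve_bracket r m n) k =
      G m (k + 1) \<otimes>\<^bsub>A\<^esub> G n (k + 2) \<oplus>\<^bsub>A\<^esub> (- 1) \<odot>\<^bsub>A\<^esub> (G m (k + 2) \<otimes>\<^bsub>A\<^esub> G n (k + 1))"
  defines "L \<equiv> (tensor_lie sl2 A)\<lparr>carrier := range (\<lambda>m. nf (G m))\<rparr>"
  shows "curve_lie r \<cong>\<^sub>L L" "L \<cong>\<^sub>L curve_lie r"
proof -
  have inj': "inj (\<lambda>m. nf (G m))"
  proof (rule injI)
    fix m n assume eq: "nf (G m) = nf (G n)"
    show "m = n"
    proof (rule inj)
      fix e k assume "e \<in> E"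
      then show "e (G m k) = e (G n k)" by (intro nf_eqD[OF E eq])
    qed
  qed
  have z: "nf (G 0) = \<zero>\<^bsub>L\<^esub>"
  proof -
    have "curve_scale 0 0 = 0" by (simp add: curve_scale_def prod_eq_iff vec_eq_iff)
    then have "nf (G 0) = nf (\<lambda>k. 0 \<odot>\<^bsub>A\<^esub> G 0 k)" using scale[of 0 0] by simp
    also have "\<dots> = 0 \<odot>\<^bsub>tensor_lie sl2 A\<^esub> nf (G 0)" by (rule nf_smult[symmetric]) (rule G)
    also have "\<dots> = cls 0" unfolding nf_def tensor_lie_smult by simp
    finally show ?thesis by (simp add: L_def tensor_lie_zero)
  qed
  have op: "nf (G (m + n)) = nf (G m) \<oplus>\<^bsub>L\<^esub> nf (G n)" "nf (G (curve_scale c m)) = c \<odot>\<^bsub>L\<^esub> nf (G m)"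
    "nf (G (curve_bracket r m n)) = lie_bracket L (nf (G m)) (nf (G n))" for m n c
  proof -
    have "G (m + n) = (\<lambda>k. G m k \<oplus>\<^bsub>A\<^esub> G n k)" "G (curve_scale c m) = (\<lambda>k. c \<odot>\<^bsub>A\<^esub> G m k)"
      "G (curve_bracket r m n) =
        (\<lambda>k. G m (k + 1) \<otimes>\<^bsub>A\<^esub> G n (k + 2) \<oplus>\<^bsub>A\<^esub> (- 1) \<odot>\<^bsub>A\<^esub> (G m (k + 2) \<otimes>\<^bsub>A\<^esub> G n (k + 1)))"
      using add scale bracket by (simp_all add: fun_eq_iff)
    then show "nf (G (m + n)) = nf (G m) \<oplus>\<^bsub>L\<^esub> nf (G n)" "nf (G (curve_scale c m)) = c \<odot>\<^bsub>L\<^esub> nf (G m)"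
      "nf (G (curve_bracket r m n)) = lie_bracket L (nf (G m)) (nf (G n))"
      by (simp_all add: L_def nf_add[OF G G] nf_smult[OF G] nf_bracket[OF G G])
  qed
  have bij: "bij_betw (\<lambda>m. nf (G m)) (carrier (curve_lie r)) (carrier L)"
    using inj' by (simp add: L_def bij_betw_def)
  note t = lie_transport[OF complex_lie_algebra_curve_lie bij]
  show "curve_lie r \<cong>\<^sub>L L" "L \<cong>\<^sub>L curve_lie r"
    by (rule t; simp add: z op)+
qed

end

lemma torus_proj_eq_iff: "torus_proj \<tau> z = torus_proj \<tau> w \<longleftrightarrow> z - w \<in> lattice \<tau>"
proof -
  have T: "torus_proj \<tau> z = {u. u - z \<in> lattice \<tau>}" for z
    unfolding torus_proj_def by (force intro: rev_image_eqI)
  show ?thesis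
  proof
    assume "torus_proj \<tau> z = torus_proj \<tau> w"
    moreover have "z \<in> torus_proj \<tau> z" by (simp add: T lattice_0)
    ultimately show "z - w \<in> lattice \<tau>" by (simp add: T)
  next
    assume zw: "z - w \<in> lattice \<tau>"
    have "u - z \<in> lattice \<tau> \<longleftrightarrow> u - w \<in> lattice \<tau>" for u
      using lattice_add_iff[OF zw, of "u - z"] by simp
    then show "torus_proj \<tau> z = torus_proj \<tau> w" by (simp add: T)
  qed
qed

text \<open>Here \<open>H\<close> is the preimage of the punctures in the plane, so that functions
  on cosets can be handled as periodic functions off \<open>H\<close>. The two instances are the
  lattice itself and the half lattice.\<close>

locale punctured_torus = upper_half_plane +
  fixes P :: "complex set set" and H :: "complex set"
  assumes proj_mem: "torus_proj \<tau> z \<in> P \<longleftrightarrow> z \<in> H"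
    and H_half: "H \<subseteq> half_lattice" and closed_H: "closed H"
begin

abbreviation "A \<equiv> torus_functions \<tau> P"
abbreviation "desc \<equiv> torus_descend \<tau> P"
abbreviation "pr \<equiv> torus_proj \<tau>"

lemma eventually_not_H: "\<forall>\<^sub>F w in at z. w \<notin> H"
  using eventually_not_half_lattice[of z] by eventually_elim (use H_half in blast)

lemma pr_in: "pr z \<in> torus \<tau> - P \<longleftrightarrow> z \<notin> H"
  by (simp add: torus_def proj_mem)

lemma torus_pointE:
  assumes "p \<in> torus \<tau> - P"
  obtains z where "p = pr z" "z \<notin> H"
  using assms by (auto simp: torus_def proj_mem)

lemma pr_some: "p \<in> torus \<tau> - P \<Longrightarrow> pr (SOME z. pr z = p) = p"
  by (rule someI_ex) (auto simp: torus_def)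

lemma A_sel:
  "f \<oplus>\<^bsub>A\<^esub> g = (\<lambda>p\<in>torus \<tau> - P. f p + g p)" "c \<odot>\<^bsub>A\<^esub> f = (\<lambda>p\<in>torus \<tau> - P. c * f p)"
  "f \<otimes>\<^bsub>A\<^esub> g = (\<lambda>p\<in>torus \<tau> - P. f p * g p)" "\<zero>\<^bsub>A\<^esub> = (\<lambda>p\<in>torus \<tau> - P. 0)" "\<one>\<^bsub>A\<^esub> = (\<lambda>p\<in>torus \<tau> - P. 1)"
  by (simp_all add: torus_functions_def)

lemma A_apply:
  assumes "z \<notin> H"
  shows "(f \<oplus>\<^bsub>A\<^esub> g) (pr z) = f (pr z) + g (pr z)" "(c \<odot>\<^bsub>A\<^esub> f) (pr z) = c * f (pr z)"
    "(f \<otimes>\<^bsub>A\<^esub> g) (pr z) = f (pr z) * g (pr z)"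
  using assms pr_in[of z] by (simp_all add: A_sel)

lemma desc_alg:
  "desc f \<oplus>\<^bsub>A\<^esub> desc g = desc (\<lambda>z. f z + g z)" "c \<odot>\<^bsub>A\<^esub> desc f = desc (\<lambda>z. c * f z)"
  "desc f \<otimes>\<^bsub>A\<^esub> desc g = desc (\<lambda>z. f z * g z)" "\<zero>\<^bsub>A\<^esub> = desc (\<lambda>z. 0)" "\<one>\<^bsub>A\<^esub> = desc (\<lambda>z. 1)"
  by (simp_all add: A_sel torus_descend_def restrict_def fun_eq_iff)

lemma desc_cong:
  assumes "\<And>z. z \<notin> H \<Longrightarrow> f z = g z"
  shows "desc f = desc g"
proof -
  have "f (SOME z. pr z = p) = g (SOME z. pr z = p)" if "p \<in> torus \<tau> - P" for p
    by (rule assms) (use pr_some[OF that] that in \<open>simp flip: proj_mem\<close>)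
  then show ?thesis by (simp add: torus_descend_def restrict_def fun_eq_iff)
qed

lemma desc_apply:
  assumes per: "\<And>z u. z \<notin> H \<Longrightarrow> u \<in> \<Lambda> \<Longrightarrow> f (z + u) = f z" and z: "z \<notin> H"
  shows "desc f (pr z) = f z"
proof -
  define w where "w = (SOME w. pr w = pr z)"
  have "pr z \<in> torus \<tau> - P" using z pr_in by blast
  then have "pr w = pr z" unfolding w_def by (rule pr_some)
  then have "w - z \<in> \<Lambda>" by (simp add: torus_proj_eq_iff)
  from per[OF z this] have "f w = f z" by simp
  then show ?thesis using \<open>pr z \<in> _\<close> by (simp add: torus_descend_def w_def)
qed

lemma carrier_A:
  "f \<in> carrier A \<longleftrightarrow> f \<in> extensional (torus \<tau> - P) \<and> (\<lambda>z. f (pr z)) holomorphic_on - H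
    \<and> (\<lambda>z. f (pr z)) meromorphic_on UNIV"
proof -
  have "{z. pr z \<notin> P} = - H" by (auto simp: proj_mem)
  then show ?thesis by (simp add: torus_functions_def)
qed

lemma carrier_A_cong:
  assumes "f \<in> extensional (torus \<tau> - P)" "F holomorphic_on - H" "F meromorphic_on UNIV"
    "\<And>z. z \<notin> H \<Longrightarrow> f (pr z) = F z"
  shows "f \<in> carrier A"
proof -
  have "(\<lambda>z. f (pr z)) holomorphic_on - H \<longleftrightarrow> F holomorphic_on - H"
    by (rule holomorphic_cong) (simp_all add: assms(4))
  moreover have "(\<lambda>z. f (pr z)) meromorphic_on UNIV \<longleftrightarrow> F meromorphic_on UNIV"
  proof (rule meromorphic_on_cong)
    show "\<forall>\<^sub>F w in at z. f (pr w) = F w" for z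
      using eventually_not_H[of z] by eventually_elim (rule assms(4))
  qed simp
  ultimately show ?thesis using assms by (simp add: carrier_A)
qed

lemma desc_in_A:
  assumes per: "\<And>z u. z \<notin> H \<Longrightarrow> u \<in> \<Lambda> \<Longrightarrow> f (z + u) = f z"
    and "f holomorphic_on - H" "f meromorphic_on UNIV"
  shows "desc f \<in> carrier A"
proof (rule carrier_A_cong[OF _ assms(2,3) desc_apply[OF per]])
  show "desc f \<in> extensional (torus \<tau> - P)" unfolding torus_descend_def by (rule restrict_extensional)
qed

lemma A_eqI:
  assumes "f \<in> carrier A" "g \<in> carrier A" "\<And>z. z \<notin> H \<Longrightarrow> f (pr z) = g (pr z)"
  shows "f = g"
proof (rule extensionalityI)
  show "f \<in> extensional (torus \<tau> - P)" "g \<in> extensional (torus \<tau> - P)"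
    using assms(1,2) by (simp_all add: carrier_A)
  show "f p = g p" if "p \<in> torus \<tau> - P" for p
    using torus_pointE[OF that] assms(3) by metis
qed

lemma A_closed:
  shows "f \<in> carrier A \<Longrightarrow> g \<in> carrier A \<Longrightarrow> f \<oplus>\<^bsub>A\<^esub> g \<in> carrier A"
    and "f \<in> carrier A \<Longrightarrow> c \<odot>\<^bsub>A\<^esub> f \<in> carrier A"
    and "f \<in> carrier A \<Longrightarrow> g \<in> carrier A \<Longrightarrow> f \<otimes>\<^bsub>A\<^esub> g \<in> carrier A"
    and "\<zero>\<^bsub>A\<^esub> \<in> carrier A" and "\<one>\<^bsub>A\<^esub> \<in> carrier A"
proof -
  have ext: "f \<oplus>\<^bsub>A\<^esub> g \<in> extensional (torus \<tau> - P)" "c \<odot>\<^bsub>A\<^esub> f \<in> extensional (torus \<tau> - P)"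
    "f \<otimes>\<^bsub>A\<^esub> g \<in> extensional (torus \<tau> - P)"
    unfolding A_sel by (rule restrict_extensional)+
  show "f \<oplus>\<^bsub>A\<^esub> g \<in> carrier A" if "f \<in> carrier A" "g \<in> carrier A"
    using that by (intro carrier_A_cong[where F = "\<lambda>z. f (pr z) + g (pr z)"])
      (auto simp: carrier_A A_apply ext intro!: holomorphic_intros meromorphic_intros)
  show "c \<odot>\<^bsub>A\<^esub> f \<in> carrier A" if "f \<in> carrier A"
    using that by (intro carrier_A_cong[where F = "\<lambda>z. c * f (pr z)"])
      (auto simp: carrier_A A_apply ext intro!: holomorphic_intros meromorphic_intros)
  show "f \<otimes>\<^bsub>A\<^esub> g \<in> carrier A" if "f \<in> carrier A" "g \<in> carrier A"
    using that by (intro carrier_A_cong[where F = "\<lambda>z. f (pr z) * g (pr z)"])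
      (auto simp: carrier_A A_apply ext intro!: holomorphic_intros meromorphic_intros)
  show "\<zero>\<^bsub>A\<^esub> \<in> carrier A" unfolding desc_alg by (rule desc_in_A) (auto intro!: meromorphic_intros)
  show "\<one>\<^bsub>A\<^esub> \<in> carrier A" unfolding desc_alg by (rule desc_in_A) (auto intro!: meromorphic_intros)
qed

lemma tensor_algebra_subalgebra:
  assumes "\<And>f g. f \<in> C \<Longrightarrow> g \<in> C \<Longrightarrow> f \<oplus>\<^bsub>A\<^esub> g \<in> C" "\<And>c f. f \<in> C \<Longrightarrow> c \<odot>\<^bsub>A\<^esub> f \<in> C"
    "\<And>f g. f \<in> C \<Longrightarrow> g \<in> C \<Longrightarrow> f \<otimes>\<^bsub>A\<^esub> g \<in> C" "\<zero>\<^bsub>A\<^esub> \<in> C"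
  shows "tensor_algebra (A\<lparr>carrier := C\<rparr>)"
  by unfold_locales (simp_all add: assms, simp_all add: A_sel restrict_def fun_eq_iff algebra_simps)

lemma tensor_algebra_A: "tensor_algebra A"
proof -
  have "A\<lparr>carrier := carrier A\<rparr> = A" by simp
  then show ?thesis using tensor_algebra_subalgebra[of "carrier A"] A_closed by simp
qed

end

section \<open>The algebra over the ring of Weierstrass functions\<close>

context weierstrass_curve
begin

text \<open>Together with \<open>yw\<close> an affine change from the Weierstrass equation to
  \<open>y^2 = (x - r_1) (x - r_2) (x - r_3)\<close>; the factor in \<open>yw\<close> comes from
  \<open>4 \<kappa>^6 / 4 = (\<kappa>^2)^3\<close>. The function \<open>xl\<close> is this
  coordinate pulled back along doubling.\<close>

definition xw :: "complex \<Rightarrow> complex" where "xw z = \<kappa>\<^sup>2 * wp z + \<beta>"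
definition yw :: "complex \<Rightarrow> complex" where "yw z = \<kappa> ^ 3 / 2 * deriv wp z"

lemma xw_yw_holomorphic: "xw holomorphic_on - \<Lambda>" "yw holomorphic_on - \<Lambda>"
  unfolding xw_def yw_def using closed_lattice
  by (auto intro!: holomorphic_intros wp_holomorphic simp: open_Compl)

lemma xw_yw_periodic:
  assumes "z \<notin> \<Lambda>" "u \<in> \<Lambda>"
  shows "xw (z + u) = xw z" "yw (z + u) = yw z"
  using assms by (simp_all add: xw_def yw_def wp_periodic deriv_wp_periodic)

lemma xw_yw_uminus:
  assumes "z \<notin> \<Lambda>"
  shows "xw (- z) = xw z" "yw (- z) = - yw z"
  using assms by (simp_all add: xw_def yw_def wp_uminus deriv_wp_uminus)

text \<open>The differential equation is available off the half lattice; continuity extends it to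
  the half periods outside \<open>\<Lambda>\<close>.\<close>

lemma yw_sq:
  assumes z: "z \<notin> \<Lambda>"
  shows "(yw z)\<^sup>2 = (xw z - r 1) * (xw z - r 2) * (xw z - r 3)"
proof -
  define F where "F z = (yw z)\<^sup>2 - (xw z - r 1) * (xw z - r 2) * (xw z - r 3)" for z
  have F0: "F w = 0" if w: "w \<notin> half_lattice" for w
  proof -
    have "(yw w)\<^sup>2 = \<kappa> ^ 6 / 4 * (4 * (wp w - wp (1/2)) * (wp w - wp (\<tau>/2)) * (wp w - wp (1/2 + \<tau>/2)))"
      unfolding yw_def power_mult_distrib wp_ode[OF frame13 w] power_divide power_mult[symmetric] by simp
    moreover have "xw w - r 1 = \<kappa>\<^sup>2 * (wp w - wp (1/2))" "xw w - r 2 = \<kappa>\<^sup>2 * (wp w - wp (1/2 + \<tau>/2))"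
      "xw w - r 3 = \<kappa>\<^sup>2 * (wp w - wp (\<tau>/2))"
      unfolding xw_def r1 r2 r3 by (simp_all add: right_diff_distrib)
    moreover have "\<kappa> ^ 6 / 4 * (4 * a * b * c) = (\<kappa>\<^sup>2 * a) * (\<kappa>\<^sup>2 * c) * (\<kappa>\<^sup>2 * b)" for a b c
      by (simp add: power2_eq_square eval_nat_numeral)
    ultimately show ?thesis unfolding F_def by (simp only: diff_self)
  qed
  have "F holomorphic_on - \<Lambda>" unfolding F_def by (intro holomorphic_intros xw_yw_holomorphic)
  then have "continuous_on (- \<Lambda>) F" by (rule holomorphic_on_imp_continuous_on)
  then have "isCont F z" using z closed_lattice by (simp add: continuous_on_eq_continuous_at open_Compl)
  then have "(F \<longlongrightarrow> F z) (at z)" by (simp add: isCont_def)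
  moreover have "(F \<longlongrightarrow> 0) (at z)"
  proof (rule tendsto_eventually)
    show "\<forall>\<^sub>F w in at z. F w = 0" using eventually_not_half_lattice[of z] by eventually_elim (rule F0)
  qed
  ultimately have "F z = 0" by (intro tendsto_unique[of "at z" F]) simp_all
  then show ?thesis by (simp add: F_def)
qed

text \<open>Square roots of \<open>x - r_k\<close> have product \<open>y\<close> or
  \<open>- y\<close>, and a sign change of \<open>s 1\<close> corrects the second case. Identities
  in \<open>\<complex>[x, y]\<close> known at points of the curve thereby pass to functions on the
  torus.\<close>

lemma curve_point_over:
  assumes z: "z \<notin> \<Lambda>"
  shows "\<exists>s :: 3 \<Rightarrow> complex. (\<forall>k. (s k)\<^sup>2 + r k = xw z) \<and> s 1 * s 2 * s 3 = yw z"
proof -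
  obtain s :: "3 \<Rightarrow> complex" where s: "\<And>k. (s k)\<^sup>2 + r k = xw z" using ex_curve_point[of r "xw z"] by blast
  then have s_sq: "xw z - r k = (s k)\<^sup>2" for k by (metis add_diff_cancel_right')
  have "(s 1 * s 2 * s 3)\<^sup>2 = (yw z)\<^sup>2"
    using s_sq by (simp add: yw_sq[OF z] power_mult_distrib)
  then consider "s 1 * s 2 * s 3 = yw z" | "(- s 1) * s 2 * s 3 = yw z"
    by (auto simp: power2_eq_iff)
  then show ?thesis
  proof cases
    case 1
    then show ?thesis using s by blast
  next
    case 2
    have "((s(1 := - s 1)) k)\<^sup>2 + r k = xw z" for k using s[of k] s[of 1] by simp
    moreover have "(s(1 := - s 1)) 1 * (s(1 := - s 1)) 2 * (s(1 := - s 1)) 3 = yw z" using 2 by simp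
    ultimately show ?thesis by blast
  qed
qed

definition pe :: "complex poly \<times> complex poly \<Rightarrow> complex \<Rightarrow> complex" where
  "pe c z = pair_eval c (xw z) (yw z)"

lemma pe_inject:
  assumes eq: "\<And>z. z \<notin> \<Lambda> \<Longrightarrow> pe c z = pe c' z"
  shows "c = c'"
proof -
  define a b where "a = fst c - fst c'" and "b = snd c - snd c'"
  have both: "poly a (xw z) = 0 \<and> yw z * poly b (xw z) = 0" if z: "z \<notin> \<Lambda>" for z
  proof -
    have "- z \<notin> \<Lambda>" using z by (simp add: lattice_uminus_iff)
    from eq[OF z] eq[OF this]
    have "poly a (xw z) + yw z * poly b (xw z) = 0" "poly a (xw z) - yw z * poly b (xw z) = 0"
      by (simp_all add: pe_def pair_eval_def xw_yw_uminus[OF z] a_def b_def algebra_simps)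
    then show ?thesis by (rule add_diff_eq_0)
  qed
  have "((\<lambda>z. \<kappa>\<^sup>2 * (z\<^sup>2 * wp z) + z\<^sup>2 * \<beta>) \<longlongrightarrow> \<kappa>\<^sup>2 * 1 + 0\<^sup>2 * \<beta>) (at 0)"
    by (intro tendsto_intros tendsto_wp_0)
  then have lim: "((\<lambda>z. z\<^sup>2 * xw z) \<longlongrightarrow> \<kappa>\<^sup>2) (at 0)" by (simp add: xw_def algebra_simps)
  have k: "\<kappa>\<^sup>2 \<noteq> 0" using \<kappa> by simp
  have nz: "\<forall>\<^sub>F z in at 0. yw z \<noteq> 0"
  proof -
    have "\<forall>\<^sub>F z in at 0. z ^ 3 * deriv wp z \<noteq> 0"
      using tendsto_deriv_wp_0 by (rule tendsto_imp_eventually_ne) simp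
    then show ?thesis by eventually_elim (use \<kappa> in \<open>auto simp: yw_def\<close>)
  qed
  have "\<forall>\<^sub>F z in at 0. poly a (xw z) = 0"
    using eventually_not_lattice[of 0] by eventually_elim (use both in blast)
  then have "a = 0" by (rule poly_eq_0_at_pole[OF _ lim k])
  moreover have "\<forall>\<^sub>F z in at 0. poly b (xw z) = 0"
    using eventually_not_lattice[of 0] nz by eventually_elim (use both in auto)
  then have "b = 0" by (rule poly_eq_0_at_pole[OF _ lim k])
  ultimately show ?thesis by (simp add: a_def b_def prod_eq_iff)
qed

lemma pe_periodic: "z \<notin> \<Lambda> \<Longrightarrow> u \<in> \<Lambda> \<Longrightarrow> pe c (z + u) = pe c z"
  by (simp add: pe_def xw_yw_periodic)

lemma punctured_torus_0: "punctured_torus \<tau> {torus_proj \<tau> 0} \<Lambda>"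
  by unfold_locales (auto simp: torus_proj_eq_iff lattice_subset_half closed_lattice)

lemma r_distinct: "r (k + 1) \<noteq> r (k + 2)"
proof -
  have "r 1 \<noteq> r 2" "r 2 \<noteq> r 3" "r 3 \<noteq> r 1"
    using wp_half_neq[OF frame13] \<kappa> by (simp_all add: r1 r2 r3)
  then show ?thesis using exhaust_3[of k] by (elim disjE) (simp_all only: add_3 simp_thms not_False_eq_True)
qed

text \<open>Coordinates in the frame map the model bijectively onto triples over
  \<open>\<complex>[x, y]\<close>, which becomes \<open>\<complex>[\<wp>, \<wp>']\<close> on
  substituting \<open>xw\<close> and \<open>yw\<close>. Brackets are respected because the frame has
  the structure constants of \<open>v_1, v_2, v_3\<close>.\<close>

lemma weierstrass_algebra_iso: "curve_lie r \<cong>\<^sub>L tensor_lie sl2 (weierstrass_algebra \<tau>)"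
proof -
  interpret T: punctured_torus \<tau> "{torus_proj \<tau> 0}" \<Lambda> by (rule punctured_torus_0)
  interpret F: curve_frame r "\<lambda>k. csqrt (r (k + 1) - r (k + 2))"
    by unfold_locales (use r_distinct in \<open>simp_all flip: power2_eq_square\<close>)
  define S where "S = algebra_span T.A {T.desc wp, T.desc (deriv wp)}"
  define B where "B = T.A\<lparr>carrier := S\<rparr>"
  have B: "weierstrass_algebra \<tau> = B" by (simp add: weierstrass_algebra_def Let_def B_def S_def)
  have Bsel: "carrier B = S" "f \<oplus>\<^bsub>B\<^esub> g = f \<oplus>\<^bsub>T.A\<^esub> g" "c \<odot>\<^bsub>B\<^esub> f = c \<odot>\<^bsub>T.A\<^esub> f" "f \<otimes>\<^bsub>B\<^esub> g = f \<otimes>\<^bsub>T.A\<^esub> g" for f g c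
    by (simp_all add: B_def)
  interpret tensor_algebra B
    unfolding B_def by (rule T.tensor_algebra_subalgebra) (auto simp: S_def intro: algebra_span.intros)
  \<comment> \<open>Replacing \<open>y^2\<close> by the cubic
    \<open>lin r 1 * lin r 2 * lin r 3\<close> brings the product back to the form
    \<open>p(x) + y q(x)\<close>.\<close>
  have pe_mult: "\<exists>e. T.desc (pe c) \<otimes>\<^bsub>T.A\<^esub> T.desc (pe c') = T.desc (pe e)" for c c'
    unfolding T.desc_alg
  proof (intro exI T.desc_cong)
    fix z assume "z \<notin> \<Lambda>"
    note y = yw_sq[OF this, unfolded power2_eq_square]
    show "pe c z * pe c' z = pe (fst c * fst c' + lin r 1 * lin r 2 * lin r 3 * snd c * snd c',
        fst c * snd c' + snd c * fst c') z"
    proof -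
      have "pe c z * pe c' z = poly (fst c) (xw z) * poly (fst c') (xw z)
          + (yw z * yw z) * (poly (snd c) (xw z) * poly (snd c') (xw z))
          + yw z * (poly (fst c) (xw z) * poly (snd c') (xw z) + poly (snd c) (xw z) * poly (fst c') (xw z))"
        by (simp add: pe_def pair_eval_def algebra_simps)
      moreover have "poly (lin r k) x = x - r k" for k x by (simp add: lin_def)
      ultimately show ?thesis unfolding y by (simp add: pe_def pair_eval_def mult.assoc)
    qed
  qed
  have span_pe: "\<exists>c. f = T.desc (pe c)" if "f \<in> S" for f
    using that unfolding S_def
  proof (induction rule: algebra_span.induct)
    case zero
    have "pe (0, 0) = (\<lambda>z. 0)" by (rule ext) (simp add: pe_def pair_eval_def)
    then show ?case using T.desc_alg(4) by metis
  next
    case one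
    have "pe (1, 0) = (\<lambda>z. 1)" by (rule ext) (simp add: pe_def pair_eval_def)
    then show ?case using T.desc_alg(5) by metis
  next
    case (incl f)
    have 1: "pe ([:- \<beta> / \<kappa>\<^sup>2, 1 / \<kappa>\<^sup>2:], 0) = wp"
    proof
      fix z
      have "pe ([:- \<beta> / \<kappa>\<^sup>2, 1 / \<kappa>\<^sup>2:], 0) z = (xw z - \<beta>) / \<kappa>\<^sup>2"
        by (simp add: pe_def pair_eval_def diff_divide_distrib)
      then show "pe ([:- \<beta> / \<kappa>\<^sup>2, 1 / \<kappa>\<^sup>2:], 0) z = wp z" using \<kappa> by (simp add: xw_def)
    qed
    have 2: "pe (0, [:2 / \<kappa> ^ 3:]) = deriv wp"
    proof
      show "pe (0, [:2 / \<kappa> ^ 3:]) z = deriv wp z" for z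
        using \<kappa> by (simp add: pe_def pair_eval_def yw_def)
    qed
    show ?case using incl 1 2 by (metis empty_iff insert_iff)
  next
    case (add f g)
    then obtain c c' where c: "f = T.desc (pe c)" "g = T.desc (pe c')" by blast
    have "pe (c + c') = (\<lambda>z. pe c z + pe c' z)"
      by (rule ext) (simp add: pe_def pair_eval_def algebra_simps)
    then show ?case unfolding c using T.desc_alg(1) by metis
  next
    case (smult f a)
    then obtain c where c: "f = T.desc (pe c)" by blast
    have "pe (Polynomial.smult a (fst c), Polynomial.smult a (snd c)) = (\<lambda>z. a * pe c z)"
      by (rule ext) (simp add: pe_def pair_eval_def algebra_simps)
    then show ?case unfolding c using T.desc_alg(2) by metis
  next
    case (mult f g)
    then show ?case using pe_mult by blast
  qed
  have pe_span: "T.desc (pe c) \<in> S" for c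
  proof -
    note intros = algebra_span.intros[where A = T.A and S = "{T.desc wp, T.desc (deriv wp)}", folded S_def]
    have x: "T.desc xw \<in> S" and y: "T.desc yw \<in> S"
    proof -
      have "\<kappa>\<^sup>2 \<odot>\<^bsub>T.A\<^esub> T.desc wp \<oplus>\<^bsub>T.A\<^esub> \<beta> \<odot>\<^bsub>T.A\<^esub> \<one>\<^bsub>T.A\<^esub> \<in> S" by (intro intros) simp
      then show "T.desc xw \<in> S" by (simp add: T.desc_alg xw_def[abs_def])
      have "(\<kappa> ^ 3 / 2) \<odot>\<^bsub>T.A\<^esub> T.desc (deriv wp) \<in> S" by (intro intros) simp
      then show "T.desc yw \<in> S" by (simp add: T.desc_alg yw_def[abs_def])
    qed
    have p: "T.desc (\<lambda>z. poly p (xw z)) \<in> S" for p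
    proof (induction p)
      case 0
      show ?case using intros(1) by (simp add: T.desc_alg)
    next
      case (pCons a p)
      have "a \<odot>\<^bsub>T.A\<^esub> \<one>\<^bsub>T.A\<^esub> \<oplus>\<^bsub>T.A\<^esub> T.desc xw \<otimes>\<^bsub>T.A\<^esub> T.desc (\<lambda>z. poly p (xw z)) \<in> S"
        by (intro intros(2,4,5,6) x pCons.IH)
      then show ?case by (simp add: T.desc_alg)
    qed
    have "T.desc (\<lambda>z. poly (fst c) (xw z)) \<oplus>\<^bsub>T.A\<^esub> T.desc yw \<otimes>\<^bsub>T.A\<^esub> T.desc (\<lambda>z. poly (snd c) (xw z)) \<in> S"
      by (intro intros(4,6) p y)
    then show ?thesis by (simp add: T.desc_alg pe_def[abs_def] pair_eval_def)
  qed
  have ap: "T.desc (pe c) (torus_proj \<tau> z) = pe c z" if "z \<notin> \<Lambda>" for c z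
    by (rule T.desc_apply[OF pe_periodic that])
  define G where "G m k = T.desc (pe (F.coord m k))" for m k
  define E where "E = {\<lambda>f :: complex set \<Rightarrow> complex. f (torus_proj \<tau> z) | z. z \<notin> \<Lambda>}"
  have co: "pe (F.coord m k) z = pair_eval (F.coord m k) (xw z) (s 1 * s 2 * s 3)"
    if "s 1 * s 2 * s 3 = yw z" for m k z and s :: "3 \<Rightarrow> complex"
    using that by (simp add: pe_def)
  have "(tensor_lie sl2 B)\<lparr>carrier := range (\<lambda>m. nf (G m))\<rparr> = tensor_lie sl2 B"
  proof -
    have "nf f \<in> range (\<lambda>m. nf (G m))" if f: "\<forall>k. f k \<in> S" for f
    proof -
      have "\<forall>k. \<exists>c. f k = T.desc (pe c)" using f span_pe by blast
      from choice[OF this] obtain c where c: "\<forall>k. f k = T.desc (pe (c k))" by (elim exE)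
      from F.coord_surj[of c] obtain m where m: "\<forall>k. F.coord m k = c k" by (elim exE)
      have "f = G m" using c m by (simp add: fun_eq_iff G_def)
      then show ?thesis by blast
    qed
    moreover have "G m k \<in> S" for m k by (simp add: G_def pe_span)
    ultimately have "range (\<lambda>m. nf (G m)) = carrier (tensor_lie sl2 B)"
      unfolding carrier_tensor_lie Bsel by blast
    then show ?thesis by simp
  qed
  moreover have "curve_lie r \<cong>\<^sub>L (tensor_lie sl2 B)\<lparr>carrier := range (\<lambda>m. nf (G m))\<rparr>"
  proof -
    have G_add: "G (m + n) k = G m k \<oplus>\<^bsub>B\<^esub> G n k" for m n k
      unfolding G_def Bsel T.desc_alg
    proof (rule T.desc_cong)
      fix z assume z: "z \<notin> \<Lambda>"
      obtain s where s: "\<And>k. (s k)\<^sup>2 + r k = xw z" "s 1 * s 2 * s 3 = yw z"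
        using curve_point_over[OF z] by blast
      show "pe (F.coord (m + n) k) z = pe (F.coord m k) z + pe (F.coord n k) z"
        unfolding co[OF s(2)] F.pair_eval_coord[OF s(1)]
        by (simp add: curve_eval_add distrib_right sum.distrib)
    qed
    have G_scale: "G (curve_scale c m) k = c \<odot>\<^bsub>B\<^esub> G m k" for c m k
      unfolding G_def Bsel T.desc_alg
    proof (rule T.desc_cong)
      fix z assume z: "z \<notin> \<Lambda>"
      obtain s where s: "\<And>k. (s k)\<^sup>2 + r k = xw z" "s 1 * s 2 * s 3 = yw z"
        using curve_point_over[OF z] by blast
      show "pe (F.coord (curve_scale c m) k) z = c * pe (F.coord m k) z"
        unfolding co[OF s(2)] F.pair_eval_coord[OF s(1)]
        by (simp add: curve_eval_scale sum_distrib_left mult.assoc)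
    qed
    have G_bracket: "G (curve_bracket r m n) k =
        G m (k + 1) \<otimes>\<^bsub>B\<^esub> G n (k + 2) \<oplus>\<^bsub>B\<^esub> (- 1) \<odot>\<^bsub>B\<^esub> (G m (k + 2) \<otimes>\<^bsub>B\<^esub> G n (k + 1))" for m n k
      unfolding G_def Bsel T.desc_alg
    proof (rule T.desc_cong)
      fix z assume z: "z \<notin> \<Lambda>"
      obtain s where s: "\<And>k. (s k)\<^sup>2 + r k = xw z" "s 1 * s 2 * s 3 = yw z"
        using curve_point_over[OF z] by blast
      show "pe (F.coord (curve_bracket r m n) k) z =
          pe (F.coord m (k + 1)) z * pe (F.coord n (k + 2)) z + - 1 * (pe (F.coord m (k + 2)) z * pe (F.coord n (k + 1)) z)"
        unfolding co[OF s(2)] F.pair_eval_coord_bracket[OF s(1)] by simp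
    qed
    have lin: "e (f \<oplus>\<^bsub>B\<^esub> g) = e f + e g" "e (c \<odot>\<^bsub>B\<^esub> f) = c * e f" if "e \<in> E" for e f g c
      using that by (auto simp: E_def Bsel T.A_apply)
    have inj: "m = n" if "\<And>e k. e \<in> E \<Longrightarrow> e (G m k) = e (G n k)" for m n
    proof (rule F.coord_inject, rule pe_inject)
      fix k z assume z: "z \<notin> \<Lambda>"
      then have "(\<lambda>f. f (torus_proj \<tau> z)) \<in> E" unfolding E_def by blast
      from that[OF this, of k] show "pe (F.coord m k) z = pe (F.coord n k) z"
        by (simp add: G_def ap[OF z])
    qed
    have "G m k \<in> carrier B" for m k by (simp add: Bsel G_def pe_span)
    from curve_lie_iso[where E = E and G = G, OF this lin inj G_add G_scale G_bracket] show ?thesis by blast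
  qed
  ultimately show ?thesis unfolding B by simp
qed

end

section \<open>Invariants under the points of order two\<close>

lemma carrier_D2: "\<gamma> \<in> carrier D2 \<longleftrightarrow> \<gamma> \<in> {(0, 0), (1, 0), (0, 1), (1, 1)}"
proof -
  have "{0..<2} = {0, 1 :: int}" by auto
  then show ?thesis by (cases \<gamma>) (auto simp: D2_def DirProd_def carrier_integer_mod_group)
qed

lemma inv_D2: "\<gamma> \<in> carrier D2 \<Longrightarrow> inv\<^bsub>D2\<^esub> \<gamma> = \<gamma>"
  unfolding carrier_D2
  by (auto simp: D2_def carrier_integer_mod_group)

lemma T_conj:
  "T\<^sub>1 ** M ** matrix_inv T\<^sub>1 = mat2 (M \<sharp> 1 \<sharp> 1) (- (M \<sharp> 1 \<sharp> 2)) (- (M \<sharp> 2 \<sharp> 1)) (M \<sharp> 2 \<sharp> 2)"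
  "T\<^sub>2 ** M ** matrix_inv T\<^sub>2 = mat2 (M \<sharp> 2 \<sharp> 2) (M \<sharp> 2 \<sharp> 1) (M \<sharp> 1 \<sharp> 2) (M \<sharp> 1 \<sharp> 1)"
proof -
  have inv: "matrix_inv T = T" if "T ** T = mat 1" for T :: "complex^2^2"
  proof -
    have "T ** matrix_inv T = mat 1 \<and> matrix_inv T ** T = mat 1"
      unfolding matrix_inv_def by (rule someI[of _ T]) (simp add: that)
    then show ?thesis using that by (metis matrix_mul_assoc matrix_mul_lid matrix_mul_rid)
  qed
  have "T\<^sub>1 ** T\<^sub>1 = mat 1" "T\<^sub>2 ** T\<^sub>2 = mat 1"
    by (simp_all add: mat_eq_iff_2 matrix_mult_nth_2 T\<^sub>1_def T\<^sub>2_def mat_def)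
  note this[THEN inv]
  then show "T\<^sub>1 ** M ** matrix_inv T\<^sub>1 = mat2 (M \<sharp> 1 \<sharp> 1) (- (M \<sharp> 1 \<sharp> 2)) (- (M \<sharp> 2 \<sharp> 1)) (M \<sharp> 2 \<sharp> 2)"
    "T\<^sub>2 ** M ** matrix_inv T\<^sub>2 = mat2 (M \<sharp> 2 \<sharp> 2) (M \<sharp> 2 \<sharp> 1) (M \<sharp> 1 \<sharp> 2) (M \<sharp> 1 \<sharp> 1)"
    by (simp_all add: mat_eq_iff_2 matrix_mult_nth_2 T\<^sub>1_def T\<^sub>2_def)
qed

lemma D2_action_simps:
  "D2_action a b (0, 0) p = p" "D2_action a b (1, 0) p = a p" "D2_action a b (0, 1) p = b p"
  "D2_action a b (1, 1) p = a (b p)"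
  by (simp_all add: D2_action_def)

lemma D2_rho_linear:
  assumes "\<gamma> \<in> carrier D2"
  shows "M \<in> carrier sl2 \<Longrightarrow> D2_rho \<gamma> M \<in> carrier sl2"
    "D2_rho \<gamma> (M \<oplus>\<^bsub>sl2\<^esub> N) = D2_rho \<gamma> M \<oplus>\<^bsub>sl2\<^esub> D2_rho \<gamma> N" "D2_rho \<gamma> (c \<odot>\<^bsub>sl2\<^esub> M) = c \<odot>\<^bsub>sl2\<^esub> D2_rho \<gamma> M"
  using assms unfolding carrier_D2
  by (auto simp: D2_rho_def D2_action_simps T_conj mat_eq_iff_2 trace_2 add.commute)

context upper_half_plane
begin

definition D2_shift :: "int \<times> int \<Rightarrow> complex" where
  "D2_shift \<gamma> = of_int (fst \<gamma>) / 2 + of_int (snd \<gamma>) * \<tau> / 2"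

lemma D2_sigma_proj:
  assumes "\<gamma> \<in> carrier D2"
  shows "D2_sigma \<tau> \<gamma> (torus_proj \<tau> z) = torus_proj \<tau> (z + D2_shift \<gamma>)"
proof -
  have t: "(\<lambda>z. z + w) ` torus_proj \<tau> z = torus_proj \<tau> (z + w)" for w z
    by (simp add: torus_proj_def image_image add_ac)
  show ?thesis
    using assms unfolding carrier_D2 by (auto simp: D2_sigma_def D2_action_simps D2_shift_def t add.assoc add.commute[of "\<tau> / 2"])
qed

lemma D2_shift_half: "\<gamma> \<in> carrier D2 \<Longrightarrow> D2_shift \<gamma> \<in> half_lattice"
  unfolding carrier_D2
  using lattice_0 lattice_1 lattice_tau lattice_add[OF lattice_1 lattice_tau]
  by (auto simp: D2_shift_def half_lattice_def distrib_left)

lemma punctured_torus_D2: "punctured_torus \<tau> (D2_orbit_zero \<tau>) half_lattice"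
proof unfold_locales
  show "torus_proj \<tau> z \<in> D2_orbit_zero \<tau> \<longleftrightarrow> z \<in> half_lattice" for z
  proof
    assume "torus_proj \<tau> z \<in> D2_orbit_zero \<tau>"
    then obtain \<gamma> where \<gamma>: "\<gamma> \<in> carrier D2" "torus_proj \<tau> z = torus_proj \<tau> (0 + D2_shift \<gamma>)"
      by (auto simp: D2_orbit_zero_def D2_sigma_proj)
    then have "z - D2_shift \<gamma> \<in> \<Lambda>" by (simp add: torus_proj_eq_iff)
    then have "z - D2_shift \<gamma> \<in> half_lattice" by (rule lattice_subset_half)
    then show "z \<in> half_lattice"
      using half_lattice_add[OF D2_shift_half[OF \<gamma>(1)], of "z - D2_shift \<gamma>"] by simp
  next
    assume "z \<in> half_lattice"
    then obtain w u where w: "z = u + w" "w \<in> \<Lambda>" and u: "u \<in> {0, 1/2, \<tau>/2, (1 + \<tau>)/2}"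
      by (rule half_lattice_cases)
    have "carrier D2 = {(0, 0), (1, 0), (0, 1), (1, 1)}" using carrier_D2 by blast
    then have "\<exists>\<gamma>\<in>carrier D2. u = D2_shift \<gamma>"
      using u by (auto simp: D2_shift_def add_divide_distrib)
    then obtain \<gamma> where \<gamma>: "\<gamma> \<in> carrier D2" "u = D2_shift \<gamma>" by blast
    have "torus_proj \<tau> z = D2_sigma \<tau> \<gamma> (torus_proj \<tau> 0)"
      using w(2) by (simp add: D2_sigma_proj[OF \<gamma>(1)] w(1) \<gamma>(2) torus_proj_eq_iff)
    then show "torus_proj \<tau> z \<in> D2_orbit_zero \<tau>" using \<gamma>(1) by (auto simp: D2_orbit_zero_def)
  qed
qed (simp_all add: closed_half_lattice)

end

context weierstrass_curve
begin

definition D2_sign :: "int \<times> int \<Rightarrow> 3 \<Rightarrow> complex" where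
  "D2_sign \<gamma> k = (if fst \<gamma> = 1 then sg1 k else 1) * (if snd \<gamma> = 1 then sg2 k else 1)"

lemma D2_rho_basis:
  assumes "\<gamma> \<in> carrier D2"
  shows "D2_rho \<gamma> (basis_vec k) = D2_sign \<gamma> k \<odot>\<^bsub>sl2\<^esub> basis_vec k"
  using assms exhaust_3[of k] unfolding carrier_D2
  by (auto simp: D2_rho_def D2_action_simps T_conj mat_eq_iff_2 D2_sign_def sg1_def sg2_def basis_vec_def
      v\<^sub>1_def v\<^sub>2_def v\<^sub>3_def)

text \<open>Each \<open>v_k\<close> is an eigenvector of \<open>D_2\<close>, so
  \<open>\<Sum> v_k \<otimes> f_k\<close> is invariant exactly when every \<open>f_k\<close> has the
  same character, the values being signs. The eigenfunction expansion describes such functions by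
  two polynomials, the components of the model, and its uniqueness gives injectivity.\<close>

lemma sl2_D2_invariants_iso:
  "curve_lie r \<cong>\<^sub>L sl2_D2_invariants \<tau>" "sl2_D2_invariants \<tau> \<cong>\<^sub>L curve_lie r"
proof -
  interpret T: punctured_torus \<tau> "D2_orbit_zero \<tau>" half_lattice by (rule punctured_torus_D2)
  interpret tensor_algebra T.A by (rule T.tensor_algebra_A)
  define g where "g m k z = curve_eval m (\<lambda>j. lam j z) (xl z) k" for m k z
  have per: "g m k (z + u) = g m k z" if "z \<notin> half_lattice" "u \<in> \<Lambda>" for m k z u
    using that by (simp add: g_def curve_eval_def lam_periodic xl_periodic)
  have eig: "g m k (z + 1/2) = sg1 k * g m k z" "g m k (z + \<tau>/2) = sg2 k * g m k z"
    if z: "z \<notin> half_lattice" for m k z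
  proof -
    have e: "a * p * P + (b * q) * (c * t) * Q = a * (p * P + q * t * Q)" if "b * c = a" for a b c p q t P Q :: complex
      unfolding that[symmetric] by (simp add: distrib_left mult_ac)
    show "g m k (z + 1/2) = sg1 k * g m k z" "g m k (z + \<tau>/2) = sg2 k * g m k z"
      unfolding g_def curve_eval_def lam_shift[OF z] xl_shift[OF z] by (rule e[OF sg_mult(1)], rule e[OF sg_mult(2)])
  qed
  have hol: "g m k holomorphic_on - half_lattice" for m k
    unfolding g_def curve_eval_def
    by (intro holomorphic_intros lam_holomorphic holomorphic_on_compose_gen[OF xl_holomorphic, of _ UNIV, unfolded o_def]) auto
  have mero: "g m k meromorphic_on UNIV" for m k
  proof -
    have "(\<lambda>z. poly p (xl z)) meromorphic_on UNIV" for p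
      by (induction p) (auto intro!: meromorphic_intros xl_meromorphic)
    then show ?thesis unfolding g_def curve_eval_def by (intro meromorphic_intros lam_meromorphic)
  qed
  define G where "G m k = T.desc (g m k)" for m k
  have G_A: "G m k \<in> carrier T.A" for m k
    unfolding G_def by (rule T.desc_in_A[OF per hol mero])
  have G_ap: "G m k (torus_proj \<tau> z) = g m k z" if "z \<notin> half_lattice" for m k z
    unfolding G_def by (rule T.desc_apply[OF per that])
  have act_ap: "D2_on_functions \<tau> \<gamma> f (torus_proj \<tau> z) = f (torus_proj \<tau> (z + D2_shift \<gamma>))"
    if "\<gamma> \<in> carrier D2" "z \<notin> half_lattice" for \<gamma> f z
    using T.pr_in[of z] that by (simp add: D2_on_functions_def inv_D2 D2_sigma_proj)
  have act_A: "D2_on_functions \<tau> \<gamma> f \<in> carrier T.A" if \<gamma>: "\<gamma> \<in> carrier D2" and f: "f \<in> carrier T.A" for \<gamma> f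
  proof (rule T.carrier_A_cong[where F = "\<lambda>z. f (torus_proj \<tau> (z + D2_shift \<gamma>))"])
    show "\<And>z. z \<notin> half_lattice \<Longrightarrow>
        D2_on_functions \<tau> \<gamma> f (torus_proj \<tau> z) = f (torus_proj \<tau> (z + D2_shift \<gamma>))"
      by (rule act_ap[OF \<gamma>])
    show "D2_on_functions \<tau> \<gamma> f \<in> extensional (torus \<tau> - D2_orbit_zero \<tau>)"
      unfolding D2_on_functions_def by (rule restrict_extensional)
    have F: "(\<lambda>z. f (torus_proj \<tau> z)) holomorphic_on - half_lattice" "(\<lambda>z. f (torus_proj \<tau> z)) meromorphic_on UNIV"
      using f by (simp_all add: T.carrier_A)
    show "(\<lambda>z. f (torus_proj \<tau> (z + D2_shift \<gamma>))) holomorphic_on - half_lattice"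
      by (rule holomorphic_on_compose_gen[OF _ F(1), unfolded o_def, of "\<lambda>z. z + D2_shift \<gamma>"])
         (auto intro!: holomorphic_intros simp: half_lattice_add[OF D2_shift_half[OF \<gamma>]])
    show "(\<lambda>z. f (torus_proj \<tau> (z + D2_shift \<gamma>))) meromorphic_on UNIV"
      by (rule meromorphic_on_compose[OF F(2), of "\<lambda>z. z + D2_shift \<gamma>"]) (auto intro!: analytic_intros)
  qed
  have tm: "tensor_map sl2 T.A (D2_rho \<gamma>) (D2_on_functions \<tau> \<gamma>) (nf f)
      = nf (\<lambda>k. D2_sign \<gamma> k \<odot>\<^bsub>T.A\<^esub> D2_on_functions \<tau> \<gamma> (f k))"
    if \<gamma>: "\<gamma> \<in> carrier D2" and f: "\<And>k. f k \<in> carrier T.A" for \<gamma> f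
  proof (rule tensor_map_nf[OF f D2_rho_linear[OF \<gamma>] act_A[OF \<gamma>] _ _ D2_rho_basis[OF \<gamma>]])
    fix h h' :: "complex set \<Rightarrow> complex" and c
    assume h: "h \<in> carrier T.A"
    show "D2_on_functions \<tau> \<gamma> (c \<odot>\<^bsub>T.A\<^esub> h) = c \<odot>\<^bsub>T.A\<^esub> D2_on_functions \<tau> \<gamma> h"
      by (rule T.A_eqI[OF act_A[OF \<gamma> T.A_closed(2)[OF h]] T.A_closed(2)[OF act_A[OF \<gamma> h]]])
         (simp add: act_ap[OF \<gamma>] T.A_apply half_lattice_add[OF D2_shift_half[OF \<gamma>]])
    assume h': "h' \<in> carrier T.A"
    show "D2_on_functions \<tau> \<gamma> (h \<oplus>\<^bsub>T.A\<^esub> h') = D2_on_functions \<tau> \<gamma> h \<oplus>\<^bsub>T.A\<^esub> D2_on_functions \<tau> \<gamma> h'"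
      by (rule T.A_eqI[OF act_A[OF \<gamma> T.A_closed(1)[OF h h']] T.A_closed(1)[OF act_A[OF \<gamma> h] act_A[OF \<gamma> h']]])
         (simp add: act_ap[OF \<gamma>] T.A_apply half_lattice_add[OF D2_shift_half[OF \<gamma>]])
  qed
  have G_inv: "tensor_map sl2 T.A (D2_rho \<gamma>) (D2_on_functions \<tau> \<gamma>) (nf (G m)) = nf (G m)"
    if \<gamma>: "\<gamma> \<in> carrier D2" for \<gamma> m
  proof -
    have "D2_sign \<gamma> k \<odot>\<^bsub>T.A\<^esub> D2_on_functions \<tau> \<gamma> (G m k) = G m k" for k
    proof (rule T.A_eqI[OF T.A_closed(2)[OF act_A[OF \<gamma> G_A]] G_A])
      fix z assume z: "z \<notin> half_lattice"
      have h: "z + 1/2 \<notin> half_lattice" "z + \<tau>/2 \<notin> half_lattice"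
        using z half_lattice_add frame13 by (auto simp: half_frame_def)
      have "g m k (z + D2_shift \<gamma>) = D2_sign \<gamma> k * g m k z"
        using \<gamma> eig[OF z, of m k] eig(2)[OF h(1), of m k] unfolding carrier_D2
        by (auto simp: D2_shift_def D2_sign_def add.assoc[symmetric] mult_ac)
      moreover have "D2_sign \<gamma> k * D2_sign \<gamma> k = 1" by (simp add: D2_sign_def sg1_def sg2_def)
      ultimately show "(D2_sign \<gamma> k \<odot>\<^bsub>T.A\<^esub> D2_on_functions \<tau> \<gamma> (G m k)) (torus_proj \<tau> z) = G m k (torus_proj \<tau> z)"
        using z by (simp add: T.A_apply act_ap[OF \<gamma>] G_ap half_lattice_add[OF D2_shift_half[OF \<gamma>]] flip: mult.assoc)
    qed
    then show ?thesis by (simp add: tm[OF \<gamma> G_A])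
  qed
  have inv_G: "\<exists>m. nf f = nf (G m)"
    if f: "\<And>k. f k \<in> carrier T.A"
      and inv: "\<And>\<gamma>. \<gamma> \<in> carrier D2 \<Longrightarrow> tensor_map sl2 T.A (D2_rho \<gamma>) (D2_on_functions \<tau> \<gamma>) (nf f) = nf f" for f
  proof -
    \<comment> \<open>Point evaluation is a linear functional, so equality of the two normal forms
      can be read off coordinate by coordinate.\<close>
    have sym: "D2_sign \<gamma> k * f k (torus_proj \<tau> (z + D2_shift \<gamma>)) = f k (torus_proj \<tau> z)"
      if \<gamma>: "\<gamma> \<in> carrier D2" and z: "z \<notin> half_lattice" for \<gamma> k z
    proof -
      have "nf (\<lambda>k. D2_sign \<gamma> k \<odot>\<^bsub>T.A\<^esub> D2_on_functions \<tau> \<gamma> (f k)) = nf f"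
        using inv[OF \<gamma>] tm[OF \<gamma> f] by simp
      from nf_eqD[of "\<lambda>h. h (torus_proj \<tau> z)", OF _ _ this, of k] show ?thesis
        using z by (simp add: T.A_apply act_ap[OF \<gamma>])
    qed
    have flip: "y = a * x" if "a * y = x" "a * a = 1" for a x y :: complex
    proof -
      have "a * x = (a * a) * y" by (simp add: that(1)[symmetric] mult.assoc)
      then show ?thesis using that(2) by simp
    qed
    have D: "(1, 0) \<in> carrier D2" "(0, 1) \<in> carrier D2" by (simp_all add: carrier_D2)
    have "\<forall>k. \<exists>p. \<forall>z. z \<notin> half_lattice \<longrightarrow> f k (torus_proj \<tau> z) =
        lam k z * poly (fst p) (xl z) + lam (k + 1) z * lam (k + 2) z * poly (snd p) (xl z)"
    proof
      fix k
      have "(\<lambda>z. f k (torus_proj \<tau> z)) meromorphic_on UNIV" using f by (simp add: T.carrier_A)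
      then obtain n L where L: "((\<lambda>z. z ^ n * f k (torus_proj \<tau> z)) \<longlongrightarrow> L) (at 0)"
        by (rule meromorphic_pole_limit)
      have ss: "sg1 k * sg1 k = 1" "sg2 k * sg2 k = 1" by (rule sg_mult)+
      have "\<exists>a b. \<forall>z. z \<notin> half_lattice \<longrightarrow> f k (torus_proj \<tau> z) =
          lam k z * poly a (xl z) + lam (k + 1) z * lam (k + 2) z * poly b (xl z)"
      proof (rule eigenfunction_expansion[OF _ _ _ L])
        show "(\<lambda>z. f k (torus_proj \<tau> z)) holomorphic_on - half_lattice" using f by (simp add: T.carrier_A)
        fix z assume z: "z \<notin> half_lattice"
        show "f k (torus_proj \<tau> (z + 1/2)) = sg1 k * f k (torus_proj \<tau> z)"
          by (rule flip[OF _ ss(1)]) (use sym[OF D(1) z, of k] in \<open>simp add: D2_sign_def D2_shift_def\<close>)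
        show "f k (torus_proj \<tau> (z + \<tau>/2)) = sg2 k * f k (torus_proj \<tau> z)"
          by (rule flip[OF _ ss(2)]) (use sym[OF D(2) z, of k] in \<open>simp add: D2_sign_def D2_shift_def\<close>)
      qed
      then obtain a b where "\<forall>z. z \<notin> half_lattice \<longrightarrow> f k (torus_proj \<tau> z) =
          lam k z * poly a (xl z) + lam (k + 1) z * lam (k + 2) z * poly b (xl z)" by (elim exE)
      then show "\<exists>p. \<forall>z. z \<notin> half_lattice \<longrightarrow> f k (torus_proj \<tau> z) =
          lam k z * poly (fst p) (xl z) + lam (k + 1) z * lam (k + 2) z * poly (snd p) (xl z)"
        by (intro exI[of _ "(a, b)"]) simp
    qed
    from choice[OF this] obtain p where p: "\<forall>k z. z \<notin> half_lattice \<longrightarrow> f k (torus_proj \<tau> z) =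
        lam k z * poly (fst (p k)) (xl z) + lam (k + 1) z * lam (k + 2) z * poly (snd (p k)) (xl z)" by (elim exE)
    define m :: curve_vec where "m = (vec_lambda (\<lambda>k. fst (p k)), vec_lambda (\<lambda>k. snd (p k)))"
    have "f = G m"
    proof
      show "f k = G m k" for k
        by (rule T.A_eqI[OF f G_A]) (simp add: p G_ap g_def curve_eval_def m_def)
    qed
    then show ?thesis by blast
  qed
  have carr: "sl2_D2_invariants \<tau> = (tensor_lie sl2 T.A)\<lparr>carrier := range (\<lambda>m. nf (G m))\<rparr>"
  proof -
    have "{U \<in> carrier (tensor_lie sl2 T.A). \<forall>\<gamma>\<in>carrier D2. tensor_map sl2 T.A (D2_rho \<gamma>) (D2_on_functions \<tau> \<gamma>) U = U}
        = range (\<lambda>m. nf (G m))" (is "?I = ?R")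
    proof (rule equalityI; rule subsetI)
      fix U assume "U \<in> ?I"
      then obtain f where f: "U = nf f" "\<And>k. f k \<in> carrier T.A"
        and inv: "\<And>\<gamma>. \<gamma> \<in> carrier D2 \<Longrightarrow> tensor_map sl2 T.A (D2_rho \<gamma>) (D2_on_functions \<tau> \<gamma>) U = U"
        unfolding carrier_tensor_lie by blast
      show "U \<in> ?R" using inv_G[OF f(2) inv[unfolded f(1)]] f(1) by blast
    next
      fix U assume "U \<in> ?R"
      then obtain m where U: "U = nf (G m)" by blast
      have "U \<in> carrier (tensor_lie sl2 T.A)" unfolding U carrier_tensor_lie using G_A by blast
      then show "U \<in> ?I" using G_inv by (simp add: U)
    qed
    then show ?thesis by (simp add: sl2_D2_invariants_def Let_def)
  qed
  define E where "E = {\<lambda>f :: complex set \<Rightarrow> complex. f (torus_proj \<tau> z) | z. z \<notin> half_lattice}"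
  have G_add: "G (m + n) k = G m k \<oplus>\<^bsub>T.A\<^esub> G n k" for m n k
    unfolding G_def T.desc_alg by (rule T.desc_cong) (simp add: g_def curve_eval_add)
  have G_scale: "G (curve_scale c m) k = c \<odot>\<^bsub>T.A\<^esub> G m k" for c m k
    unfolding G_def T.desc_alg by (rule T.desc_cong) (simp add: g_def curve_eval_scale)
  have G_bracket: "G (curve_bracket r m n) k =
      G m (k + 1) \<otimes>\<^bsub>T.A\<^esub> G n (k + 2) \<oplus>\<^bsub>T.A\<^esub> (- 1) \<odot>\<^bsub>T.A\<^esub> (G m (k + 2) \<otimes>\<^bsub>T.A\<^esub> G n (k + 1))" for m n k
    unfolding G_def T.desc_alg
    by (rule T.desc_cong) (simp add: g_def curve_eval_bracket[OF lam_sq])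
  have lin: "e (f \<oplus>\<^bsub>T.A\<^esub> h) = e f + e h" "e (c \<odot>\<^bsub>T.A\<^esub> f) = c * e f" if "e \<in> E" for e f h c
    using that by (auto simp: E_def T.A_apply)
  have inj: "m = n" if eq: "\<And>e k. e \<in> E \<Longrightarrow> e (G m k) = e (G n k)" for m n
  proof -
    have g: "lam k z * poly (fst (m - n) \<sharp> k) (xl z) + lam (k + 1) z * lam (k + 2) z * poly (snd (m - n) \<sharp> k) (xl z) = 0"
      if z: "z \<notin> half_lattice" for k z
    proof -
      have "(\<lambda>f. f (torus_proj \<tau> z)) \<in> E" unfolding E_def using z by blast
      from eq[OF this, of k] have "g m k z = g n k z" by (simp add: G_ap[OF z])
      then have "curve_eval (m - n) (\<lambda>j. lam j z) (xl z) k = 0" by (simp add: g_def curve_eval_diff)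
      then show ?thesis by (simp add: curve_eval_def)
    qed
    have "fst (m - n) \<sharp> k = 0" "snd (m - n) \<sharp> k = 0" for k
      by (rule expansion_unique[OF g], assumption)+
    then have "m - n = 0" by (simp add: prod_eq_iff vec_eq_iff)
    then show ?thesis by simp
  qed
  note iso = curve_lie_iso[where E = E and G = G, OF G_A lin inj G_add G_scale G_bracket]
  show "curve_lie r \<cong>\<^sub>L sl2_D2_invariants \<tau>" "sl2_D2_invariants \<tau> \<cong>\<^sub>L curve_lie r"
    unfolding carr by (rule iso; assumption)+
qed

end

text \<open>The affine map sending \<open>e1\<close> and \<open>e3\<close> to \<open>r 1\<close> and
  \<open>r 3\<close> has slope \<open>q = \<kappa>^2\<close>. The condition on
  \<open>modular_lambda\<close> equates the ratios formed with the middle value, so the same map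
  sends \<open>e2\<close> to \<open>r 2\<close>.\<close>

lemma ex_weierstrass_curve:
  fixes r :: "3 \<Rightarrow> complex"
  assumes r: "r 1 \<noteq> r 2" "r 2 \<noteq> r 3" "r 1 \<noteq> r 3"
    and \<tau>: "Im \<tau> > 0" "modular_lambda \<tau> = (r 3 - r 2) / (r 3 - r 1)"
  shows "\<exists>\<kappa> \<beta>. weierstrass_curve \<tau> r \<kappa> \<beta>"
proof -
  interpret upper_half_plane \<tau> by unfold_locales (rule \<tau>(1))
  define e1 e2 e3 where "e1 = wp (1/2)" and "e2 = wp (1/2 + \<tau>/2)" and "e3 = wp (\<tau>/2)"
  have e: "e1 - e3 \<noteq> 0" using wp_half_neq(1)[OF half_frames] by (simp add: e1_def e3_def)
  \<comment> \<open>As division by zero gives 0, the vanishing of either theta constant would make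
    \<open>modular_lambda \<tau>\<close> zero, contradicting \<open>r 2 \<noteq> r 3\<close> and
    \<open>r 1 \<noteq> r 3\<close>.\<close>
  have th: "theta2_null \<tau> \<noteq> 0" "theta3_null \<tau> \<noteq> 0"
    using \<tau>(2) r by (auto simp: modular_lambda_def)
  have rd: "r 3 - r 1 \<noteq> 0" using r by simp
  have half: "1/2 + \<tau>/2 = (1 + \<tau>) / 2" by (simp add: add_divide_distrib)
  have "(e2 - e3) * theta3_null \<tau> ^ 4 = (e1 - e3) * theta2_null \<tau> ^ 4"
    unfolding e1_def e2_def e3_def half by (rule theta_cross_ratio[OF th])
  then have "e2 - e3 = (e1 - e3) * modular_lambda \<tau>"
    using th by (simp add: modular_lambda_def nonzero_eq_divide_eq)
  then have e23: "e2 - e3 = (e1 - e3) * ((r 3 - r 2) / (r 3 - r 1))" by (simp only: \<tau>(2))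
  define q where "q = (r 1 - r 3) / (e1 - e3)"
  have q1: "q * (e1 - e3) = r 1 - r 3" using e by (simp add: q_def)
  have "q * (e2 - e3) = (r 1 - r 3) * ((r 3 - r 2) / (r 3 - r 1))"
    unfolding e23 by (simp only: q1 mult.assoc[symmetric])
  also have "\<dots> = r 2 - r 3" using rd by (simp add: field_simps)
  finally have q2: "q * (e2 - e3) = r 2 - r 3" .
  have "weierstrass_curve \<tau> r (csqrt q) (r 3 - q * e3)"
  proof unfold_locales
    have "q \<noteq> 0" using e r by (simp add: q_def)
    then show "csqrt q \<noteq> 0" by simp
    show "r 1 = (csqrt q)\<^sup>2 * wp (1/2) + (r 3 - q * e3)" "r 2 = (csqrt q)\<^sup>2 * wp (1/2 + \<tau>/2) + (r 3 - q * e3)"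
      "r 3 = (csqrt q)\<^sup>2 * wp (\<tau>/2) + (r 3 - q * e3)"
      using q1 q2 unfolding e1_def[symmetric] e2_def[symmetric] e3_def[symmetric]
      by (simp_all add: algebra_simps)
  qed
  then show ?thesis by blast
qed

theorem proposition3p3:
  fixes r :: "3 \<Rightarrow> complex"
  assumes "r 1 \<noteq> r 2" and "r 2 \<noteq> r 3" and "r 1 \<noteq> r 3"
  shows
    "lie_subalgebra_generated (sl2_curve r)
       {curve_generator r v\<^sub>1 1, curve_generator r v\<^sub>2 2, curve_generator r v\<^sub>3 3}
     \<cong>\<^sub>L p_algebra r
     \<and> (\<forall>\<tau>. Im \<tau> > 0 \<and> modular_lambda \<tau> = (r 3 - r 2) / (r 3 - r 1) \<longrightarrow>
          p_algebra r \<cong>\<^sub>L sl2_D2_invariants \<tau> \<and>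
          sl2_D2_invariants \<tau> \<cong>\<^sub>L tensor_lie sl2 (weierstrass_algebra \<tau>))"
proof (intro conjI allI impI)
  show "lie_subalgebra_generated (sl2_curve r)
       {curve_generator r v\<^sub>1 1, curve_generator r v\<^sub>2 2, curve_generator r v\<^sub>3 3}
     \<cong>\<^sub>L p_algebra r"
    by (rule lie_isomorphic_trans[OF curve_algebra_iso(2) p_algebra_iso(2)])
  fix \<tau> assume \<tau>: "Im \<tau> > 0 \<and> modular_lambda \<tau> = (r 3 - r 2) / (r 3 - r 1)"
  then obtain \<kappa> \<beta> where "weierstrass_curve \<tau> r \<kappa> \<beta>" using ex_weierstrass_curve[OF assms] by blast
  then interpret weierstrass_curve \<tau> r \<kappa> \<beta> .
  show "p_algebra r \<cong>\<^sub>L sl2_D2_invariants \<tau>"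
    by (rule lie_isomorphic_trans[OF p_algebra_iso(3) sl2_D2_invariants_iso(1)])
  show "sl2_D2_invariants \<tau> \<cong>\<^sub>L tensor_lie sl2 (weierstrass_algebra \<tau>)"
    by (rule lie_isomorphic_trans[OF sl2_D2_invariants_iso(2) weierstrass_algebra_iso])
qed

end
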